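(* Let $\mathbf{k}$ be a field of characteristic zero, let $X=\mathbb{T}^n$ be the $n$-dimensional algebraic torus over $\mathbf{k}$, with algebra of functions $A=\mathbf{k}[x_1^{\pm1},\dots,x_n^{\pm1}]$ and Lie algebra of polynomial vector fields $V=\operatorname{Der}(A)=\bigoplus_{i=1}^nA\frac{\partial}{\partial x_i}$. Let $W$ be a finite-dimensional $\mathcal{L}_+$-module, and let $M=A\otimes W$ be the corresponding tensor $AV$-module. Then for every $m\ge0$ $$H^m_{\mathrm{GF}}(V,A\otimes W)\cong\bigoplus_{i+j=m}\mathbf{k}^{\binom ni}\otimes H^j(\mathcal{L}_+,W).$$
   Context: Unadorned tensor products, $\operatorname{Hom}$ and exterior powers are over $\mathbf{k}$. $\mathcal{L}_+$: let $\mathcal{L}=\operatorname{Der}(\mathbf{k}[X_1,\dots,X_n])=\bigoplus_{d\ge-1}\mathcal{L}_d$ be graded by total degree ($X^k\frac{\partial}{\partial X_i}$ has degree $|k|-1$); $\mathcal{L}_+=\bigoplus_{d\ge0}\mathcal{L}_d$. On a finite-dimensional $\mathcal{L}_+$-module, $\mathcal{L}_d$ acts as zero for all large $d$. $H^*(\mathcal{L}_+,W)$ is ordinary Chevalley–Eilenberg cohomology. Tensor module $A\otimes W$: $A$ acts by multiplication on the left factor, and for $f,s\in A$, $w\in W$, $$f\tfrac{\partial}{\partial x_i}(s\otimes w)=\left(f\tfrac{\partial s}{\partial x_i}\right)\otimes w+\sum_{k\in\mathbb{Z}_{\ge0}^n\setminus\{0\}}\frac1{k!}\frac{\partial^kf}{\partial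 x^k}\,s\otimes\left(X^k\tfrac{\partial}{\partial X_i}\right)w$$ (a finite sum). Algebraic Gelfand–Fuks cohomology: $C^k(V,M)=\operatorname{Hom}(\bigwedge^kV,M)$ is the Chevalley–Eilenberg complex, with $$(d\varphi)(\eta_1,\dots,\eta_{k+1})=\sum_{s<t}(-1)^{s+t-1}\varphi([\eta_s,\eta_t],\eta_1,\dots,\hat\eta_s,\dots,\hat\eta_t,\dots,\eta_{k+1})+\sum_s(-1)^s\eta_s\varphi(\eta_1,\dots,\hat\eta_s,\dots,\eta_{k+1}).$$ $C^0_{\mathrm{GF}}(V,M)=M$, and for $k\ge1$, $C^k_{\mathrm{GF}}(V,M)$ is the set of $\varphi\in C^k(V,M)$ for which there is $p>0$ with $\sum_{i=0}^p(-1)^i\binom pi f^{p-i}\varphi(f^i\eta_1,\eta_2,\dots,\eta_k)=0$ for all $f\in A$, $\eta_1,\dots,\eta_k\in V$. For $M=A\otimes W$ these form a subcomplex, and $H^*_{\mathrm{GF}}(V,M)$ is its cohomology. *)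

theory Defs
  imports
    Complex_Main
    "HOL-Library.Cardinality"
    "HOL-Library.FuncSet"
    "HOL-Library.Poly_Mapping"
    "HOL-Library.Function_Algebras"
    "HOL-Library.Set_Algebras"
begin

section \<open>Vector spaces with explicit carrier\<close>

record ('k, 'v) vs =
  carr :: "'v set"
  vadd :: "'v \<Rightarrow> 'v \<Rightarrow> 'v"
  vscale :: "'k \<Rightarrow> 'v \<Rightarrow> 'v"

definition vs_iso :: "('k, 'u) vs \<Rightarrow> ('k, 'v) vs \<Rightarrow> bool"  (infix \<open>\<cong>\<^sub>k\<close> 50) where
  "U \<cong>\<^sub>k V \<longleftrightarrow> (\<exists>F. bij_betw F (carr U) (carr V) \<and>
     (\<forall>x\<in>carr U. \<forall>y\<in>carr U. F (vadd U x y) = vadd V (F x) (F y)) \<and>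
     (\<forall>c. \<forall>x\<in>carr U. F (vscale U c x) = vscale V c (F x)))"

text \<open>
  The quotient \<open>Z / B\<close> of subspaces \<open>B \<subseteq> Z\<close>; its elements are the cosets \<open>z + B\<close>.  The final
  \<open>+ B\<close> in the scalar multiplication matters only for the scalar \<open>0\<close>, where the image of a coset
  is \<open>{0}\<close> rather than \<open>B\<close>.
\<close>
definition quotient_vs ::
    "('k \<Rightarrow> 'v \<Rightarrow> 'v) \<Rightarrow> 'v::ab_group_add set \<Rightarrow> 'v set \<Rightarrow> ('k, 'v set) vs" where
  "quotient_vs s Z B = \<lparr>carr = (\<lambda>z. z +o B) ` Z, vadd = (+), vscale = (\<lambda>c S. s c ` S + B)\<rparr>"

text \<open>Only used for finite \<open>I\<close>, where the direct sum is the set of all families.\<close>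
definition direct_sum_vs :: "'i set \<Rightarrow> ('i \<Rightarrow> ('k, 'v) vs) \<Rightarrow> ('k, 'i \<Rightarrow> 'v) vs" where
  "direct_sum_vs I X = \<lparr>carr = (\<Pi>\<^sub>E i\<in>I. carr (X i)),
     vadd = (\<lambda>g h. \<lambda>i\<in>I. vadd (X i) (g i) (h i)),
     vscale = (\<lambda>c g. \<lambda>i\<in>I. vscale (X i) c (g i))\<rparr>"

text \<open>
  \<open>k\<^sup>N \<otimes> X\<close>, with \<open>\<Sum>\<^sub>a e\<^sub>a \<otimes> x\<^sub>a\<close> (\<open>e\<^sub>a\<close> the standard basis) written as the family \<open>(x\<^sub>a)\<^sub>a\<close>.
\<close>
definition coordinate_tensor_vs :: "nat \<Rightarrow> ('k, 'v) vs \<Rightarrow> ('k, nat \<Rightarrow> 'v) vs" where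
  "coordinate_tensor_vs N X = direct_sum_vs {..<N} (\<lambda>_. X)"

definition fun_scale :: "('k \<Rightarrow> 'v \<Rightarrow> 'v) \<Rightarrow> 'k \<Rightarrow> ('a \<Rightarrow> 'v) \<Rightarrow> 'a \<Rightarrow> 'v" where
  "fun_scale s c f = (\<lambda>x. s c (f x))"

definition pm_scale :: "('k \<Rightarrow> 'v \<Rightarrow> 'v) \<Rightarrow> 'k \<Rightarrow> ('a \<Rightarrow>\<^sub>0 'v::zero) \<Rightarrow> 'a \<Rightarrow>\<^sub>0 'v" where
  "pm_scale s c = Poly_Mapping.map (s c)"


section \<open>Lie algebras and Chevalley--Eilenberg cohomology\<close>

locale lie_algebra = vector_space sL
  for sL :: "'k::field \<Rightarrow> 'l::ab_group_add \<Rightarrow> 'l" +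
  fixes L :: "'l set" and br :: "'l \<Rightarrow> 'l \<Rightarrow> 'l"
  assumes subspace_L: "subspace L"
    and br_closed: "x \<in> L \<Longrightarrow> y \<in> L \<Longrightarrow> br x y \<in> L"
    and br_add_left: "x \<in> L \<Longrightarrow> y \<in> L \<Longrightarrow> z \<in> L \<Longrightarrow> br (x + y) z = br x z + br y z"
    and br_add_right: "x \<in> L \<Longrightarrow> y \<in> L \<Longrightarrow> z \<in> L \<Longrightarrow> br x (y + z) = br x y + br x z"
    and br_scale_left: "x \<in> L \<Longrightarrow> y \<in> L \<Longrightarrow> br (sL c x) y = sL c (br x y)"
    and br_scale_right: "x \<in> L \<Longrightarrow> y \<in> L \<Longrightarrow> br x (sL c y) = sL c (br x y)"
    and br_self: "x \<in> L \<Longrightarrow> br x x = 0"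
    and jacobi: "x \<in> L \<Longrightarrow> y \<in> L \<Longrightarrow> z \<in> L \<Longrightarrow>
      br x (br y z) + br y (br z x) + br z (br x y) = 0"

locale lie_module = lie_algebra sL L br + M: vector_space sM
  for sL :: "'k::field \<Rightarrow> 'l::ab_group_add \<Rightarrow> 'l" and L br
    and sM :: "'k \<Rightarrow> 'm::ab_group_add \<Rightarrow> 'm" +
  fixes act :: "'l \<Rightarrow> 'm \<Rightarrow> 'm"
  assumes act_linear: "x \<in> L \<Longrightarrow> Vector_Spaces.linear sM sM (act x)"
    and act_add: "x \<in> L \<Longrightarrow> y \<in> L \<Longrightarrow> act (x + y) m = act x m + act y m"
    and act_scale: "x \<in> L \<Longrightarrow> act (sL c x) m = sM c (act x m)"
    and act_br: "x \<in> L \<Longrightarrow> y \<in> L \<Longrightarrow> act (br x y) m = act x (act y m) - act y (act x m)"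

text \<open>
  \<open>Hom(\<Lambda>\<^sup>k L, M)\<close> as the alternating \<open>k\<close>-linear maps on \<open>L\<close>.  The arguments are passed as a list,
  and a cochain is \<open>0\<close> on every list that is not a list of \<open>k\<close> elements of \<open>L\<close>, so that
  equality of cochains is equality of functions.
\<close>
definition ce_cochains ::
    "('k \<Rightarrow> 'l::ab_group_add \<Rightarrow> 'l) \<Rightarrow> 'l set \<Rightarrow> ('k \<Rightarrow> 'm::ab_group_add \<Rightarrow> 'm) \<Rightarrow> nat
      \<Rightarrow> ('l list \<Rightarrow> 'm) set" where
  "ce_cochains sL L sM k = {\<phi>.
     (\<forall>xs. \<not> (length xs = k \<and> set xs \<subseteq> L) \<longrightarrow> \<phi> xs = 0) \<and>
     (\<forall>xs i x y. length xs = k \<and> set xs \<subseteq> L \<and> i < k \<and> x \<in> L \<and> y \<in> L \<longrightarrow>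
        \<phi> (xs[i := x + y]) = \<phi> (xs[i := x]) + \<phi> (xs[i := y])) \<and>
     (\<forall>xs i x c. length xs = k \<and> set xs \<subseteq> L \<and> i < k \<and> x \<in> L \<longrightarrow>
        \<phi> (xs[i := sL c x]) = sM c (\<phi> (xs[i := x]))) \<and>
     (\<forall>xs. length xs = k \<and> set xs \<subseteq> L \<and> \<not> distinct xs \<longrightarrow> \<phi> xs = 0)}"

text \<open>
  The indices \<open>s < t\<close> start at \<open>0\<close>, so the exponents \<open>s + t - 1\<close> and \<open>s\<close> of the usual one-based
  formula become \<open>s + t + 1\<close> and \<open>s + 1\<close>; \<open>nths xs (- {s, t})\<close> omits the entries \<open>s\<close> and \<open>t\<close>.
\<close>
definition ce_diff ::
    "'l set \<Rightarrow> ('l \<Rightarrow> 'l \<Rightarrow> 'l) \<Rightarrow> ('k::field \<Rightarrow> 'm::ab_group_add \<Rightarrow> 'm) \<Rightarrow> ('l \<Rightarrow> 'm \<Rightarrow> 'm)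
      \<Rightarrow> ('l list \<Rightarrow> 'm) \<Rightarrow> 'l list \<Rightarrow> 'm" where
  "ce_diff L br sM act \<phi> xs = (if set xs \<subseteq> L then
     (\<Sum>t<length xs. \<Sum>s<t.
        sM ((- 1) ^ (s + t + 1)) (\<phi> (br (xs ! s) (xs ! t) # nths xs (- {s, t})))) +
     (\<Sum>s<length xs. sM ((- 1) ^ (s + 1)) (act (xs ! s) (\<phi> (nths xs (- {s})))))
   else 0)"

definition cohomology ::
    "('k \<Rightarrow> 'c \<Rightarrow> 'c) \<Rightarrow> (nat \<Rightarrow> 'c::ab_group_add set) \<Rightarrow> ('c \<Rightarrow> 'c) \<Rightarrow> nat \<Rightarrow> ('k, 'c set) vs" where
  "cohomology s C d m =
     quotient_vs s {\<phi> \<in> C m. d \<phi> = 0} (if m = 0 then {0} else d ` C (m - 1))"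

definition ce_cohomology ::
    "('k::field \<Rightarrow> 'l::ab_group_add \<Rightarrow> 'l) \<Rightarrow> 'l set \<Rightarrow> ('l \<Rightarrow> 'l \<Rightarrow> 'l) \<Rightarrow>
     ('k \<Rightarrow> 'm::ab_group_add \<Rightarrow> 'm) \<Rightarrow> ('l \<Rightarrow> 'm \<Rightarrow> 'm) \<Rightarrow> nat \<Rightarrow> ('k, ('l list \<Rightarrow> 'm) set) vs" where
  "ce_cohomology sL L br sM act =
     cohomology (fun_scale sM) (ce_cochains sL L sM) (ce_diff L br sM act)"

definition commutator :: "('a::ab_group_add \<Rightarrow> 'a) \<Rightarrow> ('a \<Rightarrow> 'a) \<Rightarrow> 'a \<Rightarrow> 'a" where
  "commutator D E = (\<lambda>f. D (E f) - E (D f))"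

definition derivations ::
    "('k::field \<Rightarrow> 'a::comm_ring_1 \<Rightarrow> 'a) \<Rightarrow> ('a \<Rightarrow> 'a) set" where
  "derivations s = {D. Vector_Spaces.linear s s D \<and> (\<forall>f g. D (f * g) = D f * g + f * D g)}"


section \<open>Polynomial vector fields on affine space\<close>

type_synonym ('n, 'k) mpoly = "('n \<Rightarrow> nat) \<Rightarrow>\<^sub>0 'k"
type_synonym ('n, 'k) laurent = "('n \<Rightarrow> int) \<Rightarrow>\<^sub>0 'k"

definition unit_exp :: "'n \<Rightarrow> 'n \<Rightarrow> 'e::zero_neq_one" where
  "unit_exp i = (\<lambda>j. if j = i then 1 else 0)"

definition mpoly_partial :: "'n \<Rightarrow> ('n, 'k::field_char_0) mpoly \<Rightarrow> ('n, 'k) mpoly" where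
  "mpoly_partial i p =
     (\<Sum>r\<in>Poly_Mapping.keys p.
        Poly_Mapping.single (r - unit_exp i) (of_nat (r i) * Poly_Mapping.lookup p r))"

text \<open>The vector field \<open>X\<^sup>k \<partial>/\<partial>X\<^sub>i\<close>.\<close>
definition monomial_field ::
    "('n \<Rightarrow> nat) \<Rightarrow> 'n \<Rightarrow> ('n, 'k::field_char_0) mpoly \<Rightarrow> ('n, 'k) mpoly" where
  "monomial_field k i = (\<lambda>p. Poly_Mapping.single k 1 * mpoly_partial i p)"

abbreviation field_scale ::
    "'k::field \<Rightarrow> (('a \<Rightarrow>\<^sub>0 'k) \<Rightarrow> ('a \<Rightarrow>\<^sub>0 'k)) \<Rightarrow> ('a \<Rightarrow>\<^sub>0 'k) \<Rightarrow> ('a \<Rightarrow>\<^sub>0 'k)" where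
  "field_scale \<equiv> fun_scale (pm_scale (*))"

definition L_graded ::
    "int \<Rightarrow> (('n::finite, 'k::field_char_0) mpoly \<Rightarrow> ('n, 'k) mpoly) set" where
  "L_graded d = module.span field_scale {monomial_field k i |k i. int (\<Sum>j\<in>UNIV. k j) - 1 = d}"

definition L_plus :: "(('n::finite, 'k::field_char_0) mpoly \<Rightarrow> ('n, 'k) mpoly) set" where
  "L_plus = module.span field_scale (\<Union>d\<in>{0..}. L_graded d)"


section \<open>Vector fields on the torus and tensor modules\<close>

definition torus_fields :: "(('n::finite, 'k::field_char_0) laurent \<Rightarrow> ('n, 'k) laurent) set" where
  "torus_fields = derivations (pm_scale (*))"

definition coord :: "'n \<Rightarrow> ('n, 'k::field_char_0) laurent" where
  "coord i = Poly_Mapping.single (unit_exp i) 1"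

definition partial :: "'n \<Rightarrow> ('n, 'k::field_char_0) laurent \<Rightarrow> ('n, 'k) laurent" where
  "partial i f =
     (\<Sum>r\<in>Poly_Mapping.keys f.
        Poly_Mapping.single (r - unit_exp i) (of_int (r i) * Poly_Mapping.lookup f r))"

text \<open>The iterated derivative for a multi-index \<open>k\<close>; the order of the variables is immaterial.\<close>
definition partial_multi ::
    "('n::finite \<Rightarrow> nat) \<Rightarrow> ('n, 'k::field_char_0) laurent \<Rightarrow> ('n, 'k) laurent" where
  "partial_multi k f = Finite_Set.fold (\<lambda>i. partial i ^^ k i) f UNIV"

text \<open>
  Since the monomials \<open>x\<^sup>r\<close> form a basis of \<open>A\<close>, the tensor product \<open>A \<otimes> W\<close> is the space of
  finitely supported functions from exponents to \<open>W\<close>, with \<open>\<Sum>\<^sub>r x\<^sup>r \<otimes> w\<^sub>r\<close> written as \<open>r \<mapsto> w\<^sub>r\<close>.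
\<close>
definition pure_tensor ::
    "('k \<Rightarrow> 'w \<Rightarrow> 'w) \<Rightarrow> ('a \<Rightarrow>\<^sub>0 'k::zero) \<Rightarrow> 'w::zero \<Rightarrow> 'a \<Rightarrow>\<^sub>0 'w" where
  "pure_tensor sW s w = Poly_Mapping.map (\<lambda>c. sW c w) s"

text \<open>The linear map \<open>A \<otimes> W \<rightarrow> U\<close> that sends \<open>s \<otimes> w\<close> to \<open>\<beta> s w\<close>, for a bilinear \<open>\<beta>\<close>.\<close>
definition tensor_lift ::
    "(('a \<Rightarrow>\<^sub>0 'k::zero_neq_one) \<Rightarrow> 'w::zero \<Rightarrow> 'u::comm_monoid_add) \<Rightarrow> ('a \<Rightarrow>\<^sub>0 'w) \<Rightarrow> 'u" where
  "tensor_lift \<beta> m =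
     (\<Sum>r\<in>Poly_Mapping.keys m. \<beta> (Poly_Mapping.single r 1) (Poly_Mapping.lookup m r))"

definition tensor_mult ::
    "('k::field_char_0 \<Rightarrow> 'w::ab_group_add \<Rightarrow> 'w) \<Rightarrow> ('n::finite, 'k) laurent
      \<Rightarrow> (('n \<Rightarrow> int) \<Rightarrow>\<^sub>0 'w) \<Rightarrow> (('n \<Rightarrow> int) \<Rightarrow>\<^sub>0 'w)" where
  "tensor_mult sW f = tensor_lift (\<lambda>s w. pure_tensor sW (f * s) w)"

text \<open>
  The action of \<open>D = \<Sum>\<^sub>i f\<^sub>i \<partial>/\<partial>x\<^sub>i\<close>, where \<open>f\<^sub>i = D x\<^sub>i\<close>.  The sum over the multi-indices \<open>k \<noteq> 0\<close> has
  finitely many nonzero terms because \<open>X\<^sup>k \<partial>/\<partial>X\<^sub>i\<close> acts as zero on \<open>W\<close> when \<open>\<bar>k\<bar>\<close> is large.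
\<close>
definition tensor_act ::
    "('k::field_char_0 \<Rightarrow> 'w::ab_group_add \<Rightarrow> 'w)
      \<Rightarrow> ((('n::finite, 'k) mpoly \<Rightarrow> ('n, 'k) mpoly) \<Rightarrow> 'w \<Rightarrow> 'w)
      \<Rightarrow> (('n, 'k) laurent \<Rightarrow> ('n, 'k) laurent)
      \<Rightarrow> (('n \<Rightarrow> int) \<Rightarrow>\<^sub>0 'w) \<Rightarrow> (('n \<Rightarrow> int) \<Rightarrow>\<^sub>0 'w)" where
  "tensor_act sW \<rho> D = tensor_lift (\<lambda>s w. \<Sum>i\<in>UNIV.
     pure_tensor sW (D (coord i) * partial i s) w +
     Sum_any (\<lambda>k. if k = 0 then 0 else
       pure_tensor sW (pm_scale (*) (1 / (\<Prod>j\<in>UNIV. fact (k j))) (partial_multi k (D (coord i))) * s)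
         (\<rho> (monomial_field k i) w)))"


section \<open>Algebraic Gelfand--Fuks cohomology\<close>

definition gf_cochains ::
    "('k::field_char_0 \<Rightarrow> 'w::ab_group_add \<Rightarrow> 'w) \<Rightarrow> nat
      \<Rightarrow> ((('n::finite, 'k) laurent \<Rightarrow> ('n, 'k) laurent) list \<Rightarrow> (('n \<Rightarrow> int) \<Rightarrow>\<^sub>0 'w)) set" where
  "gf_cochains sW k = {\<phi> \<in> ce_cochains field_scale torus_fields (pm_scale sW) k.
     k \<ge> 1 \<longrightarrow> (\<exists>p>0. \<forall>f. \<forall>\<eta>\<in>torus_fields. \<forall>\<eta>s. length \<eta>s = k - 1 \<and> set \<eta>s \<subseteq> torus_fields \<longrightarrow>
       (\<Sum>i\<le>p. pm_scale sW ((- 1) ^ i * of_nat (p choose i))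
          (tensor_mult sW (f ^ (p - i)) (\<phi> ((\<lambda>g. f ^ i * \<eta> g) # \<eta>s)))) = 0)}"

definition gf_cohomology ::
    "('k::field_char_0 \<Rightarrow> 'w::ab_group_add \<Rightarrow> 'w)
      \<Rightarrow> ((('n::finite, 'k) mpoly \<Rightarrow> ('n, 'k) mpoly) \<Rightarrow> 'w \<Rightarrow> 'w) \<Rightarrow> nat
      \<Rightarrow> ('k, ((('n, 'k) laurent \<Rightarrow> ('n, 'k) laurent) list \<Rightarrow> (('n \<Rightarrow> int) \<Rightarrow>\<^sub>0 'w)) set) vs" where
  "gf_cohomology sW \<rho> =
     cohomology (fun_scale (pm_scale sW)) (gf_cochains sW)
       (ce_diff torus_fields commutator (pm_scale sW) (tensor_act sW \<rho>))"


section \<open>Basic properties\<close>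

lemma vector_space_fun_scale: "vector_space s \<Longrightarrow> vector_space (fun_scale s)"
  unfolding vector_space_def fun_scale_def fun_eq_iff by simp

lemma lookup_pm_scale:
  assumes "vector_space s"
  shows "Poly_Mapping.lookup (pm_scale s c f) r = s c (Poly_Mapping.lookup f r)"
proof -
  interpret vector_space s by fact
  show ?thesis by (simp add: pm_scale_def map.rep_eq when_def)
qed

lemma vector_space_pm_scale: 
  assumes "vector_space s" shows "vector_space (pm_scale s)"
proof -
  interpret vector_space s by fact
  show ?thesis
    by unfold_locales (auto intro!: poly_mapping_eqI
       simp: lookup_pm_scale[OF assms] lookup_add scale_right_distrib scale_left_distrib)
qed

lemma vector_space_mult: "vector_space ((*) :: 'k::field \<Rightarrow> 'k \<Rightarrow> 'k)"
  by unfold_locales (auto simp: algebra_simps)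

lemma pm_scale_eq_mult:
  "pm_scale (*) c f = Poly_Mapping.single (0::'a::comm_monoid_add) (c::'k::field) * f"
  by (simp add: pm_scale_def mult_map_scale_conv_mult)

lemma single_sum_keys:
  "(\<Sum>r\<in>Poly_Mapping.keys f. Poly_Mapping.single r (Poly_Mapping.lookup f r)) = f"
  by (intro poly_mapping_eqI)
    (auto simp: lookup_sum lookup_single when_def sum.delta' in_keys_iff)

lemma additive_eqI:
  fixes F G :: "('a \<Rightarrow>\<^sub>0 'b::comm_monoid_add) \<Rightarrow> 'c::comm_monoid_add"
  assumes "\<And>f g. F (f + g) = F f + F g" "\<And>f g. G (f + g) = G f + G g"
    and "F 0 = 0" "G 0 = 0"
    and "\<And>r c. F (Poly_Mapping.single r c) = G (Poly_Mapping.single r c)"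
  shows "F f = G f"
proof -
  have "F (sum h A) = (\<Sum>a\<in>A. F (h a))" "G (sum h A) = (\<Sum>a\<in>A. G (h a))" if "finite A"
    for A :: "'a set" and h
    using that by (induction A rule: finite_induct) (simp_all add: assms)
  then have "F (\<Sum>r\<in>Poly_Mapping.keys f. Poly_Mapping.single r (Poly_Mapping.lookup f r))
     = G (\<Sum>r\<in>Poly_Mapping.keys f. Poly_Mapping.single r (Poly_Mapping.lookup f r))"
    by (simp add: assms)
  then show ?thesis by (simp add: single_sum_keys)
qed

lemma sum_keys_add:
  fixes b :: "'a \<Rightarrow> 'v::ab_group_add \<Rightarrow> 'u::ab_group_add"
  assumes "\<And>r c d. b r (c + d) = b r c + b r d"
  shows "(\<Sum>r\<in>Poly_Mapping.keys (f + g). b r (Poly_Mapping.lookup (f + g) r)) =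
    (\<Sum>r\<in>Poly_Mapping.keys f. b r (Poly_Mapping.lookup f r)) +
    (\<Sum>r\<in>Poly_Mapping.keys g. b r (Poly_Mapping.lookup g r))"
proof -
  let ?A = "Poly_Mapping.keys f \<union> Poly_Mapping.keys g"
  have b0: "b r 0 = 0" for r using assms[of r 0 0] by simp
  have sub: "(\<Sum>r\<in>Poly_Mapping.keys h. b r (Poly_Mapping.lookup h r)) =
      (\<Sum>r\<in>?A. b r (Poly_Mapping.lookup h r))" if "Poly_Mapping.keys h \<subseteq> ?A" for h
    by (rule sum.mono_neutral_left) (use that in \<open>auto simp: in_keys_iff b0\<close>)
  show ?thesis
    by (subst (1 2 3) sub) (use Poly_Mapping.keys_add[of f g] in \<open>auto simp: lookup_add assms sum.distrib\<close>)
qed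

lemma mpoly_partial_add: "mpoly_partial i (f + g) = mpoly_partial i f + mpoly_partial i g"
  unfolding mpoly_partial_def
  by (rule sum_keys_add[where b = "\<lambda>r c. Poly_Mapping.single (r - unit_exp i) (of_nat (r i) * c)"])
    (simp add: single_add algebra_simps)

lemma partial_add: "partial i (f + g) = partial i f + partial i g"
  unfolding partial_def
  by (rule sum_keys_add[where b = "\<lambda>r c. Poly_Mapping.single (r - unit_exp i) (of_int (r i) * c)"])
    (simp add: single_add algebra_simps)

lemma mpoly_partial_zero [simp]: "mpoly_partial i 0 = 0"
  by (simp add: mpoly_partial_def)

lemma partial_zero [simp]: "partial i 0 = 0"
  by (simp add: partial_def)

lemma mpoly_partial_single:
  "mpoly_partial i (Poly_Mapping.single r c) = Poly_Mapping.single (r - unit_exp i) (of_nat (r i) * c)"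
  by (simp add: mpoly_partial_def)

lemma partial_single:
  "partial i (Poly_Mapping.single r c) = Poly_Mapping.single (r - unit_exp i) (of_int (r i) * c)"
  by (simp add: partial_def)

lemma mpoly_partial_mult: "mpoly_partial i (f * g) = mpoly_partial i f * g + f * mpoly_partial i g"
proof (rule additive_eqI[where f = f])
  fix r c
  show "mpoly_partial i (Poly_Mapping.single r c * g) =
    mpoly_partial i (Poly_Mapping.single r c) * g + Poly_Mapping.single r c * mpoly_partial i g"
  proof (rule additive_eqI[where f = g])
    fix s d
    have *: "of_nat (r i) * c * d = 0" if "r i = 0" using that by simp
    have 1: "Poly_Mapping.single (r + s - unit_exp i) (of_nat (r i) * c * d) =
        Poly_Mapping.single (r - unit_exp i + s) (of_nat (r i) * c * d)"
    proof (cases "r i = 0")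
      case False
      then have "r + s - unit_exp i = r - unit_exp i + s" by (auto simp: unit_exp_def)
      then show ?thesis by simp
    qed simp
    have 2: "Poly_Mapping.single (r + s - unit_exp i) (c * (of_nat (s i) * d)) =
        Poly_Mapping.single (r + (s - unit_exp i)) (c * (of_nat (s i) * d))"
    proof (cases "s i = 0")
      case False
      then have "r + s - unit_exp i = r + (s - unit_exp i)" by (auto simp: unit_exp_def)
      then show ?thesis by simp
    qed simp
    show "mpoly_partial i (Poly_Mapping.single r c * Poly_Mapping.single s d) =
      mpoly_partial i (Poly_Mapping.single r c) * Poly_Mapping.single s d +
      Poly_Mapping.single r c * mpoly_partial i (Poly_Mapping.single s d)"
      unfolding mpoly_partial_single mult_single 1[symmetric] 2[symmetric] single_add[symmetric]
      by (simp add: algebra_simps)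
  qed (simp_all add: algebra_simps mpoly_partial_add)
qed (simp_all add: algebra_simps mpoly_partial_add)

lemma partial_mult: "partial i (f * g) = partial i f * g + f * partial i g"
proof (rule additive_eqI[where f = f])
  fix r c
  show "partial i (Poly_Mapping.single r c * g) =
    partial i (Poly_Mapping.single r c) * g + Poly_Mapping.single r c * partial i g"
  proof (rule additive_eqI[where f = g])
    fix s d
    have 1: "r - unit_exp i + s = r + s - unit_exp i" "r + (s - unit_exp i) = r + s - unit_exp i"
      by (simp_all add: algebra_simps)
    show "partial i (Poly_Mapping.single r c * Poly_Mapping.single s d) =
      partial i (Poly_Mapping.single r c) * Poly_Mapping.single s d +
      Poly_Mapping.single r c * partial i (Poly_Mapping.single s d)"
      unfolding partial_single mult_single 1 single_add[symmetric]
      by (simp add: algebra_simps)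
  qed (simp_all add: algebra_simps partial_add)
qed (simp_all add: algebra_simps partial_add)

lemma mpoly_partial_single_zero [simp]: "mpoly_partial i (Poly_Mapping.single 0 c) = 0"
  by (simp add: mpoly_partial_single)
lemma partial_single_zero [simp]: "partial i (Poly_Mapping.single 0 c) = 0"
  by (simp add: partial_single)

lemma vector_space_pm: "vector_space (pm_scale ((*) :: 'k::field \<Rightarrow> _))"
  by (rule vector_space_pm_scale[OF vector_space_mult])

lemma linear_vs_iff:
  assumes "vector_space s" "vector_space t"
  shows "Vector_Spaces.linear s t D \<longleftrightarrow>
    (\<forall>f g. D (f + g) = D f + D g) \<and> (\<forall>c f. D (s c f) = t c (D f))"
  using assms by (simp add: linear_iff_module_hom module_hom_iff module_iff_vector_space)

lemma linear_pm_iff: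
  "Vector_Spaces.linear (pm_scale ((*) :: 'k::field \<Rightarrow> _)) (pm_scale ((*))) D \<longleftrightarrow>
   (\<forall>f g. D (f + g) = D f + D g) \<and> (\<forall>c f. D (pm_scale (*) c f) = pm_scale (*) c (D f))"
  by (rule linear_vs_iff[OF vector_space_pm vector_space_pm])

lemma monomial_field_derivation: "monomial_field k i \<in> derivations (pm_scale (*))"
  by (auto simp: derivations_def linear_pm_iff monomial_field_def mpoly_partial_add
     mpoly_partial_mult pm_scale_eq_mult algebra_simps)

lemma partial_torus_field: "(\<lambda>g. f * partial i g) \<in> torus_fields"
  by (auto simp: torus_fields_def derivations_def linear_pm_iff partial_add
     partial_mult pm_scale_eq_mult algebra_simps)

lemma lie_algebra_derivations:
  assumes vs: "vector_space s" and m: "\<And>c f g. s c (f * g) = s c f * g"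
  shows "lie_algebra (fun_scale s) (derivations s) commutator"
proof -
  interpret s: vector_space s by fact
  interpret F: vector_space "fun_scale s" by (rule vector_space_fun_scale[OF vs])
  have lin: "Vector_Spaces.linear s s D \<longleftrightarrow>
      (\<forall>f g. D (f + g) = D f + D g) \<and> (\<forall>c f. D (s c f) = s c (D f))" for D
    by (rule linear_vs_iff[OF vs vs])
  have m': "s c (f * g) = f * s c g" for c f g
    using m[of c g f] by (simp add: mult.commute)
  have d: "D (f - g) = D f - D g" if "D \<in> derivations s" for D f g
    using that by (auto simp: derivations_def lin) (metis add_diff_cancel diff_add_cancel)
  show ?thesis
  proof
    show "F.subspace (derivations s)"
    proof (rule F.subspaceI)
      show "0 \<in> derivations s" by (simp add: derivations_def lin)
    next
      fix D E assume "D \<in> derivations s" "E \<in> derivations s"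
      then show "D + E \<in> derivations s"
        by (simp add: derivations_def lin s.scale_right_distrib algebra_simps)
    next
      fix c D assume "D \<in> derivations s"
      then show "fun_scale s c D \<in> derivations s"
        by (simp add: derivations_def lin fun_scale_def s.scale_right_distrib m[symmetric] m'[symmetric] mult.commute)
    qed
  next
    fix D E assume DE: "D \<in> derivations s" "E \<in> derivations s"
    then show "commutator D E \<in> derivations s"
      by (simp add: derivations_def lin commutator_def s.scale_right_diff_distrib algebra_simps)
    fix c
    show "commutator (fun_scale s c D) E = fun_scale s c (commutator D E)"
      using DE by (simp add: derivations_def lin commutator_def fun_scale_def s.scale_right_diff_distrib fun_eq_iff)
    show "commutator D (fun_scale s c E) = fun_scale s c (commutator D E)"
      using DE by (simp add: derivations_def lin commutator_def fun_scale_def s.scale_right_diff_distrib fun_eq_iff)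
    show "commutator D D = 0" by (simp add: commutator_def fun_eq_iff)
    fix G assume G: "G \<in> derivations s"
    show "commutator (D + E) G = commutator D G + commutator E G"
      using DE G by (simp add: commutator_def fun_eq_iff derivations_def lin)
    show "commutator D (E + G) = commutator D E + commutator D G"
      using DE G by (simp add: commutator_def fun_eq_iff derivations_def lin)
    show "commutator D (commutator E G) + commutator E (commutator G D) + commutator G (commutator D E) = 0"
      by (simp add: commutator_def fun_eq_iff d[OF DE(1)] d[OF DE(2)] d[OF G])
  qed
qed

lemma lie_algebra_torus_fields: "lie_algebra field_scale torus_fields commutator"
  unfolding torus_fields_def
  by (rule lie_algebra_derivations[OF vector_space_pm]) (simp add: pm_scale_eq_mult mult.assoc)

lemma mpoly_partial_commute: "mpoly_partial i (mpoly_partial j f) = mpoly_partial j (mpoly_partial i f)"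
proof (rule additive_eqI[where f = f])
  fix r c
  show "mpoly_partial i (mpoly_partial j (Poly_Mapping.single r c)) =
    mpoly_partial j (mpoly_partial i (Poly_Mapping.single r c))"
  proof (cases "i = j")
    case False
    then have "r - unit_exp i - unit_exp j = r - unit_exp j - unit_exp i"
      "(r - unit_exp i) j = r j" "(r - unit_exp j) i = r i"
      by (auto simp: unit_exp_def fun_eq_iff)
    then show ?thesis by (simp add: mpoly_partial_single algebra_simps)
  qed simp
qed (simp_all add: mpoly_partial_add)

lemma commutator_monomial_field:
  "commutator (monomial_field k i) (monomial_field l j :: ('n, 'k::field_char_0) mpoly \<Rightarrow> _) =
     field_scale (of_nat (l i)) (monomial_field (k + (l - unit_exp i)) j) -
     field_scale (of_nat (k j)) (monomial_field (l + (k - unit_exp j)) i)"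
proof
  fix p :: "('n, 'k) mpoly"
  have 1: "Poly_Mapping.single k 1 * mpoly_partial i (Poly_Mapping.single l (1::'k)) =
    Poly_Mapping.single 0 (of_nat (l i)) * Poly_Mapping.single (k + (l - unit_exp i)) 1"
    for k l :: "'n \<Rightarrow> nat" and i
    by (simp add: mpoly_partial_single mult_single del: single_of_nat)
  have ring: "a * (x * P + b * R) - b * (y * Q + a * R) = (a * x) * P - (b * y) * Q"
    for a b x y P Q R :: "('n, 'k) mpoly"
    by (simp add: algebra_simps)
  have "commutator (monomial_field k i) (monomial_field l j) p =
     (Poly_Mapping.single k 1 * mpoly_partial i (Poly_Mapping.single l 1)) * mpoly_partial j p -
     (Poly_Mapping.single l 1 * mpoly_partial j (Poly_Mapping.single k 1)) * mpoly_partial i p"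
    unfolding commutator_def monomial_field_def mpoly_partial_mult mpoly_partial_commute[of j i]
    by (rule ring)
  then show "commutator (monomial_field k i) (monomial_field l j) p =
     (field_scale (of_nat (l i)) (monomial_field (k + (l - unit_exp i)) j) -
     field_scale (of_nat (k j)) (monomial_field (l + (k - unit_exp j)) i)) p"
    unfolding 1 by (simp add: monomial_field_def fun_scale_def pm_scale_eq_mult mult.assoc)
qed

lemma L_plus_eq_span:
  "(L_plus :: (('n::finite, 'k::field_char_0) mpoly \<Rightarrow> _) set) = module.span field_scale {monomial_field k i |k i. k \<noteq> 0}"
proof -
  interpret F: vector_space field_scale
    by (rule vector_space_fun_scale[OF vector_space_pm])
  have "{monomial_field k i |k i. k \<noteq> 0} \<subseteq> (\<Union>d\<in>{0..}. L_graded d :: (('n, 'k) mpoly \<Rightarrow> _) set)"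
  proof clarify
    fix k :: "'n \<Rightarrow> nat" and i assume "k \<noteq> 0"
    then obtain j where "k j > 0" by (auto simp: fun_eq_iff)
    then have "(\<Sum>j\<in>UNIV. k j) > 0" using member_le_sum[of j UNIV k] by simp
    then have "int (\<Sum>j\<in>UNIV. k j) - 1 \<in> {0..}" by (simp add: Suc_le_eq del: of_nat_sum)
    moreover have "(monomial_field k i :: ('n, 'k) mpoly \<Rightarrow> _) \<in> L_graded (int (\<Sum>j\<in>UNIV. k j) - 1)"
      unfolding L_graded_def by (rule F.span_base) auto
    ultimately show "(monomial_field k i :: ('n, 'k) mpoly \<Rightarrow> _) \<in> (\<Union>d\<in>{0..}. L_graded d)" by blast
  qed
  note sub1 = this
  have "L_graded d \<subseteq> F.span {monomial_field k i |k i. k \<noteq> 0}" if "d \<ge> 0" for d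
    unfolding L_graded_def using that by (intro F.span_mono) auto
  then have sub2: "(\<Union>d\<in>{0..}. L_graded d) \<subseteq> F.span {monomial_field k i |k i. k \<noteq> 0}"
    by auto
  show ?thesis unfolding L_plus_def
    by (rule antisym[OF F.span_minimal[OF sub2 F.subspace_span] F.span_mono[OF sub1]])
qed

lemma L_plus_subset_derivations: "L_plus \<subseteq> derivations (pm_scale (*))"
proof -
  interpret F: lie_algebra field_scale "derivations (pm_scale (*))" commutator
    by (rule lie_algebra_derivations[OF vector_space_pm]) (simp add: pm_scale_eq_mult mult.assoc)
  show ?thesis unfolding L_plus_eq_span
    by (rule F.span_minimal[OF _ F.subspace_L]) (auto simp: monomial_field_derivation)
qed

lemma lie_algebra_L_plus:
  "lie_algebra field_scale (L_plus :: (('n::finite, 'k::field_char_0) mpoly \<Rightarrow> _) set) commutator"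
proof -
  let ?L = "L_plus :: (('n, 'k) mpoly \<Rightarrow> ('n, 'k) mpoly) set"
  interpret F: lie_algebra field_scale "derivations (pm_scale (*))" commutator
    by (rule lie_algebra_derivations[OF vector_space_pm]) (simp add: pm_scale_eq_mult mult.assoc)
  note D = subsetD[OF L_plus_subset_derivations]
  have sub: "F.subspace ?L" unfolding L_plus_def by simp
  have mono: "commutator (monomial_field k i) (monomial_field l j) \<in> ?L"
    if "k \<noteq> 0" "l \<noteq> 0" for k l :: "'n \<Rightarrow> nat" and i j
  proof -
    have *: "field_scale (of_nat (l i)) (monomial_field (k + (l - unit_exp i)) j) \<in> ?L"
      if "k \<noteq> 0" for k l :: "'n \<Rightarrow> nat" and i j
    proof -
      have "k + (l - unit_exp i) \<noteq> 0" using that by (auto simp: fun_eq_iff)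
      then have "monomial_field (k + (l - unit_exp i)) j \<in> ?L"
        unfolding L_plus_eq_span by (intro F.span_base) auto
      then show ?thesis using sub by (simp add: F.subspace_scale)
    qed
    show ?thesis unfolding commutator_monomial_field
      by (intro F.subspace_diff[OF sub] * that)
  qed
  have gen: "monomial_field k i \<in> ?L" if "k \<noteq> 0" for k :: "'n \<Rightarrow> nat" and i
    unfolding L_plus_eq_span using that by (intro F.span_base) auto
  have 1: "?L \<subseteq> {D \<in> ?L. \<forall>l j. l \<noteq> 0 \<longrightarrow> commutator D (monomial_field l j) \<in> ?L}"
    (is "_ \<subseteq> ?S")
  proof -
    have "F.subspace ?S"
    proof (rule F.subspaceI)
      show "0 \<in> ?S" using F.subspace_0[OF sub]
        by (auto simp: commutator_def monomial_field_def zero_fun_def)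
    qed (auto simp: F.br_add_left F.br_scale_left D monomial_field_derivation F.subspace_add[OF sub] F.subspace_scale[OF sub])
    then show ?thesis
      by (subst L_plus_eq_span, intro F.span_minimal) (auto simp: gen mono)
  qed
  have 2: "?L \<subseteq> {E \<in> ?L. \<forall>D\<in>?L. commutator D E \<in> ?L}" (is "_ \<subseteq> ?S")
  proof -
    have "F.subspace ?S"
    proof (rule F.subspaceI)
      have "commutator D 0 = 0" if "D \<in> ?L" for D :: "('n, 'k) mpoly \<Rightarrow> ('n, 'k) mpoly"
        using F.br_scale_right[OF D[OF that] D[OF that], of 0] by simp
      then show "0 \<in> ?S" using F.subspace_0[OF sub] by auto
    qed (auto simp: F.br_add_right F.br_scale_right D F.subspace_add[OF sub] F.subspace_scale[OF sub])
    then show ?thesis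
      by (subst L_plus_eq_span, intro F.span_minimal) (use 1 in \<open>auto simp: gen\<close>)
  qed
  show ?thesis
    by unfold_locales
      (use 2 in \<open>auto simp: sub F.br_add_right F.br_scale_right F.br_add_left F.br_scale_left F.br_self F.jacobi D\<close>)
qed

lemma lookup_pure_tensor:
  assumes "vector_space sW"
  shows "Poly_Mapping.lookup (pure_tensor sW s w) r = sW (Poly_Mapping.lookup s r) w"
proof -
  interpret vector_space sW by fact
  show ?thesis by (simp add: pure_tensor_def map.rep_eq when_def)
qed

lemma pure_tensor_single:
  assumes "vector_space sW"
  shows "pure_tensor sW (Poly_Mapping.single r c) w = Poly_Mapping.single r (sW c w)"
proof -
  interpret vector_space sW by fact
  show ?thesis
    by (intro poly_mapping_eqI) (simp add: lookup_pure_tensor[OF assms] lookup_single when_def)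
qed

lemma pure_tensor_add_left:
  "vector_space sW \<Longrightarrow> pure_tensor sW (s + t) w = pure_tensor sW s w + pure_tensor sW t w"
  by (intro poly_mapping_eqI) (simp add: lookup_pure_tensor lookup_add vector_space.vector_space_assms)

lemma pure_tensor_add_right:
  "vector_space sW \<Longrightarrow> pure_tensor sW s (v + w) = pure_tensor sW s v + pure_tensor sW s w"
  by (intro poly_mapping_eqI) (simp add: lookup_pure_tensor lookup_add vector_space.vector_space_assms)

lemma pure_tensor_scale_left:
  "vector_space sW \<Longrightarrow> pure_tensor sW (pm_scale (*) c s) w = pm_scale sW c (pure_tensor sW s w)"
  by (intro poly_mapping_eqI)
    (simp add: lookup_pure_tensor lookup_pm_scale lookup_pm_scale[OF vector_space_mult] vector_space.vector_space_assms)

lemma pure_tensor_scale_right: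
  "vector_space sW \<Longrightarrow> pure_tensor sW s (sW c w) = pm_scale sW c (pure_tensor sW s w)"
  by (intro poly_mapping_eqI)
    (simp add: lookup_pure_tensor lookup_pm_scale vector_space.vector_space_assms mult.commute)

lemma tensor_lift_pure_tensor:
  fixes \<beta> :: "('a::comm_monoid_add \<Rightarrow>\<^sub>0 'k::field) \<Rightarrow> 'w::ab_group_add \<Rightarrow> 'u::ab_group_add"
  assumes vs: "vector_space sW"
    and add_left: "\<And>s t w. \<beta> (s + t) w = \<beta> s w + \<beta> t w"
    and add_right: "\<And>s v w. \<beta> s (v + w) = \<beta> s v + \<beta> s w"
    and scale: "\<And>c s w. \<beta> (pm_scale (*) c s) w = \<beta> s (sW c w)"
  shows "tensor_lift \<beta> (pure_tensor sW s w) = \<beta> s w"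
proof -
  have z: "\<beta> 0 w = 0" "\<beta> s 0 = 0" for s w
    using add_left[of 0 0 w] add_right[of s 0 0] by simp_all
  have add: "tensor_lift \<beta> (m + m') = tensor_lift \<beta> m + tensor_lift \<beta> m'" for m m'
    unfolding tensor_lift_def by (rule sum_keys_add) (rule add_right)
  have 0: "pure_tensor sW 0 w = 0" by (intro poly_mapping_eqI) (simp add: pure_tensor_def map.rep_eq)
  show ?thesis
  proof (rule additive_eqI[where f = s])
    fix r c
    have "\<beta> (Poly_Mapping.single r c) w = \<beta> (pm_scale (*) c (Poly_Mapping.single r 1)) w"
      by (simp add: pm_scale_eq_mult mult_single del: single_one)
    also have "\<dots> = tensor_lift \<beta> (pure_tensor sW (Poly_Mapping.single r c) w)"
      by (simp add: scale pure_tensor_single[OF vs] tensor_lift_def z)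
    finally show "tensor_lift \<beta> (pure_tensor sW (Poly_Mapping.single r c) w) =
      \<beta> (Poly_Mapping.single r c) w" by simp
  qed (simp_all add: pure_tensor_add_left[OF vs] add add_left z 0 tensor_lift_def[of _ 0])
qed

lemma tensor_mult_pure_tensor:
  assumes "vector_space sW"
  shows "tensor_mult sW f (pure_tensor sW s w) = pure_tensor sW (f * s) w"
proof -
  have *: "f * pm_scale (*) c s = pm_scale (*) c (f * s)" for c s
    by (simp add: pm_scale_eq_mult mult.left_commute)
  show ?thesis unfolding tensor_mult_def
    by (rule tensor_lift_pure_tensor[OF assms])
      (simp_all add: distrib_left * pure_tensor_add_left pure_tensor_add_right
        pure_tensor_scale_left pure_tensor_scale_right assms)
qed

lemma partial_coord: "partial i (coord j) = (if i = j then 1 else 0)"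
  by (simp add: coord_def partial_single) (auto simp: unit_exp_def)

lemma torus_field_eq:
  assumes "D \<in> torus_fields"
  shows "D f = (\<Sum>i\<in>UNIV. D (coord i) * partial i f)"
proof -
  define T where "T f = D f - (\<Sum>i\<in>UNIV. D (coord i) * partial i f)" for f
  have Tadd: "T (f + g) = T f + T g" for f g
    using assms by (simp add: T_def torus_fields_def derivations_def linear_pm_iff partial_add
        distrib_left sum.distrib algebra_simps)
  have Tmult: "T (f * g) = T f * g + f * T g" for f g
    using assms by (simp add: T_def torus_fields_def derivations_def partial_mult
        distrib_left sum.distrib sum_distrib_left sum_distrib_right algebra_simps)
  have T0: "T 0 = 0" using Tadd[of 0 0] by simp
  have T1: "T 1 = 0" using Tmult[of 1 1] by simp
  have Tc: "T (coord i) = 0" for i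
    by (simp add: T_def partial_coord if_distrib cong: if_cong)
  let ?x = "\<lambda>r :: 'a \<Rightarrow> int. Poly_Mapping.single r (1 :: 'b)"
  have m: "?x (r + s) = ?x r * ?x s" for r s by (simp add: mult_single)
  have add: "T (?x (r + s)) = 0" if "T (?x r) = 0" "T (?x s) = 0" for r s
    using that by (simp add: m Tmult)
  have neg: "T (?x (- r)) = 0" if "T (?x r) = 0" for r
  proof -
    have inv: "?x (- r) * ?x r = 1" by (simp add: m[symmetric])
    have "0 = T (?x r * ?x (- r))" by (simp add: m[symmetric] T1)
    also have "\<dots> = ?x r * T (?x (- r))" using that by (simp add: Tmult)
    finally have "?x (- r) * ?x r * T (?x (- r)) = 0" by (simp add: mult.assoc)
    then show ?thesis by (simp add: inv)
  qed
  have e: "T (?x (\<lambda>j. if j = i then int n else 0)) = 0" for i n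
  proof (induction n)
    case 0
    have "(\<lambda>j. if j = i then int 0 else 0) = 0" by auto
    then show ?case using T1 by simp
  next
    case (Suc n)
    have "(\<lambda>j. if j = i then int (Suc n) else 0) = unit_exp i + (\<lambda>j. if j = i then int n else 0)"
      by (auto simp: unit_exp_def)
    with Suc show ?case using add[of "unit_exp i"] Tc[of i] by (simp add: coord_def)
  qed
  have e': "T (?x (\<lambda>j. if j = i then a else 0)) = 0" for i a
  proof (cases "a \<ge> 0")
    case True
    then have "(\<lambda>j. if j = i then int (nat a) else 0) = (\<lambda>j. if j = i then a else 0)" by auto
    then show ?thesis using e[of i "nat a"] by simp
  next
    case False
    have "- (\<lambda>j. if j = i then int (nat (- a)) else 0) = (\<lambda>j. if j = i then a else 0)"
      using False by auto
    then show ?thesis using neg[OF e[of i "nat (- a)"]] by simp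
  qed
  have mon: "T (?x (\<Sum>i\<in>S. (\<lambda>j. if j = i then r i else 0))) = 0" if "finite S" for S r
    using that
  proof (induction S rule: finite_induct)
    case (insert i S)
    show ?case unfolding sum.insert[OF insert.hyps] by (rule add[OF e' insert.IH])
  qed (simp add: T1 flip: zero_fun_def)
  have sum: "(\<Sum>i\<in>UNIV. (\<lambda>j. if j = i then r i else 0)) = r" for r :: "'a \<Rightarrow> int"
  proof
    fix x
    have "(\<Sum>i\<in>S. (\<lambda>j. if j = i then r i else 0)) x = (\<Sum>i\<in>S. if x = i then r i else 0)"
      if "finite S" for S
      using that by (induction S rule: finite_induct) simp_all
    from this[of UNIV] show "(\<Sum>i\<in>UNIV. (\<lambda>j. if j = i then r i else 0)) x = r x" by simp
  qed
  have Tr: "T (?x r) = 0" for r using mon[of UNIV r] by (simp add: sum)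
  have Tcst: "T (Poly_Mapping.single 0 c) = 0" for c
  proof -
    have "Poly_Mapping.single 0 c = pm_scale (*) c (1 :: ('a, 'b) laurent)"
      by (simp add: pm_scale_eq_mult)
    moreover have "D (pm_scale (*) c 1) = pm_scale (*) c (D 1)"
      using assms by (simp add: torus_fields_def derivations_def linear_pm_iff)
    moreover have "D 1 = 0" using T1 by (simp add: T_def partial_def)
    ultimately show ?thesis
      by (simp add: T_def) (simp add: pm_scale_eq_mult del: single_one)
  qed
  have "T f = 0"
  proof (rule additive_eqI[where f = f])
    fix r c
    have "Poly_Mapping.single r c = Poly_Mapping.single 0 c * ?x r" by (simp add: mult_single)
    then show "T (Poly_Mapping.single r c) = 0" by (simp only: Tmult Tcst Tr) simp
  qed (simp_all add: Tadd T0)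
  then show ?thesis by (simp add: T_def)
qed


lemma partial_commute: "partial i (partial j f) = partial j (partial i f)"
proof (rule additive_eqI[where f = f])
  fix r c
  show "partial i (partial j (Poly_Mapping.single r c)) = partial j (partial i (Poly_Mapping.single r c))"
    by (cases "i = j") (auto simp: partial_single unit_exp_def fun_eq_iff algebra_simps)
qed (simp_all add: partial_add)

lemma partial_funpow_single:
  "(partial i ^^ n) (Poly_Mapping.single r c) =
     Poly_Mapping.single (\<lambda>j. r j - (if j = i then int n else 0)) (c * (\<Prod>l<n. of_int (r i - int l)))"
  by (induction n) (simp_all add: partial_single unit_exp_def algebra_simps fun_eq_iff cong: if_cong,
     auto intro!: arg_cong2[where f = Poly_Mapping.single])

lemma comp_fun_commute_partial: 
  "comp_fun_commute (\<lambda>i. (partial i :: ('n, 'k::field_char_0) laurent \<Rightarrow> _) ^^ k i)"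
proof
  fix i j
  have 1: "partial i ((partial j ^^ n) f) = (partial j ^^ n) (partial i f)"
    for n i j and f :: "('n, 'k) laurent"
    by (induction n) (simp_all add: partial_commute[of i j])
  have "(partial i ^^ m) ((partial j ^^ n) f) = (partial j ^^ n) ((partial i ^^ m) f)"
    for m n and f :: "('n, 'k) laurent"
    by (induction m) (simp_all add: 1)
  note c = this
  show "((partial j :: ('n, 'k) laurent \<Rightarrow> _) ^^ k j) \<circ> (partial i ^^ k i) =
      (partial i ^^ k i) \<circ> (partial j ^^ k j)"
    by (rule ext) (simp only: comp_apply c[of "k i" "k j"])
qed

lemma partial_multi_single:
  "partial_multi k (Poly_Mapping.single r c) =
     Poly_Mapping.single (\<lambda>j. r j - int (k j)) (c * (\<Prod>j\<in>UNIV. \<Prod>l<k j. of_int (r j - int l)))"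
proof -
  interpret comp_fun_commute "\<lambda>i. partial i ^^ k i" by (rule comp_fun_commute_partial)
  have "Finite_Set.fold (\<lambda>i. partial i ^^ k i) (Poly_Mapping.single r c) S =
      Poly_Mapping.single (\<lambda>j. r j - (if j \<in> S then int (k j) else 0))
        (c * (\<Prod>j\<in>S. \<Prod>l<k j. of_int (r j - int l)))" if "finite S" for S
    using that
  proof (induction S rule: finite_induct)
    case (insert i S)
    then show ?case
      by (auto simp: partial_funpow_single mult_ac intro!: arg_cong2[where f = Poly_Mapping.single])
  qed simp
  from this[of UNIV] show ?thesis by (simp add: partial_multi_def)
qed

lemma partial_multi_add: "partial_multi k (f + g) = partial_multi k f + partial_multi k g"
proof -
  interpret comp_fun_commute "\<lambda>i. partial i ^^ k i" by (rule comp_fun_commute_partial)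
  have 1: "(partial i ^^ n) (f + g) = (partial i ^^ n) f + (partial i ^^ n) g" for i n and f g :: "('a, 'b) laurent"
    by (induction n) (simp_all add: partial_add)
  have "Finite_Set.fold (\<lambda>i. partial i ^^ k i) (f + g) S =
      Finite_Set.fold (\<lambda>i. partial i ^^ k i) f S + Finite_Set.fold (\<lambda>i. partial i ^^ k i) g S"
    if "finite S" for S
    using that by (induction S rule: finite_induct) (simp_all add: 1)
  then show ?thesis by (simp add: partial_multi_def)
qed

lemma tensor_act_pure_tensor:
  fixes sW :: "'k::field_char_0 \<Rightarrow> 'w::ab_group_add \<Rightarrow> 'w"
    and \<rho> :: "(('n::finite, 'k) mpoly \<Rightarrow> ('n, 'k) mpoly) \<Rightarrow> 'w \<Rightarrow> 'w"
  assumes "lie_module field_scale L_plus commutator sW \<rho>"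
    and fin: "\<And>i. finite {k. k \<noteq> 0 \<and> \<rho> (monomial_field k i) \<noteq> 0}"
  shows "tensor_act sW \<rho> (\<lambda>g. f * partial i g) (pure_tensor sW s w) =
    pure_tensor sW (f * partial i s) w +
    (\<Sum>k | k \<noteq> 0 \<and> \<rho> (monomial_field k i) \<noteq> 0.
       pure_tensor sW (pm_scale (*) (1 / (\<Prod>j\<in>UNIV. fact (k j))) (partial_multi k f) * s)
         (\<rho> (monomial_field k i) w))"
proof -
  interpret lie_module field_scale L_plus commutator sW \<rho> by fact
  note vs = M.vector_space_axioms
  have pt0: "pure_tensor sW s 0 = 0" "pure_tensor sW 0 w = 0" for s :: "('n, 'k) laurent" and w
    by (intro poly_mapping_eqI; simp add: lookup_pure_tensor[OF vs])+
  let ?K = "\<lambda>i. {k. k \<noteq> 0 \<and> \<rho> (monomial_field k i) \<noteq> 0}"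
  let ?g = "\<lambda>D i k. pm_scale (*) (1 / (\<Prod>j\<in>UNIV. fact (k j))) (partial_multi k (D (coord i)))"
  have any: "Sum_any (\<lambda>k. if k = 0 then 0 else pure_tensor sW (?g D i k * s) (\<rho> (monomial_field k i) w)) =
     (\<Sum>k\<in>?K i. pure_tensor sW (?g D i k * s) (\<rho> (monomial_field k i) w))" for D i s w
  proof -
    have "Sum_any (\<lambda>k. if k = 0 then 0 else pure_tensor sW (?g D i k * s) (\<rho> (monomial_field k i) w)) =
       (\<Sum>k\<in>?K i. if k = 0 then 0 else pure_tensor sW (?g D i k * s) (\<rho> (monomial_field k i) w))"
      by (rule Sum_any.expand_superset[OF fin]) (auto simp: pt0)
    also have "\<dots> = (\<Sum>k\<in>?K i. pure_tensor sW (?g D i k * s) (\<rho> (monomial_field k i) w))"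
      by (rule sum.cong) auto
    finally show ?thesis .
  qed
  have lin: "\<rho> (monomial_field k i) (v + w) = \<rho> (monomial_field k i) v + \<rho> (monomial_field k i) w"
    "\<rho> (monomial_field k i) (sW c w) = sW c (\<rho> (monomial_field k i) w)" if "k \<noteq> 0" for k i v w c
  proof -
    have "(monomial_field k i :: ('n, 'k) mpoly \<Rightarrow> _) \<in> L_plus"
      unfolding L_plus_eq_span by (rule module.span_base[OF module_axioms]) (use that in auto)
    from act_linear[OF this] show
      "\<rho> (monomial_field k i) (v + w) = \<rho> (monomial_field k i) v + \<rho> (monomial_field k i) w"
      "\<rho> (monomial_field k i) (sW c w) = sW c (\<rho> (monomial_field k i) w)"
      by (simp_all add: linear_vs_iff[OF vs vs])
  qed
  have sc: "h * pm_scale (*) c s = pm_scale (*) c (h * s)" "partial i (pm_scale (*) c s) = pm_scale (*) c (partial i s)"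
    for h s :: "('n, 'k) laurent" and c i
    by (simp_all add: pm_scale_eq_mult mult.left_commute partial_mult)
  define D where "D = (\<lambda>g. f * partial i g)"
  have "tensor_act sW \<rho> D (pure_tensor sW s w) =
     (\<Sum>i\<in>UNIV. pure_tensor sW (D (coord i) * partial i s) w +
        (\<Sum>k\<in>?K i. pure_tensor sW (?g D i k * s) (\<rho> (monomial_field k i) w)))"
    unfolding tensor_act_def any
  proof (rule tensor_lift_pure_tensor[OF vs], goal_cases)
    case (1 s t w)
    show ?case by (simp add: partial_add distrib_left pure_tensor_add_left[OF vs] sum.distrib)
  next
    case (2 s v w)
    have "(\<Sum>k\<in>?K i. pure_tensor sW (?g D i k * s) (\<rho> (monomial_field k i) (v + w))) =
       (\<Sum>k\<in>?K i. pure_tensor sW (?g D i k * s) (\<rho> (monomial_field k i) v) +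
          pure_tensor sW (?g D i k * s) (\<rho> (monomial_field k i) w))" for i
      by (rule sum.cong) (auto simp: lin pure_tensor_add_right[OF vs])
    then show ?case by (simp add: pure_tensor_add_right[OF vs] sum.distrib)
  next
    case (3 c s w)
    have "(\<Sum>k\<in>?K i. pm_scale sW c (pure_tensor sW (?g D i k * s) (\<rho> (monomial_field k i) w))) =
       (\<Sum>k\<in>?K i. pure_tensor sW (?g D i k * s) (\<rho> (monomial_field k i) (sW c w)))" for i
      by (rule sum.cong) (auto simp: lin pure_tensor_scale_right[OF vs])
    then show ?case
      by (simp add: sc pure_tensor_scale_left[OF vs] pure_tensor_scale_right[OF vs])
  qed
  also have "\<dots> = (\<Sum>j\<in>{i}. pure_tensor sW (D (coord j) * partial j s) w +
        (\<Sum>k\<in>?K j. pure_tensor sW (?g D j k * s) (\<rho> (monomial_field k j) w)))"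
  proof (rule sum.mono_neutral_right, goal_cases)
    case 3
    have "partial_multi k (0 :: ('n, 'k) laurent) = 0" for k
      using partial_multi_add[of k 0 0] by simp
    then show ?case by (auto simp: D_def partial_coord pt0 pm_scale_eq_mult)
  qed auto
  finally show ?thesis by (simp add: D_def partial_coord)
qed

end

theory Submission
  imports Defs "HOL-Computational_Algebra.Formal_Power_Series" "HOL-Library.Multiset"
begin

text \<open>
  The Gelfand--Fuks condition makes a cochain a differential operator in each argument, and a vector
  field is determined by its Taylor coefficients.  Hence the Gelfand--Fuks cochains are the
  alternating functions, with values in \<open>A \<otimes> W\<close>, of finitely many symbols
  \<open>(k, i)\<close>; those with \<open>k \<noteq> 0\<close> span \<open>\<L>\<^sub>+\<close>, and \<open>(0, i)\<close>, paired with the closed form \<open>dx\<^sub>i / x\<^sub>i\<close>, is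
  central.  In this way the complex is that of the cochains of \<open>\<L>\<^sub>+ \<oplus> k\<^sup>n\<close> which vanish on
  all symbols of large degree, and \<open>A \<otimes> W\<close> splits into the weight spaces \<open>x\<^sup>s \<otimes> W\<close>, on which \<open>(0, i)\<close>
  acts as \<open>s\<^sub>i\<close>.  If \<open>s\<^sub>i \<noteq> 0\<close>, then contraction with \<open>(0, i)\<close>, divided by \<open>s\<^sub>i\<close>, is a
  contracting homotopy.  For \<open>s = 0\<close> the central elements act trivially and the exterior algebra of
  \<open>k\<^sup>n\<close> splits off, which gives the binomial coefficients.  It remains to see that the cochains of
  \<open>\<L>\<^sub>+\<close> that vanish in large degree compute the full cohomology.  By Cartan's formula, contraction
  with the Euler field contracts the cochains supported in large degree: on cochains of degree \<open>d\<close> the Lie derivative is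
  \<open>E - d\<close>, which is invertible on the finite-dimensional \<open>W\<close> when \<open>d\<close> is large.
\<close>

section \<open>Cochains as functions on lists\<close>

text \<open>The bridge between the two complexes is flatness. The jets of a vector field \<eta> form
  an element a(\<eta>) of A tensor (L_+ + k^n) with a([\<eta>,\<zeta>]) = \<eta> a(\<zeta>) -
  \<zeta> a(\<eta>) + [a(\<eta>), a(\<zeta>)], the Maurer-Cartan equation; therefore pulling
  cochains back along a commutes with the differentials. The obstacle is finiteness. On the side of
  V, the Gelfand-Fuks order p confines the symbols to degrees below n p, since n exponents with sum
  at least n p include one that is at least p. On the side of L_+ arbitrary cochains are allowed.
  Finite dimension of W enters twice, each time because an operator has only finitely many
  eigenvalues: for E on W, where E - d must be inverted, and for the commutator with E on End W,
  where the image of \<open>X^k \<partial>/\<partial>X_i\<close> has eigenvalue |k| - 1 and so is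
  zero for large |k|. With the Lie derivative and the differential defined by recursion, identities
  between cochains are proved by induction on the list of arguments, and signs arise from adjacent
  transpositions.\<close>

definition ins :: "'x \<Rightarrow> ('x list \<Rightarrow> 'm) \<Rightarrow> 'x list \<Rightarrow> 'm" where
  "ins x c = (\<lambda>xs. c (x # xs))"

lemma ins_apply [simp]: "ins x c xs = c (x # xs)"
  by (simp add: ins_def)

definition ins_br :: "('x \<Rightarrow> 'x \<Rightarrow> 'x) \<Rightarrow> 'x \<Rightarrow> 'x \<Rightarrow> ('x list \<Rightarrow> 'm) \<Rightarrow> 'x list \<Rightarrow> 'm" where
  "ins_br br x y c xs = c (br x y # xs)"

definition sgnp :: "nat \<Rightarrow> 'm::ab_group_add \<Rightarrow> 'm" where
  "sgnp n y = (if even n then y else - y)"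

lemma sgnp_simps [simp]:
  "sgnp 0 y = y" "sgnp (Suc n) y = - sgnp n y" "sgnp n 0 = 0" "sgnp n (- y) = - sgnp n y"
  "sgnp n (sgnp n y) = y" "sgnp n y = 0 \<longleftrightarrow> y = 0"
  by (simp_all add: sgnp_def)

lemma sgnp_add: "sgnp n (x + y) = sgnp n x + sgnp n y"
  by (simp add: sgnp_def)

lemma (in vector_space) scale_minus_one_power: "scale ((- 1) ^ n) x = sgnp n x"
  by (induction n) simp_all

text \<open>Adjacent swaps are the form of skew symmetry that can be proved by induction on the
  prefix \<open>us\<close>. Vanishing on repeated arguments, as in \<open>ce_cochains\<close>,
  follows when \<open>y + y = 0\<close> forces \<open>y = 0\<close>
  (\<open>alternating_repeat\<close>).\<close>

definition alternating :: "'x set \<Rightarrow> ('x list \<Rightarrow> 'm::ab_group_add) \<Rightarrow> bool" where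
  "alternating V c \<longleftrightarrow> (\<forall>us x y vs. set (us @ x # y # vs) \<subseteq> V \<longrightarrow>
     c (us @ x # y # vs) = - c (us @ y # x # vs))"

lemma alternatingD:
  "alternating V c \<Longrightarrow> set (us @ x # y # vs) \<subseteq> V \<Longrightarrow> c (us @ x # y # vs) = - c (us @ y # x # vs)"
  unfolding alternating_def by blast

lemma alternating_swap:
  "alternating V c \<Longrightarrow> x \<in> V \<Longrightarrow> y \<in> V \<Longrightarrow> set vs \<subseteq> V \<Longrightarrow> c (x # y # vs) = - c (y # x # vs)"
  using alternatingD[of V c "[]" x y vs] by simp

lemma alternating_ins: "alternating V c \<Longrightarrow> x \<in> V \<Longrightarrow> alternating V (ins x c)"
  unfolding alternating_def
proof (intro allI impI)
  fix us y z vs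
  assume *: "\<forall>us x y vs. set (us @ x # y # vs) \<subseteq> V \<longrightarrow> c (us @ x # y # vs) = - c (us @ y # x # vs)"
    and "x \<in> V" "set (us @ y # z # vs) \<subseteq> V"
  then show "ins x c (us @ y # z # vs) = - ins x c (us @ z # y # vs)"
    using *[rule_format, of "x # us" y z vs] by simp
qed

lemma alternating_move:
  "alternating V c \<Longrightarrow> set (us @ x # vs) \<subseteq> V \<Longrightarrow> c (us @ x # vs) = sgnp (length us) (c (x # us @ vs))"
proof (induction us arbitrary: c)
  case (Cons u us)
  have "c ((u # us) @ x # vs) = sgnp (length us) (c (u # x # us @ vs))"
    using Cons.IH[OF alternating_ins, of c u] Cons.prems by simp
  also have "c (u # x # us @ vs) = - c (x # u # us @ vs)"
    using Cons.prems by (intro alternating_swap) auto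
  finally show ?case by simp
qed simp

lemma alternating_repeat:
  fixes c :: "'x list \<Rightarrow> 'm::ab_group_add"
  assumes "alternating V c" "\<not> distinct xs" "set xs \<subseteq> V" and two: "\<And>y :: 'm. y + y = 0 \<Longrightarrow> y = 0"
  shows "c xs = 0"
proof -
  \<comment> \<open>Both copies of \<open>x\<close> are brought to the front; exchanging them
    changes the sign but not the list.\<close>
  obtain us x vs ws where xs: "xs = us @ [x] @ vs @ [x] @ ws"
    using not_distinct_decomp[OF assms(2)] by blast
  have "c xs = sgnp (length us) (c (x # us @ vs @ [x] @ ws))"
    using alternating_move[OF assms(1), of us x "vs @ [x] @ ws"] assms(3) xs by simp
  moreover have "c (x # us @ vs @ [x] @ ws) = sgnp (length (us @ vs)) (c (x # x # us @ vs @ ws))"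
    using alternating_move[OF alternating_ins[OF assms(1)], of x "us @ vs" x ws] assms(3) xs by simp
  moreover have "c (x # x # us @ vs @ ws) = 0"
    using alternating_swap[OF assms(1), of x x "us @ vs @ ws"] assms(3) xs
    by - (rule two, simp add: eq_neg_iff_add_eq_0)
  ultimately show ?thesis by simp
qed

text \<open>The second equation is the commutation rule \<iota>_y L_x = L_x \<iota>_y -
  \<iota>_[x,y], read as a recursion on the number of arguments.\<close>

fun lieD :: "('x \<Rightarrow> 'x \<Rightarrow> ('x list \<Rightarrow> 'm) \<Rightarrow> 'x list \<Rightarrow> 'm) \<Rightarrow> ('x \<Rightarrow> 'm \<Rightarrow> 'm) \<Rightarrow>
    'x \<Rightarrow> ('x list \<Rightarrow> 'm) \<Rightarrow> 'x list \<Rightarrow> 'm::ab_group_add" where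
  "lieD B act x c [] = act x (c [])"
| "lieD B act x c (y # ys) = lieD B act x (ins y c) ys - B x y c ys"

text \<open>
  The differential is defined through Cartan's formula \<open>\<iota>\<^sub>x d = - L\<^sub>x - d \<iota>\<^sub>x\<close>, where the sign is that
  of \<^const>\<open>ce_diff\<close>.  The parameter \<open>B x y c\<close> stands for the contraction of \<open>c\<close> with \<open>[x, y]\<close>, so
  that brackets which are formal linear combinations of basis elements are covered.
\<close>
fun cdiff :: "('x \<Rightarrow> 'x \<Rightarrow> ('x list \<Rightarrow> 'm) \<Rightarrow> 'x list \<Rightarrow> 'm) \<Rightarrow> ('x \<Rightarrow> 'm \<Rightarrow> 'm) \<Rightarrow>
    ('x list \<Rightarrow> 'm) \<Rightarrow> 'x list \<Rightarrow> 'm::ab_group_add" where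
  "cdiff B act c [] = 0"
| "cdiff B act c (x # xs) = - lieD B act x c xs - cdiff B act (ins x c) xs"

text \<open>This is what the calculus needs of a bracket known only through contraction:
  \<open>B_cong\<close> replaces closedness of \<open>V\<close> under the bracket, and
  \<open>B_alternating\<close> says that contraction with [x, y] anticommutes with contraction with
  z. Antisymmetry is left to \<open>alternating_cdiff\<close>, since for \<open>ins_br\<close> it
  holds on linear cochains only.\<close>

locale cochain_ops =
  fixes V :: "'x set" and B :: "'x \<Rightarrow> 'x \<Rightarrow> ('x list \<Rightarrow> 'm::ab_group_add) \<Rightarrow> 'x list \<Rightarrow> 'm"
    and act :: "'x \<Rightarrow> 'm \<Rightarrow> 'm"
  assumes B_add: "B x y (\<lambda>xs. c xs + d xs) zs = B x y c zs + B x y d zs"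
    and B_cong: "x \<in> V \<Longrightarrow> y \<in> V \<Longrightarrow> set zs \<subseteq> V \<Longrightarrow> (\<And>ys. set ys \<subseteq> V \<Longrightarrow> length ys = Suc (length zs) \<Longrightarrow> c ys = d ys) \<Longrightarrow>
      B x y c zs = B x y d zs"
    and B_alternating: "x \<in> V \<Longrightarrow> y \<in> V \<Longrightarrow> alternating V c \<Longrightarrow> z \<in> V \<Longrightarrow> set zs \<subseteq> V \<Longrightarrow>
      B x y c (z # zs) = - B x y (ins z c) zs"
    and act_add: "x \<in> V \<Longrightarrow> act x (a + b) = act x a + act x b"
begin

abbreviation "L \<equiv> lieD B act"
abbreviation "d \<equiv> cdiff B act"

lemma lieD_add: "x \<in> V \<Longrightarrow> L x (\<lambda>xs. c xs + e xs) ys = L x c ys + L x e ys"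
  by (induction ys arbitrary: c e) (simp_all add: act_add B_add ins_def)

lemma cdiff_add: "set ys \<subseteq> V \<Longrightarrow> d (\<lambda>xs. c xs + e xs) ys = d c ys + d e ys"
  by (induction ys arbitrary: c e) (simp_all add: lieD_add ins_def)

lemma lieD_zero: "x \<in> V \<Longrightarrow> L x (\<lambda>_. 0) ys = 0"
  using lieD_add[of x "\<lambda>_. 0" "\<lambda>_. 0" ys] by simp

lemma cdiff_zero: "set ys \<subseteq> V \<Longrightarrow> d (\<lambda>_. 0) ys = 0"
  using cdiff_add[of ys "\<lambda>_. 0" "\<lambda>_. 0"] by simp

lemma B_zero: "B x y (\<lambda>_. 0) ys = 0"
  using B_add[of x y "\<lambda>_. 0" "\<lambda>_. 0" ys] by simp

lemma lieD_minus: "x \<in> V \<Longrightarrow> L x (\<lambda>xs. - c xs) ys = - L x c ys"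
  using lieD_add[of x c "\<lambda>xs. - c xs" ys] lieD_zero[of x ys] by (simp add: eq_neg_iff_add_eq_0 add.commute)

lemma cdiff_minus: "set ys \<subseteq> V \<Longrightarrow> d (\<lambda>xs. - c xs) ys = - d c ys"
  using cdiff_add[of ys c "\<lambda>xs. - c xs"] cdiff_zero[of ys] by (simp add: eq_neg_iff_add_eq_0 add.commute)

lemma cdiff_sgnp: "set ys \<subseteq> V \<Longrightarrow> d (\<lambda>xs. sgnp n (c xs)) ys = sgnp n (d c ys)"
  by (simp add: sgnp_def cdiff_minus)

lemma lieD_cong:
  "x \<in> V \<Longrightarrow> set ys \<subseteq> V \<Longrightarrow> (\<And>zs. set zs \<subseteq> V \<Longrightarrow> length zs = length ys \<Longrightarrow> c zs = e zs) \<Longrightarrow> L x c ys = L x e ys"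
proof (induction ys arbitrary: c e)
  case (Cons y ys)
  have "L x (ins y c) ys = L x (ins y e) ys" using Cons.prems by (intro Cons.IH) auto
  moreover have "B x y c ys = B x y e ys" using Cons.prems by (intro B_cong) auto
  ultimately show ?case by simp
qed simp

lemma cdiff_cong:
  "set ys \<subseteq> V \<Longrightarrow> (\<And>zs. set zs \<subseteq> V \<Longrightarrow> Suc (length zs) = length ys \<Longrightarrow> c zs = e zs) \<Longrightarrow> d c ys = d e ys"
proof (induction ys arbitrary: c e)
  case (Cons y ys)
  have "d (ins y c) ys = d (ins y e) ys" using Cons.prems by (intro Cons.IH) auto
  moreover have "L y c ys = L y e ys" using Cons.prems by (intro lieD_cong) auto
  ultimately show ?case by simp
qed simp

lemma ins_swap:
  assumes "alternating V c" "x \<in> V" "y \<in> V" "set zs \<subseteq> V"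
  shows "w \<in> V \<Longrightarrow> L w (ins x (ins y c)) zs = - L w (ins y (ins x c)) zs"
    and "d (ins x (ins y c)) zs = - d (ins y (ins x c)) zs"
proof -
  have *: "ins x (ins y c) us = - ins y (ins x c) us" if "set us \<subseteq> V" for us
    using alternating_swap[OF assms(1) assms(3,2) that] by simp
  show "L w (ins x (ins y c)) zs = - L w (ins y (ins x c)) zs" if "w \<in> V"
    using lieD_cong[of w zs "ins x (ins y c)" "\<lambda>us. - ins y (ins x c) us", OF that assms(4) *]
      lieD_minus[OF that, of "ins y (ins x c)"] by (simp add: ins_def)
  show "d (ins x (ins y c)) zs = - d (ins y (ins x c)) zs"
    using cdiff_cong[of zs "ins x (ins y c)" "\<lambda>us. - ins y (ins x c) us", OF assms(4) *]
      cdiff_minus[OF assms(4), of "ins y (ins x c)"] by (simp add: ins_def)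
qed

lemma alternating_B:
  assumes "x \<in> V" "y \<in> V" "alternating V c"
  shows "alternating V (B x y c)"
  unfolding alternating_def
proof (intro allI impI)
  fix us u v vs assume "set (us @ u # v # vs) \<subseteq> V"
  then show "B x y c (us @ u # v # vs) = - B x y c (us @ v # u # vs)"
    using assms
  proof (induction us arbitrary: c)
    case Nil
    have "B x y c (u # v # vs) = B x y (ins v (ins u c)) vs"
      using Nil by (simp add: B_alternating alternating_ins)
    moreover have "B x y c (v # u # vs) = B x y (ins u (ins v c)) vs"
      using Nil by (simp add: B_alternating alternating_ins)
    moreover have "B x y (ins u (ins v c)) vs = B x y (\<lambda>xs. - ins v (ins u c) xs) vs"
      using Nil by (intro B_cong) (auto intro: alternating_swap)
    moreover have "B x y (\<lambda>xs. - e xs) vs = - B x y e vs" for e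
      using B_add[of x y e "\<lambda>xs. - e xs" vs] by (simp add: B_zero eq_neg_iff_add_eq_0 add.commute)
    from this[of "ins v (ins u c)"]
    have "B x y (\<lambda>xs. - ins v (ins u c) xs) vs = - B x y (ins v (ins u c)) vs" .
    ultimately show ?case by (simp only: minus_minus append_Nil)
  next
    case (Cons w us)
    have "B x y c ((w # us) @ u # v # vs) = - B x y (ins w c) (us @ u # v # vs)"
      using Cons.prems by (simp add: B_alternating)
    also have "\<dots> = B x y (ins w c) (us @ v # u # vs)"
      using Cons.IH[of "ins w c"] Cons.prems alternating_ins[of V c w] by (simp add: ins_def)
    also have "\<dots> = - B x y c ((w # us) @ v # u # vs)"
      using Cons.prems by (simp add: B_alternating)
    finally show ?case .
  qed
qed

lemma alternating_lieD:
  assumes "x \<in> V" "alternating V c"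
  shows "alternating V (L x c)"
  unfolding alternating_def
proof (intro allI impI)
  fix us u v vs assume "set (us @ u # v # vs) \<subseteq> V"
  then show "L x c (us @ u # v # vs) = - L x c (us @ v # u # vs)"
    using assms(2)
  proof (induction us arbitrary: c)
    case Nil
    then show ?case
      using ins_swap(1)[of c u v vs x] by (simp add: B_alternating assms(1))
  next
    case (Cons w us)
    have "L x (ins w c) (us @ u # v # vs) = - L x (ins w c) (us @ v # u # vs)"
      using Cons.prems by (intro Cons.IH alternating_ins) auto
    moreover have "B x w c (us @ u # v # vs) = - B x w c (us @ v # u # vs)"
      using Cons.prems assms(1) by (intro alternatingD[OF alternating_B]) auto
    ultimately show ?case by simp
  qed
qed

text \<open>When the first two arguments are exchanged, the Lie derivative terms cancel in pairs and
  \<open>B u v c + B v u c\<close> remains, so the antisymmetry of the bracket is what is needed.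
  \<open>Adm\<close> is a class of cochains on which it is available.\<close>

lemma alternating_cdiff:
  assumes "alternating V c" "c \<in> Adm"
    and Adm_ins: "\<And>x c. x \<in> V \<Longrightarrow> c \<in> Adm \<Longrightarrow> ins x c \<in> Adm"
    and B_anti: "\<And>c x y ys. c \<in> Adm \<Longrightarrow> x \<in> V \<Longrightarrow> y \<in> V \<Longrightarrow> set ys \<subseteq> V \<Longrightarrow> B x y c ys = - B y x c ys"
  shows "alternating V (d c)"
  unfolding alternating_def
proof (intro allI impI)
  fix us u v vs assume "set (us @ u # v # vs) \<subseteq> V"
  then show "d c (us @ u # v # vs) = - d c (us @ v # u # vs)"
    using assms(1,2)
  proof (induction us arbitrary: c)
    case Nil
    then show ?case
      using ins_swap(2)[of c u v vs] B_anti[of c u v vs] by simp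
  next
    case (Cons w us)
    have "d (ins w c) (us @ u # v # vs) = - d (ins w c) (us @ v # u # vs)"
      using Cons.prems by (intro Cons.IH alternating_ins Adm_ins) auto
    moreover have "L w c (us @ u # v # vs) = - L w c (us @ v # u # vs)"
      using Cons.prems by (intro alternatingD[OF alternating_lieD]) auto
    ultimately show ?case by simp
  qed
qed

end

section \<open>Agreement of the recursive differential with the alternating sum\<close>

lemma nths_Compl_zero_Cons [simp]: "nths (x # xs) (- {0}) = xs"
  by (simp add: nths_Cons nths_all)

lemma nths_Compl_Suc_Cons:
  "nths (x # xs) (- {Suc s}) = x # nths xs (- {s})"
  "nths (x # xs) (- {0, Suc t}) = nths xs (- {t})"
  "nths (x # xs) (- {Suc s, Suc t}) = x # nths xs (- {s, t})"
proof -
  have "{j. Suc j \<noteq> Suc s} = - {s}" "{j. Suc j \<in> - {0, Suc t}} = - {t}"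
    "{j. Suc j \<in> - {Suc s, Suc t}} = - {s, t}" by auto
  then show "nths (x # xs) (- {Suc s}) = x # nths xs (- {s})"
    "nths (x # xs) (- {0, Suc t}) = nths xs (- {t})"
    "nths (x # xs) (- {Suc s, Suc t}) = x # nths xs (- {s, t})"
    by (simp_all add: nths_Cons Compl_eq)
qed

lemma set_nths_subset_trans: "set xs \<subseteq> V \<Longrightarrow> set (nths xs A) \<subseteq> V"
  using notin_set_nthsI by fastforce

text \<open>Each step of the recursion contributes one bracket, which has to pass the arguments
  peeled off before it; this accounts for the sign \<open>sgnp j\<close>.\<close>

lemma lieD_alternating:
  assumes "alternating V c" "set ys \<subseteq> V" "\<And>y. y \<in> V \<Longrightarrow> br x y \<in> V"
  shows "lieD (ins_br br) act x c ys =
    act x (c ys) - (\<Sum>j<length ys. sgnp j (c (br x (ys ! j) # nths ys (- {j}))))"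
  using assms(1,2)
proof (induction ys arbitrary: c)
  case (Cons y ys)
  have "c (y # br x (ys ! j) # nths ys (- {j})) = - c (br x (ys ! j) # y # nths ys (- {j}))"
    if "j < length ys" for j
    using Cons.prems assms(3) subsetD[OF Cons.prems(2), of "ys ! j"] that
    by (intro alternating_swap[OF Cons.prems(1)] set_nths_subset_trans) auto
  moreover have "lieD (ins_br br) act x (ins y c) ys =
     act x (c (y # ys)) - (\<Sum>j<length ys. sgnp j (c (y # br x (ys ! j) # nths ys (- {j}))))"
    using Cons.IH[OF alternating_ins[OF Cons.prems(1)], of y] Cons.prems(2) by (simp add: ins_def)
  moreover have "ins_br br x y c ys = c (br x y # ys)" by (simp add: ins_br_def)
  ultimately show ?case
    unfolding length_Cons sum.lessThan_Suc_shift
    by (simp add: nths_Compl_Suc_Cons sum_negf ins_def algebra_simps)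
qed simp

text \<open>The first argument \<open>x\<close> is peeled off. The terms in which \<open>x\<close>
  acts or enters a bracket add up to minus the Lie derivative. The others form the negative of the
  sum for \<open>ins x c\<close>: in the action terms the index shifts by one, while in the bracket
  terms both indices shift, which keeps the parity, but the bracket has to be moved past
  \<open>x\<close>.\<close>

lemma ce_diff_eq_cdiff:
  assumes "vector_space sM" "alternating V c" "set xs \<subseteq> V"
    and "\<And>x y. x \<in> V \<Longrightarrow> y \<in> V \<Longrightarrow> br x y \<in> V"
  shows "ce_diff V br sM act c xs = cdiff (ins_br br) act c xs"
proof -
  interpret vector_space sM by fact
  let ?E = "\<lambda>c xs. (\<Sum>t<length xs. \<Sum>s<t. - sgnp (s + t) (c (br (xs ! s) (xs ! t) # nths xs (- {s, t})))) +
     (\<Sum>s<length xs. - sgnp s (act (xs ! s) (c (nths xs (- {s})))))"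
  have "?E c xs = cdiff (ins_br br) act c xs"
    using assms(2,3)
  proof (induction xs arbitrary: c)
    case (Cons x ys)
    note alt = Cons.prems(1)
    have sub: "set (nths ys A) \<subseteq> V" for A using Cons.prems by (intro set_nths_subset_trans) auto
    let ?n = "length ys"
    have "(\<Sum>t<Suc ?n. \<Sum>s<t. - sgnp (s + t) (c (br ((x # ys) ! s) ((x # ys) ! t) # nths (x # ys) (- {s, t}))))
       = (\<Sum>t<?n. sgnp t (c (br x (ys ! t) # nths ys (- {t})))) +
         (\<Sum>t<?n. \<Sum>s<t. - sgnp (s + t) (c (br (ys ! s) (ys ! t) # x # nths ys (- {s, t}))))"
      unfolding sum.lessThan_Suc_shift by (simp add: nths_Compl_Suc_Cons sum.distrib)
    also have "(\<Sum>t<?n. \<Sum>s<t. - sgnp (s + t) (c (br (ys ! s) (ys ! t) # x # nths ys (- {s, t})))) =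
       - (\<Sum>t<?n. \<Sum>s<t. - sgnp (s + t) (ins x c (br (ys ! s) (ys ! t) # nths ys (- {s, t}))))"
      unfolding sum_negf[symmetric]
    proof (intro sum.cong refl)
      fix s t assume st: "t \<in> {..<?n}" "s \<in> {..<t}"
      then have "ys ! s \<in> set ys" "ys ! t \<in> set ys" by auto
      then have "ys ! s \<in> V" "ys ! t \<in> V" using Cons.prems(2) by auto
      then have "br (ys ! s) (ys ! t) \<in> V" by (rule assms(4))
      with alternating_swap[OF alt this _ sub[of "- {s, t}"], of x]
      show "- sgnp (s + t) (c (br (ys ! s) (ys ! t) # x # nths ys (- {s, t}))) =
         - (- sgnp (s + t) (ins x c (br (ys ! s) (ys ! t) # nths ys (- {s, t}))))"
        using Cons.prems by simp
    qed
    finally have 1: "(\<Sum>t<Suc ?n. \<Sum>s<t. - sgnp (s + t) (c (br ((x # ys) ! s) ((x # ys) ! t) # nths (x # ys) (- {s, t}))))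
       = (\<Sum>t<?n. sgnp t (c (br x (ys ! t) # nths ys (- {t})))) -
         (\<Sum>t<?n. \<Sum>s<t. - sgnp (s + t) (ins x c (br (ys ! s) (ys ! t) # nths ys (- {s, t}))))"
      by simp
    have 2: "(\<Sum>s<Suc ?n. - sgnp s (act ((x # ys) ! s) (c (nths (x # ys) (- {s}))))) =
      - act x (c ys) - (\<Sum>s<?n. - sgnp s (act (ys ! s) (ins x c (nths ys (- {s})))))"
      unfolding sum.lessThan_Suc_shift by (simp add: nths_Compl_Suc_Cons sum_negf)
    have 3: "lieD (ins_br br) act x c ys =
       act x (c ys) - (\<Sum>j<?n. sgnp j (c (br x (ys ! j) # nths ys (- {j}))))"
      using Cons.prems by (intro lieD_alternating[OF alt]) (auto intro: assms(4))
    have 4: "?E (ins x c) ys = cdiff (ins_br br) act (ins x c) ys"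
      using Cons.prems by (intro Cons.IH alternating_ins) auto
    show ?case
      unfolding length_Cons 1 2 cdiff.simps 3 4[symmetric] by simp
  qed simp
  then show ?thesis using assms(3)
    by (simp add: ce_diff_def scale_minus_one_power del: power_Suc)
qed

section \<open>Extension of cochains along a matrix of coefficients\<close>

context cochain_ops
begin

lemma cdiff_length:
  "set ys \<subseteq> V \<Longrightarrow> (\<And>zs. Suc (length zs) = length ys \<Longrightarrow> c zs = 0) \<Longrightarrow> d c ys = 0"
  using cdiff_cong[of ys c "\<lambda>_. 0"] cdiff_zero[of ys] by simp

end

text \<open>The pullback of \<open>c\<close> along the map that sends \<open>x\<close> to the formal
  combination of the symbols \<open>\<beta>\<close> with coefficients \<open>a x \<beta>\<close>.
  The range \<open>P x\<close> may depend on \<open>x\<close> because elements of L_+ have finite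
  expansions without a common finite support, whereas jets of torus fields are truncated
  uniformly.\<close>

fun jext :: "('a \<Rightarrow> 'm \<Rightarrow> 'm) \<Rightarrow> ('x \<Rightarrow> 'b \<Rightarrow> 'a) \<Rightarrow> ('x \<Rightarrow> 'b set) \<Rightarrow> ('b list \<Rightarrow> 'm) \<Rightarrow> 'x list \<Rightarrow> 'm::comm_monoid_add"
  where
  "jext sc a P c [] = c []"
| "jext sc a P c (x # xs) = (\<Sum>\<beta>\<in>P x. sc (a x \<beta>) (jext sc a P (ins \<beta> c) xs))"

lemma jext_cong:
  "(\<And>ys. length ys = length xs \<Longrightarrow> c ys = e ys) \<Longrightarrow> jext sc a P c xs = jext sc a P e xs"
proof (induction xs arbitrary: c e)
  case (Cons x xs)
  have "jext sc a P (ins \<beta> c) xs = jext sc a P (ins \<beta> e) xs" for \<beta>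
    by (rule Cons.IH) (simp add: Cons.prems)
  then show ?case by simp
qed simp

context module
begin

lemma jext_add: "jext scale a P (\<lambda>xs. c xs + e xs) xs = jext scale a P c xs + jext scale a P e xs"
  by (induction xs arbitrary: c e) (simp_all add: scale_right_distrib sum.distrib ins_def)

lemma jext_scale: "jext scale a P (\<lambda>xs. scale r (c xs)) xs = scale r (jext scale a P c xs)"
  by (induction xs arbitrary: c)
    (simp_all add: scale_sum_right ins_def mult.commute)

lemma jext_zero: "jext scale a P (\<lambda>_. 0) xs = 0"
  using jext_add[of a P "\<lambda>_. 0" "\<lambda>_. 0" xs] by simp

lemma jext_minus: "jext scale a P (\<lambda>xs. - c xs) xs = - jext scale a P c xs"
  using jext_add[of a P c "\<lambda>xs. - c xs" xs] jext_zero[of a P xs]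
  by (simp add: eq_neg_iff_add_eq_0 add.commute)

lemma jext_diff: "jext scale a P (\<lambda>xs. c xs - e xs) xs = jext scale a P c xs - jext scale a P e xs"
  using jext_add[of a P c "\<lambda>xs. - e xs" xs] by (simp add: jext_minus)

lemma jext_sum: "jext scale a P (\<lambda>xs. \<Sum>i\<in>I. c i xs) xs = (\<Sum>i\<in>I. jext scale a P (c i) xs)"
  by (induction I rule: infinite_finite_induct) (simp_all add: jext_zero jext_add)

lemma jext_length: "(\<And>ys. length ys = length xs \<Longrightarrow> c ys = 0) \<Longrightarrow> jext scale a P c xs = 0"
  by (subst jext_cong[of xs c "\<lambda>_. 0"]) (simp_all add: jext_zero)

lemma alternating_jext:
  assumes "alternating UNIV c"
  shows "alternating U (jext scale a P c)"
  unfolding alternating_def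
proof (intro allI impI)
  fix us x y vs
  show "jext scale a P c (us @ x # y # vs) = - jext scale a P c (us @ y # x # vs)"
    using assms(1)
  proof (induction us arbitrary: c)
    case Nil
    let ?J = "\<lambda>c. jext scale a P c vs"
    have swap: "?J (ins \<gamma> (ins \<beta> c)) = - ?J (ins \<beta> (ins \<gamma> c))" for \<beta> \<gamma>
    proof -
      have "?J (ins \<gamma> (ins \<beta> c)) = ?J (\<lambda>xs. - ins \<beta> (ins \<gamma> c) xs)"
        by (rule jext_cong) (simp add: alternating_swap[OF Nil, of \<beta> \<gamma>])
      then show ?thesis by (simp only: jext_minus)
    qed
    have "jext scale a P c (x # y # vs) = (\<Sum>\<beta>\<in>P x. \<Sum>\<gamma>\<in>P y. scale (a x \<beta> * a y \<gamma>) (?J (ins \<gamma> (ins \<beta> c))))"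
      by (simp add: scale_sum_right)
    also have "\<dots> = (\<Sum>\<gamma>\<in>P y. \<Sum>\<beta>\<in>P x. scale (a x \<beta> * a y \<gamma>) (?J (ins \<gamma> (ins \<beta> c))))"
      by (rule sum.swap)
    also have "\<dots> = (\<Sum>\<gamma>\<in>P y. \<Sum>\<beta>\<in>P x. - scale (a y \<gamma> * a x \<beta>) (?J (ins \<beta> (ins \<gamma> c))))"
      by (intro sum.cong refl, subst swap) (simp add: mult.commute)
    also have "\<dots> = - jext scale a P c (y # x # vs)"
      by (simp add: scale_sum_right sum_negf)
    finally show ?case by simp
  next
    case (Cons w us)
    have "jext scale a P (ins \<beta> c) (us @ x # y # vs) = - jext scale a P (ins \<beta> c) (us @ y # x # vs)" for \<beta>
      by (rule Cons.IH[OF alternating_ins[OF Cons.prems]]) simp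
    then show ?case by (simp add: sum_negf)
  qed
qed

end

section \<open>Recognizing cochains\<close>

lemma alternating_UNIV:
  assumes "alternating V c" "\<And>xs. \<not> set xs \<subseteq> V \<Longrightarrow> c xs = 0"
  shows "alternating UNIV c"
  unfolding alternating_def
proof (intro allI impI)
  fix us x y vs
  show "c (us @ x # y # vs) = - c (us @ y # x # vs)"
  proof (cases "set (us @ x # y # vs) \<subseteq> V")
    case True
    then show ?thesis by (rule alternatingD[OF assms(1)])
  next
    case False
    then have "\<not> set (us @ y # x # vs) \<subseteq> V" by auto
    then show ?thesis using assms(2) False by simp
  qed
qed

text \<open>Skew symmetry moves any slot to the front, so linearity in the first slot suffices. This
  is the form that fits recursion on lists.\<close>

lemma (in lie_algebra) ce_cochains_iff:
  fixes sM :: "'k \<Rightarrow> 'm::ab_group_add \<Rightarrow> 'm"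
  assumes "vector_space sM" "(2 :: 'k) \<noteq> 0"
  shows "\<phi> \<in> ce_cochains sL L sM n \<longleftrightarrow> alternating L \<phi> \<and>
    (\<forall>xs. \<not> (length xs = n \<and> set xs \<subseteq> L) \<longrightarrow> \<phi> xs = 0) \<and>
    (\<forall>x\<in>L. \<forall>y\<in>L. \<forall>xs. set xs \<subseteq> L \<longrightarrow> \<phi> ((x + y) # xs) = \<phi> (x # xs) + \<phi> (y # xs)) \<and>
    (\<forall>c. \<forall>x\<in>L. \<forall>xs. set xs \<subseteq> L \<longrightarrow> \<phi> (sL c x # xs) = sM c (\<phi> (x # xs)))"
    (is "_ \<longleftrightarrow> ?R")
proof
  interpret M: vector_space sM by fact
  assume \<phi>: "\<phi> \<in> ce_cochains sL L sM n"
  have supp: "\<phi> xs = 0" if "length xs \<noteq> n \<or> \<not> set xs \<subseteq> L" for xs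
    using \<phi> that by (auto simp: ce_cochains_def)
  have add: "\<phi> (us @ (x + y) # vs) = \<phi> (us @ x # vs) + \<phi> (us @ y # vs)"
    if "set (us @ vs) \<subseteq> L" "x \<in> L" "y \<in> L" for us vs x y
  proof (cases "length (us @ x # vs) = n")
    case True
    from \<phi> have "\<forall>xs i x y. length xs = n \<and> set xs \<subseteq> L \<and> i < n \<and> x \<in> L \<and> y \<in> L \<longrightarrow>
        \<phi> (xs[i := x + y]) = \<phi> (xs[i := x]) + \<phi> (xs[i := y])" by (auto simp: ce_cochains_def)
    from this[rule_format, of "us @ x # vs" "length us" x y]
    show ?thesis using that True by simp
  qed (simp add: supp)
  have scale: "\<phi> (us @ sL c x # vs) = sM c (\<phi> (us @ x # vs))"
    if "set (us @ vs) \<subseteq> L" "x \<in> L" for us vs x c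
  proof (cases "length (us @ x # vs) = n")
    case True
    from \<phi> have "\<forall>xs i x c. length xs = n \<and> set xs \<subseteq> L \<and> i < n \<and> x \<in> L \<longrightarrow>
        \<phi> (xs[i := sL c x]) = sM c (\<phi> (xs[i := x]))" by (auto simp: ce_cochains_def)
    from this[rule_format, of "us @ x # vs" "length us" x c]
    show ?thesis using that True by simp
  qed (simp add: supp)
  have dist: "\<phi> xs = 0" if "\<not> distinct xs" for xs
    using \<phi> that supp[of xs] by (auto simp: ce_cochains_def)
  have "alternating L \<phi>"
    unfolding alternating_def
  proof (intro allI impI)
    fix us x y vs assume *: "set (us @ x # y # vs) \<subseteq> L"
    then have xy: "x + y \<in> L" using subspace_add[OF subspace_L, of x y] by simp
    have "0 = \<phi> (us @ (x + y) # (x + y) # vs)" by (rule dist[symmetric]) simp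
    also have "\<dots> = \<phi> (us @ x # (x + y) # vs) + \<phi> (us @ y # (x + y) # vs)"
      using * xy by (intro add) auto
    also have "\<dots> = (\<phi> (us @ x # x # vs) + \<phi> (us @ x # y # vs)) + (\<phi> (us @ y # x # vs) + \<phi> (us @ y # y # vs))"
      using add[of "us @ [x]" vs x y] add[of "us @ [y]" vs x y] * by simp
    also have "\<dots> = \<phi> (us @ x # y # vs) + \<phi> (us @ y # x # vs)"
      by (simp add: dist)
    finally show "\<phi> (us @ x # y # vs) = - \<phi> (us @ y # x # vs)"
      by (simp add: eq_neg_iff_add_eq_0)
  qed
  then show ?R using supp add[of "[]"] scale[of "[]"] by auto
next
  interpret M: vector_space sM by fact
  assume R: ?R
  note alt = conjunct1[OF R]
  have two: "y = 0" if "y + y = 0" for y :: 'm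
  proof -
    have "sM 2 y = 0" using that M.scale_left_distrib[of 1 1 y] by (simp add: one_add_one)
    then show ?thesis using assms(2) by simp
  qed
  have slot: "\<phi> (xs[i := x]) = sgnp i (\<phi> (x # take i xs @ drop (Suc i) xs))"
    if "i < length xs" "set xs \<subseteq> L" "x \<in> L" for xs i x
    using alternating_move[OF alt, of "take i xs" x "drop (Suc i) xs"] that
      set_take_subset[of i xs] set_drop_subset[of "Suc i" xs]
    by (simp add: upd_conv_take_nth_drop min_absorb2) blast
  have sub: "set (take i xs @ drop (Suc i) xs) \<subseteq> L" if "set xs \<subseteq> L" for xs i
    using that set_take_subset[of i xs] set_drop_subset[of "Suc i" xs] by auto
  show "\<phi> \<in> ce_cochains sL L sM n"
    unfolding ce_cochains_def
  proof (intro CollectI conjI allI impI; (elim conjE)?)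
    fix xs assume "\<not> (length xs = n \<and> set xs \<subseteq> L)" then show "\<phi> xs = 0" using R by blast
  next
    fix xs i x y assume *: "length xs = n" "set xs \<subseteq> L" "i < n" "x \<in> L" "y \<in> L"
    then have "\<phi> ((x + y) # take i xs @ drop (Suc i) xs) =
      \<phi> (x # take i xs @ drop (Suc i) xs) + \<phi> (y # take i xs @ drop (Suc i) xs)"
      using R sub[of xs i] by blast
    then show "\<phi> (xs[i := x + y]) = \<phi> (xs[i := x]) + \<phi> (xs[i := y])"
      using * subspace_add[OF subspace_L, of x y] by (simp add: slot sgnp_add)
  next
    fix xs i x c assume *: "length xs = n" "set xs \<subseteq> L" "i < n" "x \<in> L"
    then have "\<phi> (sL c x # take i xs @ drop (Suc i) xs) = sM c (\<phi> (x # take i xs @ drop (Suc i) xs))"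
      using R sub[of xs i] by blast
    then show "\<phi> (xs[i := sL c x]) = sM c (\<phi> (xs[i := x]))"
      using * subspace_scale[OF subspace_L, of x c] by (simp add: slot sgnp_def)
  next
    fix xs assume "length xs = n" "set xs \<subseteq> L" "\<not> distinct xs"
    then show "\<phi> xs = 0" using alternating_repeat[OF alt] two by blast
  qed
qed

section \<open>Cochains on basis elements\<close>

text \<open>
  The index \<open>(k, i)\<close> with \<open>k \<noteq> 0\<close> stands for \<open>X\<^sup>k \<partial>/\<partial>X\<^sub>i\<close>, and \<open>(0, i)\<close> for a central element that is
  added to \<open>\<L>\<^sub>+\<close> for each coordinate.
\<close>
type_synonym 'n idx = "('n \<Rightarrow> nat) \<times> 'n"

definition mdeg :: "'n::finite idx \<Rightarrow> nat" where
  "mdeg \<beta> = (\<Sum>j\<in>UNIV. fst \<beta> j)"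

text \<open>A cochain on symbols cannot be evaluated at a linear combination, so the two terms of
  \<open>commutator_monomial_field\<close> become two values of \<open>c\<close>. Where the
  truncated subtraction of \<open>unit_exp\<close> gives a wrong exponent, its coefficient is 0. The
  case distinction makes the symbols of degree 0 central.\<close>

definition idx_br :: "('k::field_char_0 \<Rightarrow> 'm::ab_group_add \<Rightarrow> 'm) \<Rightarrow> 'n idx \<Rightarrow> 'n idx \<Rightarrow>
    ('n idx list \<Rightarrow> 'm) \<Rightarrow> 'n idx list \<Rightarrow> 'm" where
  "idx_br sm \<beta> \<gamma> c zs = (if fst \<beta> = 0 \<or> fst \<gamma> = 0 then 0 else
     sm (of_nat (fst \<gamma> (snd \<beta>))) (c ((fst \<beta> + (fst \<gamma> - unit_exp (snd \<beta>)), snd \<gamma>) # zs)) -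
     sm (of_nat (fst \<beta> (snd \<gamma>))) (c ((fst \<gamma> + (fst \<beta> - unit_exp (snd \<gamma>)), snd \<beta>) # zs)))"

lemma mdeg_eq_0 [simp]: "mdeg \<beta> = 0 \<longleftrightarrow> fst \<beta> = 0"
  by (auto simp: mdeg_def fun_eq_iff)

lemma mdeg_bracket: "l i \<noteq> 0 \<Longrightarrow> mdeg (k + (l - unit_exp i), j) = mdeg (k, i) + mdeg (l, j) - 1"
proof -
  assume "l i \<noteq> 0"
  then have l: "l = (l - unit_exp i) + unit_exp i" by (auto simp: unit_exp_def fun_eq_iff)
  have "(\<Sum>j\<in>UNIV. l j) = (\<Sum>j\<in>UNIV. (l - unit_exp i) j) + 1"
    by (subst l) (simp add: sum.distrib unit_exp_def)
  then show ?thesis by (simp add: mdeg_def sum.distrib)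
qed

lemma finite_mdeg: "finite {\<beta> :: 'n::finite idx. mdeg \<beta> < N}"
proof -
  have "{\<beta> :: 'n idx. mdeg \<beta> < N} \<subseteq> {k. \<forall>i. k i \<in> {..<N}} \<times> UNIV"
  proof (clarsimp simp: mdeg_def)
    fix a :: "'n \<Rightarrow> nat" and i assume "(\<Sum>j\<in>UNIV. a j) < N"
    then show "a i < N" using member_le_sum[of i UNIV a] by simp
  qed
  moreover have "finite {k :: 'n \<Rightarrow> nat. \<forall>i. k i \<in> {..<N}}"
    using finite_PiE[of "UNIV :: 'n set" "\<lambda>_. {..<N}"] by (simp add: PiE_def Pi_def)
  ultimately show ?thesis by (meson finite_SigmaI finite finite_subset)
qed

text \<open>The bound is on the degree of each single symbol and not on the total degree: it is the
  trace of the Gelfand-Fuks condition, which restricts one argument at a time.\<close>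

definition bounded :: "nat \<Rightarrow> ('n::finite idx list \<Rightarrow> 'm::zero) \<Rightarrow> bool" where
  "bounded N c \<longleftrightarrow> (\<forall>xs. c xs \<noteq> 0 \<longrightarrow> (\<forall>\<beta>\<in>set xs. mdeg \<beta> < N))"

lemma boundedD: "bounded N c \<Longrightarrow> \<beta> \<in> set xs \<Longrightarrow> N \<le> mdeg \<beta> \<Longrightarrow> c xs = 0"
  unfolding bounded_def by (meson leD)

lemma bounded_mono: "bounded N c \<Longrightarrow> N \<le> M \<Longrightarrow> bounded M c"
  unfolding bounded_def by (meson order_less_le_trans)

lemma bounded_ins: "bounded N c \<Longrightarrow> bounded N (ins \<beta> c)"
  unfolding bounded_def by simp

lemma bounded_ins_zero: "bounded N c \<Longrightarrow> N \<le> mdeg \<beta> \<Longrightarrow> ins \<beta> c = (\<lambda>_. 0)"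
  using boundedD[of N c \<beta>] by (auto simp: fun_eq_iff)

lemma cochain_ops_idx_br:
  assumes "vector_space sm" "\<And>\<beta> a b. act \<beta> (a + b) = act \<beta> a + act \<beta> b"
    and V: "V = UNIV \<or> V = {\<beta> :: 'n::finite idx. fst \<beta> \<noteq> 0}"
  shows "cochain_ops V (idx_br sm) act"
proof -
  interpret vector_space sm by fact
  have in_V: "(fst \<beta> + (fst \<gamma> - unit_exp i), j) \<in> V" if "\<beta> \<in> V" for \<beta> \<gamma> :: "'n idx" and i j
    using V that by (auto simp: fun_eq_iff)
  show ?thesis
  proof
    fix \<beta> \<gamma> :: "'n idx" and c e :: "'n idx list \<Rightarrow> _" and zs
    show "idx_br sm \<beta> \<gamma> (\<lambda>xs. c xs + e xs) zs = idx_br sm \<beta> \<gamma> c zs + idx_br sm \<beta> \<gamma> e zs"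
      by (simp add: idx_br_def scale_right_distrib)
    show "idx_br sm \<beta> \<gamma> c zs = idx_br sm \<beta> \<gamma> e zs"
      if "\<beta> \<in> V" "\<gamma> \<in> V" "set zs \<subseteq> V" "\<And>ys. set ys \<subseteq> V \<Longrightarrow> length ys = Suc (length zs) \<Longrightarrow> c ys = e ys"
      using that in_V by (simp add: idx_br_def)
    show "idx_br sm \<beta> \<gamma> c (z # zs) = - idx_br sm \<beta> \<gamma> (ins z c) zs"
      if "\<beta> \<in> V" "\<gamma> \<in> V" "alternating V c" "z \<in> V" "set zs \<subseteq> V" for z
      using that alternating_swap[OF that(3) in_V[OF that(1)] that(4,5)]
        alternating_swap[OF that(3) in_V[OF that(2)] that(4,5)] by (simp add: idx_br_def)
  qed (rule assms)
qed

lemma idx_br_anti: "idx_br sm \<beta> \<gamma> c zs = - idx_br sm \<gamma> \<beta> c zs"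
  by (simp add: idx_br_def)

text \<open>The degree of a bracket is the sum of the two degrees minus 1, and off the centre both
  are at least 1; so a symbol of degree at least \<open>N\<close> only has brackets of degree at
  least \<open>N\<close>.\<close>

lemma bounded_idx_br:
  fixes c :: "'n::finite idx list \<Rightarrow> 'm::ab_group_add"
  assumes "vector_space sm" "bounded N c"
  shows "bounded N (idx_br sm \<beta> \<gamma> c)" "N \<le> mdeg \<beta> \<or> N \<le> mdeg \<gamma> \<Longrightarrow> idx_br sm \<beta> \<gamma> c zs = 0"
proof -
  interpret vector_space sm by fact
  show "bounded N (idx_br sm \<beta> \<gamma> c)"
    using boundedD[OF assms(2)] unfolding bounded_def idx_br_def
    by (metis (no_types, lifting) diff_0_right leI list.set_intros(2) scale_zero_right)
  assume *: "N \<le> mdeg \<beta> \<or> N \<le> mdeg \<gamma>"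
  have z: "sm (of_nat (fst \<gamma> (snd \<beta>))) (c ((fst \<beta> + (fst \<gamma> - unit_exp (snd \<beta>)), snd \<gamma>) # zs)) = 0"
    if "N \<le> mdeg \<beta> \<or> N \<le> mdeg \<gamma>" "fst \<beta> \<noteq> 0" "fst \<gamma> \<noteq> 0" for \<beta> \<gamma> :: "'n idx"
  proof (cases "fst \<gamma> (snd \<beta>) = 0")
    case False
    have "mdeg (fst \<beta> + (fst \<gamma> - unit_exp (snd \<beta>)), snd \<gamma>) = mdeg \<beta> + mdeg \<gamma> - 1"
      using mdeg_bracket[of "fst \<gamma>" "snd \<beta>" "fst \<beta>" "snd \<gamma>"] False by simp
    moreover have "mdeg \<beta> \<ge> 1" "mdeg \<gamma> \<ge> 1"
      using that mdeg_eq_0[of \<beta>] mdeg_eq_0[of \<gamma>] by linarith+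
    ultimately have "N \<le> mdeg (fst \<beta> + (fst \<gamma> - unit_exp (snd \<beta>)), snd \<gamma>)"
      using that(1) by linarith
    then show ?thesis by (subst boundedD[OF assms(2)]) auto
  qed simp
  show "idx_br sm \<beta> \<gamma> c zs = 0"
    using z[of \<beta> \<gamma>] z[of \<gamma> \<beta>] * by (auto simp: idx_br_def)
qed

lemma bounded_lieD:
  assumes vs: "vector_space sm" and act: "\<And>\<beta> a b. act \<beta> (a + b) = act \<beta> a + act \<beta> b"
    and c: "bounded N c"
  shows "bounded N (lieD (idx_br sm) act \<beta> c)"
    and "N \<le> mdeg \<beta> \<Longrightarrow> (\<And>a. act \<beta> a = 0) \<Longrightarrow> lieD (idx_br sm) act \<beta> c zs = 0"
proof -
  interpret cochain_ops UNIV "idx_br sm" act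
    by (rule cochain_ops_idx_br[OF vs act]) simp
  have "lieD (idx_br sm) act \<beta> c xs = 0" if "\<gamma> \<in> set xs" "N \<le> mdeg \<gamma>" for \<gamma> xs
    using c that(1)
  proof (induction xs arbitrary: c)
    case (Cons x xs)
    show ?case
    proof (cases "\<gamma> = x")
      case True
      then show ?thesis
        using bounded_ins_zero[OF Cons.prems(1), of x] bounded_idx_br(2)[OF vs Cons.prems(1), of \<beta> x] that(2)
        by (simp add: lieD_zero)
    next
      case False
      then show ?thesis
        using Cons.IH[of "ins x c"] bounded_ins[OF Cons.prems(1), of x] Cons.prems(2) that(2)
          boundedD[OF bounded_idx_br(1)[OF vs Cons.prems(1)], of \<gamma> xs \<beta> x]
        by (simp add: ins_def)
    qed
  qed simp
  then show "bounded N (lieD (idx_br sm) act \<beta> c)" unfolding bounded_def using leI by blast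
  assume *: "N \<le> mdeg \<beta>" and a: "\<And>a. act \<beta> a = 0"
  show "lieD (idx_br sm) act \<beta> c zs = 0"
    using c by (induction zs arbitrary: c) (simp_all add: a bounded_ins bounded_idx_br(2)[OF vs] *)
qed

text \<open>A symbol can enter the differential of \<open>c\<close> also by acting on a value of
  \<open>c\<close>. Hence the new bound has to reach \<open>N\<^sub>0\<close>, from which on symbols
  act as zero.\<close>

lemma bounded_cdiff:
  assumes vs: "vector_space sm" and act: "\<And>\<beta> a b. act \<beta> (a + b) = act \<beta> a + act \<beta> b"
    and act0: "\<And>\<beta> a. N\<^sub>0 \<le> mdeg \<beta> \<Longrightarrow> act \<beta> a = 0" and c: "bounded N c" and "N \<le> M" "N\<^sub>0 \<le> M"
  shows "bounded M (cdiff (idx_br sm) act c)"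
proof -
  interpret cochain_ops UNIV "idx_br sm" act
    by (rule cochain_ops_idx_br[OF vs act]) simp
  have "cdiff (idx_br sm) act c xs = 0" if "\<gamma> \<in> set xs" "M \<le> mdeg \<gamma>" for \<gamma> xs
    using c that(1)
  proof (induction xs arbitrary: c)
    case (Cons x xs)
    show ?case
    proof (cases "\<gamma> = x")
      case True
      then show ?thesis
        using bounded_ins_zero[OF Cons.prems(1), of x] that(2) assms(5,6)
          bounded_lieD(2)[where act = act, OF vs act Cons.prems(1), of x xs] act0[of x]
        by (simp add: cdiff_zero)
    next
      case False
      then show ?thesis
        using Cons.IH[of "ins x c"] bounded_ins[OF Cons.prems(1), of x] Cons.prems(2) that(2) assms(5)
          boundedD[OF bounded_lieD(1)[where act = act, OF vs act Cons.prems(1)], of \<gamma> xs x]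
        by (simp add: ins_def)
    qed
  qed simp
  then show ?thesis unfolding bounded_def using leI by blast
qed

lemma alternating_cdiff_idx:
  fixes c :: "'n::finite idx list \<Rightarrow> 'm::ab_group_add"
  assumes "vector_space sm" "\<And>\<beta> a b. act \<beta> (a + b) = act \<beta> a + act \<beta> b" "alternating UNIV c"
  shows "alternating UNIV (cdiff (idx_br sm) act c)"
proof -
  interpret cochain_ops UNIV "idx_br sm" act
    by (rule cochain_ops_idx_br[OF assms(1)]) (simp_all add: assms(2))
  show ?thesis by (rule alternating_cdiff[OF assms(3), where Adm = UNIV, OF UNIV_I UNIV_I idx_br_anti])
qed

section \<open>The comparison of differentials\<close>

context cochain_ops
begin

lemma lieD_sum: "x \<in> V \<Longrightarrow> L x (\<lambda>xs. \<Sum>i\<in>I. c i xs) ys = (\<Sum>i\<in>I. L x (c i) ys)"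
  by (induction I rule: infinite_finite_induct) (simp_all add: lieD_zero lieD_add)

lemma cdiff_sum: "set ys \<subseteq> V \<Longrightarrow> d (\<lambda>xs. \<Sum>i\<in>I. c i xs) ys = (\<Sum>i\<in>I. d (c i) ys)"
  by (induction I rule: infinite_finite_induct) (simp_all add: cdiff_zero cdiff_add)

end

lemma cochain_ops_ins_br:
  assumes "\<And>x y. x \<in> V \<Longrightarrow> y \<in> V \<Longrightarrow> br x y \<in> V"
    and "\<And>x a b. x \<in> V \<Longrightarrow> act x (a + b) = act x a + act x b"
  shows "cochain_ops V (ins_br br) act"
proof
  fix x y c z zs
  assume "x \<in> V" "y \<in> V" "alternating V c" "z \<in> V" "set zs \<subseteq> V"
  then show "ins_br br x y c (z # zs) = - ins_br br x y (ins z c) zs"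
    using alternating_swap[of V c "br x y" z zs] assms(1) by (simp add: ins_br_def)
qed (use assms in \<open>auto simp: ins_br_def\<close>)

text \<open>The product \<open>\<delta>r \<and> \<psi>\<close> of the differential of a function \<open>r\<close> with a cochain.\<close>
fun dwedge :: "('a \<Rightarrow> 'm \<Rightarrow> 'm) \<Rightarrow> ('x \<Rightarrow> 'a \<Rightarrow> 'a) \<Rightarrow> 'a \<Rightarrow> ('x list \<Rightarrow> 'm) \<Rightarrow> 'x list \<Rightarrow> 'm::ab_group_add" where
  "dwedge sc der r \<psi> [] = 0"
| "dwedge sc der r \<psi> (x # xs) = sc (der x r) (\<psi> xs) - dwedge sc der r (ins x \<psi>) xs"

text \<open>The axiom \<open>maurer_cartan\<close> is a([\<eta>,\<zeta>]) = \<eta> a(\<zeta>) -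
  \<zeta> a(\<eta>) + [a(\<eta>), a(\<zeta>)]: \<eta> \<mapsto> \<eta> + a(\<eta>) is a homomorphism
  to the semidirect product of the fields with the Lie algebra of symbols over the ring. It is
  stated after pairing with a cochain, because the bracket of symbols exists only as the contraction
  \<open>B\<close>, and for cochains in \<open>Adm\<close>, because the truncation \<open>P\<close>
  is closed under brackets only up to what these annihilate.\<close>

locale jet_map = module sc
  for sc :: "'a::comm_ring_1 \<Rightarrow> 'm::ab_group_add \<Rightarrow> 'm" +
  fixes V :: "'x set" and br :: "'x \<Rightarrow> 'x \<Rightarrow> 'x" and der :: "'x \<Rightarrow> 'a \<Rightarrow> 'a" and actV :: "'x \<Rightarrow> 'm \<Rightarrow> 'm"
    and B :: "'b \<Rightarrow> 'b \<Rightarrow> ('b list \<Rightarrow> 'm) \<Rightarrow> 'b list \<Rightarrow> 'm" and act :: "'b \<Rightarrow> 'm \<Rightarrow> 'm"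
    and a :: "'x \<Rightarrow> 'b \<Rightarrow> 'a" and P :: "'b set" and Adm :: "('b list \<Rightarrow> 'm) set"
  assumes br_closed: "\<eta> \<in> V \<Longrightarrow> \<zeta> \<in> V \<Longrightarrow> br \<eta> \<zeta> \<in> V"
    and actV_add: "\<eta> \<in> V \<Longrightarrow> actV \<eta> (m + m') = actV \<eta> m + actV \<eta> m'"
    and actV_scale: "\<eta> \<in> V \<Longrightarrow> actV \<eta> (sc r m) = sc (der \<eta> r) m + sc r (actV \<eta> m)"
    and actV_eq: "\<eta> \<in> V \<Longrightarrow> actV \<eta> m = (\<Sum>\<beta>\<in>P. sc (a \<eta> \<beta>) (act \<beta> m))"
    and Adm_alternating: "c \<in> Adm \<Longrightarrow> alternating UNIV c"
    and Adm_ins: "c \<in> Adm \<Longrightarrow> ins \<beta> c \<in> Adm"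
    and maurer_cartan: "c \<in> Adm \<Longrightarrow> \<eta> \<in> V \<Longrightarrow> \<zeta> \<in> V \<Longrightarrow>
      (\<Sum>\<gamma>\<in>P. sc (a (br \<eta> \<zeta>) \<gamma>) (jext sc a (\<lambda>_. P) (ins \<gamma> c) zs)) =
      (\<Sum>\<gamma>\<in>P. sc (der \<eta> (a \<zeta> \<gamma>) - der \<zeta> (a \<eta> \<gamma>)) (jext sc a (\<lambda>_. P) (ins \<gamma> c) zs)) +
      (\<Sum>\<beta>\<in>P. \<Sum>\<gamma>\<in>P. sc (a \<eta> \<beta> * a \<zeta> \<gamma>) (jext sc a (\<lambda>_. P) (B \<beta> \<gamma> c) zs))"
begin

sublocale cochain_ops V "ins_br br" actV
  by (rule cochain_ops_ins_br[OF br_closed actV_add])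

abbreviation "J \<equiv> jext sc a (\<lambda>_. P)"

lemma lieD_scale:
  "\<eta> \<in> V \<Longrightarrow> L \<eta> (\<lambda>xs. sc r (\<psi> xs)) \<zeta>s = sc (der \<eta> r) (\<psi> \<zeta>s) + sc r (L \<eta> \<psi> \<zeta>s)"
  by (induction \<zeta>s arbitrary: \<psi>)
    (simp_all add: actV_scale ins_def ins_br_def scale_right_diff_distrib)

lemma cdiff_scale:
  "set \<zeta>s \<subseteq> V \<Longrightarrow> d (\<lambda>xs. sc r (\<psi> xs)) \<zeta>s = sc r (d \<psi> \<zeta>s) - dwedge sc der r \<psi> \<zeta>s"
  by (induction \<zeta>s arbitrary: \<psi>)
    (simp_all add: lieD_scale ins_def scale_right_diff_distrib algebra_simps)

lemma dwedge_add: "dwedge sc der r (\<lambda>xs. \<phi> xs + \<psi> xs) \<zeta>s = dwedge sc der r \<phi> \<zeta>s + dwedge sc der r \<psi> \<zeta>s"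
  by (induction \<zeta>s arbitrary: \<phi> \<psi>) (simp_all add: ins_def scale_right_distrib)

lemma dwedge_zero: "dwedge sc der r (\<lambda>_. 0) \<zeta>s = 0"
  using dwedge_add[of r "\<lambda>_. 0" "\<lambda>_. 0" \<zeta>s] by simp

lemma dwedge_sum: "dwedge sc der r (\<lambda>xs. \<Sum>i\<in>I. \<psi> i xs) \<zeta>s = (\<Sum>i\<in>I. dwedge sc der r (\<psi> i) \<zeta>s)"
  by (induction I rule: infinite_finite_induct) (simp_all add: dwedge_zero dwedge_add)

lemma dwedge_scale: "dwedge sc der r (\<lambda>xs. sc q (\<psi> xs)) \<zeta>s = sc q (dwedge sc der r \<psi> \<zeta>s)"
  by (induction \<zeta>s arbitrary: \<psi>) (simp_all add: ins_def scale_right_diff_distrib mult.commute)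

lemma ins_jext: "ins \<eta> (J c) = (\<lambda>xs. \<Sum>\<gamma>\<in>P. sc (a \<eta> \<gamma>) (J (ins \<gamma> c) xs))"
  by (simp add: fun_eq_iff)

text \<open>Cartan's formula \<open>L\<^bsub>r\<eta>\<^esub> = r L\<^sub>\<eta> + \<delta>r \<and> \<iota>\<^sub>\<eta>\<close> for the expansion of a vector field in the basis.\<close>
lemma lieD_jext:
  assumes "\<eta> \<in> V"
  shows "c \<in> Adm \<Longrightarrow> set \<zeta>s \<subseteq> V \<Longrightarrow> L \<eta> (J c) \<zeta>s =
     (\<Sum>\<beta>\<in>P. sc (a \<eta> \<beta>) (J (lieD B act \<beta> c) \<zeta>s)) + (\<Sum>\<beta>\<in>P. dwedge sc der (a \<eta> \<beta>) (J (ins \<beta> c)) \<zeta>s)"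
proof (induction \<zeta>s arbitrary: c)
  case Nil
  then show ?case by (simp add: actV_eq assms)
next
  case (Cons \<zeta> \<zeta>s)
  then have \<zeta>: "\<zeta> \<in> V" and \<zeta>s: "set \<zeta>s \<subseteq> V" and c: "c \<in> Adm" by auto
  let ?h = "\<lambda>\<gamma>. J (ins \<gamma> c) \<zeta>s"
  have "L \<eta> (ins \<zeta> (J c)) \<zeta>s = (\<Sum>\<gamma>\<in>P. L \<eta> (\<lambda>xs. sc (a \<zeta> \<gamma>) (J (ins \<gamma> c) xs)) \<zeta>s)"
    unfolding ins_jext by (rule lieD_sum[OF assms])
  also have "\<dots> = (\<Sum>\<gamma>\<in>P. sc (der \<eta> (a \<zeta> \<gamma>)) (?h \<gamma>)) + (\<Sum>\<gamma>\<in>P. sc (a \<zeta> \<gamma>) (L \<eta> (J (ins \<gamma> c)) \<zeta>s))"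
    by (simp add: lieD_scale[OF assms] sum.distrib)
  also have "(\<Sum>\<gamma>\<in>P. sc (a \<zeta> \<gamma>) (L \<eta> (J (ins \<gamma> c)) \<zeta>s)) =
     (\<Sum>\<gamma>\<in>P. \<Sum>\<beta>\<in>P. sc (a \<eta> \<beta> * a \<zeta> \<gamma>) (J (lieD B act \<beta> (ins \<gamma> c)) \<zeta>s)) +
     (\<Sum>\<gamma>\<in>P. \<Sum>\<beta>\<in>P. sc (a \<zeta> \<gamma>) (dwedge sc der (a \<eta> \<beta>) (J (ins \<beta> (ins \<gamma> c))) \<zeta>s))"
    unfolding Cons.IH[OF Adm_ins[OF c] \<zeta>s] scale_right_distrib sum.distrib scale_sum_right scale_scale
    by (simp only: mult.commute)
  also have "(\<Sum>\<gamma>\<in>P. \<Sum>\<beta>\<in>P. sc (a \<eta> \<beta> * a \<zeta> \<gamma>) (J (lieD B act \<beta> (ins \<gamma> c)) \<zeta>s)) =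
     (\<Sum>\<beta>\<in>P. \<Sum>\<gamma>\<in>P. sc (a \<eta> \<beta> * a \<zeta> \<gamma>) (J (ins \<gamma> (lieD B act \<beta> c)) \<zeta>s)) +
     (\<Sum>\<beta>\<in>P. \<Sum>\<gamma>\<in>P. sc (a \<eta> \<beta> * a \<zeta> \<gamma>) (J (B \<beta> \<gamma> c) \<zeta>s))"
  proof -
    have "ins \<gamma> (lieD B act \<beta> c) = (\<lambda>xs. lieD B act \<beta> (ins \<gamma> c) xs - B \<beta> \<gamma> c xs)" for \<beta> \<gamma>
      by (simp add: fun_eq_iff)
    then have "J (lieD B act \<beta> (ins \<gamma> c)) \<zeta>s = J (ins \<gamma> (lieD B act \<beta> c)) \<zeta>s + J (B \<beta> \<gamma> c) \<zeta>s" for \<beta> \<gamma>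
      by (simp add: jext_diff)
    then show ?thesis by (subst sum.swap) (simp add: scale_right_distrib sum.distrib)
  qed
  \<comment> \<open>Contractions with \<open>\<beta>\<close> and \<open>\<gamma>\<close>
    anticommute, which turns this sum into the tail of the \<open>dwedge\<close> recursion at the
    argument \<open>\<zeta>\<close>.\<close>
  also have "(\<Sum>\<gamma>\<in>P. \<Sum>\<beta>\<in>P. sc (a \<zeta> \<gamma>) (dwedge sc der (a \<eta> \<beta>) (J (ins \<beta> (ins \<gamma> c))) \<zeta>s)) =
    - (\<Sum>\<beta>\<in>P. dwedge sc der (a \<eta> \<beta>) (ins \<zeta> (J (ins \<beta> c))) \<zeta>s)"
  proof -
    have swap: "J (ins \<beta> (ins \<gamma> c)) = (\<lambda>xs. - J (ins \<gamma> (ins \<beta> c)) xs)" for \<beta> \<gamma>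
    proof
      fix xs
      have "J (ins \<beta> (ins \<gamma> c)) xs = J (\<lambda>xs. - ins \<gamma> (ins \<beta> c) xs) xs"
        by (rule jext_cong) (simp add: alternating_swap[OF Adm_alternating[OF c], of \<gamma> \<beta>])
      then show "J (ins \<beta> (ins \<gamma> c)) xs = - J (ins \<gamma> (ins \<beta> c)) xs" by (simp only: jext_minus)
    qed
    have neg: "dwedge sc der r (\<lambda>xs. - \<psi> xs) xs = - dwedge sc der r \<psi> xs" for r \<psi> xs
      using dwedge_add[of r \<psi> "\<lambda>xs. - \<psi> xs" xs] by (simp add: dwedge_zero eq_neg_iff_add_eq_0 add.commute)
    show ?thesis
      unfolding ins_jext dwedge_sum dwedge_scale
      by (subst sum.swap, subst swap, simp only: neg scale_minus_right sum_negf)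
  qed
  finally have 1: "L \<eta> (ins \<zeta> (J c)) \<zeta>s = (\<Sum>\<gamma>\<in>P. sc (der \<eta> (a \<zeta> \<gamma>)) (?h \<gamma>)) +
     ((\<Sum>\<beta>\<in>P. \<Sum>\<gamma>\<in>P. sc (a \<eta> \<beta> * a \<zeta> \<gamma>) (J (ins \<gamma> (lieD B act \<beta> c)) \<zeta>s)) +
     (\<Sum>\<beta>\<in>P. \<Sum>\<gamma>\<in>P. sc (a \<eta> \<beta> * a \<zeta> \<gamma>) (J (B \<beta> \<gamma> c) \<zeta>s)) +
    - (\<Sum>\<beta>\<in>P. dwedge sc der (a \<eta> \<beta>) (ins \<zeta> (J (ins \<beta> c))) \<zeta>s))" .
  have 2: "ins_br br \<eta> \<zeta> (J c) \<zeta>s = (\<Sum>\<gamma>\<in>P. sc (a (br \<eta> \<zeta>) \<gamma>) (?h \<gamma>))"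
    by (simp add: ins_br_def)
  have 3: "(\<Sum>\<gamma>\<in>P. sc (der \<eta> (a \<zeta> \<gamma>) - der \<zeta> (a \<eta> \<gamma>)) (?h \<gamma>)) =
     (\<Sum>\<gamma>\<in>P. sc (der \<eta> (a \<zeta> \<gamma>)) (?h \<gamma>)) - (\<Sum>\<gamma>\<in>P. sc (der \<zeta> (a \<eta> \<gamma>)) (?h \<gamma>))"
    by (simp add: scale_left_diff_distrib sum_subtractf)
  have 4: "(\<Sum>\<beta>\<in>P. sc (a \<eta> \<beta>) (J (lieD B act \<beta> c) (\<zeta> # \<zeta>s))) =
     (\<Sum>\<beta>\<in>P. \<Sum>\<gamma>\<in>P. sc (a \<eta> \<beta> * a \<zeta> \<gamma>) (J (ins \<gamma> (lieD B act \<beta> c)) \<zeta>s))"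
    by (simp add: scale_sum_right)
  have 5: "(\<Sum>\<beta>\<in>P. dwedge sc der (a \<eta> \<beta>) (J (ins \<beta> c)) (\<zeta> # \<zeta>s)) =
     (\<Sum>\<gamma>\<in>P. sc (der \<zeta> (a \<eta> \<gamma>)) (?h \<gamma>)) - (\<Sum>\<beta>\<in>P. dwedge sc der (a \<eta> \<beta>) (ins \<zeta> (J (ins \<beta> c))) \<zeta>s)"
    by (simp add: sum_subtractf)
  show ?case
    unfolding lieD.simps(2) 1 2 maurer_cartan[OF c assms \<zeta>] 3 4 5 by simp
qed

text \<open>The derivatives of the coefficients occur twice: in \<open>lieD_jext\<close> with a plus
  sign and in \<open>cdiff_scale\<close> with a minus sign. They cancel, and the recursion of the
  differential on symbols remains.\<close>

lemma cdiff_jext: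
  assumes "c \<in> Adm" "set \<eta>s \<subseteq> V"
  shows "d (J c) \<eta>s = J (cdiff B act c) \<eta>s"
  using assms
proof (induction \<eta>s arbitrary: c)
  case (Cons \<eta> \<eta>s)
  then have \<eta>: "\<eta> \<in> V" and \<eta>s: "set \<eta>s \<subseteq> V" and c: "c \<in> Adm" by auto
  have "d (ins \<eta> (J c)) \<eta>s = (\<Sum>\<beta>\<in>P. sc (a \<eta> \<beta>) (d (J (ins \<beta> c)) \<eta>s)) -
      (\<Sum>\<beta>\<in>P. dwedge sc der (a \<eta> \<beta>) (J (ins \<beta> c)) \<eta>s)"
    unfolding ins_jext by (simp add: cdiff_sum[OF \<eta>s] cdiff_scale[OF \<eta>s] sum_subtractf)
  moreover have "d (J (ins \<beta> c)) \<eta>s = J (cdiff B act (ins \<beta> c)) \<eta>s" for \<beta>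
    by (rule Cons.IH[OF Adm_ins[OF c] \<eta>s])
  ultimately have 1: "d (J c) (\<eta> # \<eta>s) = (\<Sum>\<beta>\<in>P. sc (a \<eta> \<beta>)
       (- J (lieD B act \<beta> c) \<eta>s - J (cdiff B act (ins \<beta> c)) \<eta>s))"
    by (simp add: lieD_jext[OF \<eta> c \<eta>s] scale_right_diff_distrib sum_subtractf sum_negf)
  have "ins \<beta> (cdiff B act c) = (\<lambda>xs. (\<lambda>xs. - lieD B act \<beta> c xs) xs - cdiff B act (ins \<beta> c) xs)" for \<beta>
    by (simp add: fun_eq_iff)
  then have "J (ins \<beta> (cdiff B act c)) \<eta>s = - J (lieD B act \<beta> c) \<eta>s - J (cdiff B act (ins \<beta> c)) \<eta>s" for \<beta>
    by (simp only: jext_diff jext_minus)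
  then show ?case unfolding 1 by simp
qed simp

end

section \<open>Taylor coefficients\<close>

definition taylor :: "('n::finite \<Rightarrow> nat) \<Rightarrow> ('n, 'k::field_char_0) laurent \<Rightarrow> ('n, 'k) laurent" where
  "taylor k f = pm_scale (*) (1 / (\<Prod>j\<in>UNIV. fact (k j))) (partial_multi k f)"

text \<open>Division by the factorials turns the falling products into binomial coefficients whose
  upper entry may be negative. By additivity the rules for \<open>taylor\<close> reduce to
  identities between these.\<close>

lemma taylor_single:
  "taylor k (Poly_Mapping.single r (c :: 'k::field_char_0)) =
     Poly_Mapping.single (\<lambda>j. r j - int (k j)) (c * (\<Prod>j\<in>UNIV. of_int (r j) gchoose k j))"
proof -
  have "(\<Prod>j\<in>UNIV. of_int (r j) gchoose k j) =
      (\<Prod>j\<in>UNIV. \<Prod>l<k j. of_int (r j - int l)) / (\<Prod>j\<in>UNIV. fact (k j) :: 'k)"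
    by (simp add: gbinomial_prod_rev prod_dividef atLeast0LessThan)
  then show ?thesis
    by (simp add: taylor_def partial_multi_single pm_scale_eq_mult mult_single)
qed

lemma taylor_add: "taylor k (f + g) = taylor k f + taylor k g"
  by (simp add: taylor_def partial_multi_add pm_scale_eq_mult distrib_left)

lemma taylor_zero [simp]: "taylor k 0 = 0"
  using taylor_add[of k 0 0] by simp

lemma taylor_sum: "taylor k (\<Sum>i\<in>I. f i) = (\<Sum>i\<in>I. taylor k (f i))"
  by (induction I rule: infinite_finite_induct) (simp_all add: taylor_add)

lemma taylor_diff: "taylor k (f - g) = taylor k f - taylor k g"
  using taylor_add[of k "f - g" g] by simp

lemma taylor_index_zero [simp]: "taylor (\<lambda>_. 0) f = f" "taylor 0 f = f"
proof -
  show 1: "taylor (\<lambda>_. 0) f = f"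
    by (rule additive_eqI[where f = f]) (simp_all add: taylor_add taylor_single)
  then show "taylor 0 f = f" by (simp add: zero_fun_def)
qed

lemma of_nat_mult_single:
  "of_nat n * Poly_Mapping.single r c = Poly_Mapping.single r (of_nat n * c :: 'k::comm_ring_1)"
  using mult_single[of 0 "of_nat n" r c] by simp

lemma prod_upd:
  fixes F G :: "'n::finite \<Rightarrow> 'k::comm_monoid_mult"
  assumes "\<And>j. j \<noteq> i \<Longrightarrow> F j = G j"
  obtains R where "prod F UNIV = F i * R" "prod G UNIV = G i * R"
proof
  show "prod F UNIV = F i * prod F (UNIV - {i})" by (rule prod.remove) auto
  have "prod F (UNIV - {i}) = prod G (UNIV - {i})" by (rule prod.cong) (use assms in auto)
  moreover have "prod G UNIV = G i * prod G (UNIV - {i})" by (rule prod.remove) auto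
  ultimately show "prod G UNIV = G i * prod F (UNIV - {i})" by simp
qed

lemma taylor_partial:
  "taylor k (partial i g) = of_nat (Suc (k i)) * taylor (k + unit_exp i) (g :: ('n::finite, 'k::field_char_0) laurent)"
proof (rule additive_eqI[where f = g])
  fix r and c :: 'k
  obtain R where R: "(\<Prod>j\<in>UNIV. of_int ((r - unit_exp i) j) gchoose k j) = (of_int ((r - unit_exp i) i) gchoose k i) * R"
    "(\<Prod>j\<in>UNIV. of_int (r j) gchoose (k + unit_exp i) j) = (of_int (r i) gchoose (k + unit_exp i) i) * (R :: 'k)"
    by (rule prod_upd[of i "\<lambda>j. of_int ((r - unit_exp i) j) gchoose k j" "\<lambda>j. of_int (r j) gchoose (k + unit_exp i) j"])
      (auto simp: unit_exp_def)
  have e: "(\<lambda>j. (r - unit_exp i) j - int (k j)) = (\<lambda>j. r j - int ((k + unit_exp i) j))"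
    by (auto simp: unit_exp_def)
  have "of_nat (Suc (k i)) * ((of_int (r i) :: 'k) gchoose Suc (k i)) = of_int (r i) * ((of_int (r i) - 1) gchoose k i)"
    by (rule gbinomial_absorption)
  then have "of_int (r i) * (of_int ((r - unit_exp i) i) gchoose k i) =
      of_nat (Suc (k i)) * ((of_int (r i) :: 'k) gchoose (k + unit_exp i) i)"
    by (simp add: unit_exp_def del: of_nat_Suc)
  then show "taylor k (partial i (Poly_Mapping.single r c)) =
    of_nat (Suc (k i)) * taylor (k + unit_exp i) (Poly_Mapping.single r c)"
    unfolding partial_single taylor_single of_nat_mult_single e R
    by (intro arg_cong2[where f = Poly_Mapping.single] refl) (metis (no_types, lifting) mult.assoc mult.left_commute)
qed (simp_all add: partial_add taylor_add algebra_simps)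

lemma partial_taylor:
  "partial i (taylor k g) = taylor k (partial i (g :: ('n::finite, 'k::field_char_0) laurent))"
proof (rule additive_eqI[where f = g])
  fix r and c :: 'k
  obtain R where R: "(\<Prod>j\<in>UNIV. of_int ((r - unit_exp i) j) gchoose k j) = (of_int ((r - unit_exp i) i) gchoose k i) * R"
    "(\<Prod>j\<in>UNIV. of_int (r j) gchoose k j) = (of_int (r i) gchoose k i) * (R :: 'k)"
    by (rule prod_upd[of i "\<lambda>j. of_int ((r - unit_exp i) j) gchoose k j" "\<lambda>j. of_int (r j) gchoose k j"])
      (auto simp: unit_exp_def)
  have e: "(\<lambda>j. (r - unit_exp i) j - int (k j)) = (\<lambda>j. r j - int (k j)) - unit_exp i"
    by (auto simp: unit_exp_def)
  have "of_int (r i - int (k i)) * ((of_int (r i) :: 'k) gchoose k i) = of_int (r i) * (of_int ((r - unit_exp i) i) gchoose k i)"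
    using gbinomial_absorb_comp[of "of_int (r i) :: 'k" "k i"] by (simp add: unit_exp_def)
  then show "partial i (taylor k (Poly_Mapping.single r c)) = taylor k (partial i (Poly_Mapping.single r c))"
    unfolding partial_single taylor_single e R
    by (intro arg_cong2[where f = Poly_Mapping.single] refl) (metis (no_types, lifting) mult.assoc mult.left_commute)
qed (simp_all add: partial_add taylor_add)

lemma atMost_fun_eq_PiE: "{..k} = (\<Pi>\<^sub>E j\<in>UNIV. {..k j :: nat})"
  by (auto simp: le_fun_def PiE_iff)

lemma finite_atMost_fun [simp]: "finite {..k :: 'n::finite \<Rightarrow> nat}"
  unfolding atMost_fun_eq_PiE by (rule finite_PiE) auto

lemma single_sum_right: "Poly_Mapping.single r (\<Sum>i\<in>I. c i) = (\<Sum>i\<in>I. Poly_Mapping.single r (c i))"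
  by (induction I rule: infinite_finite_induct) (simp_all add: single_add)

text \<open>On monomials this is Vandermonde's convolution in each variable; multiplying out over
  the variables gives the sum over \<open>{..k}\<close>.\<close>

lemma taylor_mult:
  "taylor k (f * g) = (\<Sum>l\<in>{..k}. taylor l f * taylor (k - l) (g :: ('n::finite, 'k::field_char_0) laurent))"
proof (rule additive_eqI[where f = f])
  fix r and c :: 'k
  show "taylor k (Poly_Mapping.single r c * g) = (\<Sum>l\<in>{..k}. taylor l (Poly_Mapping.single r c) * taylor (k - l) g)"
  proof (rule additive_eqI[where f = g])
    fix s and e :: 'k
    have exp: "(\<lambda>j. r j - int (l j)) + (\<lambda>j. s j - int ((k - l) j)) = (\<lambda>j. (r + s) j - int (k j))" if "l \<le> k" for l
    proof
      fix j show "((\<lambda>j. r j - int (l j)) + (\<lambda>j. s j - int ((k - l) j))) j = (r + s) j - int (k j)"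
        using le_funD[OF that, of j] by (simp add: of_nat_diff)
    qed
    have "(\<Prod>j\<in>UNIV. of_int ((r + s) j) gchoose k j :: 'k) =
      (\<Prod>j\<in>UNIV. \<Sum>l\<in>{..k j}. (of_int (r j) gchoose l) * (of_int (s j) gchoose (k j - l)))"
      by (simp add: gbinomial_Vandermonde[symmetric] atLeast0AtMost)
    also have "\<dots> = (\<Sum>l\<in>{..k}. \<Prod>j\<in>UNIV. (of_int (r j) gchoose l j) * (of_int (s j) gchoose (k j - l j)))"
      by (simp add: prod_sum_PiE atMost_fun_eq_PiE)
    finally have V: "(\<Prod>j\<in>UNIV. of_int ((r + s) j) gchoose k j :: 'k) =
      (\<Sum>l\<in>{..k}. (\<Prod>j\<in>UNIV. of_int (r j) gchoose l j) * (\<Prod>j\<in>UNIV. of_int (s j) gchoose (k j - l j)))"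
      by (simp add: prod.distrib)
    have "taylor k (Poly_Mapping.single r c * Poly_Mapping.single s e) = (\<Sum>l\<in>{..k}. Poly_Mapping.single (\<lambda>j. (r + s) j - int (k j))
        (c * e * ((\<Prod>j\<in>UNIV. of_int (r j) gchoose l j) * (\<Prod>j\<in>UNIV. of_int (s j) gchoose (k j - l j)))))"
      by (simp only: mult_single taylor_single V sum_distrib_left single_sum_right)
    also have "\<dots> = (\<Sum>l\<in>{..k}. taylor l (Poly_Mapping.single r c) * taylor (k - l) (Poly_Mapping.single s e))"
    proof (rule sum.cong[OF refl])
      fix l assume "l \<in> {..k}"
      then have "l \<le> k" by simp
      from exp[OF this]
      show "Poly_Mapping.single (\<lambda>j. (r + s) j - int (k j))
        (c * e * ((\<Prod>j\<in>UNIV. of_int (r j) gchoose l j) * (\<Prod>j\<in>UNIV. of_int (s j) gchoose (k j - l j)))) =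
        taylor l (Poly_Mapping.single r c) * taylor (k - l) (Poly_Mapping.single s e)"
        by (simp add: taylor_single mult_single mult_ac)
    qed
    finally show "taylor k (Poly_Mapping.single r c * Poly_Mapping.single s e) =
      (\<Sum>l\<in>{..k}. taylor l (Poly_Mapping.single r c) * taylor (k - l) (Poly_Mapping.single s e))" .
  qed (simp_all add: distrib_left taylor_add sum.distrib)
qed (simp_all add: distrib_right taylor_add sum.distrib)

section \<open>The module structure of the tensor product\<close>

definition pm_map :: "('a \<Rightarrow> 'v::zero \<Rightarrow> 'w) \<Rightarrow> ('a \<Rightarrow>\<^sub>0 'v) \<Rightarrow> ('a \<Rightarrow>\<^sub>0 'w::ab_group_add)" where
  "pm_map F m = (\<Sum>r\<in>Poly_Mapping.keys m. Poly_Mapping.single r (F r (Poly_Mapping.lookup m r)))"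

lemma lookup_pm_map:
  assumes "F r 0 = 0"
  shows "Poly_Mapping.lookup (pm_map F m) r = F r (Poly_Mapping.lookup m r)"
  using assms by (auto simp: pm_map_def lookup_sum lookup_single when_def in_keys_iff cong: if_cong)

lemma pm_map_single: "F r 0 = 0 \<Longrightarrow> pm_map F (Poly_Mapping.single r w) = Poly_Mapping.single r (F r w)"
  by (simp add: pm_map_def)

lemma tensor_lift_add:
  fixes m m' :: "'a \<Rightarrow>\<^sub>0 'v::ab_group_add" and \<beta> :: "_ \<Rightarrow> 'v \<Rightarrow> 'u::ab_group_add"
  assumes "\<And>s v w. \<beta> s (v + w) = \<beta> s v + \<beta> s w"
  shows "tensor_lift \<beta> (m + m') = tensor_lift \<beta> m + tensor_lift \<beta> m'"
  unfolding tensor_lift_def by (rule sum_keys_add) (rule assms)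

lemma tensor_lift_zero [simp]: "tensor_lift \<beta> 0 = 0"
  by (simp add: tensor_lift_def)

context vector_space
begin

lemma pure_tensor_zero [simp]: "pure_tensor scale s 0 = 0" "pure_tensor scale 0 w = 0"
  by (intro poly_mapping_eqI; simp add: lookup_pure_tensor[OF vector_space_axioms])+

lemma tensor_lift_single:
  fixes \<beta> :: "('c \<Rightarrow>\<^sub>0 'a) \<Rightarrow> 'b \<Rightarrow> 'u::ab_group_add"
  assumes "\<beta> (Poly_Mapping.single r 1) 0 = 0"
  shows "tensor_lift \<beta> (Poly_Mapping.single r w) = \<beta> (Poly_Mapping.single r 1) w"
  using assms by (simp add: tensor_lift_def)

end

lemma module_tensor_mult:
  assumes vs: "vector_space sW"
  shows "module (tensor_mult sW :: ('n::finite, 'k::field_char_0) laurent \<Rightarrow> _)"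
proof -
  interpret vector_space sW by fact
  let ?T = "tensor_mult sW :: ('n, 'k) laurent \<Rightarrow> _"
  have add: "?T f (m + m') = ?T f m + ?T f m'" for f m m'
    unfolding tensor_mult_def by (rule tensor_lift_add) (rule pure_tensor_add_right[OF vs])
  have zero: "?T f 0 = 0" for f by (simp add: tensor_mult_def)
  have sing: "Poly_Mapping.single r w = pure_tensor sW (Poly_Mapping.single r 1) w" for r :: "'n \<Rightarrow> int" and w
    by (simp add: pure_tensor_single[OF vs])
  note pt = tensor_mult_pure_tensor[OF vs]
  show ?thesis
  proof
    fix f g m m'
    show "?T f (m + m') = ?T f m + ?T f m'" by (rule add)
    show "?T (f + g) m = ?T f m + ?T g m"
      by (rule additive_eqI[where f = m])
        (simp_all add: add zero sing pt distrib_right pure_tensor_add_left[OF vs])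
    show "?T f (?T g m) = ?T (f * g) m"
      by (rule additive_eqI[where f = m]) (simp_all add: add zero sing pt mult.assoc)
    show "?T 1 m = m"
      by (rule additive_eqI[where f = m]) (simp_all add: add zero sing pt)
  qed
qed

lemma tensor_mult_single_zero:
  assumes vs: "vector_space sW"
  shows "tensor_mult sW (Poly_Mapping.single 0 c) m = pm_scale sW c m"
proof (rule additive_eqI[where f = m])
  interpret vector_space sW by fact
  interpret T: module "tensor_mult sW" by (rule module_tensor_mult[OF vs])
  interpret pm: vector_space "pm_scale sW" by (rule vector_space_pm_scale[OF vs])
  fix f g
  show "tensor_mult sW (Poly_Mapping.single 0 c) (f + g) =
    tensor_mult sW (Poly_Mapping.single 0 c) f + tensor_mult sW (Poly_Mapping.single 0 c) g"
    by (rule T.scale_right_distrib)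
  show "pm_scale sW c (f + g) = pm_scale sW c f + pm_scale sW c g"
    by (rule pm.scale_right_distrib)
  show "tensor_mult sW (Poly_Mapping.single 0 c) 0 = 0" "pm_scale sW c 0 = 0" by simp_all
  fix r w
  have "tensor_mult sW (Poly_Mapping.single 0 c) (pure_tensor sW (Poly_Mapping.single r 1) w) = pm_scale sW c (pure_tensor sW (Poly_Mapping.single r 1) w)"
    by (simp add: tensor_mult_pure_tensor[OF vs] pure_tensor_scale_left[OF vs, symmetric] pm_scale_eq_mult)
  then show "tensor_mult sW (Poly_Mapping.single 0 c) (Poly_Mapping.single r w) = pm_scale sW c (Poly_Mapping.single r w)"
    by (simp add: pure_tensor_single[OF vs])
qed

section \<open>Finiteness of eigenvalues\<close>

lemma (in vector_space) independent_eigenvectors: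
  assumes add: "\<And>x y. f (x + y) = f x + f y" and hom: "\<And>c x. f (scale c x) = scale c (f x)"
    and eig: "\<And>x. x \<in> X \<Longrightarrow> f x = scale (ev x) x" and inj: "inj_on ev X" and nz: "0 \<notin> X"
  shows "independent X"
proof -
  have f0: "f 0 = 0" using hom[of 0 0] by simp
  have fs: "f (\<Sum>x\<in>t. g x) = (\<Sum>x\<in>t. f (g x))" for t :: "'b set" and g
    by (induction t rule: infinite_finite_induct) (simp_all add: f0 add)
  have "\<forall>v\<in>t. u v = 0" if "finite t" "t \<subseteq> X" "(\<Sum>v\<in>t. scale (u v) v) = 0" for t u
    using that
  proof (induction t arbitrary: u rule: finite_induct)
    case (insert x t)
    \<comment> \<open>Applying \<open>f\<close> minus the eigenvalue of \<open>x\<close> to the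
      relation removes the term of \<open>x\<close> and multiplies the others by nonzero differences
      of eigenvalues.\<close>
    have "f (\<Sum>v\<in>insert x t. scale (u v) v) - scale (ev x) (\<Sum>v\<in>insert x t. scale (u v) v) = 0"
      unfolding insert.prems(2) by (simp add: f0)
    moreover have "f (\<Sum>v\<in>insert x t. scale (u v) v) = (\<Sum>v\<in>insert x t. scale (u v * ev v) v)"
      unfolding fs using insert.prems(1) by (intro sum.cong) (auto simp: hom eig)
    ultimately have "(\<Sum>v\<in>insert x t. scale (u v * ev v) v) - (\<Sum>v\<in>insert x t. scale (u v * ev x) v) = 0"
      by (simp add: scale_sum_right mult.commute scale_right_distrib insert.hyps)
    then have "(\<Sum>v\<in>t. scale (u v * (ev v - ev x)) v) = 0"
      using insert.hyps by (simp add: sum_subtractf[symmetric] right_diff_distrib scale_left_diff_distrib)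
    then have "\<forall>v\<in>t. u v * (ev v - ev x) = 0"
      using insert.IH[of "\<lambda>v. u v * (ev v - ev x)"] insert.prems(1) by simp
    moreover have "ev v \<noteq> ev x" if "v \<in> t" for v
      using inj_onD[OF inj, of v x] that insert.prems(1) insert.hyps by blast
    ultimately have t: "\<forall>v\<in>t. u v = 0" by simp
    then have "scale (u x) x = 0" using insert.prems(2) insert.hyps by simp
    then have "u x = 0" using nz insert.prems(1) by auto
    then show ?case using t by simp
  qed simp
  then show ?thesis unfolding dependent_explicit by blast
qed

text \<open>In characteristic 0 different natural numbers are different scalars, so their
  eigenvectors are independent, and a finitely spanned space has room for only finitely many. It is
  applied to \<open>euler\<close> on W and to the commutator with \<open>euler\<close> on operators
  of W.\<close>

lemma finite_eigenvalues:
  fixes s :: "'k::field_char_0 \<Rightarrow> 'v::ab_group_add \<Rightarrow> 'v"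
  assumes vs: "vector_space s"
    and add: "\<And>x y. f (x + y) = f x + f y" and hom: "\<And>c x. f (s c x) = s c (f x)" and "finite T"
  shows "\<exists>N :: nat. \<forall>d\<ge>N. \<forall>x\<in>module.span s T. f x = s (of_nat d) x \<longrightarrow> x = 0"
proof -
  interpret vector_space s by fact
  define D where "D = {d :: nat. \<exists>x\<in>span T. x \<noteq> 0 \<and> f x = s (of_nat d) x}"
  have "\<forall>d\<in>D. \<exists>x. x \<in> span T \<and> x \<noteq> 0 \<and> f x = s (of_nat d) x" by (auto simp: D_def)
  then obtain x where x: "\<And>d. d \<in> D \<Longrightarrow> x d \<in> span T \<and> x d \<noteq> 0 \<and> f (x d) = s (of_nat d) (x d)"
    by metis
  have inj: "inj_on x D"
  proof (rule inj_onI)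
    fix d e assume de: "d \<in> D" "e \<in> D" "x d = x e"
    then have "s (of_nat d) (x d) = s (of_nat e) (x d)" using x[of d] x[of e] by metis
    then show "d = e" using x[OF de(1)] by simp
  qed
  have "independent (x ` D)"
  proof (rule independent_eigenvectors[of f "x ` D" "\<lambda>v. of_nat (inv_into D x v)"])
    show "inj_on (\<lambda>v. of_nat (inv_into D x v) :: 'k) (x ` D)"
      using inj by (auto simp: inj_on_def)
  qed (use x inj in \<open>auto simp: add hom\<close>)
  then have "finite (x ` D)"
    using independent_span_bound[OF assms(4), of "x ` D"] x by blast
  then have "finite D" using inj by (simp add: finite_image_iff)
  then obtain N where N: "\<forall>d\<in>D. d < N" using finite_nat_set_iff_bounded by blast
  show ?thesis
  proof (intro exI allI impI ballI)
    fix d y assume "N \<le> d" "y \<in> span T" "f y = s (of_nat d) y"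
    then show "y = 0" using N by (auto simp: D_def dest: leD)
  qed
qed

section \<open>Finite-dimensional modules over the vector fields vanishing at the origin\<close>

abbreviation mfield :: "'n idx \<Rightarrow> ('n, 'k::field_char_0) mpoly \<Rightarrow> ('n, 'k) mpoly" where
  "mfield \<beta> \<equiv> monomial_field (fst \<beta>) (snd \<beta>)"

lemma unit_exp_nonzero [simp]: "(unit_exp i :: 'i \<Rightarrow> nat) \<noteq> 0"
  by (auto simp: fun_eq_iff unit_exp_def)

lemma mfield_L_plus: "k \<noteq> 0 \<Longrightarrow> monomial_field k i \<in> L_plus"
proof -
  interpret lie_algebra field_scale L_plus commutator by (rule lie_algebra_L_plus)
  assume "k \<noteq> 0"
  then show ?thesis unfolding L_plus_eq_span by (intro span_base) auto
qed

locale L_plus_module = lie_module field_scale L_plus commutator sW \<rho>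
  for sW :: "'k::field_char_0 \<Rightarrow> 'w::ab_group_add \<Rightarrow> 'w"
    and \<rho> :: "(('n::finite, 'k) mpoly \<Rightarrow> ('n, 'k) mpoly) \<Rightarrow> 'w \<Rightarrow> 'w" +
  assumes finite_dimensional: "\<exists>B. finite_dimensional_vector_space sW B"
begin

lemmas vs = M.vector_space_axioms

lemma act_plus: "x \<in> L_plus \<Longrightarrow> \<rho> x (v + w) = \<rho> x v + \<rho> x w"
  and act_scale_right: "x \<in> L_plus \<Longrightarrow> \<rho> x (sW c w) = sW c (\<rho> x w)"
  using act_linear[of x] by (simp_all add: linear_vs_iff[OF vs vs])

lemma act_zero [simp]: "x \<in> L_plus \<Longrightarrow> \<rho> x 0 = 0"
  using act_plus[of x 0 0] by simp

lemma act_sum: "x \<in> L_plus \<Longrightarrow> \<rho> x (\<Sum>i\<in>I. f i) = (\<Sum>i\<in>I. \<rho> x (f i))"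
  by (induction I rule: infinite_finite_induct) (simp_all add: act_plus)

definition euler :: "'w \<Rightarrow> 'w" where
  "euler w = (\<Sum>i\<in>UNIV. \<rho> (mfield (unit_exp i, i)) w)"

lemma euler_add: "euler (v + w) = euler v + euler w"
  and euler_scale: "euler (sW c w) = sW c (euler w)"
  by (simp_all add: euler_def act_plus act_scale_right mfield_L_plus sum.distrib M.scale_sum_right)

lemma commutator_unit:
  assumes "fst \<beta> \<noteq> 0"
  shows "commutator (mfield (unit_exp i, i)) (mfield \<beta> :: ('n, 'k) mpoly \<Rightarrow> _) =
    field_scale (of_nat (fst \<beta> i) - (if i = snd \<beta> then 1 else 0)) (mfield \<beta>)"
proof -
  obtain k j where \<beta>: "\<beta> = (k, j)" by fastforce
  have 1: "field_scale (of_nat (k i)) (monomial_field (unit_exp i + (k - unit_exp i)) j) =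
     field_scale (of_nat (k i)) (monomial_field k j :: ('n, 'k) mpoly \<Rightarrow> _)"
  proof (cases "k i = 0")
    case False
    then have "unit_exp i + (k - unit_exp i) = k" by (auto simp: unit_exp_def fun_eq_iff)
    then show ?thesis by simp
  qed simp
  have 2: "field_scale (of_nat (unit_exp i j)) (monomial_field (k + (unit_exp i - unit_exp j)) i) =
     field_scale (if i = j then 1 else 0) (monomial_field k j :: ('n, 'k) mpoly \<Rightarrow> _)"
    by (cases "i = j") (simp_all add: unit_exp_def)
  show ?thesis
    by (simp add: \<beta> commutator_monomial_field 1 2 scale_left_diff_distrib)
qed

text \<open>The bracket with \<open>X_i \<partial>/\<partial>X_i\<close> counts the exponent of
  \<open>X_i\<close>, less 1 if i is the component of the field. The sum over i is the degree |k| -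
  1.\<close>

lemma euler_act:
  assumes "fst \<beta> \<noteq> 0"
  shows "euler (\<rho> (mfield \<beta>) w) = \<rho> (mfield \<beta>) (euler w) + sW (of_nat (mdeg \<beta>) - 1) (\<rho> (mfield \<beta>) w)"
proof -
  have L: "mfield \<beta> \<in> L_plus" "\<And>i. mfield (unit_exp i, i) \<in> L_plus"
    using assms by (simp_all add: mfield_L_plus)
  have "\<rho> (mfield (unit_exp i, i)) (\<rho> (mfield \<beta>) w) =
    \<rho> (mfield \<beta>) (\<rho> (mfield (unit_exp i, i)) w) +
    sW (of_nat (fst \<beta> i) - (if i = snd \<beta> then 1 else 0)) (\<rho> (mfield \<beta>) w)" for i
    using act_br[OF L(2)[of i] L(1), of w] unfolding commutator_unit[OF assms] act_scale[OF L(1)]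
    by simp
  then have "euler (\<rho> (mfield \<beta>) w) = \<rho> (mfield \<beta>) (euler w) +
     (\<Sum>i\<in>UNIV. sW (of_nat (fst \<beta> i) - (if i = snd \<beta> then 1 else 0)) (\<rho> (mfield \<beta>) w))"
    by (simp add: euler_def sum.distrib act_sum[OF L(1)])
  also have "(\<Sum>i\<in>UNIV. sW (of_nat (fst \<beta> i) - (if i = snd \<beta> then 1 else 0)) (\<rho> (mfield \<beta>) w)) =
     sW (of_nat (mdeg \<beta>) - 1) (\<rho> (mfield \<beta>) w)"
    by (simp add: M.scale_sum_left[symmetric] sum_subtractf mdeg_def)
  finally show ?thesis .
qed

text \<open>By \<open>euler_act\<close>, the operator \<open>\<rho> (mfield \<beta>)\<close> is zero
  or an eigenvector, with eigenvalue \<open>mdeg \<beta> - 1\<close>, of the commutator with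
  \<open>euler\<close>; for large degree there is no such eigenvalue.\<close>

lemma rho_eventually_zero:
  obtains N\<^sub>0 where "N\<^sub>0 > 0" "\<And>\<beta> w. N\<^sub>0 \<le> mdeg \<beta> \<Longrightarrow> \<rho> (mfield \<beta>) w = 0"
proof -
  obtain B where "finite_dimensional_vector_space sW B" using finite_dimensional by blast
  then interpret fd: finite_dimensional_vector_space sW B .
  interpret F: vector_space "fun_scale sW :: 'k \<Rightarrow> ('w \<Rightarrow> 'w) \<Rightarrow> _"
    by (rule vector_space_fun_scale[OF vs])
  \<comment> \<open>The matrix units of a basis \<open>B\<close> of W: finitely many operators whose
    span contains every \<open>\<rho> x\<close>.\<close>
  define E where "E b b' = (\<lambda>w. sW (M.representation B w b) b')" for b b'
  define f where "f g = (\<lambda>w. euler (g w) - g (euler w))" for g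
  have span: "\<rho> x \<in> F.span {E b b' |b b'. b \<in> B \<and> b' \<in> B}" if "x \<in> L_plus" for x
  proof -
    have rep: "v = (\<Sum>b\<in>B. sW (M.representation B v b) b)" for v
      using M.sum_representation_eq[OF fd.independent_Basis _ fd.finite_Basis order.refl, of v]
      by (simp add: fd.span_Basis)
    have "\<rho> x = (\<Sum>b\<in>B. \<Sum>b'\<in>B. fun_scale sW (M.representation B (\<rho> x b) b') (E b b'))"
    proof
      fix w :: 'w
      have ap: "(\<Sum>i\<in>I. h i) w = (\<Sum>i\<in>I. h i w)" for I :: "'w set" and h
        by (induction I rule: infinite_finite_induct) simp_all
      have "\<rho> x w = (\<Sum>b\<in>B. sW (M.representation B w b) (\<rho> x b))"
        by (subst rep[of w]) (simp add: act_sum[OF that] act_scale_right[OF that])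
      also have "\<dots> = (\<Sum>b\<in>B. \<Sum>b'\<in>B. sW (M.representation B w b) (sW (M.representation B (\<rho> x b) b') b'))"
        by (rule sum.cong[OF refl], subst (1) rep) (simp add: M.scale_sum_right)
      finally show "\<rho> x w = (\<Sum>b\<in>B. \<Sum>b'\<in>B. fun_scale sW (M.representation B (\<rho> x b) b') (E b b')) w"
        by (simp add: ap fun_scale_def E_def mult.commute)
    qed
    also have "\<dots> \<in> F.span {E b b' |b b'. b \<in> B \<and> b' \<in> B}"
      by (intro F.span_sum F.span_scale F.span_base) auto
    finally show ?thesis .
  qed
  have fin: "finite {E b b' |b b'. b \<in> B \<and> b' \<in> B}"
    using finite_image_set2[of "\<lambda>b. b \<in> B" "\<lambda>b'. b' \<in> B" E] fd.finite_Basis by simp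
  have f_add: "f (g + h) = f g + f h" for g h by (simp add: f_def fun_eq_iff euler_add)
  have f_scale: "f (fun_scale sW c g) = fun_scale sW c (f g)" for c g
    by (simp add: f_def fun_eq_iff fun_scale_def euler_scale M.scale_right_diff_distrib)
  obtain N where N: "\<forall>d\<ge>N. \<forall>g\<in>F.span {E b b' |b b'. b \<in> B \<and> b' \<in> B}.
      f g = fun_scale sW (of_nat d) g \<longrightarrow> g = 0"
    using finite_eigenvalues[OF vector_space_fun_scale[OF vs] f_add f_scale fin] by blast
  show ?thesis
  \<comment> \<open>The eigenvalue is the degree minus 1, hence the successor.\<close>
  proof (rule that[of "Suc N"])
    fix \<beta> :: "'n idx" and w assume "Suc N \<le> mdeg \<beta>"
    then have \<beta>: "fst \<beta> \<noteq> 0" "mdeg \<beta> - 1 \<ge> N" "mdeg \<beta> \<ge> 1"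
      using mdeg_eq_0[of \<beta>] by (auto simp del: mdeg_eq_0)
    have "f (\<rho> (mfield \<beta>)) = fun_scale sW (of_nat (mdeg \<beta> - 1)) (\<rho> (mfield \<beta>))"
      using \<beta>(3) by (simp add: f_def fun_eq_iff fun_scale_def euler_act[OF \<beta>(1)] of_nat_diff)
    then have "\<rho> (mfield \<beta>) = 0" using N \<beta>(2) span[OF mfield_L_plus[OF \<beta>(1)]] by blast
    then show "\<rho> (mfield \<beta>) w = 0" by simp
  qed simp
qed

text \<open>Once d exceeds all eigenvalues, E - d is injective, hence surjective in finite
  dimension. \<open>R d\<close> chooses preimages; its linearity is not recorded, since the second
  property recovers it where needed.\<close>

lemma euler_invertible:
  obtains N\<^sub>1 R where "\<And>d w. N\<^sub>1 \<le> d \<Longrightarrow> euler (R d w) - sW (of_nat d) (R d w) = w"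
    and "\<And>d w. N\<^sub>1 \<le> d \<Longrightarrow> euler w = sW (of_nat d) w \<Longrightarrow> w = 0"
proof -
  obtain B where "finite_dimensional_vector_space sW B" using finite_dimensional by blast
  then interpret fd: finite_dimensional_vector_space sW B .
  obtain N where N: "\<forall>d\<ge>N. \<forall>w\<in>M.span B. euler w = sW (of_nat d) w \<longrightarrow> w = 0"
    using finite_eigenvalues[OF vs, of euler, OF euler_add euler_scale fd.finite_Basis] by blast
  then have N: "w = 0" if "d \<ge> N" "euler w = sW (of_nat d) w" for d w
    using that by (simp add: fd.span_Basis)
  have surj: "\<exists>v. euler v - sW (of_nat d) v = w" if "d \<ge> N" for d w
  proof -
    let ?f = "\<lambda>v. euler v - sW (of_nat d) v"
    have lin: "Vector_Spaces.linear sW sW ?f"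
      by (simp add: linear_vs_iff[OF vs vs] euler_add euler_scale M.scale_right_diff_distrib
        M.scale_right_distrib mult.commute)
    have "inj ?f"
    proof (rule injI)
      fix x y assume "?f x = ?f y"
      then have "euler x - euler y = sW (of_nat d) x - sW (of_nat d) y"
        by (simp add: algebra_simps)
      moreover have "euler (x - y) = euler x - euler y" using euler_add[of "x - y" y] by simp
      ultimately have "euler (x - y) = sW (of_nat d) (x - y)"
        by (simp only: M.scale_right_diff_distrib)
      then show "x = y" using N[OF that, of "x - y"] by simp
    qed
    then have "surj ?f" using fd.linear_inj_imp_surj[OF lin] by blast
    then show ?thesis unfolding surj_def by metis
  qed
  then obtain R where "\<And>d w. d \<ge> N \<Longrightarrow> euler (R d w) - sW (of_nat d) (R d w) = w" by metis
  then show ?thesis using that N by blast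
qed

end

section \<open>Jets of vector fields on the torus\<close>

lemma torus_field_add: "\<eta> \<in> torus_fields \<Longrightarrow> \<eta> (f + g) = \<eta> f + \<eta> g"
  and torus_field_mult: "\<eta> \<in> torus_fields \<Longrightarrow> \<eta> (f * g) = \<eta> f * g + f * \<eta> g"
  by (auto simp: torus_fields_def derivations_def linear_pm_iff)

lemma torus_field_one: "\<eta> \<in> torus_fields \<Longrightarrow> \<eta> 1 = 0"
  using torus_field_mult[of \<eta> 1 1] by simp

definition inv_coord :: "'n \<Rightarrow> ('n, 'k::field_char_0) laurent" where
  "inv_coord i = Poly_Mapping.single (- unit_exp i) 1"

lemma coord_inv [simp]: "coord i * inv_coord i = 1" "inv_coord i * coord i = 1"
  by (simp_all add: coord_def inv_coord_def mult_single)

lemma coord_inv' [simp]: "coord i * (inv_coord i * f) = f" "inv_coord i * (coord i * f) = f"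
  by (simp_all add: mult.assoc[symmetric])

text \<open>
  The index \<open>(0, i)\<close> is paired with the closed form \<open>dx\<^sub>i / x\<^sub>i\<close>, so that it acts on \<open>A\<close> by the
  semisimple operator \<open>x\<^sub>i \<partial>/\<partial>x\<^sub>i\<close>.
\<close>
definition jet_coeff :: "(('n::finite, 'k::field_char_0) laurent \<Rightarrow> ('n, 'k) laurent) \<Rightarrow> 'n idx \<Rightarrow> ('n, 'k) laurent" where
  "jet_coeff \<eta> \<beta> = (if fst \<beta> = 0 then inv_coord (snd \<beta>) * \<eta> (coord (snd \<beta>))
     else taylor (fst \<beta>) (\<eta> (coord (snd \<beta>))))"

abbreviation idx_below :: "nat \<Rightarrow> 'n::finite idx set" where
  "idx_below M \<equiv> {\<beta>. mdeg \<beta> < M}"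

lemma idx_below_eq: "idx_below M = {k. (\<Sum>j\<in>UNIV. k j) < M} \<times> UNIV"
  by (auto simp: mdeg_def)

lemma finite_sum_below: "finite {k :: 'n::finite \<Rightarrow> nat. (\<Sum>j\<in>UNIV. k j) < M}"
proof -
  have "{k :: 'n \<Rightarrow> nat. (\<Sum>j\<in>UNIV. k j) < M} = fst ` (idx_below M :: 'n idx set)"
    by (simp add: idx_below_eq)
  then show ?thesis using finite_mdeg[of M] by (metis finite_imageI)
qed

lemma sum_idx_below:
  "(\<Sum>\<beta>\<in>idx_below M. F (fst \<beta>) (snd \<beta>)) = (\<Sum>i\<in>UNIV. \<Sum>k | (\<Sum>j\<in>UNIV. k j) < M. F k i)"
  unfolding idx_below_eq by (subst sum.swap) (simp add: sum.cartesian_product case_prod_unfold)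

text \<open>In the Leibniz expansion of the Taylor coefficients of \<eta> g, the terms that do not
  differentiate the components of \<eta> add up to \<eta> applied to the Taylor coefficient of g,
  because partial derivatives commute with \<open>taylor\<close>. What remains has l \<noteq> 0,
  that is, it involves only the part of the jet in L_+.\<close>

lemma taylor_torus_field:
  fixes g :: "('n::finite, 'k::field_char_0) laurent"
  assumes "\<eta> \<in> torus_fields"
  shows "taylor k (\<eta> g) - \<eta> (taylor k g) = (\<Sum>(l, i)\<in>({..k} - {0}) \<times> UNIV.
     taylor l (\<eta> (coord i)) * (of_nat (Suc ((k - l) i)) * taylor (k - l + unit_exp i) g))"
proof -
  have "taylor k (\<eta> g) = (\<Sum>i\<in>UNIV. \<Sum>l\<in>{..k}. taylor l (\<eta> (coord i)) * taylor (k - l) (partial i g))"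
    by (subst torus_field_eq[OF assms]) (simp add: taylor_sum taylor_mult)
  also have "\<dots> = (\<Sum>i\<in>UNIV. \<eta> (coord i) * taylor k (partial i g) +
      (\<Sum>l\<in>{..k} - {0}. taylor l (\<eta> (coord i)) * taylor (k - l) (partial i g)))"
  proof (rule sum.cong[OF refl])
    fix i
    have "0 \<in> {..k}" by (simp add: le_fun_def)
    moreover have "taylor (k - 0) (partial i g) = taylor k (partial i g)" by (simp add: fun_diff_def)
    ultimately show "(\<Sum>l\<in>{..k}. taylor l (\<eta> (coord i)) * taylor (k - l) (partial i g)) =
      \<eta> (coord i) * taylor k (partial i g) +
      (\<Sum>l\<in>{..k} - {0}. taylor l (\<eta> (coord i)) * taylor (k - l) (partial i g))"
      by (subst sum.remove[of _ "0 :: 'n \<Rightarrow> nat"]) auto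
  qed
  also have "\<dots> = \<eta> (taylor k g) +
      (\<Sum>i\<in>UNIV. \<Sum>l\<in>{..k} - {0}. taylor l (\<eta> (coord i)) * taylor (k - l) (partial i g))"
    by (simp add: sum.distrib torus_field_eq[OF assms, of "taylor k g"] partial_taylor)
  finally show ?thesis
    by (subst sum.cartesian_product[symmetric], subst sum.swap) (simp add: taylor_partial)
qed

text \<open>One half of the bracket term in the Maurer-Cartan equation. The substitution m = k - l +
  e_i turns the factor \<open>Suc ((k - l) i)\<close> into the coefficient m_i of the bracket of
  \<open>X^l \<partial>/\<partial>X_i\<close> with \<open>X^m \<partial>/\<partial>X_j\<close>. The
  truncation is consistent: since l \<noteq> 0, the degrees of l and m do not exceed that of k, and
  brackets that leave the range are killed by \<open>h\<close>.\<close>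

lemma taylor_curvature:
  fixes \<eta> :: "('n::finite, 'k::field_char_0) laurent \<Rightarrow> ('n, 'k) laurent"
    and sc :: "('n, 'k) laurent \<Rightarrow> 'm::ab_group_add \<Rightarrow> 'm"
  assumes sc: "module sc" and \<eta>: "\<eta> \<in> torus_fields" and h: "\<And>\<gamma>. M \<le> mdeg \<gamma> \<Longrightarrow> h \<gamma> = 0"
  shows "(\<Sum>\<gamma>\<in>idx_below M. sc (if fst \<gamma> = 0 then 0
       else taylor (fst \<gamma>) (\<eta> (g (snd \<gamma>))) - \<eta> (taylor (fst \<gamma>) (g (snd \<gamma>)))) (h \<gamma>)) =
    (\<Sum>\<beta>\<in>idx_below M. \<Sum>\<gamma>\<in>idx_below M. sc (taylor (fst \<beta>) (\<eta> (coord (snd \<beta>))) * taylor (fst \<gamma>) (g (snd \<gamma>)))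
       (if fst \<beta> = 0 \<or> fst \<gamma> = 0 then 0 else
          sc (of_nat (fst \<gamma> (snd \<beta>))) (h (fst \<beta> + (fst \<gamma> - unit_exp (snd \<beta>)), snd \<gamma>))))"
    (is "?L = ?R")
proof -
  interpret module sc by fact
  let ?D = "\<lambda>k. ({..k} - {0 :: 'n \<Rightarrow> nat}) \<times> (UNIV :: 'n set)"
  let ?t = "\<lambda>(k, j) (l, i). sc (taylor l (\<eta> (coord i)) * (of_nat (Suc ((k - l) i)) * taylor (k - l + unit_exp i) (g j))) (h (k, j))"
  let ?f = "\<lambda>\<beta> \<gamma>. sc (taylor (fst \<beta>) (\<eta> (coord (snd \<beta>))) * taylor (fst \<gamma>) (g (snd \<gamma>)))
       (if fst \<beta> = 0 \<or> fst \<gamma> = 0 then 0 else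
          sc (of_nat (fst \<gamma> (snd \<beta>))) (h (fst \<beta> + (fst \<gamma> - unit_exp (snd \<beta>)), snd \<gamma>)))"
  \<comment> \<open>The pairs of symbols that the substitution reaches; all other pairs below
    \<open>M\<close> contribute 0.\<close>
  define T :: "('n idx \<times> 'n idx) set" where "T = {(\<beta>, \<gamma>) \<in> idx_below M \<times> idx_below M. fst \<beta> \<noteq> 0 \<and> fst \<gamma> (snd \<beta>) \<noteq> 0 \<and>
     mdeg (fst \<beta> + (fst \<gamma> - unit_exp (snd \<beta>)), snd \<gamma>) < M}"
  have D0: "?D 0 = {}" by (auto simp: le_fun_def fun_eq_iff)
  have "?L = (\<Sum>\<gamma>\<in>idx_below M. \<Sum>\<beta>\<in>?D (fst \<gamma>). ?t \<gamma> \<beta>)"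
  proof (rule sum.cong[OF refl])
    fix \<gamma> :: "'n idx"
    show "sc (if fst \<gamma> = 0 then 0 else taylor (fst \<gamma>) (\<eta> (g (snd \<gamma>))) - \<eta> (taylor (fst \<gamma>) (g (snd \<gamma>)))) (h \<gamma>) =
      (\<Sum>\<beta>\<in>?D (fst \<gamma>). ?t \<gamma> \<beta>)"
    proof (cases "fst \<gamma> = 0")
      case False
      then show ?thesis
        by (simp add: taylor_torus_field[OF \<eta>] scale_sum_left case_prod_unfold)
    qed (simp only: D0, simp)
  qed
  also have "\<dots> = (\<Sum>(\<gamma>, \<beta>)\<in>Sigma (idx_below M) (\<lambda>\<gamma>. ?D (fst \<gamma>)). ?t \<gamma> \<beta>)"
    by (rule sum.Sigma) (auto simp: finite_mdeg)
  also have "\<dots> = (\<Sum>(\<beta>, \<gamma>)\<in>T. ?f \<beta> \<gamma>)"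
  proof (rule sum.reindex_bij_witness[where
      j = "\<lambda>(\<gamma>, \<beta>). (\<beta>, (fst \<gamma> - fst \<beta> + unit_exp (snd \<beta>), snd \<gamma>))" and
      i = "\<lambda>(\<beta>, \<gamma>). ((fst \<beta> + (fst \<gamma> - unit_exp (snd \<beta>)), snd \<gamma>), \<beta>)"])
    fix p assume "p \<in> Sigma (idx_below M) (\<lambda>\<gamma>. ?D (fst \<gamma>))"
    then obtain k j l i where p: "p = ((k, j), (l, i))" and M: "mdeg (k, j) < M" and l: "l \<le> k" "l \<noteq> 0"
      by force
    have 1: "l + (k - l) = k"
      using l(1) by (auto simp: fun_eq_iff le_fun_def)
    have kl: "mdeg (k, j) = mdeg (l, i) + mdeg (k - l, j)"
      using l(1) by (simp add: mdeg_def sum.distrib[symmetric] le_fun_def)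
    have "mdeg (l, i) \<ge> 1" using mdeg_eq_0[of "(l, i)"] l(2) by (simp del: mdeg_eq_0)
    moreover have "mdeg (k - l + unit_exp i, j) = mdeg (k - l, j) + 1"
      by (simp add: mdeg_def sum.distrib unit_exp_def)
    ultimately have deg: "mdeg (k - l + unit_exp i, j) < M" "mdeg (l, i) < M" using M kl by linarith+
    have ne: "k - l + unit_exp i \<noteq> 0" "(k - l + unit_exp i) i \<noteq> 0"
      by (auto simp: fun_eq_iff unit_exp_def)
    have ci: "(k - l + unit_exp i) i = Suc ((k - l) i)" by (simp add: unit_exp_def)
    show "(case (case p of (\<gamma>, \<beta>) \<Rightarrow> (\<beta>, (fst \<gamma> - fst \<beta> + unit_exp (snd \<beta>), snd \<gamma>))) of
        (\<beta>, \<gamma>) \<Rightarrow> ((fst \<beta> + (fst \<gamma> - unit_exp (snd \<beta>)), snd \<gamma>), \<beta>)) = p"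
      by (simp add: p 1)
    show "(case p of (\<gamma>, \<beta>) \<Rightarrow> (\<beta>, (fst \<gamma> - fst \<beta> + unit_exp (snd \<beta>), snd \<gamma>))) \<in> T"
      using deg ne M l by (auto simp: p T_def 1)
    show "(case (case p of (\<gamma>, \<beta>) \<Rightarrow> (\<beta>, (fst \<gamma> - fst \<beta> + unit_exp (snd \<beta>), snd \<gamma>))) of (\<beta>, \<gamma>) \<Rightarrow> ?f \<beta> \<gamma>) =
      (case p of (\<gamma>, \<beta>) \<Rightarrow> ?t \<gamma> \<beta>)"
      using l(2) ne(1) by (simp add: p 1 ci mult_ac del: of_nat_Suc plus_fun_apply)
  next
    fix p assume "p \<in> T"
    then obtain l i k j where p: "p = ((l, i), (k, j))" and d: "mdeg (l + (k - unit_exp i), j) < M"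
      and l: "l \<noteq> 0" and ki: "k i \<noteq> 0"
      by (auto simp: T_def)
    have "l + (k - unit_exp i) - l + unit_exp i = k"
      using ki by (auto simp: fun_eq_iff unit_exp_def)
    then show "(case (case p of (\<beta>, \<gamma>) \<Rightarrow> ((fst \<beta> + (fst \<gamma> - unit_exp (snd \<beta>)), snd \<gamma>), \<beta>)) of
        (\<gamma>, \<beta>) \<Rightarrow> (\<beta>, (fst \<gamma> - fst \<beta> + unit_exp (snd \<beta>), snd \<gamma>))) = p"
      by (simp add: p)
    show "(case p of (\<beta>, \<gamma>) \<Rightarrow> ((fst \<beta> + (fst \<gamma> - unit_exp (snd \<beta>)), snd \<gamma>), \<beta>)) \<in>
      Sigma (idx_below M) (\<lambda>\<gamma>. ?D (fst \<gamma>))"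
      using d l by (simp add: p le_fun_def)
  qed
  also have "\<dots> = (\<Sum>(\<beta>, \<gamma>)\<in>idx_below M \<times> idx_below M. ?f \<beta> \<gamma>)"
  proof (rule sum.mono_neutral_left)
    show "\<forall>p\<in>idx_below M \<times> idx_below M - T. (case p of (\<beta>, \<gamma>) \<Rightarrow> ?f \<beta> \<gamma>) = 0"
    proof
      fix p assume p: "p \<in> idx_below M \<times> idx_below M - T"
      obtain \<beta> \<gamma> where [simp]: "p = (\<beta>, \<gamma>)" by (cases p)
      consider "fst \<beta> = 0" | "fst \<gamma> (snd \<beta>) = 0" | "M \<le> mdeg (fst \<beta> + (fst \<gamma> - unit_exp (snd \<beta>)), snd \<gamma>)"
        using p unfolding T_def by fastforce
      then have "?f \<beta> \<gamma> = 0" by cases (simp_all add: h)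
      then show "(case p of (\<beta>, \<gamma>) \<Rightarrow> ?f \<beta> \<gamma>) = 0" by simp
    qed
  qed (auto simp: T_def finite_mdeg)
  also have "\<dots> = ?R" by (rule sum.cartesian_product[symmetric])
  finally show ?thesis .
qed

text \<open>The failure of \<open>jet_coeff\<close> to satisfy the equation without bracket term is
  the difference of the curvature terms for (\<eta>, \<zeta>) and (\<zeta>, \<eta>), and
  \<open>taylor_curvature\<close> identifies each with half of the bracket. The symbols of degree 0
  contribute no curvature because dx_i / x_i is closed.\<close>

lemma jet_maurer_cartan:
  fixes \<eta> \<zeta> :: "('n::finite, 'k::field_char_0) laurent \<Rightarrow> ('n, 'k) laurent"
    and sc :: "('n, 'k) laurent \<Rightarrow> 'm::ab_group_add \<Rightarrow> 'm"
  assumes sc: "module sc" and \<eta>: "\<eta> \<in> torus_fields" and \<zeta>: "\<zeta> \<in> torus_fields"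
    and h: "\<And>\<gamma>. M \<le> mdeg \<gamma> \<Longrightarrow> h \<gamma> = 0"
  shows "(\<Sum>\<gamma>\<in>idx_below M. sc (jet_coeff (commutator \<eta> \<zeta>) \<gamma>) (h \<gamma>)) =
    (\<Sum>\<gamma>\<in>idx_below M. sc (\<eta> (jet_coeff \<zeta> \<gamma>) - \<zeta> (jet_coeff \<eta> \<gamma>)) (h \<gamma>)) +
    (\<Sum>\<beta>\<in>idx_below M. \<Sum>\<gamma>\<in>idx_below M. sc (jet_coeff \<eta> \<beta> * jet_coeff \<zeta> \<gamma>)
       (if fst \<beta> = 0 \<or> fst \<gamma> = 0 then 0 else
          sc (of_nat (fst \<gamma> (snd \<beta>))) (h (fst \<beta> + (fst \<gamma> - unit_exp (snd \<beta>)), snd \<gamma>)) -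
          sc (of_nat (fst \<beta> (snd \<gamma>))) (h (fst \<gamma> + (fst \<beta> - unit_exp (snd \<gamma>)), snd \<beta>))))"
proof -
  interpret module sc by fact
  let ?I = "idx_below M :: 'n idx set"
  let ?C = "\<lambda>\<eta> \<zeta> \<gamma>. if fst \<gamma> = 0 then 0
     else taylor (fst \<gamma>) (\<eta> (\<zeta> (coord (snd \<gamma>)))) - \<eta> (taylor (fst \<gamma>) (\<zeta> (coord (snd \<gamma>)))) :: ('n, 'k) laurent"
  let ?h = "\<lambda>\<beta> \<gamma> :: 'n idx. if fst \<beta> = 0 \<or> fst \<gamma> = 0 then 0 else
          sc (of_nat (fst \<gamma> (snd \<beta>))) (h (fst \<beta> + (fst \<gamma> - unit_exp (snd \<beta>)), snd \<gamma>))"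
  \<comment> \<open>The quotient rule. It makes the terms from differentiating 1 / x_j symmetric in
    \<eta> and \<zeta>, so that they drop out of the commutator.\<close>
  have inv: "D (inv_coord j) = - (inv_coord j * inv_coord j * D (coord j))"
    if "D \<in> torus_fields" for D and j :: 'n
  proof -
    have "0 = inv_coord j * D (inv_coord j * coord j)" using that by (simp add: torus_field_one)
    also have "\<dots> = D (inv_coord j) + inv_coord j * inv_coord j * D (coord j)"
      unfolding torus_field_mult[OF that] by (simp add: algebra_simps)
    finally show ?thesis by (simp add: eq_neg_iff_add_eq_0)
  qed
  have split: "jet_coeff (commutator \<eta> \<zeta>) \<gamma> = (\<eta> (jet_coeff \<zeta> \<gamma>) - \<zeta> (jet_coeff \<eta> \<gamma>)) + (?C \<eta> \<zeta> \<gamma> - ?C \<zeta> \<eta> \<gamma>)"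
    for \<gamma>
    by (simp add: jet_coeff_def commutator_def taylor_diff torus_field_mult \<eta> \<zeta> inv algebra_simps)
  have H: "(\<Sum>\<gamma>\<in>?I. sc (?C \<eta> \<zeta> \<gamma>) (h \<gamma>)) = (\<Sum>\<beta>\<in>?I. \<Sum>\<gamma>\<in>?I. sc (jet_coeff \<eta> \<beta> * jet_coeff \<zeta> \<gamma>) (?h \<beta> \<gamma>))"
    if "\<eta> \<in> torus_fields" for \<eta> \<zeta> :: "('n, 'k) laurent \<Rightarrow> ('n, 'k) laurent"
    using taylor_curvature[OF sc that h, where g = "\<lambda>j. \<zeta> (coord j)"]
    by (auto intro!: sum.cong simp: jet_coeff_def)
  have "(\<Sum>\<gamma>\<in>?I. sc (jet_coeff (commutator \<eta> \<zeta>) \<gamma>) (h \<gamma>)) =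
    (\<Sum>\<gamma>\<in>?I. sc (\<eta> (jet_coeff \<zeta> \<gamma>) - \<zeta> (jet_coeff \<eta> \<gamma>)) (h \<gamma>)) +
    ((\<Sum>\<gamma>\<in>?I. sc (?C \<eta> \<zeta> \<gamma>) (h \<gamma>)) - (\<Sum>\<gamma>\<in>?I. sc (?C \<zeta> \<eta> \<gamma>) (h \<gamma>)))"
    unfolding split by (simp only: scale_left_distrib scale_left_diff_distrib sum.distrib sum_subtractf)
  also have "(\<Sum>\<gamma>\<in>?I. sc (?C \<zeta> \<eta> \<gamma>) (h \<gamma>)) =
      (\<Sum>\<beta>\<in>?I. \<Sum>\<gamma>\<in>?I. sc (jet_coeff \<eta> \<beta> * jet_coeff \<zeta> \<gamma>) (?h \<gamma> \<beta>))"
    unfolding H[OF \<zeta>] by (subst sum.swap) (simp only: mult.commute)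
  also have "(\<Sum>\<gamma>\<in>?I. sc (?C \<eta> \<zeta> \<gamma>) (h \<gamma>)) - \<dots> =
     (\<Sum>\<beta>\<in>?I. \<Sum>\<gamma>\<in>?I. sc (jet_coeff \<eta> \<beta> * jet_coeff \<zeta> \<gamma>) (?h \<beta> \<gamma> - ?h \<gamma> \<beta>))"
    unfolding H[OF \<eta>] by (simp only: sum_subtractf scale_right_diff_distrib)
  also have "\<dots> = (\<Sum>\<beta>\<in>?I. \<Sum>\<gamma>\<in>?I. sc (jet_coeff \<eta> \<beta> * jet_coeff \<zeta> \<gamma>)
       (if fst \<beta> = 0 \<or> fst \<gamma> = 0 then 0 else
          sc (of_nat (fst \<gamma> (snd \<beta>))) (h (fst \<beta> + (fst \<gamma> - unit_exp (snd \<beta>)), snd \<gamma>)) -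
          sc (of_nat (fst \<beta> (snd \<gamma>))) (h (fst \<gamma> + (fst \<beta> - unit_exp (snd \<gamma>)), snd \<beta>))))"
    by (intro sum.cong refl arg_cong2[where f = sc]) auto
  finally show ?thesis .
qed

section \<open>The action of vector fields on the tensor module through their jets\<close>

context L_plus_module
begin

definition idx_act :: "('n \<Rightarrow> int) \<Rightarrow> 'n idx \<Rightarrow> 'w \<Rightarrow> 'w" where
  "idx_act s \<beta> w = (if fst \<beta> = 0 then sW (of_int (s (snd \<beta>))) w else \<rho> (mfield \<beta>) w)"

lemma idx_act_add: "idx_act s \<beta> (v + w) = idx_act s \<beta> v + idx_act s \<beta> w"
  by (simp add: idx_act_def M.scale_right_distrib act_plus mfield_L_plus)

lemma idx_act_zero [simp]: "idx_act s \<beta> 0 = 0"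
  using idx_act_add[of s \<beta> 0 0] by simp

lemma idx_act_scale: "idx_act s \<beta> (sW c w) = sW c (idx_act s \<beta> w)"
  by (simp add: idx_act_def act_scale_right mfield_L_plus mult.commute)

definition ten_act :: "'n idx \<Rightarrow> (('n \<Rightarrow> int) \<Rightarrow>\<^sub>0 'w) \<Rightarrow> ('n \<Rightarrow> int) \<Rightarrow>\<^sub>0 'w" where
  "ten_act \<beta> = pm_map (\<lambda>s. idx_act s \<beta>)"

lemma lookup_ten_act: "Poly_Mapping.lookup (ten_act \<beta> m) s = idx_act s \<beta> (Poly_Mapping.lookup m s)"
  by (simp add: ten_act_def lookup_pm_map)

lemma ten_act_add: "ten_act \<beta> (m + m') = ten_act \<beta> m + ten_act \<beta> m'"
  by (rule poly_mapping_eqI) (simp add: lookup_ten_act lookup_add idx_act_add)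

lemma ten_act_single: "ten_act \<beta> (Poly_Mapping.single s w) = Poly_Mapping.single s (idx_act s \<beta> w)"
  by (simp add: ten_act_def pm_map_single)

sublocale T: module "tensor_mult sW :: ('n, 'k) laurent \<Rightarrow> _"
  by (rule module_tensor_mult[OF vs])

lemma tensor_mult_single:
  "tensor_mult sW (Poly_Mapping.single q c) (Poly_Mapping.single r w) = Poly_Mapping.single (q + r) (sW c w)"
  for q :: "'n \<Rightarrow> int"
  using tensor_mult_pure_tensor[OF vs, of "Poly_Mapping.single q c" "Poly_Mapping.single r 1" w]
  by (simp add: pure_tensor_single[OF vs] mult_single)

lemma ten_act_zero [simp]: "ten_act \<beta> 0 = 0"
  using ten_act_add[of \<beta> 0 0] by simp

lemma ten_act_tensor_mult:
  "ten_act \<beta> (tensor_mult sW f m) =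
     tensor_mult sW (if fst \<beta> = 0 then coord (snd \<beta>) * partial (snd \<beta>) f else 0) m + tensor_mult sW f (ten_act \<beta> m)"
proof (rule additive_eqI[where f = f])
  fix q c
  show "ten_act \<beta> (tensor_mult sW (Poly_Mapping.single q c) m) =
     tensor_mult sW (if fst \<beta> = 0 then coord (snd \<beta>) * partial (snd \<beta>) (Poly_Mapping.single q c) else 0) m +
     tensor_mult sW (Poly_Mapping.single q c) (ten_act \<beta> m)"
  proof (rule additive_eqI[where f = m])
    fix r w
    have 1: "coord i * partial i (Poly_Mapping.single q c) = Poly_Mapping.single q (of_int (q i) * c)" for i
      by (simp add: coord_def partial_single mult_single)
    have 2: "sW (of_int ((q + r) i)) (sW c w) = sW (of_int (q i) * c) w + sW c (sW (of_int (r i)) w)" for i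
      by (simp add: distrib_left M.scale_left_distrib mult.commute)
    show "ten_act \<beta> (tensor_mult sW (Poly_Mapping.single q c) (Poly_Mapping.single r w)) =
      tensor_mult sW (if fst \<beta> = 0 then coord (snd \<beta>) * partial (snd \<beta>) (Poly_Mapping.single q c) else 0) (Poly_Mapping.single r w) +
      tensor_mult sW (Poly_Mapping.single q c) (ten_act \<beta> (Poly_Mapping.single r w))"
    proof (cases "fst \<beta> = 0")
      case True
      then show ?thesis
        by (simp only: 1 tensor_mult_single ten_act_single idx_act_def if_True 2 single_add simp_thms)
    next
      case False
      then show ?thesis
        by (simp add: tensor_mult_single ten_act_single idx_act_def act_scale_right mfield_L_plus)
    qed
  qed (simp_all add: ten_act_add T.scale_right_distrib)
qed (simp_all add: ten_act_add T.scale_left_distrib partial_add distrib_left)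

text \<open>The first-order part f \<partial>s/\<partial>x_i of the action is carried by the symbol
  (0, i): its coefficient f / x_i meets the operator x_i \<partial>/\<partial>x_i. The bound
  \<open>M > 0\<close> keeps these symbols in the range, and the other bound makes the sum over k
  finite.\<close>

lemma tensor_act_eq:
  assumes N\<^sub>0: "\<And>\<beta> w. M \<le> mdeg \<beta> \<Longrightarrow> \<rho> (mfield \<beta>) w = 0" and "M > 0"
  shows "tensor_act sW \<rho> \<eta> m = (\<Sum>\<beta>\<in>idx_below M. tensor_mult sW (jet_coeff \<eta> \<beta>) (ten_act \<beta> m))"
proof -
  define K where "K = {k :: 'n \<Rightarrow> nat. (\<Sum>j\<in>UNIV. k j) < M}"
  have fin: "finite K" unfolding K_def by (rule finite_sum_below)
  have K0: "0 \<in> K" using \<open>M > 0\<close> by (simp add: K_def)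
  let ?g = "\<lambda>s w i k. pure_tensor sW (taylor k (\<eta> (coord i)) * s) (\<rho> (monomial_field k i) w)"
  have any: "Sum_any (\<lambda>k. if k = 0 then 0 else pure_tensor sW
      (pm_scale (*) (1 / (\<Prod>j\<in>UNIV. fact (k j))) (partial_multi k (\<eta> (coord i))) * s) (\<rho> (monomial_field k i) w)) =
      (\<Sum>k\<in>K - {0}. ?g s w i k)" for s w i
    unfolding taylor_def[symmetric]
  proof (subst Sum_any.expand_superset[OF fin])
    show "{k. (if k = 0 then 0 else ?g s w i k) \<noteq> 0} \<subseteq> K"
      using N\<^sub>0[of "(_, i)" w] by (force simp: K_def mdeg_def split: if_splits)
    show "(\<Sum>k\<in>K. if k = 0 then 0 else ?g s w i k) = (\<Sum>k\<in>K - {0}. ?g s w i k)"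
      using fin K0 by (simp add: sum.remove)
  qed
  have eq: "tensor_act sW \<rho> \<eta> = tensor_lift (\<lambda>s w. \<Sum>i\<in>UNIV. pure_tensor sW (\<eta> (coord i) * partial i s) w + (\<Sum>k\<in>K - {0}. ?g s w i k))"
    unfolding tensor_act_def any ..
  have ra: "?g s (v + w) i k = ?g s v i k + ?g s w i k" if "k \<in> K - {0}" for s v w i k
    using that by (simp add: act_plus mfield_L_plus pure_tensor_add_right[OF vs])
  have ra': "(\<Sum>k\<in>K - {0}. ?g s (v + w) i k) = (\<Sum>k\<in>K - {0}. ?g s v i k) + (\<Sum>k\<in>K - {0}. ?g s w i k)"
    for s v w i
    unfolding sum.distrib[symmetric] by (rule sum.cong[OF refl ra])
  show ?thesis
    unfolding eq
  proof (rule additive_eqI[where f = m], goal_cases)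
    case (1 f g)
    show ?case
      by (rule tensor_lift_add) (simp only: ra' sum.distrib pure_tensor_add_right[OF vs] add.assoc add.left_commute)
  next
    case (5 r w)
    let ?s = "Poly_Mapping.single r 1 :: ('n, 'k) laurent"
    have tp: "ten_act \<beta> (Poly_Mapping.single r w) = pure_tensor sW ?s (idx_act r \<beta> w)" for \<beta> w
      by (simp add: ten_act_single pure_tensor_single[OF vs])
    have "tensor_lift (\<lambda>s w. \<Sum>i\<in>UNIV. pure_tensor sW (\<eta> (coord i) * partial i s) w + (\<Sum>k\<in>K - {0}. ?g s w i k))
      (Poly_Mapping.single r w) = (\<Sum>i\<in>UNIV. pure_tensor sW (\<eta> (coord i) * partial i ?s) w + (\<Sum>k\<in>K - {0}. ?g ?s w i k))"
      by (rule M.tensor_lift_single) (auto intro!: sum.neutral simp: mfield_L_plus)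
    also have "\<dots> = (\<Sum>i\<in>UNIV. \<Sum>k\<in>K. tensor_mult sW (jet_coeff \<eta> (k, i)) (ten_act (k, i) (Poly_Mapping.single r w)))"
    proof (rule sum.cong[OF refl])
      fix i
      have "inv_coord i * \<eta> (coord i) * pm_scale (*) (of_int (r i)) ?s = \<eta> (coord i) * partial i ?s"
      proof -
        have "inv_coord i * pm_scale (*) (of_int (r i)) ?s = partial i ?s"
          by (simp add: partial_single inv_coord_def pm_scale_eq_mult mult_single del: single_of_int)
        then show ?thesis by (metis mult.assoc mult.commute)
      qed
      moreover have "pure_tensor sW (f * ?s) (sW (of_int (r i)) w) = pure_tensor sW (f * pm_scale (*) (of_int (r i)) ?s) w" for f
        by (simp add: pure_tensor_scale_right[OF vs] pure_tensor_scale_left[OF vs, symmetric] pm_scale_eq_mult mult.left_commute)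
      ultimately have "tensor_mult sW (jet_coeff \<eta> (0, i)) (ten_act (0, i) (Poly_Mapping.single r w)) =
        pure_tensor sW (\<eta> (coord i) * partial i ?s) w"
        unfolding tp tensor_mult_pure_tensor[OF vs] by (simp add: jet_coeff_def idx_act_def)
      moreover have "tensor_mult sW (jet_coeff \<eta> (k, i)) (ten_act (k, i) (Poly_Mapping.single r w)) = ?g ?s w i k"
        if "k \<in> K - {0}" for k
        using that unfolding tp tensor_mult_pure_tensor[OF vs]
        by (simp add: jet_coeff_def idx_act_def)
      ultimately show "pure_tensor sW (\<eta> (coord i) * partial i ?s) w + (\<Sum>k\<in>K - {0}. ?g ?s w i k) =
        (\<Sum>k\<in>K. tensor_mult sW (jet_coeff \<eta> (k, i)) (ten_act (k, i) (Poly_Mapping.single r w)))"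
        using fin K0 by (simp add: sum.remove)
    qed
    also have "\<dots> = (\<Sum>\<beta>\<in>idx_below M. tensor_mult sW (jet_coeff \<eta> \<beta>) (ten_act \<beta> (Poly_Mapping.single r w)))"
      unfolding K_def sum_idx_below[symmetric] by simp
    finally show ?case .
  qed (simp_all add: ten_act_add T.scale_right_distrib sum.distrib)
qed

lemma jet_map_torus:
  assumes N\<^sub>0: "\<And>\<beta> w. M \<le> mdeg \<beta> \<Longrightarrow> \<rho> (mfield \<beta>) w = 0" and M: "M > 0"
  shows "jet_map (tensor_mult sW) torus_fields commutator (\<lambda>\<eta>. \<eta>) (tensor_act sW \<rho>)
    (idx_br (pm_scale sW)) ten_act jet_coeff (idx_below M) {c. alternating UNIV c \<and> bounded M c}"
proof -
  interpret V: lie_algebra field_scale "torus_fields :: (('n, 'k) laurent \<Rightarrow> _) set" commutator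
    by (rule lie_algebra_torus_fields)
  note eq = tensor_act_eq[OF N\<^sub>0 M]
  show ?thesis
  proof
    fix \<eta> \<zeta> :: "('n, 'k) laurent \<Rightarrow> ('n, 'k) laurent" and m m' :: "('n \<Rightarrow> int) \<Rightarrow>\<^sub>0 'w" and r
    assume \<eta>: "\<eta> \<in> torus_fields"
    show "tensor_act sW \<rho> \<eta> (m + m') = tensor_act sW \<rho> \<eta> m + tensor_act sW \<rho> \<eta> m'"
      by (simp add: eq ten_act_add T.scale_right_distrib sum.distrib)
    show "tensor_act sW \<rho> \<eta> m = (\<Sum>\<beta>\<in>idx_below M. tensor_mult sW (jet_coeff \<eta> \<beta>) (ten_act \<beta> m))"
      by (rule eq)
    have K0: "(0 :: 'n \<Rightarrow> nat) \<in> {k. (\<Sum>j\<in>UNIV. k j) < M}" using M by simp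
    have fin: "finite {k :: 'n \<Rightarrow> nat. (\<Sum>j\<in>UNIV. k j) < M}" by (rule finite_sum_below)
    have "inv_coord i * e * (coord i * p) = (coord i * inv_coord i) * (e * p)"
      for i :: 'n and e p :: "('n, 'k) laurent" by (simp only: mult_ac)
    then have *: "jet_coeff \<eta> \<beta> * (if fst \<beta> = 0 then coord (snd \<beta>) * partial (snd \<beta>) r else 0) =
      (if fst \<beta> = 0 then \<eta> (coord (snd \<beta>)) * partial (snd \<beta>) r else 0)" for \<beta>
      by (simp add: jet_coeff_def)
    \<comment> \<open>Only the symbols of degree 0 differentiate the factor \<open>r\<close>, and
      together they reproduce \<eta> by \<open>torus_field_eq\<close>.\<close>
    have "(\<Sum>\<beta>\<in>idx_below M. tensor_mult sW (jet_coeff \<eta> \<beta> * (if fst \<beta> = 0 then coord (snd \<beta>) * partial (snd \<beta>) r else 0)) m) =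
      (\<Sum>i\<in>UNIV. \<Sum>k\<in>{k :: 'n \<Rightarrow> nat. (\<Sum>j\<in>UNIV. k j) < M}. if k = 0 then tensor_mult sW (\<eta> (coord i) * partial i r) m else 0)"
      unfolding * by (subst sum_idx_below[symmetric], rule sum.cong[OF refl]) simp
    also have "\<dots> = tensor_mult sW (\<eta> r) m"
      using K0 fin torus_field_eq[OF \<eta>, of r] by (simp add: T.scale_sum_left)
    finally show "tensor_act sW \<rho> \<eta> (tensor_mult sW r m) = tensor_mult sW (\<eta> r) m + tensor_mult sW r (tensor_act sW \<rho> \<eta> m)"
      by (simp add: eq ten_act_tensor_mult T.scale_right_distrib sum.distrib T.scale_sum_right mult_ac)
    assume \<zeta>: "\<zeta> \<in> torus_fields"
    show "commutator \<eta> \<zeta> \<in> torus_fields" by (rule V.br_closed[OF \<eta> \<zeta>])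
    fix c :: "'n idx list \<Rightarrow> ('n \<Rightarrow> int) \<Rightarrow>\<^sub>0 'w" and zs :: "(('n, 'k) laurent \<Rightarrow> ('n, 'k) laurent) list"
    assume c: "c \<in> {c. alternating UNIV c \<and> bounded M c}"
    let ?J = "\<lambda>c. jext (tensor_mult sW) jet_coeff (\<lambda>_. idx_below M) c zs"
    have h: "?J (ins \<gamma> c) = 0" if "M \<le> mdeg \<gamma>" for \<gamma>
      using bounded_ins_zero[of M c \<gamma>] c that by (simp add: T.jext_zero)
    have pm: "pm_scale sW (of_nat n) m = tensor_mult sW (of_nat n) m" for n m
      using tensor_mult_single_zero[OF vs, of "of_nat n" m] by simp
    have "?J (idx_br (pm_scale sW) \<beta> \<gamma> c) = (if fst \<beta> = 0 \<or> fst \<gamma> = 0 then 0 else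
          tensor_mult sW (of_nat (fst \<gamma> (snd \<beta>))) (?J (ins (fst \<beta> + (fst \<gamma> - unit_exp (snd \<beta>)), snd \<gamma>) c)) -
          tensor_mult sW (of_nat (fst \<beta> (snd \<gamma>))) (?J (ins (fst \<gamma> + (fst \<beta> - unit_exp (snd \<gamma>)), snd \<beta>) c)))" for \<beta> \<gamma>
    proof (cases "fst \<beta> = 0 \<or> fst \<gamma> = 0")
      case True
      then have "idx_br (pm_scale sW) \<beta> \<gamma> c = (\<lambda>_. 0)" by (auto simp: fun_eq_iff idx_br_def)
      then show ?thesis using True by (simp add: T.jext_zero)
    next
      case False
      then have "idx_br (pm_scale sW) \<beta> \<gamma> c = (\<lambda>xs.
        tensor_mult sW (of_nat (fst \<gamma> (snd \<beta>))) (ins (fst \<beta> + (fst \<gamma> - unit_exp (snd \<beta>)), snd \<gamma>) c xs) -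
          tensor_mult sW (of_nat (fst \<beta> (snd \<gamma>))) (ins (fst \<gamma> + (fst \<beta> - unit_exp (snd \<gamma>)), snd \<beta>) c xs))"
        by (intro ext) (simp add: idx_br_def pm)
      then show ?thesis using False by (simp only: T.jext_diff T.jext_scale if_False)
    qed
    then show "(\<Sum>\<gamma>\<in>idx_below M. tensor_mult sW (jet_coeff (commutator \<eta> \<zeta>) \<gamma>) (?J (ins \<gamma> c))) =
      (\<Sum>\<gamma>\<in>idx_below M. tensor_mult sW (\<eta> (jet_coeff \<zeta> \<gamma>) - \<zeta> (jet_coeff \<eta> \<gamma>)) (?J (ins \<gamma> c))) +
      (\<Sum>\<beta>\<in>idx_below M. \<Sum>\<gamma>\<in>idx_below M. tensor_mult sW (jet_coeff \<eta> \<beta> * jet_coeff \<zeta> \<gamma>) (?J (idx_br (pm_scale sW) \<beta> \<gamma> c)))"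
      using jet_maurer_cartan[OF T.module_axioms \<eta> \<zeta> h] by simp
  qed (auto intro: alternating_ins bounded_ins)
qed

end

section \<open>Taylor expansion of differential operators\<close>

text \<open>Trinomial revision pulls out \<open>k choose m\<close> and leaves the expansion of (1 -
  1)^(k - m). In other words, the Pascal matrix is inverted by its signed copy; this inverts the
  passage from fields to jets.\<close>

lemma binomial_orthogonality:
  "(\<Sum>l\<le>k. (-1) ^ (k - l) * of_nat (k choose l) * of_nat (l choose m)) = (if k = m then 1 else 0 :: 'k::comm_ring_1)"
proof (cases "m \<le> k")
  case False
  then show ?thesis by (auto intro!: sum.neutral simp: binomial_eq_0)
next
  case True
  have "(\<Sum>l\<le>k. (-1) ^ (k - l) * of_nat (k choose l) * of_nat (l choose m) :: 'k) =
    (\<Sum>l\<in>{m..k}. (-1) ^ (k - l) * of_nat (k choose l) * of_nat (l choose m))"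
    by (rule sum.mono_neutral_right) (auto simp: binomial_eq_0)
  also have "\<dots> = (\<Sum>t\<in>{0..k - m}. (-1) ^ (k - m - t) * of_nat (k choose m) * of_nat ((k - m) choose t))"
  proof (rule sum.reindex_bij_witness[where i = "\<lambda>t. t + m" and j = "\<lambda>l. l - m"])
    fix l assume l: "l \<in> {m..k}"
    then have "(k choose l) * (l choose m) = (k choose m) * ((k - m) choose (l - m))"
      by (intro choose_mult) auto
    then have "of_nat (k choose l) * of_nat (l choose m) = (of_nat (k choose m) * of_nat ((k - m) choose (l - m)) :: 'k)"
      by (metis of_nat_mult)
    moreover have "k - m - (l - m) = k - l" using l by auto
    ultimately show "(-1) ^ (k - m - (l - m)) * of_nat (k choose m) * of_nat ((k - m) choose (l - m)) =
      ((-1) ^ (k - l) * of_nat (k choose l) * of_nat (l choose m) :: 'k)"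
      by (simp add: mult.assoc)
  qed (use True in auto)
  also have "\<dots> = of_nat (k choose m) * (\<Sum>t\<le>k - m. of_nat ((k - m) choose t) * 1 ^ t * (-1) ^ (k - m - t))"
    by (simp add: sum_distrib_left atLeast0AtMost mult_ac)
  also have "\<dots> = of_nat (k choose m) * (1 + (-1)) ^ (k - m)"
    by (simp only: binomial_ring)
  finally show ?thesis using True by (auto simp: zero_power)
qed

section \<open>Laurent monomials as units and powers of x_i - 1\<close>

definition sconst :: "'k \<Rightarrow> ('n, 'k::field_char_0) laurent" where
  "sconst c = Poly_Mapping.single 0 c"

lemma sconst_simps [simp]:
  "sconst 0 = 0" "sconst 1 = 1" "sconst (c + e) = sconst c + sconst e" "sconst (- c) = - sconst c"
  "sconst (c * e) = sconst c * sconst e" "sconst (of_nat n) = of_nat n" "sconst (c ^ n) = sconst c ^ n"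
proof -
  show mult: "sconst (c * e) = sconst c * sconst e" for c e by (simp add: sconst_def mult_single)
  show "sconst (c ^ n) = sconst c ^ n"
    by (induction n) (simp_all add: mult, simp add: sconst_def)
qed (simp_all add: sconst_def single_add single_uminus)

lemma sconst_prod: "sconst (\<Prod>j\<in>S. c j) = (\<Prod>j\<in>S. sconst (c j))"
  by (induction S rule: infinite_finite_induct) simp_all

definition xpow :: "('n \<Rightarrow> int) \<Rightarrow> ('n, 'k::field_char_0) laurent" where
  "xpow r = Poly_Mapping.single r 1"

lemma xpow_add: "xpow (r + s) = xpow r * xpow s"
  by (simp add: xpow_def mult_single)

lemma xpow_zero [simp]: "xpow 0 = 1" by (simp add: xpow_def)

lemma xpow_uminus [simp]: "xpow r * xpow (- r) = 1" "xpow (- r) * xpow r = 1"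
  by (simp_all add: xpow_add[symmetric])

lemma single_eq_xpow: "Poly_Mapping.single r c = sconst c * xpow r"
  by (simp add: xpow_def sconst_def mult_single)

abbreviation npow :: "('n \<Rightarrow> nat) \<Rightarrow> ('n, 'k::field_char_0) laurent" where
  "npow l \<equiv> xpow (\<lambda>j. int (l j))"

lemma xpow_prod:
  "xpow r = (\<Prod>i\<in>UNIV. xpow (\<lambda>j. if j = i then r i else 0) :: ('n::finite, 'k::field_char_0) laurent)"
proof -
  have "xpow (\<lambda>j. if j \<in> S then r j else 0) = (\<Prod>i\<in>S. xpow (\<lambda>j. if j = i then r i else 0) :: ('n, 'k) laurent)"
    if "finite S" for S
    using that
  proof (induction S rule: finite_induct)
    case empty
    then show ?case by (simp flip: zero_fun_def)
  next
    case (insert i S)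
    have "(\<lambda>j. if j \<in> insert i S then r j else 0) =
        (\<lambda>j. if j = i then r i else 0) + (\<lambda>j. if j \<in> S then r j else 0)"
      using insert.hyps by auto
    then show ?case using insert by (simp add: xpow_add)
  qed
  from this[of UNIV] show ?thesis by simp
qed

lemma coord_xpow: "coord i = xpow (unit_exp i)"
  by (simp add: coord_def xpow_def)

lemma coord_power: "coord i ^ t = xpow (\<lambda>j. if j = i then int t else 0)"
proof (induction t)
  case 0
  have "(\<lambda>j. if j = i then int 0 else 0) = 0" by auto
  then show ?case by simp
next
  case (Suc t)
  have "unit_exp i + (\<lambda>j. if j = i then int t else 0) = (\<lambda>j. if j = i then int (Suc t) else 0)"
    by (auto simp: unit_exp_def)
  then have "coord i * xpow (\<lambda>j. if j = i then int t else 0) = xpow (\<lambda>j. if j = i then int (Suc t) else 0)"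
    by (simp only: coord_xpow xpow_add[symmetric])
  then show ?case by (simp only: power_Suc Suc)
qed

lemma taylor_scale: "taylor k (sconst c * f) = sconst c * taylor k f"
proof (rule additive_eqI[where f = f])
  fix r e
  show "taylor k (sconst c * Poly_Mapping.single r e) = sconst c * taylor k (Poly_Mapping.single r e)"
    by (simp add: sconst_def mult_single taylor_single mult.assoc)
qed (simp_all add: distrib_left taylor_add)

definition ypow :: "('n::finite \<Rightarrow> nat) \<Rightarrow> ('n, 'k::field_char_0) laurent" where
  "ypow k = (\<Prod>i\<in>UNIV. (coord i - 1) ^ k i)"

definition sgn_binom :: "('n::finite \<Rightarrow> nat) \<Rightarrow> ('n \<Rightarrow> nat) \<Rightarrow> 'k::field_char_0" where
  "sgn_binom k l = (\<Prod>j\<in>UNIV. (-1) ^ (k j - l j) * of_nat (k j choose l j))"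

lemma ypow_expand: "ypow k = (\<Sum>l\<in>{..k}. sconst (sgn_binom k l) * npow l)"
proof -
  have "(coord i - 1) ^ k i = (\<Sum>l\<le>k i. sconst ((-1) ^ (k i - l) * of_nat (k i choose l)) *
      (xpow (\<lambda>j. if j = i then int l else 0) :: ('a, 'b) laurent))" for i
  proof -
    have "(coord i + (-1)) ^ k i = (\<Sum>l\<le>k i. of_nat (k i choose l) * coord i ^ l * (-1 :: ('a, 'b) laurent) ^ (k i - l))"
      by (rule binomial_ring)
    then show ?thesis by (simp add: coord_power mult_ac)
  qed
  then have "ypow k = (\<Prod>i\<in>UNIV. \<Sum>l\<in>{..k i}. sconst ((-1) ^ (k i - l) * of_nat (k i choose l)) *
      (xpow (\<lambda>j. if j = i then int l else 0) :: ('a, 'b) laurent))"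
    by (simp add: ypow_def)
  also have "\<dots> = (\<Sum>l\<in>{..k}. \<Prod>i\<in>UNIV. sconst ((-1) ^ (k i - l i) * of_nat (k i choose l i)) *
      (xpow (\<lambda>j. if j = i then int (l i) else 0)))"
    by (simp add: prod_sum_PiE atMost_fun_eq_PiE)
  also have "\<dots> = (\<Sum>l\<in>{..k}. sconst (sgn_binom k l) * npow l)"
    unfolding prod.distrib xpow_prod[symmetric] unfolding sgn_binom_def sconst_prod ..
  finally show ?thesis .
qed

text \<open>\<open>G_order\<close> is the Gelfand-Fuks condition for the coordinate functions alone.
  As these and their inverses generate the ring, it already forces a finite Taylor
  expansion.\<close>

locale diff_operator = module sc
  for sc :: "('n::finite, 'k::field_char_0) laurent \<Rightarrow> 'm::ab_group_add \<Rightarrow> 'm" +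
  fixes G :: "('n, 'k) laurent \<Rightarrow> 'm" and p :: nat
  assumes G_add: "G (f + g) = G f + G g"
    and G_scale: "G (sconst c * f) = sc (sconst c) (G f)"
    and G_order: "(\<Sum>t\<le>p. sc (of_int ((-1) ^ t) * of_nat (p choose t) * coord i ^ (p - t)) (G (coord i ^ t * f))) = 0"
begin

text \<open>The linear map with x^r \<mapsto> x^(-r) G(x^r). The value of \<open>G\<close> at a
  point x depends on the jet of the argument f(y) at y = x; the substitution y = x z moves this
  point to z = 1 for all x at once, so that the order condition becomes a condition about one
  ideal.\<close>

definition Ghat :: "('n, 'k) laurent \<Rightarrow> 'm" where
  "Ghat f = (\<Sum>r\<in>Poly_Mapping.keys f. sc (Poly_Mapping.single (- r) (Poly_Mapping.lookup f r)) (G (xpow r)))"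

lemma Ghat_add: "Ghat (f + g) = Ghat f + Ghat g"
  unfolding Ghat_def
  by (rule sum_keys_add[where b = "\<lambda>r c. sc (Poly_Mapping.single (- r) c) (G (xpow r))"])
    (simp add: single_add scale_left_distrib)

lemma Ghat_zero [simp]: "Ghat 0 = 0" by (simp add: Ghat_def)

lemma Ghat_single: "Ghat (sconst c * xpow r) = sc (sconst c * xpow (- r)) (G (xpow r))"
  by (cases "c = 0") (simp_all add: Ghat_def flip: single_eq_xpow)

lemma Ghat_uminus: "Ghat (- f) = - Ghat f"
  using Ghat_add[of f "- f"] by (simp add: eq_neg_iff_add_eq_0 add.commute)

lemma Ghat_sum: "Ghat (\<Sum>i\<in>I. f i) = (\<Sum>i\<in>I. Ghat (f i))"
  by (induction I rule: infinite_finite_induct) (simp_all add: Ghat_add)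

lemma Ghat_scale: "Ghat (sconst c * f) = sc (sconst c) (Ghat f)"
proof (rule additive_eqI[where f = f])
  fix r :: "'n \<Rightarrow> int" and e :: 'k
  have 1: "sconst c * (sconst e * xpow r) = sconst (c * e) * xpow r" by (simp add: mult.assoc)
  have "Ghat (sconst c * (sconst e * xpow r)) = sc (sconst (c * e) * xpow (- r)) (G (xpow r))"
    unfolding 1 by (rule Ghat_single)
  then show "Ghat (sconst c * Poly_Mapping.single r e) = sc (sconst c) (Ghat (Poly_Mapping.single r e))"
    by (simp only: Ghat_single single_eq_xpow[of r e] scale_scale sconst_simps mult.assoc)
qed (simp_all add: Ghat_add distrib_left scale_right_distrib)

text \<open>The largest ideal inside the kernel of \<open>Ghat\<close>. Congruences modulo an ideal
  can be multiplied, which those modulo the kernel cannot.\<close>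

definition I :: "('n, 'k) laurent set" where
  "I = {f. \<forall>h. Ghat (h * f) = 0}"

lemma I_add: "f \<in> I \<Longrightarrow> g \<in> I \<Longrightarrow> f + g \<in> I"
  by (simp add: I_def distrib_left Ghat_add)

lemma I_mult: "f \<in> I \<Longrightarrow> h * f \<in> I"
  by (simp add: I_def mult.assoc[symmetric])

lemma I_zero [simp]: "0 \<in> I" by (simp add: I_def)

lemma I_uminus: "f \<in> I \<Longrightarrow> - f \<in> I"
  by (simp add: I_def Ghat_uminus)

lemma I_sum: "(\<And>i. i \<in> S \<Longrightarrow> f i \<in> I) \<Longrightarrow> (\<Sum>i\<in>S. f i) \<in> I"
  by (induction S rule: infinite_finite_induct) (simp_all add: I_add)

lemma I_cong_mult:
  assumes "f - f' \<in> I" "g - g' \<in> I"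
  shows "f * g - f' * g' \<in> I"
proof -
  have "f * g - f' * g' = g * (f - f') + f' * (g - g')" by (simp add: algebra_simps)
  then show ?thesis using assms by (simp add: I_add I_mult)
qed

lemma Ghat_cong: "f - g \<in> I \<Longrightarrow> Ghat f = Ghat g"
proof -
  assume "f - g \<in> I"
  then have "Ghat (1 * (f - g)) = 0" unfolding I_def by blast
  then show ?thesis using Ghat_add[of "f - g" g] by simp
qed

text \<open>The order condition for x_i, evaluated at x^r and divided by its top monomial, is up to
  sign the value of \<open>Ghat\<close> at \<open>xpow r * (coord i - 1) ^ p\<close>.\<close>

lemma power_in_I: "(coord i - 1) ^ p \<in> I"
proof -
  have "Ghat (h * (coord i - 1) ^ p) = 0" for h
  proof (rule additive_eqI[where f = h and G = "\<lambda>_. 0"])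
    fix r :: "'n \<Rightarrow> int" and c :: 'k
    let ?e = "\<lambda>t j. if j = i then int t else 0"
    have "(coord i + (-1)) ^ p = (\<Sum>t\<le>p. of_nat (p choose t) * coord i ^ t * (-1 :: ('n, 'k) laurent) ^ (p - t))"
      by (rule binomial_ring)
    then have "xpow r * (coord i - 1 :: ('n, 'k) laurent) ^ p = (\<Sum>t\<le>p. sconst (of_nat (p choose t) * (-1) ^ (p - t)) * xpow (?e t + r))"
    proof -
      assume *: "(coord i + (-1)) ^ p = (\<Sum>t\<le>p. of_nat (p choose t) * coord i ^ t * (-1 :: ('n, 'k) laurent) ^ (p - t))"
      then have **: "(coord i - 1) ^ p = (\<Sum>t\<le>p. of_nat (p choose t) * coord i ^ t * (-1 :: ('n, 'k) laurent) ^ (p - t))"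
        by simp
      show ?thesis
        unfolding ** sum_distrib_left
        by (rule sum.cong[OF refl]) (simp add: xpow_add coord_power mult_ac)
    qed
    then have "Ghat (xpow r * (coord i - 1) ^ p) =
       (\<Sum>t\<le>p. sc (sconst (of_nat (p choose t) * (-1) ^ (p - t)) * xpow (- (?e t + r))) (G (xpow (?e t + r))))"
      by (simp only: Ghat_sum Ghat_single)
    also have "\<dots> = sc ((-1) ^ p * xpow (- (?e p + r))) (\<Sum>t\<le>p. sc (of_int ((-1) ^ t) * of_nat (p choose t) * coord i ^ (p - t)) (G (coord i ^ t * xpow r)))"
      unfolding scale_sum_right
    proof (rule sum.cong[OF refl])
      fix t assume "t \<in> {..p}"
      then have t: "t \<le> p" by simp
      have e: "- (?e t + r) = - (?e p + r) + ?e (p - t)" using t by (auto simp: of_nat_diff)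
      have s: "sconst (of_nat (p choose t) * (-1) ^ (p - t)) = ((-1) ^ p * of_int ((-1) ^ t) * of_nat (p choose t) :: ('n, 'k) laurent)"
        using t by (cases "even p"; cases "even t") simp_all
      show "sc (sconst (of_nat (p choose t) * (-1) ^ (p - t)) * xpow (- (?e t + r))) (G (xpow (?e t + r))) =
        sc ((-1) ^ p * xpow (- (?e p + r))) (sc (of_int ((-1) ^ t) * of_nat (p choose t) * coord i ^ (p - t)) (G (coord i ^ t * xpow r)))"
        unfolding scale_scale s e xpow_add coord_power
        by (intro arg_cong2[where f = sc] refl) (simp only: mult_ac)
    qed
    also have "\<dots> = 0" by (simp only: G_order scale_zero_right)
    finally have "Ghat (xpow r * (coord i - 1) ^ p) = 0" .
    then show "Ghat (Poly_Mapping.single r c * (coord i - 1) ^ p) = 0"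
      unfolding single_eq_xpow[of r c] mult.assoc Ghat_scale by simp
  qed (simp_all add: distrib_right Ghat_add)
  then show ?thesis by (simp add: I_def)
qed

lemma power_in_I_le: "p \<le> t \<Longrightarrow> (coord i - 1) ^ t \<in> I"
  using I_mult[OF power_in_I, of "(coord i - 1) ^ (t - p)" i] by (simp add: power_add[symmetric])

text \<open>Pigeonhole principle: exponents with sum at least n p cannot all be below p.\<close>

lemma ypow_in_I:
  assumes "CARD('n) * p \<le> (\<Sum>j\<in>UNIV. k j)" "p > 0"
  shows "ypow k \<in> I"
proof -
  have "\<exists>i. p \<le> k i"
  proof (rule ccontr)
    assume "\<not> (\<exists>i. p \<le> k i)"
    then have "(\<Sum>j\<in>UNIV. k j) < (\<Sum>j\<in>(UNIV :: 'n set). p)" by (intro sum_strict_mono) (auto simp: not_le)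
    then show False using assms(1) by simp
  qed
  then obtain i where i: "p \<le> k i" ..
  have "ypow k = (\<Prod>j\<in>UNIV - {i}. (coord j - 1) ^ k j) * (coord i - 1 :: ('n, 'k) laurent) ^ k i"
    unfolding ypow_def by (subst prod.remove[of _ i]) (simp_all add: mult.commute)
  then show ?thesis using I_mult[OF power_in_I_le[OF i]] by simp
qed

text \<open>Modulo the p-th power of x_i - 1 the binomial series of (1 + (x_i - 1))^a breaks off.
  Modulo \<open>I\<close> both sides are multiplied by x_i when a grows by 1; as x_i is a unit, the
  induction also runs to negative a.\<close>

lemma xpow_one_variable:
  "xpow (\<lambda>j. if j = i then a else 0) - (\<Sum>t<p. sconst (of_int a gchoose t) * (coord i - 1) ^ t) \<in> I"
proof -
  let ?y = "coord i - 1 :: ('n, 'k) laurent" and ?x = "\<lambda>a. xpow (\<lambda>j. if j = i then a else 0) :: ('n, 'k) laurent"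
  let ?s = "\<lambda>a. \<Sum>t<p. sconst (of_int a gchoose t :: 'k) * ?y ^ t"
  \<comment> \<open>By Pascal's rule all terms cancel except the multiple of the p-th power that the
    truncation cuts off.\<close>
  have step: "coord i * ?s a - ?s (a + 1) \<in> I" for a
  proof (cases p)
    case 0
    then show ?thesis by simp
  next
    case (Suc q)
    let ?c = "\<lambda>t. sconst (of_int a gchoose t :: 'k) :: ('n, 'k) laurent"
    have "?s (a + 1) = 1 + (\<Sum>t<q. sconst (of_int (a + 1) gchoose Suc t :: 'k) * ?y ^ Suc t)"
      unfolding Suc sum.lessThan_Suc_shift by simp
    also have "(\<Sum>t<q. sconst (of_int (a + 1) gchoose Suc t :: 'k) * ?y ^ Suc t) =
      (\<Sum>t<q. ?c t * ?y ^ Suc t) + (\<Sum>t<q. ?c (Suc t) * ?y ^ Suc t)"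
      by (simp add: gbinomial_Suc_Suc single_add distrib_right sum.distrib)
    also have "1 + \<dots> = (\<Sum>t<q. ?c t * ?y ^ Suc t) + ?s a"
      unfolding Suc sum.lessThan_Suc_shift by simp
    finally have 1: "?s (a + 1) = (\<Sum>t<q. ?c t * ?y ^ Suc t) + ?s a" .
    have "coord i * ?s a = ?s a + ?y * ?s a" by (simp add: algebra_simps)
    also have "?y * ?s a = (\<Sum>t<q. ?c t * ?y ^ Suc t) + ?c q * ?y ^ p"
      unfolding Suc by (simp add: sum_distrib_left distrib_left mult_ac)
    finally have 2: "coord i * ?s a = ?s a + ((\<Sum>t<q. ?c t * ?y ^ Suc t) + ?c q * ?y ^ p)" .
    have "coord i * ?s a - ?s (a + 1) = ?c q * ?y ^ p"
      unfolding diff_eq_eq 1 2 by (simp only: add_ac)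
    then show ?thesis using I_mult[OF power_in_I, of "?c q" i] by (simp only:)
  qed
  have x: "?x (a + 1) = coord i * ?x a" for a
  proof -
    have "(\<lambda>j. if j = i then a + 1 else 0) = unit_exp i + (\<lambda>j. if j = i then a else 0)" by (auto simp: unit_exp_def)
    then show ?thesis by (simp add: xpow_add coord_xpow)
  qed
  define s where "s = ?s"
  have step': "coord i * s a - s (a + 1) \<in> I" for a unfolding s_def by (rule step)
  have up: "?x (a + 1) - s (a + 1) \<in> I" if "?x a - s a \<in> I" for a
    using I_add[OF I_mult[OF that, of "coord i"] step'[of a]]
    by (simp add: x right_diff_distrib)
  have down: "?x a - s a \<in> I" if "?x (a + 1) - s (a + 1) \<in> I" for a
  proof -
    have "coord i * (?x a - s a) \<in> I"
      using I_add[OF that I_uminus[OF step'[of a]]] by (simp add: x right_diff_distrib)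
    from I_mult[OF this, of "inv_coord i"] show ?thesis by simp
  qed
  have zero: "?x 0 - ?s 0 \<in> I"
  proof (cases p)
    case 0
    then show ?thesis using I_mult[OF power_in_I[of i], of "?x 0"] by simp
  next
    case (Suc q)
    have "?s 0 = 1" unfolding Suc sum.lessThan_Suc_shift by (simp add: gbinomial_Suc_Suc)
    moreover have "?x 0 = 1" by (simp flip: zero_fun_def)
    ultimately show ?thesis by simp
  qed
  have "?x a - s a \<in> I"
  proof (induction a rule: int_induct[where k = 0])
    case base show ?case using zero by (simp only: s_def)
  next
    case (step1 a) then show ?case using up by blast
  next
    case (step2 a)
    have "a - 1 + 1 = a" by simp
    then show ?case using down[of "a - 1"] step2(2) by (simp only:)
  qed
  then show ?thesis by (simp only: s_def)
qed

text \<open>The product of the expansions in single variables runs over the cube of exponents below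
  p. It is enlarged to all k with sum below \<open>M\<close>, because this is the range used for
  symbols; the bound on \<open>M\<close> puts the cube inside, and each added term has an exponent
  that is at least p.\<close>

lemma xpow_newton:
  assumes "CARD('n) * p \<le> M" "p > 0"
  shows "xpow r - (\<Sum>k | (\<Sum>j\<in>UNIV. k j) < M. sconst (\<Prod>j\<in>UNIV. of_int (r j) gchoose k j) * ypow k) \<in> I"
proof -
  let ?f = "\<lambda>k. sconst (\<Prod>j\<in>UNIV. of_int (r j) gchoose k j) * ypow k :: ('n, 'k) laurent"
  have "(\<Prod>i\<in>S. xpow (\<lambda>j. if j = i then r i else 0)) -
     (\<Prod>i\<in>S. \<Sum>t<p. sconst (of_int (r i) gchoose t) * (coord i - 1) ^ t) \<in> I" if "finite S" for S
    using that by (induction S rule: finite_induct) (simp_all add: I_cong_mult[OF xpow_one_variable])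
  from this[of UNIV]
  have "xpow r - (\<Prod>i\<in>UNIV. \<Sum>t<p. sconst (of_int (r i) gchoose t) * (coord i - 1) ^ t) \<in> I"
    by (simp add: xpow_prod[symmetric])
  also have "(\<Prod>i\<in>UNIV. \<Sum>t\<in>{..<p}. sconst (of_int (r i) gchoose t :: 'k) * (coord i - 1) ^ t) =
    (\<Sum>k\<in>(\<Pi>\<^sub>E i\<in>UNIV. {..<p}). ?f k)"
    by (subst prod_sum_PiE) (simp_all add: prod.distrib ypow_def sconst_prod)
  finally have 1: "xpow r - (\<Sum>k\<in>(\<Pi>\<^sub>E i\<in>UNIV. {..<p}). ?f k) \<in> I" .
  let ?K = "{k :: 'n \<Rightarrow> nat. (\<Sum>j\<in>UNIV. k j) < M}"
  have sub: "(\<Pi>\<^sub>E i\<in>UNIV. {..<p}) \<subseteq> ?K"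
  proof
    fix k :: "'n \<Rightarrow> nat" assume "k \<in> (\<Pi>\<^sub>E i\<in>UNIV. {..<p})"
    then have "(\<Sum>j\<in>UNIV. k j) < (\<Sum>j\<in>(UNIV :: 'n set). p)" by (intro sum_strict_mono) auto
    then show "k \<in> ?K" using assms(1) by simp
  qed
  have 2: "(\<Sum>k\<in>?K - (\<Pi>\<^sub>E i\<in>UNIV. {..<p}). ?f k) \<in> I"
  proof (rule I_sum, rule I_mult)
    fix k assume "k \<in> ?K - (\<Pi>\<^sub>E i\<in>UNIV. {..<p})"
    then obtain i where i: "p \<le> k i" by (auto simp: PiE_iff not_less)
    have "ypow k = (\<Prod>j\<in>UNIV - {i}. (coord j - 1) ^ k j) * (coord i - 1 :: ('n, 'k) laurent) ^ k i"
      unfolding ypow_def by (subst prod.remove[of _ i]) (simp_all add: mult.commute)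
    then show "ypow k \<in> I" using I_mult[OF power_in_I_le[OF i]] by simp
  qed
  have 3: "(\<Sum>k\<in>?K. ?f k) = (\<Sum>k\<in>?K - (\<Pi>\<^sub>E i\<in>UNIV. {..<p}). ?f k) + (\<Sum>k\<in>(\<Pi>\<^sub>E i\<in>UNIV. {..<p}). ?f k)"
    by (rule sum.subset_diff[OF sub finite_sum_below])
  have 4: "xpow r - (D + E) = (xpow r - E) + - D" for D E :: "('n, 'k) laurent" by simp
  show ?thesis unfolding 3 4 by (rule I_add[OF 1 I_uminus[OF 2]])
qed

text \<open>The value of \<open>G\<close> at (y - x)^k as a function of y, taken at y = x, with the
  power expanded by the binomial theorem.\<close>

definition coeff :: "('n \<Rightarrow> nat) \<Rightarrow> 'm" where
  "coeff k = (\<Sum>l\<in>{..k}. sc (sconst (sgn_binom k l) * xpow (\<lambda>j. int (k j) - int (l j))) (G (npow l)))"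

lemma coeff_eq: "coeff k = sc (npow k) (Ghat (ypow k))"
proof -
  have "xpow (\<lambda>j. int (k j) - int (l j)) = npow k * (xpow (- (\<lambda>j. int (l j))) :: ('n, 'k) laurent)" for l
    unfolding xpow_add[symmetric] by (rule arg_cong[where f = xpow]) auto
  then show ?thesis
    by (simp add: coeff_def ypow_expand Ghat_sum Ghat_single scale_sum_right mult.left_commute)
qed

lemma coeff_zero: "CARD('n) * p \<le> (\<Sum>j\<in>UNIV. k j) \<Longrightarrow> p > 0 \<Longrightarrow> coeff k = 0"
  using ypow_in_I[of k] Ghat_cong[of "ypow k" 0] by (simp add: coeff_eq)

text \<open>Newton's expansion modulo \<open>I\<close>, multiplied back by x^r, becomes Taylor's:
  x^r times the binomial coefficient of r over k is \<open>taylor k\<close> of x^r times x^k, and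
  the factor x^k belongs to \<open>coeff k\<close>.\<close>

theorem taylor_expansion:
  assumes "CARD('n) * p \<le> M" "p > 0"
  shows "G f = (\<Sum>k | (\<Sum>j\<in>UNIV. k j) < M. sc (taylor k f) (coeff k))"
proof (rule additive_eqI[where f = f])
  fix r and c :: 'k
  let ?K = "{k :: 'n \<Rightarrow> nat. (\<Sum>j\<in>UNIV. k j) < M}"
  have "sc (xpow (- r)) (G (xpow r)) = Ghat (xpow r)"
    using Ghat_single[of 1 r] by simp
  also have "\<dots> = (\<Sum>k\<in>?K. sc (sconst (\<Prod>j\<in>UNIV. of_int (r j) gchoose k j)) (Ghat (ypow k)))"
    unfolding Ghat_cong[OF xpow_newton[OF assms]] Ghat_sum Ghat_scale ..
  finally have "sc (xpow r) (sc (xpow (- r)) (G (xpow r))) =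
    sc (xpow r) (\<Sum>k\<in>?K. sc (sconst (\<Prod>j\<in>UNIV. of_int (r j) gchoose k j)) (Ghat (ypow k)))"
    by simp
  then have "G (xpow r) = (\<Sum>k\<in>?K. sc (xpow r * sconst (\<Prod>j\<in>UNIV. of_int (r j) gchoose k j)) (Ghat (ypow k)))"
    by (simp add: scale_sum_right)
  then have "G (Poly_Mapping.single r c) = (\<Sum>k\<in>?K. sc (sconst c * (xpow r * sconst (\<Prod>j\<in>UNIV. of_int (r j) gchoose k j))) (Ghat (ypow k)))"
    unfolding single_eq_xpow[of r c] G_scale by (simp add: scale_sum_right)
  also have "\<dots> = (\<Sum>k\<in>?K. sc (taylor k (Poly_Mapping.single r c)) (coeff k))"
  proof (rule sum.cong[OF refl])
    fix k
    have "(\<lambda>j. r j - int (k j)) + (\<lambda>j. int (k j)) = r" by auto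
    then have "sconst c * (xpow r * sconst (\<Prod>j\<in>UNIV. of_int (r j) gchoose k j)) =
      taylor k (Poly_Mapping.single r c) * npow k"
      by (simp add: taylor_single xpow_def sconst_def mult_single)
    then show "sc (sconst c * (xpow r * sconst (\<Prod>j\<in>UNIV. of_int (r j) gchoose k j))) (Ghat (ypow k)) =
      sc (taylor k (Poly_Mapping.single r c)) (coeff k)"
      by (simp add: coeff_eq)
  qed
  finally show "G (Poly_Mapping.single r c) = (\<Sum>k\<in>?K. sc (taylor k (Poly_Mapping.single r c)) (coeff k))" .
next
  have "G 0 = 0" using G_add[of 0 0] by simp
  then show "G 0 = 0" .
qed (simp_all add: G_add taylor_add scale_left_distrib sum.distrib)

end

section \<open>Taylor coefficients are differential operators\<close>

text \<open>The p-fold commutator of \<open>T\<close> with multiplication by \<open>f\<close>, which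
  expands to the Gelfand-Fuks sum. The recursion replaces \<open>T\<close> by its commutator, so
  that an induction may generalize over \<open>T\<close>.\<close>

primrec ad_power :: "'a::comm_ring_1 \<Rightarrow> nat \<Rightarrow> ('a \<Rightarrow> 'a) \<Rightarrow> 'a \<Rightarrow> 'a" where
  "ad_power f 0 T = T"
| "ad_power f (Suc p) T = ad_power f p (\<lambda>g. f * T g - T (f * g))"

lemma ad_power_eq: "ad_power f p T g = (\<Sum>i\<le>p. (-1) ^ i * of_nat (p choose i) * f ^ (p - i) * T (f ^ i * g))"
proof (induction p arbitrary: T)
  case (Suc p)
  let ?t = "\<lambda>i. f ^ (Suc p - i) * T (f ^ i * g)"
  have "ad_power f (Suc p) T g = (\<Sum>i\<le>p. (-1) ^ i * of_nat (p choose i) * f ^ (p - i) * (f * T (f ^ i * g) - T (f * (f ^ i * g))))"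
    by (simp add: Suc)
  also have "\<dots> = (\<Sum>i\<le>p. (-1) ^ i * of_nat (p choose i) * ?t i) - (\<Sum>i\<le>p. (-1) ^ i * of_nat (p choose i) * ?t (Suc i))"
    unfolding sum_subtractf[symmetric]
    by (rule sum.cong[OF refl]) (simp add: right_diff_distrib Suc_diff_le mult_ac)
  also have "(\<Sum>i\<le>p. (-1) ^ i * of_nat (p choose i) * ?t i) = (\<Sum>i\<le>Suc p. (-1) ^ i * of_nat (p choose i) * ?t i)"
    by (simp add: binomial_eq_0)
  also have "\<dots> = ?t 0 + (\<Sum>i\<le>p. - ((-1) ^ i * of_nat (p choose Suc i) * ?t (Suc i)))"
    unfolding sum.atMost_Suc_shift by simp
  also have "\<dots> - (\<Sum>i\<le>p. (-1) ^ i * of_nat (p choose i) * ?t (Suc i)) =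
     ?t 0 + (\<Sum>i\<le>p. (-1) ^ Suc i * of_nat (Suc p choose Suc i) * ?t (Suc i))"
  proof -
    have "(\<Sum>i\<le>p. (-1) ^ Suc i * of_nat (Suc p choose Suc i) * ?t (Suc i)) =
      (\<Sum>i\<le>p. - ((-1) ^ i * of_nat (p choose Suc i) * ?t (Suc i)) - (-1) ^ i * of_nat (p choose i) * ?t (Suc i))"
    proof (rule sum.cong[OF refl])
      fix i
      have "(-1) ^ Suc i * of_nat (Suc p choose Suc i) * X = - ((-1) ^ i * of_nat (p choose Suc i) * X) - (-1) ^ i * of_nat (p choose i) * X"
        for X :: 'a by (simp add: algebra_simps)
      then show "(-1) ^ Suc i * of_nat (Suc p choose Suc i) * ?t (Suc i) =
        - ((-1) ^ i * of_nat (p choose Suc i) * ?t (Suc i)) - (-1) ^ i * of_nat (p choose i) * ?t (Suc i)" .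
    qed
    then show ?thesis by (simp only: sum_subtractf add_diff_eq)
  qed
  also have "\<dots> = (\<Sum>i\<le>Suc p. (-1) ^ i * of_nat (Suc p choose i) * ?t i)"
    unfolding sum.atMost_Suc_shift by simp
  finally show ?case by (simp add: mult.assoc)
qed simp

lemma ad_power_sum: "ad_power f p (\<lambda>g. \<Sum>l\<in>S. c l * T l g) g = (\<Sum>l\<in>S. c l * ad_power f p (T l) g)"
  unfolding ad_power_eq sum_distrib_left by (subst sum.swap) (simp add: mult_ac)

text \<open>A commutator with a function lowers the order: by the Leibniz rule the commutator of
  \<open>f\<close> with \<open>taylor k\<close> is a combination of \<open>taylor (k - l)\<close>
  with l \<noteq> 0 and function coefficients.\<close>

lemma ad_power_taylor: "(\<Sum>j\<in>UNIV. k j) < p \<Longrightarrow> ad_power f p (taylor k) (g :: ('n::finite, 'k::field_char_0) laurent) = 0"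
proof (induction p arbitrary: k)
  case (Suc p)
  have "f * taylor k g - taylor k (f * g) = (\<Sum>l\<in>{..k} - {0}. (- taylor l f) * taylor (k - l) g)" for g
  proof -
    have "0 \<in> {..k}" by (simp add: le_fun_def)
    moreover have "taylor (k - 0) g = taylor k g" by (simp add: fun_diff_def)
    ultimately show ?thesis
      unfolding taylor_mult by (subst sum.remove[of _ "0 :: 'n \<Rightarrow> nat"]) (simp_all add: sum_negf)
  qed
  then have "ad_power f (Suc p) (taylor k) g = (\<Sum>l\<in>{..k} - {0}. (- taylor l f) * ad_power f p (taylor (k - l)) g)"
    by (simp only: ad_power.simps ad_power_sum)
  also have "\<dots> = 0"
  proof (rule sum.neutral, rule ballI)
    fix l assume l: "l \<in> {..k} - {0}"
    have "(\<Sum>j\<in>UNIV. (k - l) j) < (\<Sum>j\<in>UNIV. k j)"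
    proof (rule sum_strict_mono_ex1)
      obtain j where "l j \<noteq> 0" "l j \<le> k j" using l by (auto simp: fun_eq_iff le_fun_def)
      then show "\<exists>j\<in>UNIV. (k - l) j < k j" by (intro bexI[of _ j]) auto
    qed auto
    then have "ad_power f p (taylor (k - l)) g = 0"
      using Suc.prems by (intro Suc.IH) linarith
    then show "- taylor l f * ad_power f p (taylor (k - l)) g = 0" by (simp only: mult_zero_right)
  qed
  finally show ?case .
qed simp

section \<open>Gelfand--Fuks cochains as cochains on the basis\<close>

type_synonym ('n, 'k) vfield = "('n, 'k) laurent \<Rightarrow> ('n, 'k) laurent"

definition pfield :: "'n idx \<Rightarrow> ('n::finite, 'k::field_char_0) laurent \<Rightarrow> ('n, 'k) laurent" where
  "pfield \<beta> = (\<lambda>g. npow (fst \<beta>) * partial (snd \<beta>) g)"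

lemma pfield_torus [simp]: "pfield \<beta> \<in> torus_fields"
  unfolding pfield_def by (rule partial_torus_field)

lemma set_map_pfield [simp]: "set (map pfield \<beta>s) \<subseteq> torus_fields" "pfield ` S \<subseteq> torus_fields"
  by auto

text \<open>
  \<open>X\<^sup>k \<partial>/\<partial>X\<^sub>i\<close> is the value at \<open>y = x\<close> of \<open>(y - x)\<^sup>k \<partial>/\<partial>y\<^sub>i\<close>, which is expanded by the binomial theorem
  in the fields \<open>y\<^sup>l \<partial>/\<partial>y\<^sub>i\<close>.
\<close>
definition inv_coeff :: "'n idx \<Rightarrow> 'n idx \<Rightarrow> ('n::finite, 'k::field_char_0) laurent" where
  "inv_coeff \<beta> \<gamma> = (if fst \<beta> = 0 then coord (snd \<beta>) else 1) *
     (sconst (sgn_binom (fst \<beta>) (fst \<gamma>)) * xpow (\<lambda>j. int (fst \<beta> j) - int (fst \<gamma> j)))"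

abbreviation inv_supp :: "'n idx \<Rightarrow> 'n idx set" where
  "inv_supp \<beta> \<equiv> {..fst \<beta>} \<times> {snd \<beta>}"

lemma jet_coeff_pfield:
  "jet_coeff (pfield \<beta>) \<gamma> = (if snd \<beta> = snd \<gamma> then (if fst \<gamma> = 0 then inv_coord (snd \<gamma>) else 1) *
     (sconst (\<Prod>j\<in>UNIV. of_nat (fst \<beta> j choose fst \<gamma> j)) * xpow (\<lambda>j. int (fst \<beta> j) - int (fst \<gamma> j)))
   else (0 :: ('n::finite, 'k::field_char_0) laurent))"
proof -
  have t: "taylor k (npow l) = sconst (\<Prod>j\<in>UNIV. of_nat (l j choose k j)) * xpow (\<lambda>j. int (l j) - int (k j))"
    for k l :: "'n \<Rightarrow> nat"
    by (simp add: xpow_def taylor_single sconst_def mult_single binomial_gbinomial)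
  have c: "pfield \<beta> (coord j) = (if snd \<beta> = j then npow (fst \<beta>) else 0)" for j
    by (simp add: pfield_def partial_coord)
  have t0: "npow l = sconst (\<Prod>j\<in>UNIV. of_nat (l j choose k j)) * (xpow (\<lambda>j. int (l j) - int (k j)) :: ('n, 'k) laurent)"
    if "k = 0" for k l :: "'n \<Rightarrow> nat"
    unfolding t[symmetric] using that by simp
  show ?thesis
    using t0[of "fst \<gamma>" "fst \<beta>"] by (auto simp: jet_coeff_def c t)
qed

text \<open>Binomial inversion in every variable; the powers of x combine to one that depends on
  \<open>\<beta>\<close> and \<open>\<gamma>\<close> only, and for equal symbols of degree 0 the
  factors x_i and 1 / x_i cancel.\<close>

lemma inv_coeff_jet_coeff:
  "(\<Sum>l\<in>inv_supp \<beta>. inv_coeff \<beta> l * jet_coeff (pfield l) \<gamma>) = (if \<beta> = \<gamma> then 1 else (0 :: ('n::finite, 'k::field_char_0) laurent))"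
proof (cases "snd \<beta> = snd \<gamma>")
  case False
  then have "\<beta> \<noteq> \<gamma>" by auto
  then show ?thesis using False by (auto simp: jet_coeff_pfield intro!: sum.neutral)
next
  case True
  let ?k = "fst \<beta>" and ?m = "fst \<gamma>" and ?j = "snd \<gamma>"
  let ?a = "(if ?k = 0 then coord ?j else 1) * (if ?m = 0 then inv_coord ?j else 1) :: ('n, 'k) laurent"
  let ?s = "\<lambda>l. sgn_binom ?k l * (\<Prod>j\<in>UNIV. of_nat (l j choose ?m j)) :: 'k"
  have "(\<Sum>l\<in>inv_supp \<beta>. inv_coeff \<beta> l * jet_coeff (pfield l) \<gamma>) =
    (\<Sum>l\<in>{..?k}. inv_coeff \<beta> (l, snd \<beta>) * jet_coeff (pfield (l, snd \<beta>)) \<gamma> :: ('n, 'k) laurent)"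
    by (rule sum.reindex_bij_witness[where i = "\<lambda>l. (l, snd \<beta>)" and j = fst]) auto
  also have "\<dots> = (\<Sum>l\<in>{..?k}. ?a * xpow (\<lambda>j. int (?k j) - int (?m j)) * sconst (?s l))"
  proof (rule sum.cong[OF refl])
    fix l
    have "xpow (\<lambda>j. int (?k j) - int (?m j)) =
      xpow (\<lambda>j. int (?k j) - int (l j)) * (xpow (\<lambda>j. int (l j) - int (?m j)) :: ('n, 'k) laurent)"
      unfolding xpow_add[symmetric] by (rule arg_cong[where f = xpow]) auto
    then show "inv_coeff \<beta> (l, snd \<beta>) * jet_coeff (pfield (l, snd \<beta>)) \<gamma> = ?a * xpow (\<lambda>j. int (?k j) - int (?m j)) * sconst (?s l)"
      using True by (simp add: inv_coeff_def jet_coeff_pfield mult_ac)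
  qed
  also have "\<dots> = ?a * xpow (\<lambda>j. int (?k j) - int (?m j)) * sconst (\<Sum>l\<in>{..?k}. ?s l)"
  proof -
    have "sconst (\<Sum>l\<in>S. f l) = (\<Sum>l\<in>S. sconst (f l) :: ('n, 'k) laurent)" for S :: "('n \<Rightarrow> nat) set" and f
      by (induction S rule: infinite_finite_induct) simp_all
    then show ?thesis by (simp only: sum_distrib_left)
  qed
  also have "(\<Sum>l\<in>{..?k}. ?s l) = (\<Prod>j\<in>UNIV. \<Sum>l\<le>?k j. (-1) ^ (?k j - l) * of_nat (?k j choose l) * of_nat (l choose ?m j))"
    by (simp add: prod_sum_PiE atMost_fun_eq_PiE sgn_binom_def prod.distrib)
  also have "\<dots> = (\<Prod>j\<in>UNIV. if ?k j = ?m j then 1 else 0)"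
    by (simp only: binomial_orthogonality)
  also have "\<dots> = (if \<beta> = \<gamma> then 1 else 0)"
  proof (cases "\<beta> = \<gamma>")
    case False
    then have "?k \<noteq> ?m" using True by (auto simp: prod_eq_iff)
    then obtain j where "?k j \<noteq> ?m j" by (auto simp: fun_eq_iff)
    then show ?thesis using False by (auto intro!: prod_zero bexI[of _ j])
  qed simp
  finally show ?thesis by (auto simp flip: zero_fun_def)
qed

section \<open>Cochains on vector fields and cochains on symbols\<close>

context L_plus_module
begin

definition Tinv :: "(('n, 'k) vfield list \<Rightarrow> ('n \<Rightarrow> int) \<Rightarrow>\<^sub>0 'w) \<Rightarrow> 'n idx list \<Rightarrow> ('n \<Rightarrow> int) \<Rightarrow>\<^sub>0 'w" where
  "Tinv \<phi> = jext (tensor_mult sW) inv_coeff inv_supp (\<lambda>\<beta>s. \<phi> (map pfield \<beta>s))"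

text \<open>Every \<open>M\<close> that bounds the degrees in \<open>c\<close> gives the same
  cochain. It is an explicit parameter because the sum over all symbols is infinite.\<close>

definition Tjet :: "nat \<Rightarrow> ('n idx list \<Rightarrow> ('n \<Rightarrow> int) \<Rightarrow>\<^sub>0 'w) \<Rightarrow> ('n, 'k) vfield list \<Rightarrow> ('n \<Rightarrow> int) \<Rightarrow>\<^sub>0 'w" where
  "Tjet M c \<eta>s = (if set \<eta>s \<subseteq> torus_fields then jext (tensor_mult sW) jet_coeff (\<lambda>_. idx_below M) c \<eta>s else 0)"

lemma pm_scale_eq_tensor_mult: "pm_scale sW c m = tensor_mult sW (sconst c :: ('n, 'k) laurent) m"
  by (simp add: tensor_mult_single_zero[OF vs] sconst_def)

lemma Tinv_add: "Tinv (\<lambda>xs. \<phi> xs + \<psi> xs) \<beta>s = Tinv \<phi> \<beta>s + Tinv \<psi> \<beta>s"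
  by (simp add: Tinv_def T.jext_add)

lemma Tinv_scale: "Tinv (\<lambda>xs. tensor_mult sW r (\<phi> xs)) \<beta>s = tensor_mult sW r (Tinv \<phi> \<beta>s)"
  by (simp add: Tinv_def T.jext_scale)

lemma Tinv_Cons: "Tinv \<phi> (\<beta> # \<beta>s) = (\<Sum>l\<in>inv_supp \<beta>. tensor_mult sW (inv_coeff \<beta> l) (Tinv (ins (pfield l) \<phi>) \<beta>s))"
  by (simp add: Tinv_def ins_def)

text \<open>The outermost symbol is expanded into fields and these into symbols again, and
  \<open>inv_coeff_jet_coeff\<close> leaves only \<open>\<beta>\<close> itself. If
  \<open>\<beta>\<close> lies beyond \<open>M\<close>, the left side is an empty sum and
  \<open>c\<close> vanishes by boundedness.\<close>

lemma Tinv_Tjet: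
  assumes "bounded M c"
  shows "Tinv (Tjet M c) = c"
proof
  fix \<beta>s show "Tinv (Tjet M c) \<beta>s = c \<beta>s"
    using assms
  proof (induction \<beta>s arbitrary: c)
    case Nil
    then show ?case by (simp add: Tinv_def Tjet_def)
  next
    case (Cons \<beta> \<beta>s)
    have ins: "Tinv (ins (pfield l) (Tjet M c)) \<beta>s = (\<Sum>\<gamma>\<in>idx_below M. tensor_mult sW (jet_coeff (pfield l) \<gamma>) (c (\<gamma> # \<beta>s)))" for l
    proof -
      have "Tinv (ins (pfield l) (Tjet M c)) \<beta>s =
        jext (tensor_mult sW) inv_coeff inv_supp (\<lambda>ls. \<Sum>\<gamma>\<in>idx_below M. tensor_mult sW (jet_coeff (pfield l) \<gamma>) (Tjet M (ins \<gamma> c) (map pfield ls))) \<beta>s"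
        by (simp add: Tinv_def Tjet_def)
      also have "\<dots> = (\<Sum>\<gamma>\<in>idx_below M. tensor_mult sW (jet_coeff (pfield l) \<gamma>) (Tinv (Tjet M (ins \<gamma> c)) \<beta>s))"
        by (simp only: T.jext_sum T.jext_scale Tinv_def)
      also have "\<dots> = (\<Sum>\<gamma>\<in>idx_below M. tensor_mult sW (jet_coeff (pfield l) \<gamma>) (ins \<gamma> c \<beta>s))"
        by (simp only: Cons.IH[OF bounded_ins[OF Cons.prems]])
      finally show ?thesis by simp
    qed
    have "Tinv (Tjet M c) (\<beta> # \<beta>s) = (\<Sum>l\<in>inv_supp \<beta>. \<Sum>\<gamma>\<in>idx_below M.
       tensor_mult sW (inv_coeff \<beta> l * jet_coeff (pfield l) \<gamma>) (c (\<gamma> # \<beta>s)))"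
      unfolding Tinv_Cons ins by (simp only: T.scale_sum_right T.scale_scale)
    also have "\<dots> = (\<Sum>\<gamma>\<in>idx_below M. tensor_mult sW (if \<beta> = \<gamma> then 1 else 0) (c (\<gamma> # \<beta>s)))"
      by (subst sum.swap) (simp only: T.scale_sum_left[symmetric] inv_coeff_jet_coeff)
    also have "\<dots> = (\<Sum>\<gamma>\<in>idx_below M. if \<beta> = \<gamma> then c (\<gamma> # \<beta>s) else 0)"
      by (intro sum.cong) auto
    also have "\<dots> = c (\<beta> # \<beta>s)"
      using boundedD[OF Cons.prems, of \<beta> "\<beta> # \<beta>s"] by (auto simp: finite_mdeg not_less)
    finally show ?case .
  qed
qed

text \<open>Gelfand-Fuks cochains with a fixed order but without a fixed number of arguments. Thus
  the class is closed under contraction, as induction on the arguments requires, and one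
  \<open>p\<close> serves at all stages.\<close>

definition gf_class :: "nat \<Rightarrow> (('n, 'k) vfield list \<Rightarrow> ('n \<Rightarrow> int) \<Rightarrow>\<^sub>0 'w) set" where
  "gf_class p = {\<phi>. alternating UNIV \<phi> \<and> (\<forall>\<eta>s. \<not> set \<eta>s \<subseteq> torus_fields \<longrightarrow> \<phi> \<eta>s = 0) \<and>
     (\<forall>\<eta>\<in>torus_fields. \<forall>\<zeta>\<in>torus_fields. \<forall>\<eta>s. set \<eta>s \<subseteq> torus_fields \<longrightarrow> \<phi> ((\<eta> + \<zeta>) # \<eta>s) = \<phi> (\<eta> # \<eta>s) + \<phi> (\<zeta> # \<eta>s)) \<and>
     (\<forall>c. \<forall>\<eta>\<in>torus_fields. \<forall>\<eta>s. set \<eta>s \<subseteq> torus_fields \<longrightarrow> \<phi> (field_scale c \<eta> # \<eta>s) = tensor_mult sW (sconst c) (\<phi> (\<eta> # \<eta>s))) \<and>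
     (\<forall>f. \<forall>\<eta>\<in>torus_fields. \<forall>\<eta>s. set \<eta>s \<subseteq> torus_fields \<longrightarrow>
       (\<Sum>i\<le>p. tensor_mult sW ((-1) ^ i * of_nat (p choose i) * f ^ (p - i)) (\<phi> ((\<lambda>g. f ^ i * \<eta> g) # \<eta>s))) = 0)}"

lemma gf_classD:
  assumes "\<phi> \<in> gf_class p"
  shows "alternating UNIV \<phi>" and "\<not> set \<eta>s \<subseteq> torus_fields \<Longrightarrow> \<phi> \<eta>s = 0"
    and "\<eta> \<in> torus_fields \<Longrightarrow> \<zeta> \<in> torus_fields \<Longrightarrow> set \<eta>s \<subseteq> torus_fields \<Longrightarrow> \<phi> ((\<eta> + \<zeta>) # \<eta>s) = \<phi> (\<eta> # \<eta>s) + \<phi> (\<zeta> # \<eta>s)"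
    and "\<eta> \<in> torus_fields \<Longrightarrow> set \<eta>s \<subseteq> torus_fields \<Longrightarrow> \<phi> (field_scale q \<eta> # \<eta>s) = tensor_mult sW (sconst q) (\<phi> (\<eta> # \<eta>s))"
    and "\<eta> \<in> torus_fields \<Longrightarrow> set \<eta>s \<subseteq> torus_fields \<Longrightarrow>
      (\<Sum>i\<le>p. tensor_mult sW ((-1) ^ i * of_nat (p choose i) * f ^ (p - i)) (\<phi> ((\<lambda>g. f ^ i * \<eta> g) # \<eta>s))) = 0"
proof -
  note * = assms[unfolded gf_class_def mem_Collect_eq]
  note 2 = *[THEN conjunct2] and 3 = *[THEN conjunct2, THEN conjunct2] and 4 = *[THEN conjunct2, THEN conjunct2, THEN conjunct2]
  show "alternating UNIV \<phi>" by (rule *[THEN conjunct1])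
  show "\<phi> \<eta>s = 0" if "\<not> set \<eta>s \<subseteq> torus_fields"
    by (rule 2[THEN conjunct1, rule_format, OF that])
  show "\<phi> ((\<eta> + \<zeta>) # \<eta>s) = \<phi> (\<eta> # \<eta>s) + \<phi> (\<zeta> # \<eta>s)"
    if "\<eta> \<in> torus_fields" "\<zeta> \<in> torus_fields" "set \<eta>s \<subseteq> torus_fields"
    by (rule 3[THEN conjunct1, rule_format, OF that])
  show "\<phi> (field_scale q \<eta> # \<eta>s) = tensor_mult sW (sconst q) (\<phi> (\<eta> # \<eta>s))"
    if "\<eta> \<in> torus_fields" "set \<eta>s \<subseteq> torus_fields"
    by (rule 4[THEN conjunct1, rule_format, OF that])
  show "(\<Sum>i\<le>p. tensor_mult sW ((-1) ^ i * of_nat (p choose i) * f ^ (p - i)) (\<phi> ((\<lambda>g. f ^ i * \<eta> g) # \<eta>s))) = 0"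
    if "\<eta> \<in> torus_fields" "set \<eta>s \<subseteq> torus_fields"
    by (rule 4[THEN conjunct2, rule_format, OF that])
qed

lemma torus_field_mult_closed: "\<eta> \<in> torus_fields \<Longrightarrow> (\<lambda>g. (f :: ('n, 'k) laurent) * \<eta> g) \<in> torus_fields"
  by (auto simp: torus_fields_def derivations_def linear_pm_iff pm_scale_eq_mult algebra_simps)

lemma gf_class_ins:
  assumes \<phi>: "\<phi> \<in> gf_class p" and \<eta>: "\<eta> \<in> torus_fields"
  shows "ins \<eta> \<phi> \<in> gf_class p"
proof -
  interpret V: lie_algebra field_scale "torus_fields :: (('n, 'k) laurent \<Rightarrow> _) set" commutator
    by (rule lie_algebra_torus_fields)
  note alt = gf_classD(1)[OF \<phi>]
  have sw: "\<phi> (\<eta> # \<zeta> # \<zeta>s) = - \<phi> (\<zeta> # \<eta> # \<zeta>s)" for \<zeta> \<zeta>s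
    by (rule alternating_swap[OF alt]) auto
  show ?thesis
    unfolding gf_class_def
  proof (intro CollectI conjI allI impI ballI)
    show "alternating UNIV (ins \<eta> \<phi>)" by (rule alternating_ins[OF alt]) simp
  next
    fix \<eta>s :: "('n, 'k) vfield list"
    assume "\<not> set \<eta>s \<subseteq> torus_fields" then show "ins \<eta> \<phi> \<eta>s = 0" using gf_classD(2)[OF \<phi>, of "\<eta> # \<eta>s"] by simp
  next
    fix \<zeta> \<xi> :: "('n, 'k) vfield" and \<eta>s :: "('n, 'k) vfield list"
    assume "\<zeta> \<in> torus_fields" "\<xi> \<in> torus_fields" "set \<eta>s \<subseteq> torus_fields"
    then have "\<phi> ((\<zeta> + \<xi>) # \<eta> # \<eta>s) = \<phi> (\<zeta> # \<eta> # \<eta>s) + \<phi> (\<xi> # \<eta> # \<eta>s)"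
      using \<eta> by (intro gf_classD(3)[OF \<phi>]) auto
    then show "ins \<eta> \<phi> ((\<zeta> + \<xi>) # \<eta>s) = ins \<eta> \<phi> (\<zeta> # \<eta>s) + ins \<eta> \<phi> (\<xi> # \<eta>s)" by (simp add: sw)
  next
    fix c and \<zeta> :: "('n, 'k) vfield" and \<eta>s :: "('n, 'k) vfield list"
    assume "\<zeta> \<in> torus_fields" "set \<eta>s \<subseteq> torus_fields"
    then have "\<phi> (field_scale c \<zeta> # \<eta> # \<eta>s) = tensor_mult sW (sconst c) (\<phi> (\<zeta> # \<eta> # \<eta>s))"
      using \<eta> by (intro gf_classD(4)[OF \<phi>]) auto
    then show "ins \<eta> \<phi> (field_scale c \<zeta> # \<eta>s) = tensor_mult sW (sconst c) (ins \<eta> \<phi> (\<zeta> # \<eta>s))"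
      by (simp add: sw)
  next
    fix f and \<zeta> :: "('n, 'k) vfield" and \<eta>s :: "('n, 'k) vfield list"
    assume "\<zeta> \<in> torus_fields" "set \<eta>s \<subseteq> torus_fields"
    then have "(\<Sum>i\<le>p. tensor_mult sW ((-1) ^ i * of_nat (p choose i) * f ^ (p - i)) (\<phi> ((\<lambda>g. f ^ i * \<zeta> g) # \<eta> # \<eta>s))) = 0"
      using \<eta> by (intro gf_classD(5)[OF \<phi>]) auto
    then show "(\<Sum>i\<le>p. tensor_mult sW ((-1) ^ i * of_nat (p choose i) * f ^ (p - i)) (ins \<eta> \<phi> ((\<lambda>g. f ^ i * \<zeta> g) # \<eta>s))) = 0"
      by (simp add: sw sum_negf)
  qed
qed

text \<open>For fixed i and fixed remaining arguments, f \<mapsto> \<phi>(f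
  \<partial>/\<partial>x_i, ...) is a differential operator, to which
  \<open>taylor_expansion\<close> applies. Its coefficients are the values on symbols, up to the
  factor x_i in degree 0 that undoes dx_i / x_i.\<close>

lemma gf_class_taylor:
  assumes \<phi>: "\<phi> \<in> gf_class p" and "p > 0" and \<eta>s: "set \<eta>s \<subseteq> torus_fields" and M: "CARD('n) * p \<le> M"
  shows "\<eta> \<in> torus_fields \<Longrightarrow> \<phi> (\<eta> # \<eta>s) =
      (\<Sum>\<beta>\<in>idx_below M. tensor_mult sW (jet_coeff \<eta> \<beta>) (\<Sum>l\<in>inv_supp \<beta>. tensor_mult sW (inv_coeff \<beta> l) (\<phi> (pfield l # \<eta>s))))"
    and "M \<le> mdeg \<beta> \<Longrightarrow> (\<Sum>l\<in>inv_supp \<beta>. tensor_mult sW (inv_coeff \<beta> l) (\<phi> (pfield l # \<eta>s))) = 0"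
proof -
  interpret V: lie_algebra field_scale "torus_fields :: (('n, 'k) laurent \<Rightarrow> _) set" commutator
    by (rule lie_algebra_torus_fields)
  define G where "G i f = \<phi> ((\<lambda>g. f * partial i g) # \<eta>s)" for i f
  have add: "\<phi> ((\<eta> + \<zeta>) # \<eta>s) = \<phi> (\<eta> # \<eta>s) + \<phi> (\<zeta> # \<eta>s)" if "\<eta> \<in> torus_fields" "\<zeta> \<in> torus_fields" for \<eta> \<zeta>
    by (rule gf_classD(3)[OF \<phi> that \<eta>s])
  have G: "diff_operator (tensor_mult sW) (G i) p" for i
  proof
    fix f g :: "('n, 'k) laurent" and c :: 'k and j
    have "(\<lambda>h. (f + g) * partial i h) = (\<lambda>h. f * partial i h) + (\<lambda>h. g * partial i h)"
      by (simp add: fun_eq_iff distrib_right)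
    then show "G i (f + g) = G i f + G i g"
      by (simp only: G_def add[OF partial_torus_field partial_torus_field])
    have "(\<lambda>h. sconst c * f * partial i h) = field_scale c (\<lambda>h. f * partial i h)"
      by (simp add: fun_eq_iff fun_scale_def pm_scale_eq_mult sconst_def mult.assoc)
    moreover have "\<phi> (field_scale c (\<lambda>h. f * partial i h) # \<eta>s) = tensor_mult sW (sconst c) (\<phi> ((\<lambda>h. f * partial i h) # \<eta>s))"
      by (rule gf_classD(4)[OF \<phi> partial_torus_field \<eta>s])
    ultimately show "G i (sconst c * f) = tensor_mult sW (sconst c) (G i f)"
      by (simp only: G_def)
    have "(\<Sum>t\<le>p. tensor_mult sW ((-1) ^ t * of_nat (p choose t) * coord j ^ (p - t)) (\<phi> ((\<lambda>g. coord j ^ t * (f * partial i g)) # \<eta>s))) = 0"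
      by (rule gf_classD(5)[OF \<phi> partial_torus_field \<eta>s])
    then show "(\<Sum>t\<le>p. tensor_mult sW (of_int ((-1) ^ t) * of_nat (p choose t) * coord j ^ (p - t)) (G i (coord j ^ t * f))) = 0"
      by (simp add: G_def mult.assoc)
  qed
  have coeff: "(\<Sum>l\<in>inv_supp \<beta>. tensor_mult sW (inv_coeff \<beta> l) (\<phi> (pfield l # \<eta>s))) =
    tensor_mult sW (if fst \<beta> = 0 then coord (snd \<beta>) else 1) (diff_operator.coeff (tensor_mult sW) (G (snd \<beta>)) (fst \<beta>))" for \<beta>
  proof -
    have "(\<Sum>l\<in>inv_supp \<beta>. tensor_mult sW (inv_coeff \<beta> l) (\<phi> (pfield l # \<eta>s))) =
      (\<Sum>l\<in>{..fst \<beta>}. tensor_mult sW (inv_coeff \<beta> (l, snd \<beta>)) (\<phi> (pfield (l, snd \<beta>) # \<eta>s)))"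
      by (rule sum.reindex_bij_witness[where i = "\<lambda>l. (l, snd \<beta>)" and j = fst]) auto
    then show ?thesis
      by (simp add: diff_operator.coeff_def[OF G] G_def pfield_def inv_coeff_def T.scale_sum_right mult.assoc)
  qed
  show "(\<Sum>l\<in>inv_supp \<beta>. tensor_mult sW (inv_coeff \<beta> l) (\<phi> (pfield l # \<eta>s))) = 0" if "M \<le> mdeg \<beta>"
    using that M \<open>p > 0\<close> by (simp add: coeff diff_operator.coeff_zero[OF G] mdeg_def)
  assume \<eta>: "\<eta> \<in> torus_fields"
  have "\<phi> ((\<Sum>i\<in>S. (\<lambda>g. \<eta> (coord i) * partial i g)) # \<eta>s) = (\<Sum>i\<in>S. G i (\<eta> (coord i)))" if "finite S" for S
    using that
  proof (induction S rule: finite_induct)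
    case empty
    have "\<phi> (0 # \<eta>s) = 0" using add[of 0 0] V.subspace_0[OF V.subspace_L] by simp
    then show ?case by (simp only: sum.empty)
  next
    case (insert i S)
    have "(\<Sum>i\<in>S. (\<lambda>g. \<eta> (coord i) * partial i g)) \<in> torus_fields"
      by (intro V.subspace_sum[OF V.subspace_L] partial_torus_field)
    then show ?case
      using insert.IH add[OF partial_torus_field, of "\<Sum>i\<in>S. (\<lambda>g. \<eta> (coord i) * partial i g)" "\<eta> (coord i)" i]
      by (simp only: sum.insert[OF insert.hyps] G_def)
  qed
  from this[of UNIV] have sum: "\<phi> ((\<Sum>i\<in>UNIV. (\<lambda>g. \<eta> (coord i) * partial i g)) # \<eta>s) = (\<Sum>i\<in>UNIV. G i (\<eta> (coord i)))"
    by simp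
  have "\<eta> = (\<Sum>i\<in>UNIV. (\<lambda>g. \<eta> (coord i) * partial i g))"
  proof
    fix g
    have "(\<Sum>i\<in>S. h i) g = (\<Sum>i\<in>S. h i g)" for S :: "'n set" and h :: "'n \<Rightarrow> ('n, 'k) laurent \<Rightarrow> ('n, 'k) laurent"
      by (induction S rule: infinite_finite_induct) simp_all
    then show "\<eta> g = (\<Sum>i\<in>UNIV. (\<lambda>g. \<eta> (coord i) * partial i g)) g"
      using torus_field_eq[OF \<eta>, of g] by simp
  qed
  then have "\<phi> (\<eta> # \<eta>s) = (\<Sum>i\<in>UNIV. G i (\<eta> (coord i)))" using sum by simp
  also have "\<dots> = (\<Sum>i\<in>UNIV. \<Sum>k | (\<Sum>j\<in>UNIV. k j) < M. tensor_mult sW (taylor k (\<eta> (coord i))) (diff_operator.coeff (tensor_mult sW) (G i) k))"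
    by (simp only: diff_operator.taylor_expansion[OF G M \<open>p > 0\<close>])
  also have "\<dots> = (\<Sum>\<beta>\<in>idx_below M. tensor_mult sW (taylor (fst \<beta>) (\<eta> (coord (snd \<beta>)))) (diff_operator.coeff (tensor_mult sW) (G (snd \<beta>)) (fst \<beta>)))"
    by (rule sum_idx_below[symmetric])
  also have "\<dots> = (\<Sum>\<beta>\<in>idx_below M. tensor_mult sW (jet_coeff \<eta> \<beta>) (\<Sum>l\<in>inv_supp \<beta>. tensor_mult sW (inv_coeff \<beta> l) (\<phi> (pfield l # \<eta>s))))"
  proof (rule sum.cong[OF refl])
    fix \<beta> :: "'n idx"
    have "inv_coord i * f * coord i = f" for i and f :: "('n, 'k) laurent"
      by (metis coord_inv(2) mult.assoc mult.commute mult_1)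
    then have "jet_coeff \<eta> \<beta> * (if fst \<beta> = 0 then coord (snd \<beta>) else 1) = taylor (fst \<beta>) (\<eta> (coord (snd \<beta>)))"
      by (simp add: jet_coeff_def)
    then show "tensor_mult sW (taylor (fst \<beta>) (\<eta> (coord (snd \<beta>)))) (diff_operator.coeff (tensor_mult sW) (G (snd \<beta>)) (fst \<beta>)) =
      tensor_mult sW (jet_coeff \<eta> \<beta>) (\<Sum>l\<in>inv_supp \<beta>. tensor_mult sW (inv_coeff \<beta> l) (\<phi> (pfield l # \<eta>s)))"
      unfolding coeff by simp
  qed
  finally show "\<phi> (\<eta> # \<eta>s) =
      (\<Sum>\<beta>\<in>idx_below M. tensor_mult sW (jet_coeff \<eta> \<beta>) (\<Sum>l\<in>inv_supp \<beta>. tensor_mult sW (inv_coeff \<beta> l) (\<phi> (pfield l # \<eta>s))))" .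
qed

lemma alternating_Tinv: "alternating UNIV \<phi> \<Longrightarrow> alternating UNIV (Tinv \<phi>)"
  unfolding Tinv_def
proof (rule T.alternating_jext)
  assume alt: "alternating UNIV \<phi>"
  show "alternating UNIV (\<lambda>\<beta>s. \<phi> (map pfield \<beta>s))"
    unfolding alternating_def
  proof (intro allI impI)
    fix us x y vs
    show "\<phi> (map pfield (us @ x # y # vs)) = - \<phi> (map pfield (us @ y # x # vs))"
      using alternatingD[OF alt, of "map pfield us" "pfield x" "pfield y" "map pfield vs"] by simp
  qed
qed

lemma alternating_Tjet:
  assumes "alternating UNIV c"
  shows "alternating torus_fields (Tjet M c)"
  unfolding alternating_def
proof (intro allI impI)
  fix us vs :: "('n, 'k) vfield list" and x y assume *: "set (us @ x # y # vs) \<subseteq> torus_fields"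
  then have "set (us @ y # x # vs) \<subseteq> torus_fields" by auto
  with * show "Tjet M c (us @ x # y # vs) = - Tjet M c (us @ y # x # vs)"
    using alternatingD[OF T.alternating_jext[OF assms, of UNIV], of us x y vs] by (simp add: Tjet_def)
qed

text \<open>\<open>gf_class_taylor\<close> controls the first argument; skew symmetry carries the
  bound to the others.\<close>

lemma bounded_Tinv:
  assumes \<phi>: "\<phi> \<in> gf_class p" and "p > 0" and M: "CARD('n) * p \<le> M"
  shows "bounded M (Tinv \<phi>)"
proof -
  have head: "Tinv \<phi> (\<beta> # \<beta>s) = 0" if "M \<le> mdeg \<beta>" for \<beta> \<beta>s
  proof -
    have "Tinv \<phi> (\<beta> # \<beta>s) = (\<Sum>l\<in>inv_supp \<beta>. tensor_mult sW (inv_coeff \<beta> l) (Tinv (ins (pfield l) \<phi>) \<beta>s))"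
      by (rule Tinv_Cons)
    also have "\<dots> = jext (tensor_mult sW) inv_coeff inv_supp
      (\<lambda>\<beta>s. \<Sum>l\<in>inv_supp \<beta>. tensor_mult sW (inv_coeff \<beta> l) (\<phi> (pfield l # map pfield \<beta>s))) \<beta>s"
      by (simp only: T.jext_sum T.jext_scale Tinv_def ins_def)
    finally show ?thesis
      using gf_class_taylor(2)[OF \<phi> \<open>p > 0\<close> set_map_pfield(1) M that] by (simp only: T.jext_zero)
  qed
  have alt: "alternating UNIV (Tinv \<phi>)"
    by (rule alternating_Tinv[OF gf_classD(1)[OF \<phi>]])
  show ?thesis
    unfolding bounded_def
  proof (intro allI impI ballI, rule ccontr)
    fix xs and \<beta> :: "'n idx" assume nz: "Tinv \<phi> xs \<noteq> 0" and "\<beta> \<in> set xs" "\<not> mdeg \<beta> < M"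
    then obtain us ws where "xs = us @ \<beta> # ws" "M \<le> mdeg \<beta>" by (auto simp: in_set_conv_decomp)
    then show False using nz alternating_move[OF alt, of us \<beta> ws] head by simp
  qed
qed

text \<open>The arguments are expanded one after another by \<open>gf_class_taylor\<close>.
  Contraction with a field stays in \<open>gf_class p\<close>, so the same \<open>M\<close> works
  throughout.\<close>

lemma Tjet_Tinv:
  assumes "\<phi> \<in> gf_class p" and "p > 0" and M: "CARD('n) * p \<le> M"
  shows "Tjet M (Tinv \<phi>) = \<phi>"
proof
  fix \<eta>s
  show "Tjet M (Tinv \<phi>) \<eta>s = \<phi> \<eta>s"
  proof (cases "set \<eta>s \<subseteq> torus_fields")
    case False
    then show ?thesis using gf_classD(2)[OF assms(1) False] by (simp add: Tjet_def)
  next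
    case True
    let ?J = "jext (tensor_mult sW) jet_coeff (\<lambda>_. idx_below M)"
    have "?J (Tinv \<phi>) \<eta>s = \<phi> \<eta>s"
      using True assms(1)
    proof (induction \<eta>s arbitrary: \<phi>)
      case Nil
      then show ?case by (simp add: Tinv_def)
    next
      case (Cons \<eta> \<eta>s)
      have "?J (ins \<beta> (Tinv \<phi>)) \<eta>s = (\<Sum>l\<in>inv_supp \<beta>. tensor_mult sW (inv_coeff \<beta> l) (\<phi> (pfield l # \<eta>s)))" for \<beta>
      proof -
        have "ins \<beta> (Tinv \<phi>) = (\<lambda>\<beta>s. \<Sum>l\<in>inv_supp \<beta>. tensor_mult sW (inv_coeff \<beta> l) (Tinv (ins (pfield l) \<phi>) \<beta>s))"
          by (simp add: fun_eq_iff Tinv_Cons)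
        then have "?J (ins \<beta> (Tinv \<phi>)) \<eta>s = (\<Sum>l\<in>inv_supp \<beta>. tensor_mult sW (inv_coeff \<beta> l) (?J (Tinv (ins (pfield l) \<phi>)) \<eta>s))"
          by (simp only: T.jext_sum T.jext_scale)
        also have "\<dots> = (\<Sum>l\<in>inv_supp \<beta>. tensor_mult sW (inv_coeff \<beta> l) (ins (pfield l) \<phi> \<eta>s))"
          using Cons.prems by (intro sum.cong refl arg_cong2[where f = "tensor_mult sW"] Cons.IH gf_class_ins) auto
        finally show ?thesis by simp
      qed
      then show ?case
        using gf_class_taylor(1)[OF Cons.prems(2) \<open>p > 0\<close> _ M, of \<eta>s \<eta>] Cons.prems(1) by simp
    qed
    then show ?thesis using True by (simp add: Tjet_def)
  qed
qed

lemma gf_cochains_class: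
  assumes "\<phi> \<in> gf_cochains sW n"
  obtains p where "p > 0" "\<phi> \<in> gf_class p" "\<And>\<eta>s. length \<eta>s \<noteq> n \<Longrightarrow> \<phi> \<eta>s = 0"
proof -
  interpret V: lie_algebra field_scale "torus_fields :: (('n, 'k) laurent \<Rightarrow> _) set" commutator
    by (rule lie_algebra_torus_fields)
  have ce: "\<phi> \<in> ce_cochains field_scale torus_fields (pm_scale sW) n"
    using assms by (simp add: gf_cochains_def)
  note R = iffD1[OF V.ce_cochains_iff[OF vector_space_pm_scale[OF vs]] ce, simplified]
  have supp: "\<phi> \<eta>s = 0" if "length \<eta>s \<noteq> n \<or> \<not> set \<eta>s \<subseteq> torus_fields" for \<eta>s
    using R that by blast
  obtain p where "p > 0" and p: "n \<ge> 1 \<longrightarrow> (\<forall>f. \<forall>\<eta>\<in>torus_fields. \<forall>\<eta>s. length \<eta>s = n - 1 \<and> set \<eta>s \<subseteq> torus_fields \<longrightarrow>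
       (\<Sum>i\<le>p. pm_scale sW ((- 1) ^ i * of_nat (p choose i))
          (tensor_mult sW (f ^ (p - i)) (\<phi> ((\<lambda>g. f ^ i * \<eta> g) # \<eta>s)))) = 0)"
    using assms by (cases "n \<ge> 1") (auto simp: gf_cochains_def)
  have "\<phi> \<in> gf_class p"
    unfolding gf_class_def
  proof (intro CollectI conjI allI impI ballI)
    show "alternating UNIV \<phi>" by (rule alternating_UNIV[of torus_fields]) (use R supp in auto)
  next
    fix \<eta>s :: "('n, 'k) vfield list"
    assume "\<not> set \<eta>s \<subseteq> torus_fields" then show "\<phi> \<eta>s = 0" using supp by blast
  next
    fix \<zeta> \<xi> :: "('n, 'k) vfield" and \<eta>s :: "('n, 'k) vfield list"
    assume "\<zeta> \<in> torus_fields" "\<xi> \<in> torus_fields" "set \<eta>s \<subseteq> torus_fields"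
    then show "\<phi> ((\<zeta> + \<xi>) # \<eta>s) = \<phi> (\<zeta> # \<eta>s) + \<phi> (\<xi> # \<eta>s)" using R by blast
  next
    fix c and \<zeta> :: "('n, 'k) vfield" and \<eta>s :: "('n, 'k) vfield list"
    assume "\<zeta> \<in> torus_fields" "set \<eta>s \<subseteq> torus_fields"
    then show "\<phi> (field_scale c \<zeta> # \<eta>s) = tensor_mult sW (sconst c) (\<phi> (\<zeta> # \<eta>s))"
      using R by (simp add: pm_scale_eq_tensor_mult)
  next
    fix f and \<zeta> :: "('n, 'k) vfield" and \<eta>s :: "('n, 'k) vfield list"
    assume *: "\<zeta> \<in> torus_fields" "set \<eta>s \<subseteq> torus_fields"
    show "(\<Sum>i\<le>p. tensor_mult sW ((-1) ^ i * of_nat (p choose i) * f ^ (p - i)) (\<phi> ((\<lambda>g. f ^ i * \<zeta> g) # \<eta>s))) = 0"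
    proof (cases "Suc (length \<eta>s) = n")
      case True
      then have "(\<Sum>i\<le>p. pm_scale sW ((- 1) ^ i * of_nat (p choose i))
          (tensor_mult sW (f ^ (p - i)) (\<phi> ((\<lambda>g. f ^ i * \<zeta> g) # \<eta>s)))) = 0" using p * by auto
      then show ?thesis by (simp add: pm_scale_eq_tensor_mult mult.assoc)
    qed (simp add: supp)
  qed
  then show ?thesis using that \<open>p > 0\<close> supp by blast
qed

lemma Tjet_gf_cochain:
  assumes alt: "alternating UNIV c" and len: "\<And>\<beta>s. length \<beta>s \<noteq> n \<Longrightarrow> c \<beta>s = 0"
  shows "Tjet M c \<in> gf_cochains sW n"
proof -
  interpret V: lie_algebra field_scale "torus_fields :: (('n, 'k) laurent \<Rightarrow> _) set" commutator
    by (rule lie_algebra_torus_fields)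
  let ?J = "jext (tensor_mult sW) jet_coeff (\<lambda>_. idx_below M)"
  note alt' = alternating_Tjet[OF alt]
  have add: "jet_coeff (\<eta> + \<zeta>) \<beta> = jet_coeff \<eta> \<beta> + jet_coeff \<zeta> \<beta>" for \<eta> \<zeta> :: "('n, 'k) vfield" and \<beta>
    by (simp add: jet_coeff_def distrib_left taylor_add)
  have scale: "jet_coeff (field_scale q \<eta>) \<beta> = sconst q * jet_coeff \<eta> \<beta>" for q :: 'k and \<eta> :: "('n, 'k) vfield" and \<beta>
    by (simp add: jet_coeff_def fun_scale_def pm_scale_eq_mult taylor_scale[unfolded sconst_def] sconst_def mult.left_commute)
  have ce: "Tjet M c \<in> ce_cochains field_scale torus_fields (pm_scale sW) n"
    unfolding V.ce_cochains_iff[OF vector_space_pm_scale[OF vs], of "Tjet M c", simplified]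
  proof (intro conjI alt' allI impI ballI)
    fix \<eta>s :: "('n, 'k) vfield list"
    assume "length \<eta>s = n \<longrightarrow> \<not> set \<eta>s \<subseteq> torus_fields"
    then show "Tjet M c \<eta>s = 0"
      by (cases "set \<eta>s \<subseteq> torus_fields") (auto simp: Tjet_def intro!: T.jext_length len)
  next
    fix \<eta> \<zeta> :: "('n, 'k) vfield" and \<eta>s :: "('n, 'k) vfield list"
    assume "\<eta> \<in> torus_fields" "\<zeta> \<in> torus_fields" "set \<eta>s \<subseteq> torus_fields"
    then show "Tjet M c ((\<eta> + \<zeta>) # \<eta>s) = Tjet M c (\<eta> # \<eta>s) + Tjet M c (\<zeta> # \<eta>s)"
      using V.subspace_add[OF V.subspace_L, of \<eta> \<zeta>]
      by (simp add: Tjet_def add T.scale_left_distrib sum.distrib)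
  next
    fix q and \<eta> :: "('n, 'k) vfield" and \<eta>s :: "('n, 'k) vfield list"
    assume "\<eta> \<in> torus_fields" "set \<eta>s \<subseteq> torus_fields"
    then show "Tjet M c (field_scale q \<eta> # \<eta>s) = pm_scale sW q (Tjet M c (\<eta> # \<eta>s))"
      using V.subspace_scale[OF V.subspace_L, of \<eta> q]
      by (simp add: Tjet_def scale pm_scale_eq_tensor_mult T.scale_sum_right)
  qed
  \<comment> \<open>The jet coefficients of degree below \<open>M\<close> are operators of order
    below \<open>M\<close>. The exponent \<open>Suc M\<close> is positive also for
    \<open>M = 0\<close>, as \<open>gf_cochains\<close> demands.\<close>
  have order: "(\<Sum>i\<le>Suc M. (-1) ^ i * of_nat (Suc M choose i) * f ^ (Suc M - i) * jet_coeff (\<lambda>g. f ^ i * \<eta> g) \<beta>) = 0"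
    if "mdeg \<beta> < M" for f and \<eta> :: "('n, 'k) vfield" and \<beta>
  proof (cases "fst \<beta> = 0")
    case True
    have "(\<Sum>i\<le>Suc M. (-1) ^ i * of_nat (Suc M choose i) * f ^ (Suc M - i) * taylor (fst \<beta>) (f ^ i * \<eta> (coord (snd \<beta>)))) = 0"
      using ad_power_taylor[of "fst \<beta>" "Suc M" f "\<eta> (coord (snd \<beta>))"] that
      unfolding ad_power_eq by (simp add: mdeg_def)
    then have "inv_coord (snd \<beta>) * (\<Sum>i\<le>Suc M. (-1) ^ i * of_nat (Suc M choose i) * f ^ (Suc M - i) * (f ^ i * \<eta> (coord (snd \<beta>)))) = 0"
      using True by (simp del: sum.atMost_Suc)
    then show ?thesis
      using True unfolding sum_distrib_left by (simp add: jet_coeff_def mult_ac del: sum.atMost_Suc)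
  next
    case False
    then show ?thesis
      using ad_power_taylor[of "fst \<beta>" "Suc M" f "\<eta> (coord (snd \<beta>))"] that
      unfolding ad_power_eq by (simp add: jet_coeff_def mdeg_def del: sum.atMost_Suc)
  qed
  have "(\<Sum>i\<le>Suc M. pm_scale sW ((- 1) ^ i * of_nat (Suc M choose i))
          (tensor_mult sW (f ^ (Suc M - i)) (Tjet M c ((\<lambda>g. f ^ i * \<eta> g) # \<eta>s)))) = 0"
    if "\<eta> \<in> torus_fields" "set \<eta>s \<subseteq> torus_fields" for f \<eta> \<eta>s
  proof -
    have "(\<Sum>i\<le>Suc M. pm_scale sW ((- 1) ^ i * of_nat (Suc M choose i))
          (tensor_mult sW (f ^ (Suc M - i)) (Tjet M c ((\<lambda>g. f ^ i * \<eta> g) # \<eta>s)))) =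
      (\<Sum>i\<le>Suc M. \<Sum>\<beta>\<in>idx_below M. tensor_mult sW ((- 1) ^ i * of_nat (Suc M choose i) * f ^ (Suc M - i) * jet_coeff (\<lambda>g. f ^ i * \<eta> g) \<beta>) (?J (ins \<beta> c) \<eta>s))"
      using that torus_field_mult_closed[OF that(1)]
      by (intro sum.cong refl) (simp add: Tjet_def pm_scale_eq_tensor_mult T.scale_sum_right mult.assoc)
    also have "\<dots> = (\<Sum>\<beta>\<in>idx_below M. tensor_mult sW (\<Sum>i\<le>Suc M. (- 1) ^ i * of_nat (Suc M choose i) * f ^ (Suc M - i) * jet_coeff (\<lambda>g. f ^ i * \<eta> g) \<beta>) (?J (ins \<beta> c) \<eta>s))"
      by (subst sum.swap) (simp only: T.scale_sum_left)
    also have "\<dots> = 0"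
      by (rule sum.neutral) (use order in \<open>simp del: sum.atMost_Suc\<close>)
    finally show ?thesis .
  qed
  then show ?thesis using ce unfolding gf_cochains_def by (intro CollectI conjI impI exI[of _ "Suc M"]) auto
qed

lemma ce_diff_Tjet:
  assumes N\<^sub>0: "\<And>\<beta> w. M \<le> mdeg \<beta> \<Longrightarrow> \<rho> (mfield \<beta>) w = 0" and M: "M > 0"
    and alt: "alternating UNIV c" and bd: "bounded M c"
  shows "ce_diff torus_fields commutator (pm_scale sW) (tensor_act sW \<rho>) (Tjet M c) =
    Tjet M (cdiff (idx_br (pm_scale sW)) ten_act c)"
proof
  interpret V: lie_algebra field_scale "torus_fields :: (('n, 'k) laurent \<Rightarrow> _) set" commutator
    by (rule lie_algebra_torus_fields)
  interpret jm: jet_map "tensor_mult sW" torus_fields commutator "\<lambda>\<eta>. \<eta>" "tensor_act sW \<rho>"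
    "idx_br (pm_scale sW)" ten_act jet_coeff "idx_below M" "{c. alternating UNIV c \<and> bounded M c}"
    by (rule jet_map_torus[OF N\<^sub>0 M])
  fix \<eta>s :: "('n, 'k) vfield list"
  show "ce_diff torus_fields commutator (pm_scale sW) (tensor_act sW \<rho>) (Tjet M c) \<eta>s =
    Tjet M (cdiff (idx_br (pm_scale sW)) ten_act c) \<eta>s"
  proof (cases "set \<eta>s \<subseteq> torus_fields")
    case False
    then show ?thesis by (simp add: ce_diff_def Tjet_def)
  next
    case True
    note alt' = alternating_Tjet[OF alt]
    have "ce_diff torus_fields commutator (pm_scale sW) (tensor_act sW \<rho>) (Tjet M c) \<eta>s = jm.d (Tjet M c) \<eta>s"
      by (rule ce_diff_eq_cdiff[OF vector_space_pm_scale[OF vs] alt' True]) (rule V.br_closed)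
    also have "\<dots> = jm.d (jm.J c) \<eta>s"
      by (rule jm.cdiff_cong[OF True]) (simp add: Tjet_def)
    also have "\<dots> = jm.J (cdiff (idx_br (pm_scale sW)) ten_act c) \<eta>s"
      using alt bd by (intro jm.cdiff_jext[OF _ True]) simp
    finally show ?thesis using True by (simp add: Tjet_def)
  qed
qed

end

section \<open>Weights and central components\<close>

definition central :: "'n \<Rightarrow> 'n idx" where
  "central i = (0, i)"

lemma central_simps [simp]: "fst (central i) = 0" "snd (central i) = i" "central i = central j \<longleftrightarrow> i = j"
  by (simp_all add: central_def)

lemma central_iff: "fst \<beta> = 0 \<longleftrightarrow> \<beta> = central (snd \<beta>)"
  by (cases \<beta>) (simp add: central_def)

abbreviation plus_idx :: "'n idx set" where
  "plus_idx \<equiv> {\<beta>. fst \<beta> \<noteq> 0}"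

definition plus_supp :: "('n idx list \<Rightarrow> 'm::zero) \<Rightarrow> bool" where
  "plus_supp c \<longleftrightarrow> (\<forall>xs. c xs \<noteq> 0 \<longrightarrow> set xs \<subseteq> plus_idx)"

lemma plus_suppD: "plus_supp c \<Longrightarrow> \<not> set xs \<subseteq> plus_idx \<Longrightarrow> c xs = 0"
  unfolding plus_supp_def by metis

lemma not_plus_idx: "\<not> set xs \<subseteq> plus_idx \<Longrightarrow> \<exists>i. central i \<in> set xs"
proof -
  assume "\<not> set xs \<subseteq> plus_idx"
  then obtain \<beta> where "\<beta> \<in> set xs" "fst \<beta> = 0" by auto
  then show ?thesis using central_iff[of \<beta>] by metis
qed

text \<open>The exterior product, from the left, with the linear form dual to
  \<open>central v\<close>; the second equation is the rule for contracting such a product.\<close>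

fun wedge :: "'n \<Rightarrow> ('n idx list \<Rightarrow> 'm) \<Rightarrow> 'n idx list \<Rightarrow> 'm::ab_group_add" where
  "wedge v c [] = 0"
| "wedge v c (x # xs) = (if x = central v then c xs else 0) - wedge v (ins x c) xs"

lemma wedge_add: "wedge v (\<lambda>xs. c xs + e xs) xs = wedge v c xs + wedge v e xs"
  by (induction xs arbitrary: c e) (simp_all add: ins_def)

lemma wedge_zero: "wedge v (\<lambda>_. 0) xs = 0"
  using wedge_add[of v "\<lambda>_. 0" "\<lambda>_. 0" xs] by simp

lemma wedge_minus: "wedge v (\<lambda>xs. - c xs) xs = - wedge v c xs"
  using wedge_add[of v c "\<lambda>xs. - c xs" xs] by (simp add: wedge_zero eq_neg_iff_add_eq_0 add.commute)

lemma alternating_wedge: "alternating UNIV c \<Longrightarrow> alternating UNIV (wedge v c)"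
  unfolding alternating_def[of UNIV "wedge v c"]
proof (intro allI impI)
  fix us x y vs
  assume "alternating UNIV c"
  then show "wedge v c (us @ x # y # vs) = - wedge v c (us @ y # x # vs)"
  proof (induction us arbitrary: c)
    case Nil
    have "ins y (ins x c) = (\<lambda>zs. - ins x (ins y c) zs)"
    proof
      fix zs show "ins y (ins x c) zs = - ins x (ins y c) zs"
        using alternating_swap[OF Nil, of x y zs] by simp
    qed
    then have "wedge v (ins y (ins x c)) vs = - wedge v (ins x (ins y c)) vs" by (simp only: wedge_minus)
    then show ?case by simp
  next
    case (Cons u us)
    have u: "c (us @ x # y # vs) = - c (us @ y # x # vs)"
      by (rule alternatingD[OF Cons.prems]) simp
    have "wedge v (ins u c) (us @ x # y # vs) = - wedge v (ins u c) (us @ y # x # vs)"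
      by (rule Cons.IH[OF alternating_ins[OF Cons.prems]]) simp
    then show ?case using u by simp
  qed
qed

lemma wedge_absent: "central v \<notin> set xs \<Longrightarrow> wedge v c xs = 0"
  by (induction xs arbitrary: c) auto

lemma wedge_other:
  assumes "\<And>xs. central v \<in> set xs \<Longrightarrow> c xs = 0" "v \<noteq> w" "central v \<in> set xs"
  shows "wedge w c xs = 0"
  using assms(1,3)
proof (induction xs arbitrary: c)
  case (Cons x xs)
  show ?case
  proof (cases "x = central v")
    case True
    then have "ins x c = (\<lambda>_. 0)" using Cons.prems(1) by (simp add: fun_eq_iff)
    then show ?thesis using True assms(2) by (simp add: wedge_zero)
  next
    case False
    then have "c xs = 0" using Cons.prems by simp
    moreover have "wedge w (ins x c) xs = 0" using Cons.prems False by (intro Cons.IH) auto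
    ultimately show ?thesis by simp
  qed
qed simp

lemma bounded_wedge:
  assumes "bounded N c" "N > 0"
  shows "bounded N (wedge v c)"
proof -
  have "wedge v c xs = 0" if "\<beta> \<in> set xs" "N \<le> mdeg \<beta>" for \<beta> xs
    using assms(1) that(1)
  proof (induction xs arbitrary: c)
    case (Cons x xs)
    have ne: "\<beta> \<noteq> central v" using that(2) assms(2) mdeg_eq_0[of \<beta>] by (auto simp del: mdeg_eq_0)
    show ?case
    proof (cases "\<beta> = x")
      case True
      then show ?thesis using bounded_ins_zero[OF Cons.prems(1), of x] that(2) ne by (simp add: wedge_zero)
    next
      case False
      then have "\<beta> \<in> set xs" using Cons.prems(2) by simp
      then have "wedge v (ins x c) xs = 0" "c xs = 0"
        by (rule Cons.IH[OF bounded_ins[OF Cons.prems(1)]], rule boundedD[OF Cons.prems(1) _ that(2)])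
      then show ?thesis by simp
    qed
  qed simp
  then show ?thesis unfolding bounded_def using leI by blast
qed

text \<open>The sum over the subsets I of \<open>vs\<close> of the product of the forms dual to the
  central symbols in I, in the order of \<open>vs\<close>, with \<open>f I\<close>. One recursion
  step separates the subsets without \<open>v\<close> from those with \<open>v\<close>.\<close>

fun ext :: "'n list \<Rightarrow> ('n set \<Rightarrow> 'n idx list \<Rightarrow> 'm) \<Rightarrow> 'n idx list \<Rightarrow> 'm::ab_group_add" where
  "ext [] f = f {}"
| "ext (v # vs) f = (\<lambda>xs. ext vs f xs + wedge v (ext vs (\<lambda>I. f (insert v I))) xs)"

lemma wedge_length:
  "(\<And>zs. Suc (length zs) = length xs \<Longrightarrow> c zs = 0) \<Longrightarrow> wedge v c xs = 0"
proof (induction xs arbitrary: c)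
  case (Cons x xs)
  have "wedge v (ins x c) xs = 0" by (rule Cons.IH) (simp add: Cons.prems)
  then show ?case using Cons.prems[of xs] by simp
qed simp

lemma alternating_add:
  assumes "alternating V c" "alternating V e"
  shows "alternating V (\<lambda>xs. c xs + e xs)"
  unfolding alternating_def
proof (intro allI impI)
  fix us x y vs assume *: "set (us @ x # y # vs) \<subseteq> V"
  show "c (us @ x # y # vs) + e (us @ x # y # vs) = - (c (us @ y # x # vs) + e (us @ y # x # vs))"
    unfolding alternatingD[OF assms(1) *] alternatingD[OF assms(2) *] by simp
qed

lemma alternating_map:
  assumes "alternating V c" "\<And>y. h (- y) = - h y"
  shows "alternating V (\<lambda>xs. h (c xs))"
  unfolding alternating_def
proof (intro allI impI)
  fix us x y vs assume *: "set (us @ x # y # vs) \<subseteq> V"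
  show "h (c (us @ x # y # vs)) = - h (c (us @ y # x # vs))"
    unfolding alternatingD[OF assms(1) *] by (rule assms(2))
qed

lemma alternating_ext: "(\<And>I. alternating UNIV (f I)) \<Longrightarrow> alternating UNIV (ext vs f)"
  by (induction vs arbitrary: f) (simp_all add: alternating_add alternating_wedge)

lemma ext_absent:
  "v \<notin> set vs \<Longrightarrow> (\<And>I. plus_supp (f I)) \<Longrightarrow> central v \<in> set xs \<Longrightarrow> ext vs f xs = 0"
proof (induction vs arbitrary: f xs)
  case Nil
  then show ?case by (force simp: plus_supp_def)
next
  case (Cons w vs)
  have "wedge w (ext vs (\<lambda>I. f (insert w I))) xs = 0"
    using Cons.prems by (intro wedge_other[of v] Cons.IH) auto
  moreover have "ext vs f xs = 0" using Cons.prems by (intro Cons.IH) auto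
  ultimately show ?case by simp
qed

lemma bounded_add: "bounded N c \<Longrightarrow> bounded N e \<Longrightarrow> bounded N (\<lambda>xs. c xs + e xs :: 'm::ab_group_add)"
  unfolding bounded_def
proof (intro allI impI)
  fix xs assume *: "\<forall>xs. c xs \<noteq> 0 \<longrightarrow> (\<forall>\<beta>\<in>set xs. mdeg \<beta> < N)" "\<forall>xs. e xs \<noteq> 0 \<longrightarrow> (\<forall>\<beta>\<in>set xs. mdeg \<beta> < N)"
    and "c xs + e xs \<noteq> 0"
  then have "c xs \<noteq> 0 \<or> e xs \<noteq> 0" by auto
  then show "\<forall>\<beta>\<in>set xs. mdeg \<beta> < N" using * by blast
qed

lemma bounded_ext: "(\<And>I. bounded N (f I)) \<Longrightarrow> N > 0 \<Longrightarrow> bounded N (ext vs f)"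
  by (induction vs arbitrary: f) (simp_all add: bounded_add bounded_wedge)

lemma ext_length:
  "distinct vs \<Longrightarrow> (\<And>I zs. I \<subseteq> set vs \<Longrightarrow> length zs + card I = length xs \<Longrightarrow> f I zs = 0) \<Longrightarrow> ext vs f xs = 0"
proof (induction vs arbitrary: f xs)
  case (Cons v vs)
  have "ext vs f xs = 0" using Cons.prems by (intro Cons.IH) auto
  moreover have "wedge v (ext vs (\<lambda>I. f (insert v I))) xs = 0"
  proof (rule wedge_length, rule Cons.IH)
    fix zs :: "'a idx list" and I and us :: "'a idx list"
    assume *: "Suc (length zs) = length xs" "I \<subseteq> set vs" "length us + card I = length zs"
    then have "card (insert v I) = Suc (card I)"
      using Cons.prems(1) finite_subset[OF *(2)] by (subst card_insert_disjoint) auto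
    then show "f (insert v I) us = 0" using * by (intro Cons.prems(2)) auto
  qed (use Cons.prems in auto)
  ultimately show ?case by simp
qed simp

text \<open>The central arguments stand in the same order as the forms, so each is paired with its
  own form at the front of the list and no sign arises. Summands lacking that form vanish by
  \<open>ext_absent\<close>.\<close>

lemma ext_component:
  "distinct vs \<Longrightarrow> (\<And>I. plus_supp (f I)) \<Longrightarrow> I \<subseteq> set vs \<Longrightarrow> set ys \<subseteq> plus_idx \<Longrightarrow>
   ext vs f (map central (filter (\<lambda>i. i \<in> I) vs) @ ys) = f I ys"
proof (induction vs arbitrary: f I)
  case (Cons v vs)
  let ?g = "\<lambda>I. f (insert v I)" and ?R = "\<lambda>I. map central (filter (\<lambda>i. i \<in> I) vs) @ ys"
  have abs: "central v \<notin> set (?R I)" for I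
    using Cons.prems(1,4) by auto
  show ?case
  proof (cases "v \<in> I")
    case True
    have "filter (\<lambda>i. i \<in> I) vs = filter (\<lambda>i. i \<in> I - {v}) vs"
      using Cons.prems(1) by (intro filter_cong) auto
    then have R: "?R I = ?R (I - {v})" by simp
    have "ins (central v) (ext vs ?g) = (\<lambda>_. 0)"
      using Cons.prems by (auto simp: fun_eq_iff intro!: ext_absent)
    moreover have "ext vs f (central v # ?R I) = 0"
      using Cons.prems by (intro ext_absent[of v]) auto
    ultimately have "ext (v # vs) f (central v # ?R I) = ext vs ?g (?R I)" by (simp add: wedge_zero)
    also have "\<dots> = ?g (I - {v}) ys"
      unfolding R using Cons.prems by (intro Cons.IH) auto
    finally show ?thesis using True by (simp add: insert_absorb)
  next
    case False
    have "ext vs f (?R I) = f I ys" using Cons.prems False by (intro Cons.IH) auto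
    then show ?thesis using False wedge_absent[OF abs] by simp
  qed
qed simp

definition var_list :: "'n::finite list" where
  "var_list = (SOME vs. distinct vs \<and> set vs = UNIV)"

lemma var_list: "distinct (var_list :: 'n::finite list)" "set (var_list :: 'n::finite list) = UNIV"
proof -
  have "\<exists>vs :: 'n list. distinct vs \<and> set vs = UNIV" using finite_distinct_list[OF finite, of UNIV] by blast
  from someI_ex[OF this] show "distinct (var_list :: 'n list)" "set (var_list :: 'n list) = UNIV"
    unfolding var_list_def by blast+
qed

text \<open>The coefficient of the product of the central forms indexed by \<open>I\<close>, as a
  cochain on symbols of L_+; the order of \<open>var_list\<close> fixes the sign.\<close>

definition component :: "('n::finite idx list \<Rightarrow> 'm) \<Rightarrow> 'n set \<Rightarrow> 'n idx list \<Rightarrow> 'm::zero" where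
  "component c I ys = (if set ys \<subseteq> plus_idx then c (map central (filter (\<lambda>i. i \<in> I) var_list) @ ys) else 0)"

lemma length_filter_var_list: "length (filter (\<lambda>i. i \<in> I) var_list) = card (I :: 'n::finite set)"
  using distinct_card[of "filter (\<lambda>i. i \<in> I) (var_list :: 'n list)"] by (simp add: var_list)

lemma plus_supp_component: "plus_supp (component c I)"
  by (auto simp: plus_supp_def component_def)

lemma alternating_component:
  assumes "alternating UNIV c" shows "alternating UNIV (component c I)"
  unfolding alternating_def
proof (intro allI impI)
  fix us x y vs
  show "component c I (us @ x # y # vs) = - component c I (us @ y # x # vs)"
    using alternatingD[OF assms, of "map central (filter (\<lambda>i. i \<in> I) var_list) @ us" x y vs]
    by (auto simp: component_def)
qed

lemma bounded_component: "bounded N c \<Longrightarrow> bounded N (component c I)"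
  unfolding bounded_def component_def by (metis Un_iff set_append)

lemma component_ext:
  assumes "\<And>I. plus_supp (f I)" shows "component (ext var_list f) I = f I"
proof
  fix ys show "component (ext var_list f) I ys = f I ys"
    using ext_component[OF var_list(1) assms, of I ys] var_list(2) assms[of I]
    by (auto simp: component_def plus_supp_def)
qed

lemma alternating_mset:
  "alternating UNIV c \<Longrightarrow> mset xs = mset ys \<Longrightarrow> c ys = c xs \<or> c ys = - c xs"
proof (induction xs arbitrary: c ys)
  case (Cons x xs)
  then have "x \<in> set ys" by (metis list.set_intros(1) set_mset_mset)
  then obtain us vs where ys: "ys = us @ x # vs" by (auto simp: in_set_conv_decomp)
  then have m: "mset xs = mset (us @ vs)" using Cons.prems(2) by simp
  have "c ys = sgnp (length us) (c (x # us @ vs))"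
    unfolding ys by (rule alternating_move[OF Cons.prems(1)]) simp
  moreover have "c (x # us @ vs) = c (x # xs) \<or> c (x # us @ vs) = - c (x # xs)"
    using Cons.IH[OF alternating_ins[OF Cons.prems(1)] m, of x] by simp
  ultimately show ?case by (auto simp: sgnp_def)
qed simp

text \<open>A list without repetitions can be sorted, up to sign, into central symbols in the order
  of \<open>var_list\<close> followed by the others, and there the value is a component.\<close>

lemma component_determines:
  fixes c :: "'n::finite idx list \<Rightarrow> 'm::ab_group_add"
  assumes alt: "alternating UNIV c" and comp: "\<And>I ys. component c I ys = 0"
    and two: "\<And>y :: 'm. y + y = 0 \<Longrightarrow> y = 0"
  shows "c xs = 0"
proof (cases "distinct xs")
  case False
  then show ?thesis using alternating_repeat[OF alt _ subset_UNIV two] by blast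
next
  case True
  define I where "I = {i. central i \<in> set xs}"
  let ?ys = "filter (\<lambda>\<beta>. fst \<beta> \<noteq> 0) xs"
  have "mset (filter (\<lambda>\<beta>. \<not> fst \<beta> \<noteq> 0) xs) = mset (map central (filter (\<lambda>i. i \<in> I) var_list))"
  proof (subst set_eq_iff_mset_eq_distinct[symmetric])
    show "distinct (filter (\<lambda>\<beta>. \<not> fst \<beta> \<noteq> 0) xs)" using True by simp
    show "distinct (map central (filter (\<lambda>i. i \<in> I) (var_list :: 'n list)))"
      by (simp add: distinct_map inj_on_def var_list)
    show "set (filter (\<lambda>\<beta>. \<not> fst \<beta> \<noteq> 0) xs) = set (map central (filter (\<lambda>i. i \<in> I) var_list))"
    proof (intro set_eqI iffI)
      fix \<beta> assume "\<beta> \<in> set (filter (\<lambda>\<beta>. \<not> fst \<beta> \<noteq> 0) xs)"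
      then have "\<beta> \<in> set xs" "\<beta> = central (snd \<beta>)" using central_iff[of \<beta>] by auto
      then show "\<beta> \<in> set (map central (filter (\<lambda>i. i \<in> I) var_list))"
        using image_eqI[of \<beta> central "snd \<beta>" I] by (simp add: I_def var_list)
    next
      fix \<beta> :: "'n idx" assume "\<beta> \<in> set (map central (filter (\<lambda>i. i \<in> I) var_list))"
      then show "\<beta> \<in> set (filter (\<lambda>\<beta>. \<not> fst \<beta> \<noteq> 0) xs)" by (auto simp: I_def)
    qed
  qed
  then have "mset (map central (filter (\<lambda>i. i \<in> I) var_list) @ ?ys) = mset xs"
    using multiset_partition[of "mset xs" "\<lambda>\<beta>. fst \<beta> \<noteq> 0"] by (simp add: mset_filter union_commute)
  moreover have "c (map central (filter (\<lambda>i. i \<in> I) var_list) @ ?ys) = 0"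
    using comp[of I ?ys] by (auto simp: component_def split: if_splits)
  ultimately show ?thesis using alternating_mset[OF alt] by (metis neg_0_equal_iff_equal)
qed

section \<open>The differential on weight spaces and on components\<close>

context L_plus_module
begin

sublocale W: cochain_ops UNIV "idx_br sW" "idx_act s" for s
  by (rule cochain_ops_idx_br[OF vs idx_act_add]) simp

sublocale Wp: cochain_ops plus_idx "idx_br sW" "idx_act s" for s
  by (rule cochain_ops_idx_br[OF vs idx_act_add]) simp

abbreviation dT :: "('n idx list \<Rightarrow> ('n \<Rightarrow> int) \<Rightarrow>\<^sub>0 'w) \<Rightarrow> 'n idx list \<Rightarrow> ('n \<Rightarrow> int) \<Rightarrow>\<^sub>0 'w" where
  "dT \<equiv> cdiff (idx_br (pm_scale sW)) ten_act"

abbreviation weight :: "('n \<Rightarrow> int) \<Rightarrow> ('n idx list \<Rightarrow> ('n \<Rightarrow> int) \<Rightarrow>\<^sub>0 'w) \<Rightarrow> 'n idx list \<Rightarrow> 'w" where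
  "weight s c \<equiv> (\<lambda>xs. Poly_Mapping.lookup (c xs) s)"

lemma two_torsion_free: "y + y = 0 \<Longrightarrow> y = 0" for y :: 'w
proof -
  assume "y + y = 0"
  then have "sW 2 y = 0" using M.scale_left_distrib[of 1 1 y] by (simp add: one_add_one)
  then show ?thesis by simp
qed

lemma weight_lieD: "weight s (lieD (idx_br (pm_scale sW)) ten_act \<beta> c) ys = W.L s \<beta> (weight s c) ys"
  by (induction ys arbitrary: c)
    (simp_all add: lookup_ten_act lookup_minus ins_def idx_br_def lookup_pm_scale[OF vs])

lemma weight_dT: "weight s (dT c) ys = W.d s (weight s c) ys"
proof (induction ys arbitrary: c)
  case (Cons y ys)
  show ?case using weight_lieD[where s = s and \<beta> = y and c = c and ys = ys] Cons[of "ins y c"] by (simp add: lookup_minus ins_def)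
qed simp

lemma lieD_central: "W.L s (central i) c ys = sW (of_int (s i)) (c ys)"
  by (induction ys arbitrary: c) (simp_all add: idx_act_def idx_br_def)

lemma cdiff_central: "W.d s c (central i # ys) = - sW (of_int (s i)) (c ys) - W.d s (ins (central i) c) ys"
  by (simp add: lieD_central)

lemma cdiff_central_zero: "W.d 0 c (central i # ys) = - W.d 0 (ins (central i) c) ys"
proof -
  have "W.L 0 (central i) c ys = 0" by (simp add: lieD_central)
  then show ?thesis by (simp only: cdiff.simps minus_zero diff_0)
qed

lemma lieD_scale_idx: "W.L s \<beta> (\<lambda>xs. sW q (c xs)) ys = sW q (W.L s \<beta> c ys)"
  by (induction ys arbitrary: c)
    (simp_all add: idx_act_scale ins_def idx_br_def M.scale_right_diff_distrib mult.commute)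

lemma cdiff_scale_idx: "W.d s (\<lambda>xs. sW q (c xs)) ys = sW q (W.d s c ys)"
  by (induction ys arbitrary: c)
    (simp_all add: lieD_scale_idx ins_def M.scale_right_diff_distrib)

text \<open>In the present sign convention contraction and differential satisfy \<iota> d + d
  \<iota> = - L, and the Lie derivative along \<open>central i\<close> is multiplication by s_i;
  this is the origin of the minus sign in the factor.\<close>

lemma cdiff_nonzero_weight:
  assumes "W.d s c = (\<lambda>_. 0)" "s i \<noteq> 0"
  shows "W.d s (\<lambda>xs. sW (- (1 / of_int (s i))) (c (central i # xs))) ys = c ys"
proof -
  have "W.d s (ins (central i) c) ys = - sW (of_int (s i)) (c ys)"
    using fun_cong[OF assms(1), of "central i # ys"] unfolding cdiff_central
    by (simp only: diff_eq_eq add_0)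
  moreover have "W.d s (\<lambda>xs. sW (- (1 / of_int (s i))) (ins (central i) c xs)) ys =
      sW (- (1 / of_int (s i))) (W.d s (ins (central i) c) ys)"
    by (rule cdiff_scale_idx)
  ultimately show ?thesis using assms(2) by simp
qed

text \<open>At weight 0 the Lie derivative along a central symbol vanishes, so contraction with it
  anticommutes with the differential.\<close>

lemma cdiff_zero_weight_central:
  "W.d 0 c (map central is @ ys) = sgnp (length is) (W.d 0 (\<lambda>zs. c (map central is @ zs)) ys)"
proof (induction "is" arbitrary: c)
  case (Cons i "is")
  have "W.d 0 c (map central (i # is) @ ys) = - W.d 0 (ins (central i) c) (map central is @ ys)"
    using cdiff_central[of 0 c i "map central is @ ys"] by (simp del: cdiff.simps)
  also have "\<dots> = - sgnp (length is) (W.d 0 (\<lambda>zs. ins (central i) c (map central is @ zs)) ys)"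
    by (simp only: Cons.IH)
  finally show ?case by (simp only: length_Cons sgnp_simps list.map append_Cons ins_apply)
qed simp

lemma alternating_W_d: "alternating UNIV c \<Longrightarrow> alternating UNIV (W.d s c)"
  by (rule alternating_cdiff_idx[OF vs idx_act_add])

lemma plus_supp_W_d:
  assumes "alternating UNIV c" "plus_supp c" shows "plus_supp (W.d 0 c)"
  unfolding plus_supp_def
proof (intro allI impI, rule ccontr)
  fix xs assume nz: "W.d 0 c xs \<noteq> 0" and "\<not> set xs \<subseteq> plus_idx"
  from not_plus_idx[OF this(2)] obtain i us ws where xs: "xs = us @ central i # ws" by (auto simp: in_set_conv_decomp)
  have "ins (central i) c = (\<lambda>_. 0)" using assms(2) by (force simp: plus_supp_def fun_eq_iff)
  then have "W.d 0 c (central i # us @ ws) = 0" unfolding cdiff_central_zero by (simp only: W.cdiff_zero subset_UNIV minus_zero)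
  then show False
    using nz alternating_move[OF alternating_W_d[OF assms(1)], of us "central i" ws 0] by (simp add: xs)
qed

text \<open>Dually, the forms of the central symbols are closed, and the differential picks up one
  sign for each of them that it passes.\<close>

lemma component_W_d:
  assumes alt: "alternating UNIV c"
  shows "component (W.d 0 c) I = (\<lambda>ys. sgnp (card I) (W.d 0 (component c I) ys))"
proof
  fix ys
  let ?is = "filter (\<lambda>i. i \<in> I) var_list"
  show "component (W.d 0 c) I ys = sgnp (card I) (W.d 0 (component c I) ys)"
  proof (cases "set ys \<subseteq> plus_idx")
    case True
    have "W.d 0 (component c I) ys = W.d 0 (\<lambda>zs. c (map central ?is @ zs)) ys"
      by (rule Wp.cdiff_cong[OF True]) (simp add: component_def)
    then show ?thesis using True
      by (simp add: component_def cdiff_zero_weight_central length_filter_var_list)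
  next
    case False
    then show ?thesis
      using plus_supp_W_d[OF alternating_component[OF alt] plus_supp_component, of I]
      by (auto simp: component_def plus_supp_def)
  qed
qed

lemma component_ext_cdiff:
  assumes alt: "\<And>I. alternating UNIV (f I)" and supp: "\<And>I. plus_supp (f I)"
    and c: "alternating UNIV c" "\<And>I. component c I = (\<lambda>ys. sgnp (card I) (W.d 0 (f I) ys))"
  shows "W.d 0 (ext var_list f) = c"
proof
  fix xs
  let ?D = "\<lambda>xs. W.d 0 (ext var_list f) xs + - c xs"
  have "?D xs = 0"
  proof (rule component_determines[of ?D, OF _ _ two_torsion_free])
    have "alternating UNIV (\<lambda>xs. - c xs)"
      by (rule alternating_map[OF c(1)]) simp
    then show "alternating UNIV ?D"
      by (intro alternating_add alternating_W_d alternating_ext alt)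
    fix I ys
    show "component ?D I ys = 0"
      using fun_cong[OF component_W_d[OF alternating_ext[of f, OF alt]], of var_list I ys] fun_cong[OF c(2), of I ys]
      by (simp add: component_ext[OF supp]) (auto simp: component_def split: if_splits)
  qed
  then show "W.d 0 (ext var_list f) xs = c xs" by simp
qed

definition weight_idx :: "('n \<Rightarrow> int) \<Rightarrow> 'n" where
  "weight_idx s = (SOME i. s i \<noteq> 0)"

lemma weight_idx: "s \<noteq> 0 \<Longrightarrow> s (weight_idx s) \<noteq> 0"
  unfolding weight_idx_def by (rule someI_ex) (auto simp: fun_eq_iff)

text \<open>The primitive is built weight by weight: at weight 0 from the given primitives
  \<open>b I\<close> of the components, elsewhere by the contracting homotopy for the index
  \<open>weight_idx s\<close>. Only finitely many weights occur in a value of \<open>e\<close>,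
  because the homotopies act weight by weight on the finitely many values
  \<open>c (central i # xs)\<close>.\<close>

lemma T_primitive:
  assumes alt: "alternating UNIV c" and bd: "bounded N c" and N: "N > 0"
    and len: "\<And>xs. length xs \<noteq> m \<Longrightarrow> c xs = 0" and dc: "dT c = (\<lambda>_. 0)"
    and b: "\<And>I. alternating UNIV (b I)" "\<And>I. plus_supp (b I)" "\<And>I. bounded N (b I)"
      "\<And>I ys. Suc (length ys + card I) \<noteq> m \<Longrightarrow> b I ys = 0" "\<And>I. component (weight 0 c) I = W.d 0 (b I)"
  obtains e where "alternating UNIV e" "bounded N e" "\<And>xs. Suc (length xs) \<noteq> m \<Longrightarrow> e xs = 0" "dT e = c"
proof -
  \<comment> \<open>The sign compensates the one in \<open>component_W_d\<close>.\<close>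
  define f where "f I = (\<lambda>ys. sgnp (card I) (b I ys))" for I
  \<comment> \<open>\<open>h i\<close> treats the weights for which i is the chosen index, so that
    the sum over i meets every nonzero weight exactly once.\<close>
  define h where "h i = (\<lambda>s w. if s \<noteq> 0 \<and> weight_idx s = i then sW (- (1 / of_int (s i))) w else 0)" for i
  define e where "e xs = Poly_Mapping.single 0 (ext var_list f xs) + (\<Sum>i\<in>UNIV. pm_map (h i) (c (central i # xs)))" for xs
  have f: "alternating UNIV (f I)" "plus_supp (f I)" "bounded N (f I)" for I
  proof -
    show "alternating UNIV (f I)" unfolding f_def by (rule alternating_map[OF b(1)]) simp
    show "plus_supp (f I)" using b(2)[of I] unfolding f_def plus_supp_def by simp
    show "bounded N (f I)" using b(3)[of I] unfolding f_def bounded_def by simp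
  qed
  have e0: "weight 0 e xs = ext var_list f xs" for xs
    by (simp add: e_def lookup_add lookup_sum lookup_pm_map h_def)
  have es: "weight s e xs = sW (- (1 / of_int (s (weight_idx s)))) (weight s c (central (weight_idx s) # xs))"
    if "s \<noteq> 0" for s xs
    using that by (simp add: e_def lookup_add lookup_sum lookup_pm_map h_def lookup_single when_def if_distrib cong: if_cong)
  show ?thesis
  proof (rule that[of e])
    have alte: "alternating UNIV (ext var_list f)" by (rule alternating_ext[OF f(1)])
    show "alternating UNIV e"
      unfolding alternating_def
    proof (intro allI impI poly_mapping_eqI)
      fix us x y vs s
      show "weight s e (us @ x # y # vs) = Poly_Mapping.lookup (- e (us @ y # x # vs)) s"
      proof (cases "s = 0")
        case True
        then show ?thesis using alternatingD[OF alte, of us x y vs] by (simp add: e0)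
      next
        case False
        then show ?thesis
          using alternatingD[OF alt, of "central (weight_idx s) # us" x y vs] by (simp add: es)
      qed
    qed
    have c0: "c (central i # xs) = 0" if "\<beta> \<in> set xs" "N \<le> mdeg \<beta>" for \<beta> i xs
      by (rule boundedD[OF bd _ that(2)]) (use that(1) in simp)
    have z: "pm_map (h i) 0 = 0" for i by (simp add: pm_map_def)
    show "bounded N e"
      unfolding bounded_def
    proof (intro allI impI ballI, rule ccontr)
      fix xs and \<beta> :: "'n idx" assume nz: "e xs \<noteq> 0" and *: "\<beta> \<in> set xs" "\<not> mdeg \<beta> < N"
      have "ext var_list f xs = 0"
        using boundedD[OF bounded_ext[OF f(3) N] *(1), of var_list] * by simp
      then show False using nz c0[OF *(1)] * by (simp add: e_def z)
    qed
    show "e xs = 0" if "Suc (length xs) \<noteq> m" for xs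
    proof -
      have "ext var_list f xs = 0"
        using that by (intro ext_length[OF var_list(1)]) (auto simp: f_def intro!: b(4))
      then show ?thesis using that len[of "central _ # xs"] by (simp add: e_def z)
    qed
    show "dT e = c"
    proof (intro ext poly_mapping_eqI)
      fix xs s
      have dW: "W.d s (weight s c) = (\<lambda>_. 0)"
        using weight_dT[where s = s and c = c] dc by (auto simp: fun_eq_iff)
      show "weight s (dT e) xs = weight s c xs"
      proof (cases "s = 0")
        case True
        have "W.d 0 (ext var_list f) = weight 0 c"
        proof (rule component_ext_cdiff[OF f(1,2)])
          show "alternating UNIV (weight 0 c)"
            by (rule alternating_map[OF alt]) simp
          show "component (weight 0 c) I = (\<lambda>ys. sgnp (card I) (W.d 0 (f I) ys))" for I
            unfolding f_def b(5) by (simp add: W.cdiff_sgnp)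
        qed
        moreover have "weight 0 e = ext var_list f" by (rule ext) (rule e0)
        ultimately show ?thesis unfolding weight_dT True by simp
      next
        case False
        have "weight s e = (\<lambda>xs. sW (- (1 / of_int (s (weight_idx s)))) (weight s c (central (weight_idx s) # xs)))"
          by (rule ext) (rule es[OF False])
        then show ?thesis
          unfolding weight_dT using cdiff_nonzero_weight[OF dW weight_idx[OF False]] by simp
      qed
    qed
  qed
qed

text \<open>Prescribed components are realized by a cochain concentrated at weight 0, where the
  differential acts on components one by one.\<close>

lemma T_cocycle:
  assumes N: "N > 0" and f: "\<And>I. alternating UNIV (f I)" "\<And>I. plus_supp (f I)" "\<And>I. bounded N (f I)"
      "\<And>I ys. length ys + card I \<noteq> m \<Longrightarrow> f I ys = 0" "\<And>I. W.d 0 (f I) = (\<lambda>_. 0)"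
  obtains c where "alternating UNIV c" "bounded N c" "\<And>xs. length xs \<noteq> m \<Longrightarrow> c xs = 0"
    "dT c = (\<lambda>_. 0)" "\<And>I. component (weight 0 c) I = f I"
proof -
  define c where "c xs = Poly_Mapping.single (0 :: 'n \<Rightarrow> int) (ext var_list f xs)" for xs
  have c0: "weight 0 c = ext var_list f" by (simp add: c_def fun_eq_iff)
  have cs: "weight s c = (\<lambda>_. 0)" if "s \<noteq> 0" for s
    by (rule HOL.ext) (simp add: c_def lookup_single_not_eq[OF that[symmetric]])
  show ?thesis
  proof (rule that[of c])
    have alte: "alternating UNIV (ext var_list f)" by (rule alternating_ext[OF f(1)])
    then show "alternating UNIV c" unfolding c_def by (rule alternating_map) (simp add: single_uminus)
    show "bounded N c" using bounded_ext[of N f var_list, OF f(3) N] unfolding bounded_def c_def by (metis single_zero)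
    show "c xs = 0" if "length xs \<noteq> m" for xs
    proof -
      have "ext var_list f xs = 0"
        using that by (intro ext_length[OF var_list(1)]) (auto intro!: f(4))
      then show ?thesis by (simp add: c_def)
    qed
    show "dT c = (\<lambda>_. 0)"
    proof (intro ext poly_mapping_eqI)
      fix xs s
      have "W.d 0 (ext var_list f) = (\<lambda>_. 0)"
        by (rule component_ext_cdiff[OF f(1,2)]) (simp add: alternating_def, simp add: component_def f(5) fun_eq_iff)
      then show "weight s (dT c) xs = Poly_Mapping.lookup 0 s"
        unfolding weight_dT by (cases "s = 0") (simp_all add: c0 cs W.cdiff_zero)
    qed
    show "component (weight 0 c) I = f I" for I
      unfolding c0 by (rule component_ext[OF f(2)])
  qed
qed

end

section \<open>The Chevalley--Eilenberg complex\<close>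

context lie_module
begin

sublocale CE: cochain_ops L "ins_br br" act
  by (rule cochain_ops_ins_br[OF br_closed])
    (use act_linear in \<open>simp_all add: linear_vs_iff[OF M.vector_space_axioms M.vector_space_axioms]\<close>)

text \<open>As with \<open>gf_class\<close>, the number of arguments is left open so that
  contraction and differential stay inside.\<close>

definition ce_class :: "('l list \<Rightarrow> 'm) set" where
  "ce_class = {\<phi>. alternating L \<phi> \<and>
    (\<forall>x\<in>L. \<forall>y\<in>L. \<forall>xs. set xs \<subseteq> L \<longrightarrow> \<phi> ((x + y) # xs) = \<phi> (x # xs) + \<phi> (y # xs)) \<and>
    (\<forall>c. \<forall>x\<in>L. \<forall>xs. set xs \<subseteq> L \<longrightarrow> \<phi> (sL c x # xs) = sM c (\<phi> (x # xs)))}"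

lemma ce_classD:
  assumes "\<phi> \<in> ce_class"
  shows "alternating L \<phi>"
    and "x \<in> L \<Longrightarrow> y \<in> L \<Longrightarrow> set xs \<subseteq> L \<Longrightarrow> \<phi> ((x + y) # xs) = \<phi> (x # xs) + \<phi> (y # xs)"
    and "x \<in> L \<Longrightarrow> set xs \<subseteq> L \<Longrightarrow> \<phi> (sL c x # xs) = sM c (\<phi> (x # xs))"
  using assms by (simp_all add: ce_class_def)

lemma ce_class_ins:
  assumes \<phi>: "\<phi> \<in> ce_class" and x: "x \<in> L" shows "ins x \<phi> \<in> ce_class"
proof -
  note alt = ce_classD(1)[OF \<phi>]
  have sw: "\<phi> (x # y # ys) = - \<phi> (y # x # ys)" if "y \<in> L" "set ys \<subseteq> L" for y ys
    using that by (intro alternating_swap[OF alt x])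
  show ?thesis
    unfolding ce_class_def
  proof (intro CollectI conjI ballI allI impI)
    show "alternating L (ins x \<phi>)" by (rule alternating_ins[OF alt x])
  next
    fix y z ys assume "y \<in> L" "z \<in> L" "set ys \<subseteq> L"
    then show "ins x \<phi> ((y + z) # ys) = ins x \<phi> (y # ys) + ins x \<phi> (z # ys)"
      using ce_classD(2)[OF \<phi>, of y z "x # ys"] x subspace_add[OF subspace_L, of y z] by (simp add: sw)
  next
    fix c y ys assume "y \<in> L" "set ys \<subseteq> L"
    then show "ins x \<phi> (sL c y # ys) = sM c (ins x \<phi> (y # ys))"
      using ce_classD(3)[OF \<phi>, of y "x # ys" c] x subspace_scale[OF subspace_L, of y c] by (simp add: sw)
  qed
qed

lemma ce_class_uminus: "\<phi> \<in> ce_class \<Longrightarrow> x \<in> L \<Longrightarrow> set xs \<subseteq> L \<Longrightarrow> \<phi> (- x # xs) = - \<phi> (x # xs)"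
  using ce_classD(3)[of \<phi> x xs "- 1"] by simp

lemma ce_class_diff: "\<phi> \<in> ce_class \<Longrightarrow> x \<in> L \<Longrightarrow> y \<in> L \<Longrightarrow> set xs \<subseteq> L \<Longrightarrow> \<phi> ((x - y) # xs) = \<phi> (x # xs) - \<phi> (y # xs)"
  using ce_classD(2)[of \<phi> x "- y" xs] ce_class_uminus[of \<phi> y xs] subspace_neg[OF subspace_L, of y] by simp

lemma br_anti: "x \<in> L \<Longrightarrow> y \<in> L \<Longrightarrow> br x y = - br y x"
proof -
  assume *: "x \<in> L" "y \<in> L"
  then have "x + y \<in> L" by (rule subspace_add[OF subspace_L])
  then have "br (x + y) (x + y) = (br x x + br x y) + (br y x + br y y)"
    using * by (simp add: br_add_left br_add_right)
  then show ?thesis using * \<open>x + y \<in> L\<close> by (simp add: br_self eq_neg_iff_add_eq_0)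
qed

lemma lieD_Cons: "CE.L x \<phi> (z # zs) = CE.L x (ins z \<phi>) zs - \<phi> (br x z # zs)"
  by (simp only: lieD.simps ins_br_def)

lemma lieD_add_left:
  "\<phi> \<in> ce_class \<Longrightarrow> x \<in> L \<Longrightarrow> y \<in> L \<Longrightarrow> set zs \<subseteq> L \<Longrightarrow> CE.L (x + y) \<phi> zs = CE.L x \<phi> zs + CE.L y \<phi> zs"
proof (induction zs arbitrary: \<phi>)
  case (Cons z zs)
  have "CE.L (x + y) (ins z \<phi>) zs = CE.L x (ins z \<phi>) zs + CE.L y (ins z \<phi>) zs"
    using Cons.prems by (intro Cons.IH ce_class_ins) auto
  then show ?case
    unfolding lieD_Cons using Cons.prems ce_classD(2)[of \<phi> "br x z" "br y z" zs]
    by (simp add: br_add_left br_closed)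
qed (simp add: act_add)

lemma lieD_scale_left:
  "\<phi> \<in> ce_class \<Longrightarrow> x \<in> L \<Longrightarrow> set zs \<subseteq> L \<Longrightarrow> CE.L (sL c x) \<phi> zs = sM c (CE.L x \<phi> zs)"
proof (induction zs arbitrary: \<phi>)
  case (Cons z zs)
  have "CE.L (sL c x) (ins z \<phi>) zs = sM c (CE.L x (ins z \<phi>) zs)"
    using Cons.prems by (intro Cons.IH ce_class_ins) auto
  then show ?case
    unfolding lieD_Cons using Cons.prems ce_classD(3)[of \<phi> "br x z" zs c]
    by (simp add: br_scale_left br_closed M.scale_right_diff_distrib)
qed (simp add: act_scale)

lemma act_scale_right': "x \<in> L \<Longrightarrow> act x (sM c m) = sM c (act x m)"
  using act_linear by (simp add: linear_vs_iff[OF M.vector_space_axioms M.vector_space_axioms])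

lemma lieD_scale_right: "x \<in> L \<Longrightarrow> CE.L x (\<lambda>xs. sM c (\<phi> xs)) zs = sM c (CE.L x \<phi> zs)"
  by (induction zs arbitrary: \<phi>) (simp_all add: act_scale_right' ins_def ins_br_def M.scale_right_diff_distrib)

lemma cdiff_scale_right: "set zs \<subseteq> L \<Longrightarrow> CE.d (\<lambda>xs. sM c (\<phi> xs)) zs = sM c (CE.d \<phi> zs)"
  by (induction zs arbitrary: \<phi>) (simp_all add: lieD_scale_right ins_def M.scale_right_diff_distrib)

lemma ce_class_cdiff: "\<phi> \<in> ce_class \<Longrightarrow> CE.d \<phi> \<in> ce_class"
proof -
  assume \<phi>: "\<phi> \<in> ce_class"
  show ?thesis
    unfolding ce_class_def
  proof (intro CollectI conjI ballI allI impI)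
    show "alternating L (CE.d \<phi>)"
    proof (rule CE.alternating_cdiff[OF ce_classD(1)[OF \<phi>] \<phi> ce_class_ins])
      fix c x y ys assume *: "c \<in> ce_class" "x \<in> L" "y \<in> L" "set ys \<subseteq> L"
      have "c (br x y # ys) = c (- br y x # ys)" by (simp only: br_anti[OF *(2,3)])
      also have "\<dots> = - c (br y x # ys)" using * by (intro ce_class_uminus) (auto simp: br_closed)
      finally show "ins_br br x y c ys = - ins_br br y x c ys" by (simp add: ins_br_def)
    qed
  next
    fix x y ys assume *: "x \<in> L" "y \<in> L" "set ys \<subseteq> L"
    have "CE.d (ins (x + y) \<phi>) ys = CE.d (\<lambda>zs. ins x \<phi> zs + ins y \<phi> zs) ys"
      using * by (intro CE.cdiff_cong) (auto simp: ce_classD(2)[OF \<phi>])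
    also have "\<dots> = CE.d (ins x \<phi>) ys + CE.d (ins y \<phi>) ys" by (rule CE.cdiff_add[OF *(3)])
    finally show "CE.d \<phi> ((x + y) # ys) = CE.d \<phi> (x # ys) + CE.d \<phi> (y # ys)"
      using * by (simp add: lieD_add_left[OF \<phi>])
  next
    fix c x ys assume *: "x \<in> L" "set ys \<subseteq> L"
    have "CE.d (ins (sL c x) \<phi>) ys = CE.d (\<lambda>zs. sM c (ins x \<phi> zs)) ys"
      using * by (intro CE.cdiff_cong) (auto simp: ce_classD(3)[OF \<phi>])
    also have "\<dots> = sM c (CE.d (ins x \<phi>) ys)" by (rule cdiff_scale_right[OF *(2)])
    finally show "CE.d \<phi> (sL c x # ys) = sM c (CE.d \<phi> (x # ys))"
      using * by (simp add: lieD_scale_left[OF \<phi>] M.scale_right_diff_distrib)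
  qed
qed

lemma ins_lieD: "ins y (CE.L x \<phi>) = (\<lambda>zs. CE.L x (ins y \<phi>) zs + - ins (br x y) \<phi> zs)"
  by (rule ext) (simp add: ins_br_def)

text \<open>Peeling off \<open>z\<close> on both sides leaves the mixed terms, which are symmetric
  in x and y, and three double brackets that match by the Jacobi identity.\<close>

lemma lieD_commutator:
  assumes x: "x \<in> L" and y: "y \<in> L"
  shows "\<phi> \<in> ce_class \<Longrightarrow> set zs \<subseteq> L \<Longrightarrow>
    CE.L x (CE.L y \<phi>) zs - CE.L y (CE.L x \<phi>) zs = CE.L (br x y) \<phi> zs"
proof (induction zs arbitrary: \<phi>)
  case Nil
  then show ?case by (simp add: act_br x y)
next
  case (Cons z zs)
  then have z: "z \<in> L" "set zs \<subseteq> L" by auto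
  have exp: "CE.L x (CE.L y \<phi>) (z # zs) = CE.L x (CE.L y (ins z \<phi>)) zs - CE.L x (ins (br y z) \<phi>) zs
      - CE.L y (ins (br x z) \<phi>) zs + \<phi> (br y (br x z) # zs)" if "x \<in> L" "y \<in> L" for x y
    unfolding lieD_Cons ins_lieD CE.lieD_add[OF that(1)] CE.lieD_minus[OF that(1)] by (simp add: ins_def)
  have "br (br x y) z = br x (br y z) - br y (br x z)"
  proof -
    have A: "br y (br z x) = - br y (br x z)"
      using br_anti[OF z(1) x] br_scale_right[of y "br x z" "- 1"] x y z by (simp add: br_closed)
    have B: "br z (br x y) = - br (br x y) z" by (rule br_anti[OF z(1) br_closed[OF x y]])
    show ?thesis using jacobi[OF x y z(1)] unfolding A B by simp
  qed
  then have "\<phi> (br (br x y) z # zs) = \<phi> (br x (br y z) # zs) - \<phi> (br y (br x z) # zs)"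
    using ce_class_diff[OF Cons.prems(1)] x y z by (simp add: br_closed)
  moreover have "CE.L x (CE.L y (ins z \<phi>)) zs - CE.L y (CE.L x (ins z \<phi>)) zs = CE.L (br x y) (ins z \<phi>) zs"
    by (rule Cons.IH[OF ce_class_ins[OF Cons.prems(1) z(1)] z(2)])
  moreover have "CE.L (br x y) \<phi> (z # zs) = CE.L (br x y) (ins z \<phi>) zs - \<phi> (br (br x y) z # zs)"
    by (rule lieD_Cons)
  ultimately show ?case unfolding exp[OF x y] exp[OF y x] by (simp add: algebra_simps)
qed

lemma ins_cdiff: "ins y (CE.d \<phi>) = (\<lambda>zs. - (CE.L y \<phi> zs + CE.d (ins y \<phi>) zs))"
  by (rule ext) simp

lemma cdiff_lieD:
  assumes x: "x \<in> L"
  shows "\<phi> \<in> ce_class \<Longrightarrow> set zs \<subseteq> L \<Longrightarrow> CE.d (CE.L x \<phi>) zs = CE.L x (CE.d \<phi>) zs"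
proof (induction zs arbitrary: \<phi>)
  case Nil
  then show ?case using CE.act_add[OF x, of 0 0] by simp
next
  case (Cons y ys)
  then have y: "y \<in> L" "set ys \<subseteq> L" by auto
  have "CE.d (ins y (CE.L x \<phi>)) ys = CE.d (CE.L x (ins y \<phi>)) ys - CE.d (ins (br x y) \<phi>) ys"
    unfolding ins_lieD CE.cdiff_add[OF y(2)] CE.cdiff_minus[OF y(2)] by (simp add: ins_def)
  then have l: "CE.d (CE.L x \<phi>) (y # ys) = - CE.L y (CE.L x \<phi>) ys - CE.d (CE.L x (ins y \<phi>)) ys + CE.d (ins (br x y) \<phi>) ys"
    unfolding cdiff.simps(2) by (simp only: minus_diff_eq diff_conv_add_uminus minus_add_distrib minus_minus add_ac)
  have "CE.L x (ins y (CE.d \<phi>)) ys = - (CE.L x (CE.L y \<phi>) ys + CE.L x (CE.d (ins y \<phi>)) ys)"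
    unfolding ins_cdiff CE.lieD_minus[OF x] CE.lieD_add[OF x] ..
  then have r: "CE.L x (CE.d \<phi>) (y # ys) = - CE.L x (CE.L y \<phi>) ys - CE.L x (CE.d (ins y \<phi>)) ys
      + CE.L (br x y) \<phi> ys + CE.d (ins (br x y) \<phi>) ys"
    unfolding lieD_Cons cdiff.simps(2) by (simp add: ins_def)
  show ?case
    unfolding l r Cons.IH[OF ce_class_ins[OF Cons.prems(1) y(1)] y(2)] lieD_commutator[OF x y(1) Cons.prems(1) y(2), symmetric]
    by simp
qed

text \<open>Since the differential commutes with Lie derivatives, Cartan's formula applied twice
  gives \<iota>_x d d = d d \<iota>_x, which is an induction on the number of arguments.\<close>

lemma cdiff_cdiff: "\<phi> \<in> ce_class \<Longrightarrow> set zs \<subseteq> L \<Longrightarrow> CE.d (CE.d \<phi>) zs = 0"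
proof (induction zs arbitrary: \<phi>)
  case (Cons x zs)
  then have x: "x \<in> L" "set zs \<subseteq> L" by auto
  have "CE.d (ins x (CE.d \<phi>)) zs = - (CE.d (CE.L x \<phi>) zs + CE.d (CE.d (ins x \<phi>)) zs)"
    unfolding ins_cdiff CE.cdiff_minus[OF x(2)] CE.cdiff_add[OF x(2)] ..
  then show ?case
    using Cons.IH[OF ce_class_ins[OF Cons.prems(1) x(1)] x(2)] cdiff_lieD[OF x(1) Cons.prems(1) x(2)] by simp
qed simp

end

section \<open>Cochains on the vector fields vanishing at the origin\<close>

definition lcoef :: "(('n::finite, 'k::field_char_0) mpoly \<Rightarrow> ('n, 'k) mpoly) \<Rightarrow> 'n idx \<Rightarrow> 'k" where
  "lcoef D \<beta> = Poly_Mapping.lookup (D (Poly_Mapping.single (unit_exp (snd \<beta>)) 1)) (fst \<beta>)"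

definition lsupp :: "(('n::finite, 'k::field_char_0) mpoly \<Rightarrow> ('n, 'k) mpoly) \<Rightarrow> 'n idx set" where
  "lsupp D = {\<beta>. fst \<beta> \<noteq> 0 \<and> lcoef D \<beta> \<noteq> 0}"

lemma finite_lsupp: "finite (lsupp D)"
proof (rule finite_subset)
  show "lsupp D \<subseteq> (\<Union>i. Poly_Mapping.keys (D (Poly_Mapping.single (unit_exp i) 1)) \<times> {i})"
    by (force simp: lsupp_def lcoef_def in_keys_iff)
qed auto

lemma lcoef_add: "lcoef (D + E) \<beta> = lcoef D \<beta> + lcoef E \<beta>"
  and lcoef_scale: "lcoef (field_scale c D) \<beta> = c * lcoef D \<beta>"
  by (simp_all add: lcoef_def lookup_add fun_scale_def lookup_pm_scale[OF vector_space_mult])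

lemma lcoef_zero: "lcoef 0 \<beta> = 0"
  by (simp add: lcoef_def)

lemma lcoef_sum: "lcoef (\<Sum>i\<in>I. f i) \<beta> = (\<Sum>i\<in>I. lcoef (f i) \<beta>)"
proof (induction I rule: infinite_finite_induct)
  case (infinite A)
  show ?case unfolding sum.infinite[OF infinite] by (rule lcoef_zero)
next
  case empty
  show ?case unfolding sum.empty by (rule lcoef_zero)
next
  case (insert x F)
  show ?case unfolding sum.insert[OF insert.hyps] lcoef_add insert.IH ..
qed

lemma lcoef_mfield: "lcoef (mfield \<beta> :: ('n::finite, 'k::field_char_0) mpoly \<Rightarrow> _) \<gamma> = (if \<beta> = \<gamma> then 1 else 0)"
proof -
  have "mfield \<beta> (Poly_Mapping.single (unit_exp i) 1) = (if snd \<beta> = i then Poly_Mapping.single (fst \<beta>) 1 else (0 :: ('n, 'k) mpoly))" for i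
  proof -
    have "unit_exp i - unit_exp i = (0 :: 'n \<Rightarrow> nat)" by auto
    then show ?thesis by (simp add: monomial_field_def mpoly_partial_single mult_single) (simp add: unit_exp_def)
  qed
  then show ?thesis by (auto simp: lcoef_def lookup_single when_def prod_eq_iff)
qed

lemma lsupp_mfield: "fst \<beta> \<noteq> 0 \<Longrightarrow> lsupp (mfield \<beta>) = {\<beta>}"
  by (auto simp: lsupp_def lcoef_mfield split: if_splits)

text \<open>The functionals \<open>lcoef\<close>, which read off the coefficients of D X_i, are dual
  to the monomial fields; so they recover the coefficients in any expression of
  \<open>D\<close>.\<close>

lemma L_plus_expansion:
  fixes D :: "('n::finite, 'k::field_char_0) mpoly \<Rightarrow> ('n, 'k) mpoly"
  assumes "D \<in> L_plus"
  shows "D = (\<Sum>\<beta>\<in>lsupp D. field_scale (lcoef D \<beta>) (mfield \<beta>))"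
proof -
  interpret F: vector_space field_scale
    by (rule vector_space_fun_scale[OF vector_space_pm])
  have "{monomial_field k i |k i. k \<noteq> 0} = (mfield ` plus_idx :: (('n, 'k) mpoly \<Rightarrow> _) set)"
  proof (intro set_eqI iffI)
    fix E :: "('n, 'k) mpoly \<Rightarrow> ('n, 'k) mpoly" assume "E \<in> {monomial_field k i |k i. k \<noteq> 0}"
    then obtain k i where "E = mfield (k, i)" "(k, i) \<in> plus_idx" by auto
    then show "E \<in> mfield ` plus_idx" by (rule image_eqI)
  qed auto
  then have "D \<in> F.span (mfield ` plus_idx)" using assms unfolding L_plus_eq_span by simp
  then obtain t r where t: "finite t" "t \<subseteq> mfield ` plus_idx" and D: "D = (\<Sum>a\<in>t. field_scale (r a) a)"
    unfolding F.span_explicit by blast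
  obtain P where P: "P \<subseteq> plus_idx" "inj_on (mfield :: 'n idx \<Rightarrow> ('n, 'k) mpoly \<Rightarrow> _) P" "t = mfield ` P"
    using t(2)[unfolded subset_image_inj] by (elim exE conjE) (rule that)
  have D': "D = (\<Sum>\<beta>\<in>P. field_scale (r (mfield \<beta>)) (mfield \<beta>))"
    using P by (simp add: D sum.reindex)
  have fP: "finite P" using t(1) P by (simp add: finite_image_iff)
  have lc: "lcoef D \<gamma> = (if \<gamma> \<in> P then r (mfield \<gamma>) else 0)" for \<gamma>
    unfolding D' lcoef_sum lcoef_scale lcoef_mfield using fP by (simp add: if_distrib cong: if_cong)
  have "D = (\<Sum>\<beta>\<in>P. field_scale (lcoef D \<beta>) (mfield \<beta>))"
    by (subst D') (rule sum.cong, simp_all add: lc)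
  also have "\<dots> = (\<Sum>\<beta>\<in>lsupp D. field_scale (lcoef D \<beta>) (mfield \<beta>))"
    by (rule sum.mono_neutral_right[OF fP]) (use P(1) in \<open>auto simp: lsupp_def lc split: if_splits\<close>)
  finally show ?thesis .
qed

context L_plus_module
begin

text \<open>In contrast to \<open>Tjet\<close> there is no truncation: elements of L_+ are finite
  combinations of monomial fields, so symbols of arbitrarily large degree may occur in
  \<open>c\<close>.\<close>

definition Ljet :: "('n idx list \<Rightarrow> 'w) \<Rightarrow> (('n, 'k) mpoly \<Rightarrow> ('n, 'k) mpoly) list \<Rightarrow> 'w" where
  "Ljet c xs = (if set xs \<subseteq> L_plus then jext sW lcoef lsupp c xs else 0)"

definition Lres :: "((('n, 'k) mpoly \<Rightarrow> ('n, 'k) mpoly) list \<Rightarrow> 'w) \<Rightarrow> 'n idx list \<Rightarrow> 'w" where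
  "Lres \<phi> \<beta>s = (if set \<beta>s \<subseteq> plus_idx then \<phi> (map mfield \<beta>s) else 0)"

lemma map_mfield: "set \<beta>s \<subseteq> plus_idx \<Longrightarrow> set (map mfield \<beta>s) \<subseteq> (L_plus :: (('n, 'k) mpoly \<Rightarrow> _) set)"
  by (auto intro!: mfield_L_plus)

lemma plus_supp_Lres: "plus_supp (Lres \<phi>)"
  by (auto simp: plus_supp_def Lres_def)

lemma alternating_Lres:
  assumes "alternating L_plus \<phi>" shows "alternating UNIV (Lres \<phi>)"
proof (rule alternating_UNIV[of plus_idx])
  show "alternating plus_idx (Lres \<phi>)"
    unfolding alternating_def
  proof (intro allI impI)
    fix us vs and x y :: "'n idx" assume *: "set (us @ x # y # vs) \<subseteq> plus_idx"
    then have "set (us @ y # x # vs) \<subseteq> plus_idx" by auto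
    then show "Lres \<phi> (us @ x # y # vs) = - Lres \<phi> (us @ y # x # vs)"
      using alternatingD[OF assms, of "map mfield us" "mfield x" "mfield y" "map mfield vs"] map_mfield[OF *] *
      by (simp add: Lres_def)
  qed
qed (simp add: Lres_def)

lemma Lres_Ljet:
  assumes "plus_supp c" shows "Lres (Ljet c) = c"
proof -
  have "jext sW lcoef lsupp c (map mfield \<beta>s) = c \<beta>s" if "set \<beta>s \<subseteq> plus_idx" for \<beta>s c
    using that by (induction \<beta>s arbitrary: c) (simp_all add: lsupp_mfield lcoef_mfield)
  note * = this
  show ?thesis
  proof
    fix \<beta>s show "Lres (Ljet c) \<beta>s = c \<beta>s"
    proof (cases "set \<beta>s \<subseteq> plus_idx")
      case True
      then show ?thesis using *[OF True] map_mfield[OF True] by (simp only: Lres_def Ljet_def if_True)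
    next
      case False
      then show ?thesis using assms unfolding Lres_def plus_supp_def by auto
    qed
  qed
qed

lemma Lres_ins: "fst \<beta> \<noteq> 0 \<Longrightarrow> Lres (ins (mfield \<beta>) \<phi>) = ins \<beta> (Lres \<phi>)"
  by (rule ext) (simp add: Lres_def)

lemma jext_Lres:
  assumes "\<phi> \<in> ce_class" "set xs \<subseteq> L_plus"
  shows "jext sW lcoef lsupp (Lres \<phi>) xs = \<phi> xs"
  using assms
proof (induction xs arbitrary: \<phi>)
  case (Cons x xs)
  then have x: "x \<in> L_plus" "set xs \<subseteq> L_plus" by auto
  have sub: "(\<Sum>\<beta>\<in>S. field_scale (r \<beta>) (mfield \<beta>)) \<in> L_plus \<and>
      \<phi> ((\<Sum>\<beta>\<in>S. field_scale (r \<beta>) (mfield \<beta>)) # xs) = (\<Sum>\<beta>\<in>S. sW (r \<beta>) (\<phi> (mfield \<beta> # xs)))"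
    if "finite S" "S \<subseteq> plus_idx" for S and r :: "'n idx \<Rightarrow> 'k"
    using that
  proof (induction S rule: finite_induct)
    case empty
    have "\<phi> (0 # xs) = 0"
      using ce_classD(3)[OF Cons.prems(1) x, of 0] by simp
    then show ?case using subspace_0[OF subspace_L] by (simp only: sum.empty)
  next
    case (insert \<beta> S)
    then have m: "mfield \<beta> \<in> L_plus" by (intro mfield_L_plus) auto
    then have "field_scale (r \<beta>) (mfield \<beta>) \<in> L_plus" by (rule subspace_scale[OF subspace_L])
    then show ?case
      using insert ce_classD(2)[OF Cons.prems(1) _ _ x(2)] ce_classD(3)[OF Cons.prems(1) m x(2)] subspace_add[OF subspace_L]
      by (simp only: sum.insert[OF insert.hyps] insert_subset simp_thms)
  qed
  have "jext sW lcoef lsupp (Lres \<phi>) (x # xs) = (\<Sum>\<beta>\<in>lsupp x. sW (lcoef x \<beta>) (\<phi> (mfield \<beta> # xs)))"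
    unfolding jext.simps
  proof (rule sum.cong[OF refl])
    fix \<beta> assume "\<beta> \<in> lsupp x"
    then have \<beta>: "fst \<beta> \<noteq> 0" by (simp add: lsupp_def)
    have "jext sW lcoef lsupp (ins \<beta> (Lres \<phi>)) xs = ins (mfield \<beta>) \<phi> xs"
      unfolding Lres_ins[OF \<beta>, symmetric]
      by (rule Cons.IH[OF ce_class_ins[OF Cons.prems(1) mfield_L_plus[OF \<beta>]] x(2)])
    then show "sW (lcoef x \<beta>) (jext sW lcoef lsupp (ins \<beta> (Lres \<phi>)) xs) = sW (lcoef x \<beta>) (\<phi> (mfield \<beta> # xs))" by simp
  qed
  also have "\<dots> = \<phi> ((\<Sum>\<beta>\<in>lsupp x. field_scale (lcoef x \<beta>) (mfield \<beta>)) # xs)"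
  proof -
    have "lsupp x \<subseteq> plus_idx" by (auto simp: lsupp_def)
    from sub[OF finite_lsupp this, of "lcoef x"] show ?thesis by simp
  qed
  also have "\<dots> = \<phi> (x # xs)" using L_plus_expansion[OF x(1)] by simp
  finally show ?case .
qed (simp add: Lres_def)

lemma Ljet_class:
  assumes "alternating UNIV c" shows "Ljet c \<in> ce_class"
  unfolding ce_class_def
proof (intro CollectI conjI ballI allI impI)
  show "alternating L_plus (Ljet c)"
    unfolding alternating_def
  proof (intro allI impI)
    fix us vs and x y :: "('n, 'k) mpoly \<Rightarrow> ('n, 'k) mpoly" assume *: "set (us @ x # y # vs) \<subseteq> L_plus"
    then have "set (us @ y # x # vs) \<subseteq> L_plus" by auto
    with * show "Ljet c (us @ x # y # vs) = - Ljet c (us @ y # x # vs)"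
      using alternatingD[OF M.alternating_jext[OF assms, of UNIV], of us x y vs] by (simp add: Ljet_def)
  qed
next
  fix x y :: "('n, 'k) mpoly \<Rightarrow> ('n, 'k) mpoly" and xs :: "(('n, 'k) mpoly \<Rightarrow> ('n, 'k) mpoly) list"
  assume *: "x \<in> L_plus" "y \<in> L_plus" "set xs \<subseteq> L_plus"
  let ?S = "lsupp x \<union> lsupp y"
  have big: "(\<Sum>\<beta>\<in>lsupp z. sW (lcoef z \<beta>) (h \<beta>)) = (\<Sum>\<beta>\<in>?S. sW (lcoef z \<beta>) (h \<beta>))"
    if "lsupp z \<subseteq> ?S" for z h
  proof (rule sum.mono_neutral_left[OF _ that])
    show "finite ?S" by (simp add: finite_lsupp)
    show "\<forall>\<beta>\<in>?S - lsupp z. sW (lcoef z \<beta>) (h \<beta>) = 0" by (auto simp: lsupp_def)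
  qed
  have sub: "lsupp (x + y) \<subseteq> ?S" by (auto simp: lsupp_def lcoef_add simp del: plus_fun_apply)
  have "(\<Sum>\<beta>\<in>lsupp (x + y). sW (lcoef (x + y) \<beta>) (h \<beta>)) =
    (\<Sum>\<beta>\<in>lsupp x. sW (lcoef x \<beta>) (h \<beta>)) + (\<Sum>\<beta>\<in>lsupp y. sW (lcoef y \<beta>) (h \<beta>))" for h
    unfolding big[OF sub] big[OF Un_upper1] big[OF Un_upper2]
    unfolding lcoef_add M.scale_left_distrib sum.distrib ..
  then have "jext sW lcoef lsupp c ((x + y) # xs) = jext sW lcoef lsupp c (x # xs) + jext sW lcoef lsupp c (y # xs)"
    by (simp only: jext.simps)
  then show "Ljet c ((x + y) # xs) = Ljet c (x # xs) + Ljet c (y # xs)"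
    using * subspace_add[OF subspace_L *(1,2)] unfolding Ljet_def by (simp del: jext.simps)
next
  fix q :: 'k and x :: "('n, 'k) mpoly \<Rightarrow> ('n, 'k) mpoly" and xs :: "(('n, 'k) mpoly \<Rightarrow> ('n, 'k) mpoly) list"
  assume *: "x \<in> L_plus" "set xs \<subseteq> L_plus"
  have "(\<Sum>\<beta>\<in>lsupp (field_scale q x). sW (lcoef (field_scale q x) \<beta>) (h \<beta>)) = (\<Sum>\<beta>\<in>lsupp x. sW (lcoef (field_scale q x) \<beta>) (h \<beta>))" for h
    by (rule sum.mono_neutral_left[OF finite_lsupp]) (auto simp: lsupp_def lcoef_scale)
  then have "jext sW lcoef lsupp c (field_scale q x # xs) = sW q (jext sW lcoef lsupp c (x # xs))"
    by (simp add: lcoef_scale M.scale_sum_right)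
  then show "Ljet c (field_scale q x # xs) = sW q (Ljet c (x # xs))"
    using * subspace_scale[OF subspace_L *(1), of q] unfolding Ljet_def by (simp del: jext.simps)
qed

lemma ins_br_mfield:
  assumes "\<phi> \<in> ce_class" "fst \<beta> \<noteq> 0" "fst \<gamma> \<noteq> 0" "set \<beta>s \<subseteq> plus_idx"
  shows "\<phi> (commutator (mfield \<beta>) (mfield \<gamma>) # map mfield \<beta>s) = idx_br sW \<beta> \<gamma> (Lres \<phi>) \<beta>s"
proof -
  have nz: "k + l \<noteq> 0" if "k \<noteq> 0" for k l :: "'n \<Rightarrow> nat" using that by (auto simp: fun_eq_iff)
  let ?u = "monomial_field (fst \<beta> + (fst \<gamma> - unit_exp (snd \<beta>))) (snd \<gamma>) :: ('n, 'k) mpoly \<Rightarrow> _"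
  let ?v = "monomial_field (fst \<gamma> + (fst \<beta> - unit_exp (snd \<gamma>))) (snd \<beta>) :: ('n, 'k) mpoly \<Rightarrow> _"
  have L: "?u \<in> L_plus" "?v \<in> L_plus" by (rule mfield_L_plus[OF nz[OF assms(2)]], rule mfield_L_plus[OF nz[OF assms(3)]])
  have "\<phi> (commutator (mfield \<beta>) (mfield \<gamma>) # map mfield \<beta>s) =
     sW (of_nat (fst \<gamma> (snd \<beta>))) (\<phi> (?u # map mfield \<beta>s)) - sW (of_nat (fst \<beta> (snd \<gamma>))) (\<phi> (?v # map mfield \<beta>s))"
    unfolding commutator_monomial_field
    by (simp only: ce_class_diff[OF assms(1) subspace_scale[OF subspace_L L(1)] subspace_scale[OF subspace_L L(2)] map_mfield[OF assms(4)]]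
      ce_classD(3)[OF assms(1) L(1) map_mfield[OF assms(4)]] ce_classD(3)[OF assms(1) L(2) map_mfield[OF assms(4)]])
  then show ?thesis
    using assms nz[OF assms(2)] nz[OF assms(3)] by (simp add: idx_br_def Lres_def del: plus_fun_apply)
qed

text \<open>Restriction to symbols commutes with contraction (\<open>Lres_ins\<close>), so the two
  recursions run in parallel; linearity of \<phi> splits the bracket of two monomial fields into the
  two terms of \<open>idx_br\<close>.\<close>

lemma lieD_mfield:
  assumes "fst \<beta> \<noteq> 0"
  shows "\<phi> \<in> ce_class \<Longrightarrow> set \<beta>s \<subseteq> plus_idx \<Longrightarrow> CE.L (mfield \<beta>) \<phi> (map mfield \<beta>s) = W.L 0 \<beta> (Lres \<phi>) \<beta>s"
proof (induction \<beta>s arbitrary: \<phi>)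
  case Nil
  then show ?case using assms by (simp add: idx_act_def Lres_def)
next
  case (Cons \<gamma> \<beta>s)
  then have \<gamma>: "fst \<gamma> \<noteq> 0" "set \<beta>s \<subseteq> plus_idx" by auto
  have "CE.L (mfield \<beta>) (ins (mfield \<gamma>) \<phi>) (map mfield \<beta>s) = W.L 0 \<beta> (ins \<gamma> (Lres \<phi>)) \<beta>s"
    unfolding Lres_ins[OF \<gamma>(1), symmetric]
    by (rule Cons.IH[OF ce_class_ins[OF Cons.prems(1) mfield_L_plus[OF \<gamma>(1)]] \<gamma>(2)])
  then show ?case
    using ins_br_mfield[OF Cons.prems(1) assms \<gamma>] by (simp only: list.map lieD_Cons, simp only: lieD.simps(2))
qed

lemma cdiff_mfield:
  "\<phi> \<in> ce_class \<Longrightarrow> set \<beta>s \<subseteq> plus_idx \<Longrightarrow> CE.d \<phi> (map mfield \<beta>s) = W.d 0 (Lres \<phi>) \<beta>s"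
proof (induction \<beta>s arbitrary: \<phi>)
  case (Cons \<gamma> \<beta>s)
  then have \<gamma>: "fst \<gamma> \<noteq> 0" "set \<beta>s \<subseteq> plus_idx" by auto
  have "CE.d (ins (mfield \<gamma>) \<phi>) (map mfield \<beta>s) = W.d 0 (ins \<gamma> (Lres \<phi>)) \<beta>s"
    unfolding Lres_ins[OF \<gamma>(1), symmetric]
    by (rule Cons.IH[OF ce_class_ins[OF Cons.prems(1) mfield_L_plus[OF \<gamma>(1)]] \<gamma>(2)])
  then show ?case
    using lieD_mfield[OF \<gamma>(1) Cons.prems(1) \<gamma>(2)] by (simp only: list.map cdiff.simps)
qed simp

abbreviation ceL :: "((('n, 'k) mpoly \<Rightarrow> ('n, 'k) mpoly) list \<Rightarrow> 'w) \<Rightarrow> (('n, 'k) mpoly \<Rightarrow> ('n, 'k) mpoly) list \<Rightarrow> 'w" where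
  "ceL \<equiv> ce_diff L_plus commutator sW \<rho>"

lemma ceL_eq: "\<phi> \<in> ce_class \<Longrightarrow> set xs \<subseteq> L_plus \<Longrightarrow> ceL \<phi> xs = CE.d \<phi> xs"
  by (rule ce_diff_eq_cdiff[OF vs ce_classD(1)]) (auto intro: br_closed)

lemma Lres_ceL:
  assumes "\<phi> \<in> ce_class" shows "Lres (ceL \<phi>) = W.d 0 (Lres \<phi>)"
proof
  fix \<beta>s
  show "Lres (ceL \<phi>) \<beta>s = W.d 0 (Lres \<phi>) \<beta>s"
  proof (cases "set \<beta>s \<subseteq> plus_idx")
    case True
    then show ?thesis
      using ceL_eq[OF assms map_mfield[OF True]] cdiff_mfield[OF assms True] by (simp only: Lres_def if_True)
  next
    case False
    then show ?thesis
      using plus_supp_W_d[OF alternating_Lres[OF ce_classD(1)[OF assms]] plus_supp_Lres]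
      by (auto simp: Lres_def plus_supp_def)
  qed
qed

lemma ceL_Ljet:
  assumes "alternating UNIV c" "plus_supp c"
  shows "ceL (Ljet c) = Ljet (W.d 0 c)"
proof
  fix xs
  note J = Ljet_class[OF assms(1)]
  show "ceL (Ljet c) xs = Ljet (W.d 0 c) xs"
  proof (cases "set xs \<subseteq> L_plus")
    case True
    have "CE.d (Ljet c) \<in> ce_class" by (rule ce_class_cdiff[OF J])
    moreover have "Lres (CE.d (Ljet c)) = W.d 0 c"
    proof -
      have "Lres (CE.d (Ljet c)) = Lres (ceL (Ljet c))"
        by (rule HOL.ext) (simp add: Lres_def ceL_eq[OF J map_mfield])
      then show ?thesis using Lres_ceL[OF J] Lres_Ljet[OF assms(2)] by simp
    qed
    ultimately have "CE.d (Ljet c) xs = jext sW lcoef lsupp (W.d 0 c) xs" using jext_Lres True by metis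
    then show ?thesis using ceL_eq[OF J True] True by (simp add: Ljet_def)
  qed (simp add: ce_diff_def Ljet_def)
qed

text \<open>The identity is imported from the Lie algebra L_+ through \<open>Ljet\<close>; this
  replaces a Jacobi identity for the formal bracket \<open>idx_br\<close>.\<close>

lemma W_d_W_d:
  assumes "alternating UNIV c" "plus_supp c"
  shows "W.d 0 (W.d 0 c) = (\<lambda>_. 0)"
proof -
  note J = Ljet_class[OF assms(1)]
  have "CE.d (CE.d (Ljet c)) (map mfield \<beta>s) = 0" if "set \<beta>s \<subseteq> plus_idx" for \<beta>s
    by (rule cdiff_cdiff[OF J map_mfield[OF that]])
  moreover have "Lres (CE.d (Ljet c)) = W.d 0 c"
  proof -
    have "Lres (CE.d (Ljet c)) = Lres (ceL (Ljet c))"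
      by (rule HOL.ext) (simp add: Lres_def ceL_eq[OF J map_mfield])
    then show ?thesis using Lres_ceL[OF J] Lres_Ljet[OF assms(2)] by simp
  qed
  ultimately have z: "W.d 0 (W.d 0 c) \<beta>s = 0" if "set \<beta>s \<subseteq> plus_idx" for \<beta>s
    using cdiff_mfield[OF ce_class_cdiff[OF J] that] that by simp
  have "plus_supp (W.d 0 (W.d 0 c))"
    by (intro plus_supp_W_d alternating_W_d assms)
  then have z': "W.d 0 (W.d 0 c) \<beta>s = 0" if "\<not> set \<beta>s \<subseteq> plus_idx" for \<beta>s
    by (rule plus_suppD[OF _ that])
  show ?thesis by (rule HOL.ext, rule case_split, erule z, erule z')
qed

end

section \<open>The Euler field and truncation\<close>

text \<open>The total degree for the grading in which \<open>X^k \<partial>/\<partial>X_i\<close>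
  has degree |k| - 1. On symbols of L_+ the subtraction does not truncate.\<close>

definition sdeg :: "'n::finite idx list \<Rightarrow> nat" where
  "sdeg ys = sum_list (map (\<lambda>\<beta>. mdeg \<beta> - 1) ys)"

lemma sdeg_simps [simp]: "sdeg [] = 0" "sdeg (y # ys) = (mdeg y - 1) + sdeg ys" "sdeg (xs @ ys) = sdeg xs + sdeg ys"
  by (simp_all add: sdeg_def)

lemma mdeg_le_sdeg: "\<beta> \<in> set ys \<Longrightarrow> mdeg \<beta> - 1 \<le> sdeg ys"
  by (induction ys) auto

lemma mdeg_pos: "fst \<beta> \<noteq> 0 \<Longrightarrow> mdeg \<beta> \<ge> 1"
  using mdeg_eq_0[of \<beta>] by (simp del: mdeg_eq_0)

context L_plus_module
begin

text \<open>The number of arguments is an integer, so that primitives of 0-cochains have degree -1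
  and are zero, without a separate case.\<close>

definition L_cochain :: "int \<Rightarrow> ('n idx list \<Rightarrow> 'w) \<Rightarrow> bool" where
  "L_cochain k c \<longleftrightarrow> alternating UNIV c \<and> plus_supp c \<and> (\<forall>ys. int (length ys) \<noteq> k \<longrightarrow> c ys = 0)"

lemma L_cochain_D:
  assumes "L_cochain k c"
  shows "alternating UNIV c" "plus_supp c" "int (length ys) \<noteq> k \<Longrightarrow> c ys = 0" "\<not> set ys \<subseteq> plus_idx \<Longrightarrow> c ys = 0"
  using assms plus_suppD unfolding L_cochain_def by blast+

lemma plus_suppI: "(\<And>xs. \<not> set xs \<subseteq> plus_idx \<Longrightarrow> c xs = 0) \<Longrightarrow> plus_supp c"
  unfolding plus_supp_def by blast

lemma L_cochain_I:
  "alternating UNIV c \<Longrightarrow> (\<And>xs. \<not> set xs \<subseteq> plus_idx \<Longrightarrow> c xs = 0) \<Longrightarrow> (\<And>ys. int (length ys) \<noteq> k \<Longrightarrow> c ys = 0) \<Longrightarrow> L_cochain k c"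
  unfolding L_cochain_def using plus_suppI by blast

lemma L_cochain_add: "L_cochain k c \<Longrightarrow> L_cochain k e \<Longrightarrow> L_cochain k (\<lambda>xs. c xs + e xs)"
  by (rule L_cochain_I) (simp_all add: alternating_add L_cochain_D)

lemma L_cochain_scale: "L_cochain k c \<Longrightarrow> L_cochain k (\<lambda>xs. sW q (c xs))"
  by (rule L_cochain_I) (simp_all add: alternating_map L_cochain_D)

lemma L_cochain_minus: "L_cochain k c \<Longrightarrow> L_cochain k (\<lambda>xs. - c xs)"
  by (rule L_cochain_I) (simp_all add: alternating_map L_cochain_D)

lemma L_cochain_zero: "L_cochain k (\<lambda>_. 0)"
  by (rule L_cochain_I) (simp_all add: alternating_def)

lemma L_cochain_d:
  assumes "L_cochain k c" shows "L_cochain (k + 1) (W.d 0 c)"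
  unfolding L_cochain_def
proof (intro conjI allI impI)
  show "alternating UNIV (W.d 0 c)" by (rule alternating_W_d[OF L_cochain_D(1)[OF assms]])
  show "plus_supp (W.d 0 c)" by (rule plus_supp_W_d[OF L_cochain_D(1,2)[OF assms]])
  fix ys :: "'n idx list" assume *: "int (length ys) \<noteq> k + 1"
  show "W.d 0 c ys = 0"
    by (rule W.cdiff_length[OF subset_UNIV], rule L_cochain_D(3)[OF assms]) (use * in auto)
qed

lemma L_cochain_dd: "L_cochain k c \<Longrightarrow> W.d 0 (W.d 0 c) = (\<lambda>_. 0)"
  by (rule W_d_W_d[OF L_cochain_D(1,2)])

text \<open>Total degree is measured here, and not the degree of single symbols as in
  \<open>bounded\<close>, because it is the total degree that the Euler field detects.\<close>

definition low :: "nat \<Rightarrow> ('n idx list \<Rightarrow> 'w) \<Rightarrow> bool" where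
  "low N c \<longleftrightarrow> (\<forall>ys. set ys \<subseteq> plus_idx \<longrightarrow> sdeg ys < N \<longrightarrow> c ys = 0)"

lemma lowD: "low N c \<Longrightarrow> set ys \<subseteq> plus_idx \<Longrightarrow> sdeg ys < N \<Longrightarrow> c ys = 0"
  unfolding low_def by blast

lemma low_ins: "low N c \<Longrightarrow> fst \<gamma> \<noteq> 0 \<Longrightarrow> low (N - (mdeg \<gamma> - 1)) (ins \<gamma> c)"
  unfolding low_def by simp

lemma low_add: "low N c \<Longrightarrow> low N e \<Longrightarrow> low N (\<lambda>xs. c xs + e xs)"
  and low_minus: "low N c \<Longrightarrow> low N (\<lambda>xs. - c xs)"
  unfolding low_def by simp_all

lemma low_idx_br:
  assumes c: "low N c" and "fst \<beta> \<noteq> 0" "fst \<gamma> \<noteq> 0" "set ys \<subseteq> plus_idx"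
    and "(mdeg \<beta> - 1) + (mdeg \<gamma> - 1) + sdeg ys < N"
  shows "idx_br sW \<beta> \<gamma> c ys = 0"
proof -
  have t: "sW (of_nat (fst \<gamma> (snd \<beta>))) (c ((fst \<beta> + (fst \<gamma> - unit_exp (snd \<beta>)), snd \<gamma>) # ys)) = 0"
    if "fst \<beta> \<noteq> 0" "fst \<gamma> \<noteq> 0" "(mdeg \<beta> - 1) + (mdeg \<gamma> - 1) + sdeg ys < N" for \<beta> \<gamma> :: "'n idx"
  proof (cases "fst \<gamma> (snd \<beta>) = 0")
    case False
    let ?\<delta> = "(fst \<beta> + (fst \<gamma> - unit_exp (snd \<beta>)), snd \<gamma>) :: 'n idx"
    have d: "mdeg ?\<delta> = mdeg \<beta> + mdeg \<gamma> - 1"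
      using mdeg_bracket[of "fst \<gamma>" "snd \<beta>" "fst \<beta>" "snd \<gamma>"] False by simp
    have ge: "mdeg \<beta> \<ge> 1" "mdeg \<gamma> \<ge> 1" using that mdeg_pos by blast+
    then have "mdeg ?\<delta> \<noteq> 0" unfolding d by linarith
    then have "set (?\<delta> # ys) \<subseteq> plus_idx" using assms(4) mdeg_eq_0[of ?\<delta>] by simp
    moreover have "sdeg (?\<delta> # ys) < N" unfolding sdeg_simps d using that(3) ge by linarith
    ultimately have "c (?\<delta> # ys) = 0" by (rule lowD[OF c])
    then show ?thesis by simp
  qed simp
  show ?thesis
    unfolding idx_br_def t[OF assms(2,3,5)] t[OF assms(3,2) assms(5)[unfolded add.commute[of "mdeg \<beta> - 1"]]] by simp
qed

lemma low_lieD: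
  "low N c \<Longrightarrow> fst \<beta> \<noteq> 0 \<Longrightarrow> set ys \<subseteq> plus_idx \<Longrightarrow> (mdeg \<beta> - 1) + sdeg ys < N \<Longrightarrow> W.L 0 \<beta> c ys = 0"
proof (induction ys arbitrary: c N)
  case Nil
  then have "c [] = 0" by (intro lowD[OF Nil(1)]) auto
  then show ?case by simp
next
  case (Cons \<gamma> ys)
  have "W.L 0 \<beta> (ins \<gamma> c) ys = 0"
    by (rule Cons.IH[OF low_ins[OF Cons.prems(1)]]) (use Cons.prems in auto)
  moreover have "idx_br sW \<beta> \<gamma> c ys = 0"
    using Cons.prems by (intro low_idx_br[OF Cons.prems(1)]) auto
  ultimately show ?case by (simp only: lieD.simps diff_self)
qed

text \<open>Brackets preserve the degree |k| - 1, and an argument that acts only takes its own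
  nonnegative degree away from the rest.\<close>

lemma low_d: "low N c \<Longrightarrow> low N (W.d 0 c)"
  unfolding low_def[of N "W.d 0 c"]
proof (intro allI impI)
  fix ys :: "'n idx list" assume "low N c" "set ys \<subseteq> plus_idx" "sdeg ys < N"
  then show "W.d 0 c ys = 0"
  proof (induction ys arbitrary: c N)
    case (Cons \<gamma> ys)
    have "W.L 0 \<gamma> c ys = 0" using Cons.prems by (intro low_lieD[OF Cons.prems(1)]) auto
    moreover have "W.d 0 (ins \<gamma> c) ys = 0"
      by (rule Cons.IH[OF low_ins[OF Cons.prems(1)]]) (use Cons.prems in auto)
    ultimately show ?case by (simp only: cdiff.simps diff_self minus_zero)
  qed simp
qed

section \<open>Cartan's formula for the Euler field\<close>

definition iE :: "('n idx list \<Rightarrow> 'w) \<Rightarrow> 'n idx list \<Rightarrow> 'w" where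
  "iE c = (\<lambda>ys. \<Sum>i\<in>UNIV. ins (unit_exp i, i) c ys)"

lemma cdiff_iE: "W.d 0 (iE c) ys = - iE (W.d 0 c) ys - (\<Sum>i\<in>UNIV. W.L 0 (unit_exp i, i) c ys)"
  unfolding iE_def W.cdiff_sum[OF subset_UNIV] by (simp add: sum_subtractf sum_negf ins_def)

lemma idx_br_unit:
  assumes "fst \<gamma> \<noteq> 0"
  shows "idx_br sW (unit_exp i, i) \<gamma> c ys = sW (of_nat (fst \<gamma> i) - (if i = snd \<gamma> then 1 else 0)) (c (\<gamma> # ys))"
proof -
  obtain l j where \<gamma>: "\<gamma> = (l, j)" by fastforce
  have 1: "sW (of_nat (l i)) (c ((unit_exp i + (l - unit_exp i), j) # ys)) = sW (of_nat (l i)) (c ((l, j) # ys))"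
  proof (cases "l i = 0")
    case False
    then have "unit_exp i + (l - unit_exp i) = l" by (auto simp: unit_exp_def fun_eq_iff)
    then show ?thesis by simp
  qed simp
  have 2: "sW (of_nat (unit_exp i j)) (c ((l + (unit_exp i - unit_exp j), i) # ys)) = sW (if i = j then 1 else 0) (c ((l, j) # ys))"
  proof (cases "i = j")
    case True
    have "l + (unit_exp j - unit_exp j) = l" by (auto simp: fun_eq_iff)
    then show ?thesis using True by (simp add: unit_exp_def)
  qed (simp add: unit_exp_def)
  show ?thesis
    using assms 1 2 unit_exp_nonzero[of i] by (simp only: \<gamma> idx_br_def fst_conv snd_conv if_False simp_thms M.scale_left_diff_distrib)
qed

lemma sum_lieD_unit:
  "set ys \<subseteq> plus_idx \<Longrightarrow> (\<Sum>i\<in>UNIV. W.L 0 (unit_exp i, i) c ys) = euler (c ys) - sW (of_nat (sdeg ys)) (c ys)"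
proof (induction ys arbitrary: c)
  case Nil
  then show ?case by (simp add: euler_def idx_act_def)
next
  case (Cons \<gamma> ys)
  then have \<gamma>: "fst \<gamma> \<noteq> 0" "set ys \<subseteq> plus_idx" by auto
  have "(\<Sum>i\<in>UNIV. idx_br sW (unit_exp i, i) \<gamma> c ys) = sW (of_nat (mdeg \<gamma>) - 1) (c (\<gamma> # ys))"
    by (simp add: idx_br_unit[OF \<gamma>(1)] M.scale_sum_left[symmetric] sum_subtractf mdeg_def)
  moreover have "(of_nat (sdeg (\<gamma> # ys)) :: 'k) = (of_nat (mdeg \<gamma>) - 1) + of_nat (sdeg ys)"
    using mdeg_pos[OF \<gamma>(1)] by (simp add: of_nat_diff)
  moreover have "(\<Sum>i\<in>UNIV. W.L 0 (unit_exp i, i) (ins \<gamma> c) ys) = euler (c (\<gamma> # ys)) - sW (of_nat (sdeg ys)) (c (\<gamma> # ys))"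
    using Cons.IH[OF \<gamma>(2), of "ins \<gamma> c"] unfolding ins_def .
  ultimately show ?case
    by (simp only: lieD.simps sum_subtractf M.scale_left_distrib) simp
qed

lemma L_cochain_iE:
  assumes "L_cochain k c" shows "L_cochain (k - 1) (iE c)"
proof (rule L_cochain_I)
  show "alternating UNIV (iE c)"
    unfolding alternating_def
  proof (intro allI impI)
    fix us vs :: "'n idx list" and x y :: "'n idx"
    have "c ((unit_exp i, i) # us @ x # y # vs) = - c ((unit_exp i, i) # us @ y # x # vs)" for i
      using alternatingD[OF L_cochain_D(1)[OF assms], of "(unit_exp i, i) # us" x y vs] by simp
    then show "iE c (us @ x # y # vs) = - iE c (us @ y # x # vs)"
      by (simp add: iE_def sum_negf)
  qed
  show "iE c xs = 0" if "\<not> set xs \<subseteq> plus_idx" for xs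
    unfolding iE_def by (rule sum.neutral) (use L_cochain_D(4)[OF assms] that in auto)
  show "iE c ys = 0" if "int (length ys) \<noteq> k - 1" for ys
    unfolding iE_def by (rule sum.neutral) (use L_cochain_D(3)[OF assms] that in auto)
qed

text \<open>Let v be the preimage of c under E - d, degree by degree, and w its differential.
  Cartan's formula says that the differential of - \<iota>_E v is c + \<iota>_E w. That w = 0 is
  derived without knowing that \<open>R\<close> commutes with the differential: applying the
  differential once more shows that \<iota>_E w is closed, so the Euler field has zero Lie
  derivative on the closed cochain w, and w = 0 by injectivity. A bound on the symbols of c passes
  to u because v vanishes wherever c does.\<close>

lemma low_acyclic:
  assumes R: "\<And>d w. N\<^sub>1 \<le> d \<Longrightarrow> euler (R d w) - sW (of_nat d) (R d w) = w"
    and inj: "\<And>d w. N\<^sub>1 \<le> d \<Longrightarrow> euler w = sW (of_nat d) w \<Longrightarrow> w = 0"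
    and c: "L_cochain k c" "low N\<^sub>1 c" and dc: "W.d 0 c = (\<lambda>_. 0)"
  obtains u where "L_cochain (k - 1) u" "low N\<^sub>1 u" "W.d 0 u = c" "\<And>N. bounded N c \<Longrightarrow> bounded N u"
proof -
  have e0: "euler 0 = 0" using euler_scale[of 0 0] by simp
  have R0: "R d 0 = 0" if "N\<^sub>1 \<le> d" for d
    using inj[OF that, of "R d 0"] R[OF that, of 0] by simp
  \<comment> \<open>Compatibility with signs comes from uniqueness of preimages; it is needed for v
    to be alternating.\<close>
  have Rm: "R d (- w) = - R d w" if "N\<^sub>1 \<le> d" for d w
  proof -
    have "euler (R d (- w) + R d w) = sW (of_nat d) (R d (- w) + R d w)"
      using R[OF that, of "- w"] R[OF that, of w] unfolding euler_add M.scale_right_distrib diff_eq_eq by simp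
    then have "R d (- w) + R d w = 0" by (rule inj[OF that])
    then show ?thesis by (simp add: eq_neg_iff_add_eq_0)
  qed
  \<comment> \<open>Below \<open>N\<^sub>1\<close> nothing is known about \<open>R\<close>; there c
    vanishes on symbols of L_+, and 0 is the right value.\<close>
  define v where "v ys = (if N\<^sub>1 \<le> sdeg ys then R (sdeg ys) (c ys) else 0)" for ys
  have v0: "v ys = 0" if "c ys = 0" for ys using that by (simp add: v_def R0)
  have v: "L_cochain k v"
  proof (rule L_cochain_I)
    show "alternating UNIV v"
      unfolding alternating_def
    proof (intro allI impI)
      fix us vs :: "'n idx list" and x y :: "'n idx"
      have s: "sdeg (us @ x # y # vs) = sdeg (us @ y # x # vs)" by simp
      show "v (us @ x # y # vs) = - v (us @ y # x # vs)"
        unfolding v_def s alternatingD[OF L_cochain_D(1)[OF c(1)] subset_UNIV, of us x y vs] by (simp add: Rm)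
    qed
    show "v xs = 0" if "\<not> set xs \<subseteq> plus_idx" for xs by (rule v0[OF L_cochain_D(4)[OF c(1) that]])
    show "v ys = 0" if "int (length ys) \<noteq> k" for ys by (rule v0[OF L_cochain_D(3)[OF c(1) that]])
  qed
  have lowv: "low N\<^sub>1 v" by (simp add: low_def v_def)
  have LEv: "(\<Sum>i\<in>UNIV. W.L 0 (unit_exp i, i) v ys) = c ys" if "set ys \<subseteq> plus_idx" for ys
    unfolding sum_lieD_unit[OF that]
    using R[of "sdeg ys" "c ys"] lowD[OF c(2) that] by (simp add: v_def e0)
  define w where "w = W.d 0 v"
  have w: "L_cochain (k + 1) w" unfolding w_def by (rule L_cochain_d[OF v])
  have dw: "W.d 0 w = (\<lambda>_. 0)" unfolding w_def by (rule L_cochain_dd[OF v])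
  have iE0: "iE (\<lambda>_. 0) ys = 0" for ys by (simp add: iE_def)
  have eq: "W.d 0 (iE v) = (\<lambda>ys. - (iE w ys + c ys))"
  proof
    fix ys :: "'n idx list"
    show "W.d 0 (iE v) ys = - (iE w ys + c ys)"
    proof (cases "set ys \<subseteq> plus_idx")
      case True
      then show ?thesis unfolding cdiff_iE LEv[OF True] w_def by simp
    next
      case False
      then show ?thesis
        using L_cochain_D(4)[OF L_cochain_d[OF L_cochain_iE[OF v]] False] L_cochain_D(4)[OF L_cochain_iE[OF w] False] L_cochain_D(4)[OF c(1) False]
        by simp
    qed
  qed
  have "W.d 0 (W.d 0 (iE v)) = (\<lambda>_. 0)" by (rule L_cochain_dd[OF L_cochain_iE[OF v]])
  then have "W.d 0 (iE w) ys = 0" for ys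
    unfolding eq fun_eq_iff W.cdiff_minus[OF subset_UNIV] W.cdiff_add[OF subset_UNIV] dc by simp
  then have ew: "euler (w ys) = sW (of_nat (sdeg ys)) (w ys)" if "set ys \<subseteq> plus_idx" for ys
    using cdiff_iE[of w ys] unfolding dw iE0 sum_lieD_unit[OF that] by simp
  have w0: "w ys = 0" for ys
  proof (cases "set ys \<subseteq> plus_idx")
    case True
    then show ?thesis
      using inj[OF _ ew[OF True]] lowD[OF low_d[OF lowv] True] unfolding w_def by (cases "sdeg ys < N\<^sub>1") auto
  qed (rule L_cochain_D(4)[OF w])
  show ?thesis
  proof (rule that[of "\<lambda>ys. - iE v ys"])
    show "L_cochain (k - 1) (\<lambda>ys. - iE v ys)" by (intro L_cochain_minus L_cochain_iE v)
    have "iE w = (\<lambda>_. 0)" using w0 by (simp add: iE_def fun_eq_iff)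
    then show "W.d 0 (\<lambda>ys. - iE v ys) = c"
      unfolding fun_eq_iff W.cdiff_minus[OF subset_UNIV] eq by simp
    have u: "mdeg (unit_exp i, i) = 1" for i :: 'n by (simp add: mdeg_def unit_exp_def)
    have "iE v ys = 0" if "set ys \<subseteq> plus_idx" "sdeg ys < N\<^sub>1" for ys
      unfolding iE_def
      by (rule sum.neutral) (use lowD[OF lowv, of "(unit_exp _, _) # ys"] that u in simp)
    then show "low N\<^sub>1 (\<lambda>ys. - iE v ys)" by (simp add: low_def)
    show "bounded N (\<lambda>ys. - iE v ys)" if "bounded N c" for N
      unfolding bounded_def
    proof (intro allI impI ballI, rule ccontr)
      fix ys :: "'n idx list" and \<beta> :: "'n idx" assume "- iE v ys \<noteq> 0" "\<beta> \<in> set ys" "\<not> mdeg \<beta> < N"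
      moreover have "v ((unit_exp i, i) # ys) = 0" for i
        by (rule v0, rule boundedD[OF that, of \<beta>]) (use calculation in auto)
      ultimately show False by (simp add: iE_def)
    qed
  qed
qed

text \<open>The total degree is invariant under permutations, so cutting there keeps a cochain
  alternating. A total degree below \<open>N\<close> bounds every |k| - 1 by it, hence every |k| by
  \<open>N\<close>: this is the successor in the bound.\<close>

lemma cochain_truncation:
  assumes "L_cochain k c"
  obtains c' c'' where "L_cochain k c'" "L_cochain k c''" "bounded (Suc N) c'" "low N c''" "c = (\<lambda>ys. c' ys + c'' ys)"
proof -
  define t where "t P ys = (if P (sdeg ys) then c ys else 0)" for P :: "nat \<Rightarrow> bool" and ys
  have t: "L_cochain k (t P)" for P
  proof (rule L_cochain_I)
    show "alternating UNIV (t P)"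
      unfolding alternating_def
    proof (intro allI impI)
      fix us vs :: "'n idx list" and x y :: "'n idx"
      have s: "sdeg (us @ x # y # vs) = sdeg (us @ y # x # vs)" by simp
      show "t P (us @ x # y # vs) = - t P (us @ y # x # vs)"
        unfolding t_def s alternatingD[OF L_cochain_D(1)[OF assms] subset_UNIV, of us x y vs] by simp
    qed
  qed (simp_all add: t_def L_cochain_D(3,4)[OF assms])
  show ?thesis
  proof (rule that[of "t (\<lambda>d. d < N)" "t (\<lambda>d. \<not> d < N)"])
    show "bounded (Suc N) (t (\<lambda>d. d < N))"
      unfolding bounded_def
    proof (intro allI impI ballI)
      fix ys :: "'n idx list" and \<beta> :: "'n idx" assume "t (\<lambda>d. d < N) ys \<noteq> 0" "\<beta> \<in> set ys"
      then have "sdeg ys < N" "mdeg \<beta> - 1 \<le> sdeg ys" using mdeg_le_sdeg[of \<beta> ys] by (auto simp: t_def split: if_splits)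
      then show "mdeg \<beta> < Suc N" by linarith
    qed
    show "low N (t (\<lambda>d. \<not> d < N))" by (simp add: low_def t_def)
  qed (simp_all add: t fun_eq_iff, simp_all add: t_def)
qed

lemma bounded_W_d:
  assumes "bounded N c" obtains M where "bounded M (W.d 0 c)"
proof -
  obtain N\<^sub>0 where N\<^sub>0: "N\<^sub>0 > 0" "\<And>\<beta> w. N\<^sub>0 \<le> mdeg \<beta> \<Longrightarrow> \<rho> (mfield \<beta>) w = 0" by (rule rho_eventually_zero) blast
  have "idx_act 0 \<beta> a = 0" if "N\<^sub>0 \<le> mdeg \<beta>" for \<beta> a
  proof -
    have "mdeg \<beta> \<noteq> 0" using that N\<^sub>0(1) by linarith
    then show ?thesis using N\<^sub>0(2)[OF that] by (simp add: idx_act_def)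
  qed
  then have "bounded (max N N\<^sub>0) (W.d 0 c)"
    by (rule bounded_cdiff[OF vs idx_act_add _ assms]) auto
  then show ?thesis by (rule that)
qed

lemma bounded_minus: "bounded N c \<Longrightarrow> bounded N (\<lambda>xs. - c xs :: 'w)"
  unfolding bounded_def by simp

text \<open>The cochains supported in large degree form an acyclic subcomplex.\<close>
lemma bounded_representative:
  assumes c: "L_cochain k c" and dc: "W.d 0 c = (\<lambda>_. 0)"
  obtains c' u N where "L_cochain k c'" "bounded N c'" "W.d 0 c' = (\<lambda>_. 0)" "L_cochain (k - 1) u" "c = (\<lambda>ys. c' ys + W.d 0 u ys)"
proof -
  obtain N\<^sub>1 R where R: "\<And>d w. N\<^sub>1 \<le> d \<Longrightarrow> euler (R d w) - sW (of_nat d) (R d w) = w"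
    and inj: "\<And>d w. N\<^sub>1 \<le> d \<Longrightarrow> euler w = sW (of_nat d) w \<Longrightarrow> w = 0"
    by (rule euler_invertible) blast
  obtain c1 c2 where c1: "L_cochain k c1" "bounded (Suc N\<^sub>1) c1" and c2: "L_cochain k c2" "low N\<^sub>1 c2" and ceq: "c = (\<lambda>ys. c1 ys + c2 ys)"
    by (rule cochain_truncation[OF c])
  have "W.d 0 c1 ys + W.d 0 c2 ys = 0" for ys
    using fun_cong[OF dc, of ys] unfolding ceq W.cdiff_add[OF subset_UNIV] .
  then have d1: "W.d 0 c1 = (\<lambda>ys. - W.d 0 c2 ys)" by (simp add: fun_eq_iff eq_neg_iff_add_eq_0)
  \<comment> \<open>The differential of \<open>c1\<close> is supported in large degree, being minus
    that of \<open>c2\<close>, and it is bounded, since \<open>c1\<close> is. So it has a bounded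
    primitive \<open>u1\<close> supported in large degree, and \<open>c1 - u1\<close> is the bounded
    cocycle.\<close>
  have low1: "low N\<^sub>1 (W.d 0 c1)" unfolding d1 by (rule low_minus[OF low_d[OF c2(2)]])
  obtain u1 where u1: "L_cochain (k + 1 - 1) u1" "low N\<^sub>1 u1" "W.d 0 u1 = W.d 0 c1" "\<And>N. bounded N (W.d 0 c1) \<Longrightarrow> bounded N u1"
    by (rule low_acyclic[OF R inj L_cochain_d[OF c1(1)] low1 L_cochain_dd[OF c1(1)]]) (assumption | blast)+
  obtain M where "bounded M (W.d 0 c1)" by (rule bounded_W_d[OF c1(2)])
  then have bu: "bounded M u1" by (rule u1(4))
  have u1': "L_cochain k u1" using u1(1) by simp
  let ?c' = "\<lambda>ys. c1 ys + - u1 ys" and ?r = "\<lambda>ys. c2 ys + u1 ys"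
  have d': "W.d 0 ?c' = (\<lambda>_. 0)"
    unfolding fun_eq_iff W.cdiff_add[OF subset_UNIV] W.cdiff_minus[OF subset_UNIV] u1(3) by simp
  have dr: "W.d 0 ?r = (\<lambda>_. 0)"
    unfolding fun_eq_iff W.cdiff_add[OF subset_UNIV] u1(3) d1 by simp
  obtain u where u: "L_cochain (k - 1) u" "W.d 0 u = ?r"
    by (rule low_acyclic[OF R inj L_cochain_add[OF c2(1) u1'] low_add[OF c2(2) u1(2)] dr])
  show ?thesis
  proof (rule that)
    show "L_cochain k ?c'" by (intro L_cochain_add L_cochain_minus c1 u1')
    show "bounded (max (Suc N\<^sub>1) M) ?c'"
      by (intro bounded_add bounded_minus bounded_mono[OF c1(2)] bounded_mono[OF bu]) auto
    show "W.d 0 ?c' = (\<lambda>_. 0)" by (rule d')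
    show "L_cochain (k - 1) u" by (rule u(1))
    show "c = (\<lambda>ys. ?c' ys + W.d 0 u ys)" unfolding u(2) ceq by simp
  qed
qed

text \<open>The part \<open>b1\<close> of small degree is kept. The differential of the rest is
  supported in large degree and, as a difference of bounded cochains, bounded; hence it has a
  bounded primitive \<open>u\<close>, and \<open>b1 + u\<close> replaces \<open>b\<close>. With
  \<open>bounded_representative\<close>, this shows that bounded cochains compute the full
  cohomology.\<close>

lemma bounded_primitive:
  assumes b: "L_cochain k b" and bd: "bounded N (W.d 0 b)"
  obtains b' M where "L_cochain k b'" "bounded M b'" "W.d 0 b' = W.d 0 b"
proof -
  obtain N\<^sub>1 R where R: "\<And>d w. N\<^sub>1 \<le> d \<Longrightarrow> euler (R d w) - sW (of_nat d) (R d w) = w"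
    and inj: "\<And>d w. N\<^sub>1 \<le> d \<Longrightarrow> euler w = sW (of_nat d) w \<Longrightarrow> w = 0"
    by (rule euler_invertible) blast
  obtain b1 b2 where b1: "L_cochain k b1" "bounded (Suc N\<^sub>1) b1" and b2: "L_cochain k b2" "low N\<^sub>1 b2" and beq: "b = (\<lambda>ys. b1 ys + b2 ys)"
    by (rule cochain_truncation[OF b])
  have d2: "W.d 0 b2 = (\<lambda>ys. W.d 0 b ys + - W.d 0 b1 ys)"
    unfolding beq fun_eq_iff W.cdiff_add[OF subset_UNIV] by simp
  obtain M where M: "bounded M (W.d 0 b1)" by (rule bounded_W_d[OF b1(2)])
  obtain u where u: "L_cochain (k + 1 - 1) u" "W.d 0 u = W.d 0 b2" "\<And>N. bounded N (W.d 0 b2) \<Longrightarrow> bounded N u"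
    by (rule low_acyclic[OF R inj L_cochain_d[OF b2(1)] low_d[OF b2(2)] L_cochain_dd[OF b2(1)]]) (assumption | blast)+
  have "bounded (max N M) (W.d 0 b2)"
    unfolding d2 by (intro bounded_add bounded_minus bounded_mono[OF bd] bounded_mono[OF M]) auto
  then have bu: "bounded (max N M) u" by (rule u(3))
  show ?thesis
  proof (rule that)
    show "L_cochain k (\<lambda>ys. b1 ys + u ys)" using u(1) by (intro L_cochain_add b1) simp
    show "bounded (max (Suc N\<^sub>1) (max N M)) (\<lambda>ys. b1 ys + u ys)"
      by (intro bounded_add bounded_mono[OF b1(2)] bounded_mono[OF bu]) auto
    show "W.d 0 (\<lambda>ys. b1 ys + u ys) = W.d 0 b"
      unfolding fun_eq_iff W.cdiff_add[OF subset_UNIV] u(2) d2 by simp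
  qed
qed

end

section \<open>Quotients and direct sums\<close>

context vector_space
begin

lemma coset_eq_iff:
  assumes "subspace B" shows "z +o B = z' +o B \<longleftrightarrow> z - z' \<in> B"
proof
  assume eq: "z +o B = z' +o B"
  have "z \<in> z +o B" using subspace_0[OF assms] by (auto simp: elt_set_plus_def)
  then show "z - z' \<in> B" unfolding eq by (auto simp: elt_set_plus_def)
next
  assume d: "z - z' \<in> B"
  have sub: "x +o B \<subseteq> y +o B" if "x - y \<in> B" for x y
  proof
    fix v assume "v \<in> x +o B"
    then obtain b where b: "b \<in> B" "v = x + b" by (auto simp: elt_set_plus_def)
    then have "v = y + ((x - y) + b)" by simp
    moreover have "(x - y) + b \<in> B" by (rule subspace_add[OF assms that b(1)])
    ultimately show "v \<in> y +o B" unfolding elt_set_plus_def by blast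
  qed
  have "z' - z \<in> B" using subspace_neg[OF assms d] by simp
  then show "z +o B = z' +o B" using sub d by blast
qed

lemma coset_add:
  assumes "subspace B" shows "(z +o B) + (z' +o B) = (z + z') +o B"
proof
  show "(z +o B) + (z' +o B) \<subseteq> (z + z') +o B"
  proof
    fix v assume "v \<in> (z +o B) + (z' +o B)"
    then obtain b b' where b: "b \<in> B" "b' \<in> B" "v = (z + b) + (z' + b')"
      by (auto simp: elt_set_plus_def set_plus_def)
    then have "v = (z + z') + (b + b')" by (simp add: algebra_simps)
    then show "v \<in> (z + z') +o B" using subspace_add[OF assms b(1,2)] unfolding elt_set_plus_def by blast
  qed
  show "(z + z') +o B \<subseteq> (z +o B) + (z' +o B)"
  proof
    fix v assume "v \<in> (z + z') +o B"
    then obtain b where b: "b \<in> B" "v = (z + b) + (z' + 0)" by (auto simp: elt_set_plus_def algebra_simps)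
    then show "v \<in> (z +o B) + (z' +o B)"
      using subspace_0[OF assms] unfolding elt_set_plus_def set_plus_def by blast
  qed
qed

lemma coset_scale:
  assumes "subspace B" shows "scale c ` (z +o B) + B = scale c z +o B"
proof
  show "scale c ` (z +o B) + B \<subseteq> scale c z +o B"
  proof
    fix v assume "v \<in> scale c ` (z +o B) + B"
    then obtain b b' where b: "b \<in> B" "b' \<in> B" "v = scale c (z + b) + b'"
      by (auto simp: elt_set_plus_def set_plus_def)
    then have "v = scale c z + (scale c b + b')" by (simp add: scale_right_distrib)
    then show "v \<in> scale c z +o B"
      using subspace_add[OF assms subspace_scale[OF assms b(1)] b(2)] unfolding elt_set_plus_def by blast
  qed
  show "scale c z +o B \<subseteq> scale c ` (z +o B) + B"
  proof
    fix v assume "v \<in> scale c z +o B"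
    then obtain b where b: "b \<in> B" "v = scale c (z + 0) + b" by (auto simp: elt_set_plus_def)
    then show "v \<in> scale c ` (z +o B) + B"
      using subspace_0[OF assms] unfolding elt_set_plus_def set_plus_def by blast
  qed
qed

end

text \<open>The isomorphism sends a coset to the cosets of the images of a chosen representative.
  \<open>ker\<close> yields both independence of the choice and injectivity; \<open>surj\<close>
  asks for preimages only modulo \<open>B'\<close>, which is all that holds for the comparison
  map.\<close>

lemma quotient_direct_sum_iso:
  fixes s :: "'k::field \<Rightarrow> 'v::ab_group_add \<Rightarrow> 'v" and s' :: "'k \<Rightarrow> 'u::ab_group_add \<Rightarrow> 'u"
    and R :: "'i \<Rightarrow> nat \<Rightarrow> 'v \<Rightarrow> 'u"
  assumes vs: "vector_space s" "vector_space s'"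
    and Z: "module.subspace s Z" and B: "module.subspace s B"
    and B': "\<And>i. i \<in> I \<Longrightarrow> module.subspace s' (B' i)"
    and R: "\<And>i a x. i \<in> I \<Longrightarrow> a < N i \<Longrightarrow> x \<in> Z \<Longrightarrow> R i a x \<in> Z' i"
    and R_add: "\<And>i a x y. x \<in> Z \<Longrightarrow> y \<in> Z \<Longrightarrow> R i a (x + y) = R i a x + R i a y"
    and R_scale: "\<And>i a c x. x \<in> Z \<Longrightarrow> R i a (s c x) = s' c (R i a x)"
    and ker: "\<And>x. x \<in> Z \<Longrightarrow> (\<forall>i\<in>I. \<forall>a<N i. R i a x \<in> B' i) \<longleftrightarrow> x \<in> B"
    and surj: "\<And>y. (\<And>i a. i \<in> I \<Longrightarrow> a < N i \<Longrightarrow> y i a \<in> Z' i) \<Longrightarrow>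
      \<exists>z\<in>Z. \<forall>i\<in>I. \<forall>a<N i. R i a z - y i a \<in> B' i"
  shows "quotient_vs s Z B \<cong>\<^sub>k
    direct_sum_vs I (\<lambda>i. coordinate_tensor_vs (N i) (quotient_vs s' (Z' i) (B' i)))"
    (is "?U \<cong>\<^sub>k ?V")
proof -
  interpret A: vector_space s by fact
  interpret A': vector_space s' by fact
  define G where "G z = (\<lambda>i\<in>I. \<lambda>a\<in>{..<N i}. R i a z +o B' i)" for z
  define r where "r S = (SOME z. z \<in> Z \<and> S = z +o B)" for S
  have r: "r (z +o B) \<in> Z \<and> z +o B = r (z +o B) +o B" if "z \<in> Z" for z
    unfolding r_def by (rule someI[of _ z]) (simp add: that)
  have R_diff: "R i a (x - y) = R i a x - R i a y" if "x \<in> Z" "y \<in> Z" for i a x y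
    using R_add[OF A.subspace_diff[OF Z that] that(2), of i a] by simp
  have G_iff: "G x = G y \<longleftrightarrow> x - y \<in> B" if "x \<in> Z" "y \<in> Z" for x y
  proof -
    have "G x = G y \<longleftrightarrow> (\<forall>i\<in>I. \<forall>a<N i. R i a x +o B' i = R i a y +o B' i)"
    proof
      assume "G x = G y"
      then have "G x i a = G y i a" for i a by simp
      moreover have "G z i a = R i a z +o B' i" if "i \<in> I" "a < N i" for z i a
        using that by (simp add: G_def)
      ultimately show "\<forall>i\<in>I. \<forall>a<N i. R i a x +o B' i = R i a y +o B' i" by metis
    next
      assume "\<forall>i\<in>I. \<forall>a<N i. R i a x +o B' i = R i a y +o B' i"
      then show "G x = G y" unfolding G_def by (intro restrict_ext) auto
    qed
    also have "\<dots> \<longleftrightarrow> (\<forall>i\<in>I. \<forall>a<N i. R i a (x - y) \<in> B' i)"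
      unfolding R_diff[OF that] using A'.coset_eq_iff[OF B'] by blast
    also have "\<dots> \<longleftrightarrow> x - y \<in> B" by (rule ker[OF A.subspace_diff[OF Z that]])
    finally show ?thesis .
  qed
  have F: "G (r (z +o B)) = G z" if "z \<in> Z" for z
    using r[OF that] G_iff[of "r (z +o B)" z] A.coset_eq_iff[OF B, of "r (z +o B)" z] that by auto
  have V: "carr ?V = (\<Pi>\<^sub>E i\<in>I. \<Pi>\<^sub>E a\<in>{..<N i}. (\<lambda>z. z +o B' i) ` Z' i)"
    by (simp add: direct_sum_vs_def coordinate_tensor_vs_def quotient_vs_def)
  have G_V: "G z \<in> carr ?V" if "z \<in> Z" for z
    unfolding V G_def using R[OF _ _ that] by auto
  have onto: "\<exists>z\<in>Z. G z = y" if "y \<in> carr ?V" for y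
  proof -
    have y: "\<And>i a. i \<in> I \<Longrightarrow> a < N i \<Longrightarrow> y i a \<in> (\<lambda>z. z +o B' i) ` Z' i"
      and yi: "\<And>i. i \<in> I \<Longrightarrow> y i \<in> extensional {..<N i}" and yI: "y \<in> extensional I"
      using that unfolding V by (auto simp: PiE_iff)
    from y have "\<forall>i a. \<exists>w. i \<in> I \<longrightarrow> a < N i \<longrightarrow> w \<in> Z' i \<and> y i a = w +o B' i" by blast
    then obtain w where w: "\<And>i a. i \<in> I \<Longrightarrow> a < N i \<Longrightarrow> w i a \<in> Z' i \<and> y i a = w i a +o B' i" by metis
    then obtain z where z: "z \<in> Z" "\<And>i a. i \<in> I \<Longrightarrow> a < N i \<Longrightarrow> R i a z - w i a \<in> B' i"
      using surj[of w] by blast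
    have "R i a z +o B' i = y i a" if "i \<in> I" "a < N i" for i a
      using A'.coset_eq_iff[OF B'[OF that(1)]] z(2)[OF that] w[OF that] by simp
    then have "G z = y"
      unfolding G_def by (intro extensionalityI[OF _ yI] ) (auto intro!: extensionalityI[OF _ yi])
    then show ?thesis using z by blast
  qed
  have U: "carr ?U = (\<lambda>z. z +o B) ` Z" by (simp add: quotient_vs_def)
  show ?thesis
    unfolding vs_iso_def
  proof (intro exI conjI allI ballI)
    show "bij_betw (\<lambda>S. G (r S)) (carr ?U) (carr ?V)"
      unfolding bij_betw_def U
    proof
      show "inj_on (\<lambda>S. G (r S)) ((\<lambda>z. z +o B) ` Z)"
      proof (rule inj_onI)
        fix S T assume "S \<in> (\<lambda>z. z +o B) ` Z" "T \<in> (\<lambda>z. z +o B) ` Z" and eq: "G (r S) = G (r T)"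
        then obtain x y where xy: "x \<in> Z" "y \<in> Z" "S = x +o B" "T = y +o B" by blast
        with eq have "x - y \<in> B" by (simp add: F G_iff)
        then show "S = T" unfolding xy(3,4) by (simp only: A.coset_eq_iff[OF B])
      qed
      show "(\<lambda>S. G (r S)) ` (\<lambda>z. z +o B) ` Z = carr ?V"
      proof
        show "(\<lambda>S. G (r S)) ` (\<lambda>z. z +o B) ` Z \<subseteq> carr ?V" using F G_V by auto
        show "carr ?V \<subseteq> (\<lambda>S. G (r S)) ` (\<lambda>z. z +o B) ` Z"
        proof
          fix y assume "y \<in> carr ?V"
          then obtain z where "z \<in> Z" "G z = y" using onto by blast
          then show "y \<in> (\<lambda>S. G (r S)) ` (\<lambda>z. z +o B) ` Z" using F by force
        qed
      qed
    qed
  next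
    fix S T assume "S \<in> carr ?U" "T \<in> carr ?U"
    then obtain x y where xy: "x \<in> Z" "S = x +o B" "y \<in> Z" "T = y +o B" unfolding U by blast
    have "G (r (vadd ?U S T)) = G (x + y)"
      using F[OF A.subspace_add[OF Z xy(1,3)]] by (simp add: quotient_vs_def xy A.coset_add[OF B])
    also have "\<dots> = vadd ?V (G x) (G y)"
      by (auto simp: G_def direct_sum_vs_def coordinate_tensor_vs_def quotient_vs_def R_add[OF xy(1,3)]
          A'.coset_add[OF B'] intro!: restrict_ext)
    finally show "G (r (vadd ?U S T)) = vadd ?V (G (r S)) (G (r T))" by (simp add: xy F)
  next
    fix c S assume "S \<in> carr ?U"
    then obtain x where x: "x \<in> Z" "S = x +o B" unfolding U by blast
    have "G (r (vscale ?U c S)) = G (s c x)"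
      using F[OF A.subspace_scale[OF Z x(1)]] by (simp add: quotient_vs_def x A.coset_scale[OF B])
    also have "\<dots> = vscale ?V c (G x)"
      by (auto simp: G_def direct_sum_vs_def coordinate_tensor_vs_def quotient_vs_def R_scale[OF x(1)]
          A'.coset_scale[OF B'] intro!: restrict_ext)
    finally show "G (r (vscale ?U c S)) = vscale ?V c (G (r S))" by (simp add: x F)
  qed
qed

section \<open>The comparison map\<close>

context L_plus_module
begin

abbreviation gf_diff :: "(('n, 'k) vfield list \<Rightarrow> ('n \<Rightarrow> int) \<Rightarrow>\<^sub>0 'w) \<Rightarrow> ('n, 'k) vfield list \<Rightarrow> ('n \<Rightarrow> int) \<Rightarrow>\<^sub>0 'w" where
  "gf_diff \<equiv> ce_diff torus_fields commutator (pm_scale sW) (tensor_act sW \<rho>)"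

definition T_cochain :: "int \<Rightarrow> nat \<Rightarrow> ('n idx list \<Rightarrow> ('n \<Rightarrow> int) \<Rightarrow>\<^sub>0 'w) \<Rightarrow> bool" where
  "T_cochain k N c \<longleftrightarrow> alternating UNIV c \<and> bounded N c \<and> (\<forall>xs. int (length xs) \<noteq> k \<longrightarrow> c xs = 0)"

text \<open>Order and degree bounds differ from cochain to cochain. Requiring the relation for all
  large \<open>M\<close> lets sums, multiples and differentials be formed without choosing a common
  bound each time.\<close>

definition represents :: "int \<Rightarrow> ('n idx list \<Rightarrow> ('n \<Rightarrow> int) \<Rightarrow>\<^sub>0 'w) \<Rightarrow> (('n, 'k) vfield list \<Rightarrow> ('n \<Rightarrow> int) \<Rightarrow>\<^sub>0 'w) \<Rightarrow> bool" where
  "represents k c \<phi> \<longleftrightarrow> (\<forall>\<^sub>F M in sequentially. T_cochain k M c \<and> \<phi> = Tjet M c)"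

lemma T_cochain_mono: "T_cochain k N c \<Longrightarrow> N \<le> M \<Longrightarrow> T_cochain k M c"
  unfolding T_cochain_def using bounded_mono by blast

lemma T_cochain_zero: "T_cochain k N (\<lambda>_. 0)"
  by (simp add: T_cochain_def alternating_def bounded_def)

lemma T_cochain_add: "T_cochain k N c \<Longrightarrow> T_cochain k N e \<Longrightarrow> T_cochain k N (\<lambda>xs. c xs + e xs)"
  unfolding T_cochain_def using alternating_add bounded_add by auto

lemma T_cochain_scale:
  assumes "T_cochain k N c" shows "T_cochain k N (\<lambda>xs. pm_scale sW q (c xs))"
proof -
  interpret P: vector_space "pm_scale sW :: 'k \<Rightarrow> (('n \<Rightarrow> int) \<Rightarrow>\<^sub>0 'w) \<Rightarrow> _"
    by (rule vector_space_pm_scale[OF vs])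
  have "alternating UNIV (\<lambda>xs. pm_scale sW q (c xs))"
    by (rule alternating_map) (use assms in \<open>simp_all add: T_cochain_def\<close>)
  then show ?thesis using assms unfolding T_cochain_def bounded_def by auto
qed

lemma dT_add: "dT (\<lambda>xs. c xs + e xs) = (\<lambda>ys. dT c ys + dT e ys)"
  by (rule HOL.ext, rule poly_mapping_eqI) (simp add: weight_dT lookup_add W.cdiff_add)

lemma dT_scale: "dT (\<lambda>xs. pm_scale sW q (c xs)) = (\<lambda>ys. pm_scale sW q (dT c ys))"
  by (rule HOL.ext, rule poly_mapping_eqI) (simp add: weight_dT lookup_pm_scale[OF vs] cdiff_scale_idx)

lemma dT_zero: "dT (\<lambda>_. 0) = (\<lambda>_. 0)"
  by (rule HOL.ext, rule poly_mapping_eqI) (simp add: weight_dT W.cdiff_zero)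

lemma Tjet_add: "Tjet M (\<lambda>xs. c xs + e xs) = Tjet M c + Tjet M e"
  by (rule HOL.ext) (simp add: Tjet_def T.jext_add)

lemma Tjet_scale: "Tjet M (\<lambda>xs. pm_scale sW q (c xs)) = fun_scale (pm_scale sW) q (Tjet M c)"
  by (rule HOL.ext) (simp add: Tjet_def fun_scale_def pm_scale_eq_tensor_mult T.jext_scale)

lemma Tjet_zero: "Tjet M (\<lambda>_. 0) = 0"
  by (rule HOL.ext) (simp add: Tjet_def T.jext_zero)

lemma represents_unique: "represents k c \<phi> \<Longrightarrow> represents k' c \<psi> \<Longrightarrow> \<phi> = \<psi>"
  unfolding represents_def using eventually_happens'[OF sequentially_bot eventually_conj] by (metis (mono_tags, lifting))

lemma represents_Tinv: "represents k c \<phi> \<Longrightarrow> Tinv \<phi> = c"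
proof -
  assume "represents k c \<phi>"
  then obtain M where "T_cochain k M c" "\<phi> = Tjet M c"
    unfolding represents_def using eventually_happens'[OF sequentially_bot] by blast
  then show ?thesis using Tinv_Tjet[of M c] by (simp add: T_cochain_def)
qed

lemma represents_T_cochain: "represents k c \<phi> \<Longrightarrow> \<exists>N. T_cochain k N c"
  unfolding represents_def using eventually_happens'[OF sequentially_bot] by blast

lemma represents_zero: "represents k (\<lambda>_. 0) 0"
  unfolding represents_def using T_cochain_zero Tjet_zero by simp

lemma represents_add:
  "represents k c \<phi> \<Longrightarrow> represents k e \<psi> \<Longrightarrow> represents k (\<lambda>xs. c xs + e xs) (\<phi> + \<psi>)"
  unfolding represents_def by (rule eventually_elim2, assumption, assumption) (simp add: T_cochain_add Tjet_add)

lemma represents_scale: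
  "represents k c \<phi> \<Longrightarrow> represents k (\<lambda>xs. pm_scale sW q (c xs)) (fun_scale (pm_scale sW) q \<phi>)"
  unfolding represents_def by (rule eventually_mono, assumption) (simp add: T_cochain_scale Tjet_scale)

lemma gf_cochains_represents:
  assumes "\<phi> \<in> gf_cochains sW m" shows "represents (int m) (Tinv \<phi>) \<phi>"
proof -
  obtain p where p: "p > 0" "\<phi> \<in> gf_class p" "\<And>\<eta>s. length \<eta>s \<noteq> m \<Longrightarrow> \<phi> \<eta>s = 0"
    by (rule gf_cochains_class[OF assms]) blast
  have "Tinv \<phi> xs = 0" if "int (length xs) \<noteq> int m" for xs
    unfolding Tinv_def by (rule T.jext_length, rule p(3)) (use that in simp)
  then have "T_cochain (int m) M (Tinv \<phi>) \<and> \<phi> = Tjet M (Tinv \<phi>)" if "CARD('n) * p \<le> M" for M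
    unfolding T_cochain_def using alternating_Tinv[OF gf_classD(1)[OF p(2)]] bounded_Tinv[OF p(2,1) that] Tjet_Tinv[OF p(2,1) that]
    by simp
  then show ?thesis unfolding represents_def eventually_sequentially by blast
qed

lemma represents_gf_cochains:
  assumes "represents (int m) c \<phi>" shows "\<phi> \<in> gf_cochains sW m"
proof -
  obtain M where "T_cochain (int m) M c" "\<phi> = Tjet M c"
    using assms unfolding represents_def using eventually_happens'[OF sequentially_bot] by blast
  then show ?thesis using Tjet_gf_cochain[of c m M] by (simp add: T_cochain_def)
qed

text \<open>\<open>Tjet N c\<close> is a Gelfand-Fuks cochain, and \<open>Tinv\<close> returns
  \<open>c\<close> from it; hence it has the same expansion for all large truncations.\<close>

lemma T_cochain_represents:
  assumes "T_cochain k N c" shows "\<exists>\<phi>. represents k c \<phi>"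
proof (cases "k < 0")
  case True
  then have "c = (\<lambda>_. 0)" using assms by (auto simp: T_cochain_def fun_eq_iff)
  then show ?thesis using represents_zero by blast
next
  case False
  then obtain m where m: "k = int m" by (metis nonneg_int_cases not_less)
  have "Tjet N c \<in> gf_cochains sW m" using Tjet_gf_cochain[of c m N] assms by (simp add: T_cochain_def m)
  then have "represents (int m) (Tinv (Tjet N c)) (Tjet N c)" by (rule gf_cochains_represents)
  then show ?thesis using Tinv_Tjet[of N c] assms by (auto simp: T_cochain_def m)
qed

lemma represents_gf_diff:
  assumes "represents k c \<phi>" shows "represents (k + 1) (dT c) (gf_diff \<phi>)"
proof -
  obtain N\<^sub>0 where N\<^sub>0: "N\<^sub>0 > 0" "\<And>\<beta> w. N\<^sub>0 \<le> mdeg \<beta> \<Longrightarrow> \<rho> (mfield \<beta>) w = 0" by (rule rho_eventually_zero) blast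
  have "idx_act s \<beta> a = 0" if "N\<^sub>0 \<le> mdeg \<beta>" for s \<beta> a
  proof -
    have "mdeg \<beta> \<noteq> 0" using that N\<^sub>0(1) by linarith
    then show ?thesis using N\<^sub>0(2)[OF that] by (simp add: idx_act_def)
  qed
  then have act0: "ten_act \<beta> a = 0" if "N\<^sub>0 \<le> mdeg \<beta>" for \<beta> a
    using that by (intro poly_mapping_eqI) (simp add: lookup_ten_act)
  have step: "T_cochain (k + 1) M (dT c) \<and> gf_diff \<phi> = Tjet M (dT c)" if c: "T_cochain k M c \<and> \<phi> = Tjet M c" and M: "N\<^sub>0 \<le> M" for M
  proof
    have cc: "alternating UNIV c" "bounded M c" "\<And>xs. int (length xs) \<noteq> k \<Longrightarrow> c xs = 0" using c by (auto simp: T_cochain_def)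
    have "dT c xs = 0" if "int (length xs) \<noteq> k + 1" for xs
    proof (rule poly_mapping_eqI)
      fix s
      have "W.d s (weight s c) xs = 0"
        by (rule W.cdiff_length[OF subset_UNIV]) (use cc(3) that in auto)
      then show "Poly_Mapping.lookup (dT c xs) s = Poly_Mapping.lookup 0 s" by (simp add: weight_dT)
    qed
    moreover have "alternating UNIV (dT c)"
      by (rule alternating_cdiff_idx[OF vector_space_pm_scale[OF vs] _ cc(1)]) (rule ten_act_add)
    moreover have "bounded M (dT c)"
      by (rule bounded_cdiff[OF vector_space_pm_scale[OF vs] _ _ cc(2) order_refl M]) (fact ten_act_add act0)+
    ultimately show "T_cochain (k + 1) M (dT c)" unfolding T_cochain_def by blast
    have "\<rho> (mfield \<beta>) w = 0" if "M \<le> mdeg \<beta>" for \<beta> w using N\<^sub>0(2) M that by simp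
    then show "gf_diff \<phi> = Tjet M (dT c)"
      using ce_diff_Tjet[OF _ _ cc(1,2)] c M N\<^sub>0(1) by simp
  qed
  show ?thesis
    unfolding represents_def
    by (rule eventually_elim2[OF assms[unfolded represents_def] eventually_ge_at_top[of N\<^sub>0]]) (rule step)
qed

section \<open>Cocycles and coboundaries in terms of cochains on symbols\<close>

definition gf_cocycles :: "nat \<Rightarrow> (('n, 'k) vfield list \<Rightarrow> ('n \<Rightarrow> int) \<Rightarrow>\<^sub>0 'w) set" where
  "gf_cocycles m = {\<phi> \<in> gf_cochains sW m. gf_diff \<phi> = 0}"

definition gf_boundaries :: "nat \<Rightarrow> (('n, 'k) vfield list \<Rightarrow> ('n \<Rightarrow> int) \<Rightarrow>\<^sub>0 'w) set" where
  "gf_boundaries m = (if m = 0 then {0} else gf_diff ` gf_cochains sW (m - 1))"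

lemma gf_cocycles_iff: "\<phi> \<in> gf_cocycles m \<longleftrightarrow> (\<exists>c. represents (int m) c \<phi> \<and> dT c = (\<lambda>_. 0))"
proof
  assume "\<phi> \<in> gf_cocycles m"
  then have r: "represents (int m) (Tinv \<phi>) \<phi>" and 0: "gf_diff \<phi> = 0"
    using gf_cochains_represents by (auto simp: gf_cocycles_def)
  have "Tinv (gf_diff \<phi>) = dT (Tinv \<phi>)" by (rule represents_Tinv[OF represents_gf_diff[OF r]])
  then have "dT (Tinv \<phi>) = (\<lambda>_. 0)" using represents_Tinv[OF represents_zero] unfolding 0 by simp
  then show "\<exists>c. represents (int m) c \<phi> \<and> dT c = (\<lambda>_. 0)" using r by blast
next
  assume "\<exists>c. represents (int m) c \<phi> \<and> dT c = (\<lambda>_. 0)"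
  then obtain c where c: "represents (int m) c \<phi>" "dT c = (\<lambda>_. 0)" by blast
  have "gf_diff \<phi> = 0" using represents_unique[OF represents_gf_diff[OF c(1), unfolded c(2)] represents_zero] .
  then show "\<phi> \<in> gf_cocycles m" using represents_gf_cochains[OF c(1)] by (simp add: gf_cocycles_def)
qed

lemma gf_boundaries_iff: "\<phi> \<in> gf_boundaries m \<longleftrightarrow> (\<exists>e. represents (int m) (dT e) \<phi> \<and> (\<exists>N. T_cochain (int m - 1) N e))"
proof
  assume \<phi>: "\<phi> \<in> gf_boundaries m"
  show "\<exists>e. represents (int m) (dT e) \<phi> \<and> (\<exists>N. T_cochain (int m - 1) N e)"
  proof (cases m)
    case 0
    then have "\<phi> = 0" using \<phi> by (simp add: gf_boundaries_def)
    then show ?thesis using represents_zero dT_zero T_cochain_zero by metis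
  next
    case (Suc n)
    then obtain \<psi> where \<psi>: "\<psi> \<in> gf_cochains sW n" "\<phi> = gf_diff \<psi>" using \<phi> by (auto simp: gf_boundaries_def)
    note r = gf_cochains_represents[OF \<psi>(1)]
    have "represents (int m) (dT (Tinv \<psi>)) \<phi>" using represents_gf_diff[OF r] by (simp add: Suc \<psi>(2) add.commute)
    then show ?thesis using represents_T_cochain[OF r] by (auto simp: Suc)
  qed
next
  assume "\<exists>e. represents (int m) (dT e) \<phi> \<and> (\<exists>N. T_cochain (int m - 1) N e)"
  then obtain e N where e: "represents (int m) (dT e) \<phi>" "T_cochain (int m - 1) N e" by blast
  obtain \<psi> where \<psi>: "represents (int m - 1) e \<psi>" using T_cochain_represents[OF e(2)] by blast
  show "\<phi> \<in> gf_boundaries m"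
  proof (cases m)
    case 0
    then have "e = (\<lambda>_. 0)" using e(2) by (auto simp: T_cochain_def fun_eq_iff)
    then have "represents (int m) (\<lambda>_. 0) \<phi>" using e(1) by (simp only: dT_zero)
    then have "\<phi> = 0" by (rule represents_unique[OF _ represents_zero])
    then show ?thesis by (simp add: gf_boundaries_def 0)
  next
    case (Suc n)
    then have "\<psi> \<in> gf_cochains sW n" using represents_gf_cochains[of n] \<psi> by simp
    moreover have "\<phi> = gf_diff \<psi>" by (rule represents_unique[OF e(1) represents_gf_diff[OF \<psi>]])
    ultimately show ?thesis by (simp add: gf_boundaries_def Suc)
  qed
qed

lemma vector_space_gf: "vector_space (fun_scale (pm_scale sW) :: 'k \<Rightarrow> (('n, 'k) vfield list \<Rightarrow> ('n \<Rightarrow> int) \<Rightarrow>\<^sub>0 'w) \<Rightarrow> _)"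
  by (intro vector_space_fun_scale vector_space_pm_scale vs)

lemma subspace_gf_cocycles: "module.subspace (fun_scale (pm_scale sW)) (gf_cocycles m)"
proof -
  interpret P: vector_space "pm_scale sW :: 'k \<Rightarrow> (('n \<Rightarrow> int) \<Rightarrow>\<^sub>0 'w) \<Rightarrow> _"
    by (rule vector_space_pm_scale[OF vs])
  interpret G: vector_space "fun_scale (pm_scale sW) :: 'k \<Rightarrow> (('n, 'k) vfield list \<Rightarrow> ('n \<Rightarrow> int) \<Rightarrow>\<^sub>0 'w) \<Rightarrow> _"
    by (rule vector_space_gf)
  show ?thesis
  proof (rule G.subspaceI)
    show "0 \<in> gf_cocycles m" unfolding gf_cocycles_iff using represents_zero dT_zero by blast
  next
    fix \<phi> \<psi> :: "('n, 'k) vfield list \<Rightarrow> ('n \<Rightarrow> int) \<Rightarrow>\<^sub>0 'w"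
    assume "\<phi> \<in> gf_cocycles m" "\<psi> \<in> gf_cocycles m"
    then obtain c e where "represents (int m) c \<phi>" "dT c = (\<lambda>_. 0)" "represents (int m) e \<psi>" "dT e = (\<lambda>_. 0)"
      unfolding gf_cocycles_iff by blast
    then show "\<phi> + \<psi> \<in> gf_cocycles m"
      unfolding gf_cocycles_iff by (intro exI[of _ "\<lambda>xs. c xs + e xs"]) (simp add: represents_add dT_add)
  next
    fix \<phi> :: "('n, 'k) vfield list \<Rightarrow> ('n \<Rightarrow> int) \<Rightarrow>\<^sub>0 'w" and q
    assume "\<phi> \<in> gf_cocycles m"
    then obtain c where "represents (int m) c \<phi>" "dT c = (\<lambda>_. 0)" unfolding gf_cocycles_iff by blast
    then show "fun_scale (pm_scale sW) q \<phi> \<in> gf_cocycles m"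
      unfolding gf_cocycles_iff by (intro exI[of _ "\<lambda>xs. pm_scale sW q (c xs)"]) (simp add: represents_scale dT_scale)
  qed
qed

lemma subspace_gf_boundaries: "module.subspace (fun_scale (pm_scale sW)) (gf_boundaries m)"
proof -
  interpret G: vector_space "fun_scale (pm_scale sW) :: 'k \<Rightarrow> (('n, 'k) vfield list \<Rightarrow> ('n \<Rightarrow> int) \<Rightarrow>\<^sub>0 'w) \<Rightarrow> _"
    by (rule vector_space_gf)
  show ?thesis
  proof (rule G.subspaceI)
    show "0 \<in> gf_boundaries m" unfolding gf_boundaries_iff using represents_zero dT_zero T_cochain_zero by metis
  next
    fix \<phi> \<psi> :: "('n, 'k) vfield list \<Rightarrow> ('n \<Rightarrow> int) \<Rightarrow>\<^sub>0 'w"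
    assume "\<phi> \<in> gf_boundaries m" "\<psi> \<in> gf_boundaries m"
    then obtain c e N N' where r: "represents (int m) (dT c) \<phi>" "represents (int m) (dT e) \<psi>"
      and t: "T_cochain (int m - 1) N c" "T_cochain (int m - 1) N' e"
      unfolding gf_boundaries_iff by blast
    have "T_cochain (int m - 1) (max N N') (\<lambda>xs. c xs + e xs)"
      using T_cochain_add[OF T_cochain_mono[OF t(1)] T_cochain_mono[OF t(2)], of "max N N'"] by simp
    moreover have "represents (int m) (dT (\<lambda>xs. c xs + e xs)) (\<phi> + \<psi>)"
      unfolding dT_add by (rule represents_add[OF r])
    ultimately show "\<phi> + \<psi> \<in> gf_boundaries m" unfolding gf_boundaries_iff by blast
  next
    fix \<phi> :: "('n, 'k) vfield list \<Rightarrow> ('n \<Rightarrow> int) \<Rightarrow>\<^sub>0 'w" and q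
    assume "\<phi> \<in> gf_boundaries m"
    then obtain c N where "represents (int m) (dT c) \<phi>" "T_cochain (int m - 1) N c" unfolding gf_boundaries_iff by blast
    then show "fun_scale (pm_scale sW) q \<phi> \<in> gf_boundaries m"
      unfolding gf_boundaries_iff
      by (intro exI[of _ "\<lambda>xs. pm_scale sW q (c xs)"] conjI exI[of _ N]) (simp_all add: represents_scale dT_scale T_cochain_scale)
  qed
qed

definition ce_cocycles :: "nat \<Rightarrow> ((('n, 'k) mpoly \<Rightarrow> ('n, 'k) mpoly) list \<Rightarrow> 'w) set" where
  "ce_cocycles j = {\<psi> \<in> ce_cochains field_scale L_plus sW j. ceL \<psi> = 0}"

definition ce_boundaries :: "nat \<Rightarrow> ((('n, 'k) mpoly \<Rightarrow> ('n, 'k) mpoly) list \<Rightarrow> 'w) set" where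
  "ce_boundaries j = (if j = 0 then {0} else ceL ` ce_cochains field_scale L_plus sW (j - 1))"

lemma Ljet_add: "Ljet (\<lambda>xs. c xs + e xs) = Ljet c + Ljet e"
  by (rule HOL.ext) (simp add: Ljet_def M.jext_add)

lemma Ljet_scale: "Ljet (\<lambda>xs. sW q (c xs)) = fun_scale sW q (Ljet c)"
  by (rule HOL.ext) (simp add: Ljet_def fun_scale_def M.jext_scale)

lemma Ljet_minus: "Ljet (\<lambda>xs. - c xs) = - Ljet c"
  by (rule HOL.ext) (simp add: Ljet_def M.jext_minus)

lemma Ljet_zero: "Ljet (\<lambda>_. 0) = 0"
  by (rule HOL.ext) (simp add: Ljet_def M.jext_zero)

lemma ce_cochains_Ljet: "\<psi> \<in> ce_cochains field_scale L_plus sW j \<longleftrightarrow> (\<exists>c. L_cochain (int j) c \<and> \<psi> = Ljet c)"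
proof
  assume "\<psi> \<in> ce_cochains field_scale L_plus sW j"
  note R = iffD1[OF ce_cochains_iff[OF vs] this, simplified]
  have z: "\<psi> xs = 0" if "length xs \<noteq> j \<or> \<not> set xs \<subseteq> L_plus" for xs using R that by blast
  have cl: "\<psi> \<in> ce_class" using R unfolding ce_class_def by blast
  have "L_cochain (int j) (Lres \<psi>)"
    by (rule L_cochain_I) (use alternating_Lres[OF ce_classD(1)[OF cl]] plus_suppD[OF plus_supp_Lres] z in \<open>auto simp: Lres_def\<close>)
  moreover have "\<psi> = Ljet (Lres \<psi>)"
    by (rule HOL.ext) (use jext_Lres[OF cl] z in \<open>auto simp: Ljet_def\<close>)
  ultimately show "\<exists>c. L_cochain (int j) c \<and> \<psi> = Ljet c" by blast
next
  assume "\<exists>c. L_cochain (int j) c \<and> \<psi> = Ljet c"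
  then obtain c where c: "L_cochain (int j) c" "\<psi> = Ljet c" by blast
  have cl: "\<psi> \<in> ce_class" unfolding c(2) by (rule Ljet_class[OF L_cochain_D(1)[OF c(1)]])
  have "\<psi> xs = 0" if "\<not> (length xs = j \<and> set xs \<subseteq> L_plus)" for xs
  proof (cases "set xs \<subseteq> L_plus")
    case True
    have "jext sW lcoef lsupp c xs = 0"
      by (rule M.jext_length, rule L_cochain_D(3)[OF c(1)]) (use True that in simp)
    then show ?thesis by (simp add: c(2) Ljet_def)
  qed (simp add: c(2) Ljet_def)
  then show "\<psi> \<in> ce_cochains field_scale L_plus sW j"
    using cl ce_cochains_iff[OF vs, of \<psi> j] unfolding ce_class_def by auto
qed

lemma ceL_Ljet_L_cochain: "L_cochain k c \<Longrightarrow> ceL (Ljet c) = Ljet (W.d 0 c)"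
  by (rule ceL_Ljet[OF L_cochain_D(1,2)])

lemma Lres_Ljet_L_cochain: "L_cochain k c \<Longrightarrow> Lres (Ljet c) = c"
  by (rule Lres_Ljet[OF L_cochain_D(2)])

lemma ce_cocycles_iff: "\<psi> \<in> ce_cocycles j \<longleftrightarrow> (\<exists>c. L_cochain (int j) c \<and> \<psi> = Ljet c \<and> W.d 0 c = (\<lambda>_. 0))"
proof
  assume "\<psi> \<in> ce_cocycles j"
  then obtain c where c: "L_cochain (int j) c" "\<psi> = Ljet c" "ceL \<psi> = 0"
    unfolding ce_cocycles_def ce_cochains_Ljet by blast
  have "Ljet (W.d 0 c) = Ljet (\<lambda>_. 0)" using ceL_Ljet_L_cochain[OF c(1)] c(2,3) Ljet_zero by simp
  then have "W.d 0 c = (\<lambda>_. 0)"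
    using Lres_Ljet_L_cochain[OF L_cochain_d[OF c(1)]] Lres_Ljet_L_cochain[OF L_cochain_zero] by metis
  then show "\<exists>c. L_cochain (int j) c \<and> \<psi> = Ljet c \<and> W.d 0 c = (\<lambda>_. 0)" using c by blast
next
  assume "\<exists>c. L_cochain (int j) c \<and> \<psi> = Ljet c \<and> W.d 0 c = (\<lambda>_. 0)"
  then obtain c where c: "L_cochain (int j) c" "\<psi> = Ljet c" "W.d 0 c = (\<lambda>_. 0)" by blast
  then have "ceL \<psi> = 0" using ceL_Ljet_L_cochain[OF c(1)] Ljet_zero by simp
  then show "\<psi> \<in> ce_cocycles j" unfolding ce_cocycles_def ce_cochains_Ljet using c by blast
qed

lemma ce_boundaries_iff: "\<psi> \<in> ce_boundaries j \<longleftrightarrow> (\<exists>b. L_cochain (int j - 1) b \<and> \<psi> = Ljet (W.d 0 b))"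
proof (cases j)
  case 0
  have "W.d 0 b = (\<lambda>_. 0)" if "L_cochain (- 1) b" for b
  proof -
    have "b = (\<lambda>_. 0)" using L_cochain_D(3)[OF that] by (auto simp: fun_eq_iff)
    then show ?thesis using W.cdiff_zero[OF subset_UNIV] by auto
  qed
  then have "(\<exists>b. L_cochain (int j - 1) b \<and> \<psi> = Ljet (W.d 0 b)) \<longleftrightarrow> \<psi> = 0"
    using L_cochain_zero Ljet_zero unfolding 0 by fastforce
  then show ?thesis by (simp add: ce_boundaries_def 0)
next
  case (Suc n)
  have "\<psi> \<in> ce_boundaries j \<longleftrightarrow> (\<exists>\<chi>. \<chi> \<in> ce_cochains field_scale L_plus sW n \<and> \<psi> = ceL \<chi>)"
    by (auto simp: ce_boundaries_def Suc)
  also have "\<dots> \<longleftrightarrow> (\<exists>b. L_cochain (int n) b \<and> \<psi> = ceL (Ljet b))" unfolding ce_cochains_Ljet by blast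
  also have "\<dots> \<longleftrightarrow> (\<exists>b. L_cochain (int n) b \<and> \<psi> = Ljet (W.d 0 b))" using ceL_Ljet_L_cochain by metis
  finally show ?thesis by (simp add: Suc)
qed

lemma W_d_add: "W.d 0 (\<lambda>xs. b xs + e xs) = (\<lambda>ys. W.d 0 b ys + W.d 0 e ys)"
  by (rule HOL.ext, rule W.cdiff_add[OF subset_UNIV])

lemma W_d_scale: "W.d 0 (\<lambda>xs. sW q (b xs)) = (\<lambda>ys. sW q (W.d 0 b ys))"
  by (rule HOL.ext, rule cdiff_scale_idx)

lemma W_d_minus: "W.d 0 (\<lambda>xs. - b xs) = (\<lambda>ys. - W.d 0 b ys)"
  by (rule HOL.ext, rule W.cdiff_minus[OF subset_UNIV])

lemma W_d_zero: "W.d 0 (\<lambda>_. 0) = (\<lambda>_. 0)"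
  by (rule HOL.ext, rule W.cdiff_zero[OF subset_UNIV])

lemma subspace_ce_boundaries: "module.subspace (fun_scale sW) (ce_boundaries j)"
proof -
  interpret G: vector_space "fun_scale sW :: 'k \<Rightarrow> ((('n, 'k) mpoly \<Rightarrow> ('n, 'k) mpoly) list \<Rightarrow> 'w) \<Rightarrow> _"
    by (rule vector_space_fun_scale[OF vs])
  show ?thesis
  proof (rule G.subspaceI)
    show "0 \<in> ce_boundaries j" unfolding ce_boundaries_iff using L_cochain_zero Ljet_zero W_d_zero by metis
  next
    fix \<phi> \<psi> assume "\<phi> \<in> ce_boundaries j" "\<psi> \<in> ce_boundaries j"
    then obtain b e where "L_cochain (int j - 1) b" "\<phi> = Ljet (W.d 0 b)" "L_cochain (int j - 1) e" "\<psi> = Ljet (W.d 0 e)"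
      unfolding ce_boundaries_iff by blast
    then show "\<phi> + \<psi> \<in> ce_boundaries j"
      unfolding ce_boundaries_iff by (intro exI[of _ "\<lambda>xs. b xs + e xs"]) (simp add: L_cochain_add W_d_add Ljet_add)
  next
    fix \<phi> q assume "\<phi> \<in> ce_boundaries j"
    then obtain b where "L_cochain (int j - 1) b" "\<phi> = Ljet (W.d 0 b)" unfolding ce_boundaries_iff by blast
    then show "fun_scale sW q \<phi> \<in> ce_boundaries j"
      unfolding ce_boundaries_iff by (intro exI[of _ "\<lambda>xs. sW q (b xs)"]) (simp add: L_cochain_scale W_d_scale Ljet_scale)
  qed
qed

section \<open>Components of weight zero and the comparison of cohomology\<close>

lemma alternating_weight: "alternating UNIV c \<Longrightarrow> alternating UNIV (weight s c)"
  by (rule alternating_map[where h = "\<lambda>m. Poly_Mapping.lookup m s"]) (simp_all add: lookup_minus)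

lemma bounded_weight: "bounded N c \<Longrightarrow> bounded N (weight s c)"
  unfolding bounded_def by (metis lookup_zero)

lemma weight_dT_fun: "weight 0 (dT c) = W.d 0 (weight 0 c)"
  by (rule HOL.ext, rule weight_dT)

lemma L_cochain_component:
  assumes "T_cochain k N c" shows "L_cochain (k - int (card I)) (component (weight 0 c) I)"
proof (rule L_cochain_I)
  show "alternating UNIV (component (weight 0 c) I)"
    using assms by (intro alternating_component alternating_weight) (simp add: T_cochain_def)
  show "component (weight 0 c) I ys = 0" if "\<not> set ys \<subseteq> plus_idx" for ys using that by (simp add: component_def)
  show "component (weight 0 c) I ys = 0" if "int (length ys) \<noteq> k - int (card I)" for ys
    using assms that by (simp add: component_def T_cochain_def length_filter_var_list)
qed

lemma L_cochain_sgnp: "L_cochain k b \<Longrightarrow> L_cochain k (\<lambda>ys. sgnp n (b ys))"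
  by (cases "even n") (simp_all add: sgnp_def L_cochain_minus)

text \<open>The coefficient of the exterior product of the forms dx_i / x_i, i in \<open>I\<close>,
  at weight 0, as a cochain of L_+.\<close>

definition comparison :: "'n set \<Rightarrow> (('n, 'k) vfield list \<Rightarrow> ('n \<Rightarrow> int) \<Rightarrow>\<^sub>0 'w) \<Rightarrow> (('n, 'k) mpoly \<Rightarrow> ('n, 'k) mpoly) list \<Rightarrow> 'w" where
  "comparison I \<phi> = Ljet (component (weight 0 (Tinv \<phi>)) I)"

lemma comparison_add: "comparison I (\<phi> + \<psi>) = comparison I \<phi> + comparison I \<psi>"
proof -
  have "Tinv (\<phi> + \<psi>) = (\<lambda>xs. Tinv \<phi> xs + Tinv \<psi> xs)"
    by (rule HOL.ext) (simp only: plus_fun_def Tinv_add)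
  then have "component (weight 0 (Tinv (\<phi> + \<psi>))) I =
      (\<lambda>ys. component (weight 0 (Tinv \<phi>)) I ys + component (weight 0 (Tinv \<psi>)) I ys)"
    by (simp add: component_def lookup_add fun_eq_iff)
  then show ?thesis unfolding comparison_def by (simp only: Ljet_add)
qed

lemma comparison_scale: "comparison I (fun_scale (pm_scale sW) q \<phi>) = fun_scale sW q (comparison I \<phi>)"
proof -
  have "Tinv (fun_scale (pm_scale sW) q \<phi>) = (\<lambda>xs. pm_scale sW q (Tinv \<phi> xs))"
    by (rule HOL.ext) (simp only: fun_scale_def pm_scale_eq_tensor_mult Tinv_scale)
  then have "component (weight 0 (Tinv (fun_scale (pm_scale sW) q \<phi>))) I =
      (\<lambda>ys. sW q (component (weight 0 (Tinv \<phi>)) I ys))"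
    by (simp add: component_def lookup_pm_scale[OF vs] fun_eq_iff)
  then show ?thesis unfolding comparison_def by (simp only: Ljet_scale)
qed

lemma component_cocycle:
  assumes "T_cochain k N c" "dT c = (\<lambda>_. 0)" shows "W.d 0 (component (weight 0 c) I) = (\<lambda>_. 0)"
proof
  fix ys
  have "alternating UNIV (weight 0 c)" using assms(1) by (intro alternating_weight) (simp add: T_cochain_def)
  from fun_cong[OF component_W_d[OF this], of I ys]
  have "sgnp (card I) (W.d 0 (component (weight 0 c) I) ys) = component (weight 0 (dT c)) I ys"
    unfolding weight_dT_fun by simp
  then show "W.d 0 (component (weight 0 c) I) ys = 0" unfolding assms(2) by (simp add: component_def)
qed

lemma comparison_cocycle:
  assumes "\<phi> \<in> gf_cocycles m" "card I + j = m" shows "comparison I \<phi> \<in> ce_cocycles j"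
proof -
  obtain c where c: "represents (int m) c \<phi>" "dT c = (\<lambda>_. 0)" using assms(1) unfolding gf_cocycles_iff by blast
  obtain N where N: "T_cochain (int m) N c" using represents_T_cochain[OF c(1)] by blast
  have "L_cochain (int j) (component (weight 0 c) I)" using L_cochain_component[OF N, of I] assms(2) by auto
  then show ?thesis
    unfolding ce_cocycles_iff comparison_def represents_Tinv[OF c(1)] using component_cocycle[OF N c(2)] by blast
qed

lemma comparison_boundary:
  assumes "\<phi> \<in> gf_boundaries m" "card I + j = m" shows "comparison I \<phi> \<in> ce_boundaries j"
proof -
  obtain e N where e: "represents (int m) (dT e) \<phi>" "T_cochain (int m - 1) N e"
    using assms(1) unfolding gf_boundaries_iff by blast
  have "alternating UNIV (weight 0 e)" using e(2) by (intro alternating_weight) (simp add: T_cochain_def)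
  from component_W_d[OF this, of I]
  have eq: "component (weight 0 (dT e)) I = W.d 0 (\<lambda>ys. sgnp (card I) (component (weight 0 e) I ys))"
    unfolding weight_dT_fun by (simp only: fun_eq_iff W.cdiff_sgnp[OF subset_UNIV] simp_thms)
  have "L_cochain (int j - 1) (\<lambda>ys. sgnp (card I) (component (weight 0 e) I ys))"
    using L_cochain_sgnp[OF L_cochain_component[OF e(2), of I], of "card I"] assms(2) by (auto simp: algebra_simps)
  then show ?thesis
    unfolding ce_boundaries_iff comparison_def represents_Tinv[OF e(1)] eq by (intro exI conjI, assumption) (rule refl)
qed

lemma L_cochain_negative: "L_cochain k c \<Longrightarrow> k < 0 \<Longrightarrow> c = (\<lambda>_. 0)"
  using L_cochain_D(3) by (fastforce simp: fun_eq_iff)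

lemma common_bound:
  assumes "\<And>I :: 'n set. bounded (f I) (b I)"
  obtains N where "N > 0" "n \<le> N" "\<And>I. bounded N (b I)"
proof (rule that[of "Suc (n + Max (range f))"])
  fix I :: "'n set"
  have "f I \<le> Max (range f)" by (rule Max_ge) auto
  then have "f I \<le> Suc (n + Max (range f))" by linarith
  then show "bounded (Suc (n + Max (range f))) (b I)" by (rule bounded_mono[OF assms])
qed auto

text \<open>The components of a bounded cocycle are bounded, so a primitive of each can be taken
  bounded as well (\<open>bounded_primitive\<close>). There are finitely many \<open>I\<close>,
  hence a common bound, and \<open>T_primitive\<close> joins the primitives and supplies the nonzero
  weights.\<close>

lemma comparison_injective:
  assumes \<phi>: "\<phi> \<in> gf_cocycles m" and B: "\<And>I j. card I + j = m \<Longrightarrow> comparison I \<phi> \<in> ce_boundaries j"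
  shows "\<phi> \<in> gf_boundaries m"
proof -
  obtain c where c: "represents (int m) c \<phi>" "dT c = (\<lambda>_. 0)" using \<phi> unfolding gf_cocycles_iff by blast
  obtain N where N: "T_cochain (int m) N c" using represents_T_cochain[OF c(1)] by blast
  have bw: "bounded N (weight 0 c)" using N by (intro bounded_weight) (simp add: T_cochain_def)
  have "\<exists>b M. L_cochain (int m - int (card I) - 1) b \<and> bounded M b \<and> component (weight 0 c) I = W.d 0 b" for I
  proof (cases "card I \<le> m")
    case True
    then obtain j where j: "card I + j = m" using le_Suc_ex by blast
    obtain b where b: "L_cochain (int j - 1) b" "comparison I \<phi> = Ljet (W.d 0 b)"
      using B[OF j] unfolding ce_boundaries_iff by blast
    have "component (weight 0 c) I = Lres (comparison I \<phi>)"
      unfolding comparison_def represents_Tinv[OF c(1)] by (rule Lres_Ljet_L_cochain[OF L_cochain_component[OF N], symmetric])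
    also have "\<dots> = W.d 0 b" unfolding b(2) by (rule Lres_Ljet_L_cochain[OF L_cochain_d[OF b(1)]])
    finally have eq: "component (weight 0 c) I = W.d 0 b" .
    have "bounded N (W.d 0 b)" unfolding eq[symmetric] by (rule bounded_component[OF bw])
    then obtain b' M where b': "L_cochain (int j - 1) b'" "bounded M b'" "W.d 0 b' = W.d 0 b"
      by (rule bounded_primitive[OF b(1)])
    moreover have "int j = int m - int (card I)" using j by simp
    ultimately show ?thesis using eq by metis
  next
    case False
    \<comment> \<open>With more central arguments than arguments in total, the component has
      negative degree.\<close>
    then have "component (weight 0 c) I = (\<lambda>_. 0)" by (intro L_cochain_negative[OF L_cochain_component[OF N]]) simp
    moreover have "bounded 0 (\<lambda>_. 0 :: 'w)" by (simp add: bounded_def)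
    ultimately show ?thesis using L_cochain_zero W_d_zero by metis
  qed
  then obtain b f where b: "\<And>I. L_cochain (int m - int (card I) - 1) (b I)" "\<And>I. bounded (f I) (b I)"
    "\<And>I. component (weight 0 c) I = W.d 0 (b I)" by metis
  obtain K where K: "K > 0" "N \<le> K" "\<And>I. bounded K (b I)" by (rule common_bound[of f b N, OF b(2)]) blast
  have cc: "alternating UNIV c" "bounded K c" "\<And>xs. length xs \<noteq> m \<Longrightarrow> c xs = 0"
    using T_cochain_mono[OF N K(2)] by (auto simp: T_cochain_def)
  have len: "b I ys = 0" if "Suc (length ys + card I) \<noteq> m" for I ys
    by (rule L_cochain_D(3)[OF b(1)]) (use that in linarith)
  obtain e where e: "alternating UNIV e" "bounded K e" "\<And>xs. Suc (length xs) \<noteq> m \<Longrightarrow> e xs = 0" "dT e = c"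
    by (rule T_primitive[OF cc(1,2) K(1) cc(3) c(2) L_cochain_D(1)[OF b(1)] L_cochain_D(2)[OF b(1)] K(3) len b(3)]) blast+
  have "T_cochain (int m - 1) K e" unfolding T_cochain_def using e(1,2,3) by auto
  then show ?thesis unfolding gf_boundaries_iff using c(1) e(4) by blast
qed

text \<open>Cocycles of L_+ may have unbounded degree and then come from no Gelfand-Fuks cochain.
  Each is replaced by a cohomologous bounded one (\<open>bounded_representative\<close>), whence the
  preimage is exact only modulo coboundaries.\<close>

lemma comparison_surjective:
  assumes y: "\<And>I j. card I + j = m \<Longrightarrow> y I \<in> ce_cocycles j"
  obtains \<phi> where "\<phi> \<in> gf_cocycles m" "\<And>I j. card I + j = m \<Longrightarrow> comparison I \<phi> - y I \<in> ce_boundaries j"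
proof -
  have "\<exists>f M. L_cochain (int m - int (card I)) f \<and> bounded M f \<and> W.d 0 f = (\<lambda>_. 0) \<and>
      (\<forall>j. card I + j = m \<longrightarrow> Ljet f - y I \<in> ce_boundaries j)" for I
  proof (cases "card I \<le> m")
    case True
    then obtain j where j: "card I + j = m" using le_Suc_ex by blast
    obtain c where c: "L_cochain (int j) c" "y I = Ljet c" "W.d 0 c = (\<lambda>_. 0)"
      using y[OF j] unfolding ce_cocycles_iff by blast
    obtain f u M where f: "L_cochain (int j) f" "bounded M f" "W.d 0 f = (\<lambda>_. 0)" "L_cochain (int j - 1) u" "c = (\<lambda>ys. f ys + W.d 0 u ys)"
      by (rule bounded_representative[OF c(1,3)])
    have "Ljet f - y I = Ljet (W.d 0 (\<lambda>ys. - u ys))"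
      unfolding c(2) f(5) Ljet_add W_d_minus Ljet_minus by simp
    then have "Ljet f - y I \<in> ce_boundaries j" unfolding ce_boundaries_iff using L_cochain_minus[OF f(4)] by blast
    moreover have "int j = int m - int (card I)" using j by simp
    ultimately show ?thesis using f(1-3) j by (metis add_left_cancel)
  next
    case False
    moreover have "bounded 0 (\<lambda>_. 0 :: 'w)" by (simp add: bounded_def)
    ultimately show ?thesis using L_cochain_zero W_d_zero by (metis le_add1)
  qed
  then obtain f g where f: "\<And>I. L_cochain (int m - int (card I)) (f I)" "\<And>I. bounded (g I) (f I)" "\<And>I. W.d 0 (f I) = (\<lambda>_. 0)"
    "\<And>I j. card I + j = m \<Longrightarrow> Ljet (f I) - y I \<in> ce_boundaries j" by metis
  obtain K where K: "K > 0" "\<And>I. bounded K (f I)" by (rule common_bound[of g f 0, OF f(2)]) blast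
  have len: "f I ys = 0" if "length ys + card I \<noteq> m" for I ys
    by (rule L_cochain_D(3)[OF f(1)]) (use that in linarith)
  obtain c where c: "alternating UNIV c" "bounded K c" "\<And>xs. length xs \<noteq> m \<Longrightarrow> c xs = 0"
    "dT c = (\<lambda>_. 0)" "\<And>I. component (weight 0 c) I = f I"
    by (rule T_cocycle[OF K(1) L_cochain_D(1)[OF f(1)] L_cochain_D(2)[OF f(1)] K(2) len f(3)]) blast+
  have "T_cochain (int m) K c" unfolding T_cochain_def using c(1-3) by auto
  then obtain \<phi> where \<phi>: "represents (int m) c \<phi>" using T_cochain_represents by blast
  show ?thesis
  proof (rule that)
    show "\<phi> \<in> gf_cocycles m" unfolding gf_cocycles_iff using \<phi> c(4) by blast
    show "comparison I \<phi> - y I \<in> ce_boundaries j" if "card I + j = m" for I j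
      unfolding comparison_def represents_Tinv[OF \<phi>] c(5) by (rule f(4)[OF that])
  qed
qed

text \<open>The basis of k^(n choose i) is indexed by the subsets of size i: \<open>S i\<close>
  numbers them, and coordinate a of the summand (i, j) is the comparison map for
  \<open>S i a\<close>. \<open>T\<close> recovers the number from the subset, to turn a family
  indexed by numbers into one indexed by subsets.\<close>

lemma gf_cohomology_iso:
  "gf_cohomology sW \<rho> m \<cong>\<^sub>k direct_sum_vs {(i, j). i + j = m}
    (\<lambda>(i, j). coordinate_tensor_vs (CARD('n) choose i) (ce_cohomology field_scale L_plus commutator sW \<rho> j))"
proof -
  have "\<exists>h. bij_betw h {..<CARD('n) choose i} {I :: 'n set. card I = i}" for i
  proof -
    have "card {I :: 'n set. card I = i} = CARD('n) choose i"
      using n_subsets[of "UNIV :: 'n set" i] by simp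
    then have "card {..<CARD('n) choose i} = card {I :: 'n set. card I = i}" by simp
    then show ?thesis by (intro finite_same_card_bij) auto
  qed
  then obtain S where S: "\<And>i. bij_betw (S i) {..<CARD('n) choose i} {I :: 'n set. card I = i}" by metis
  have card_S: "card (S i a) = i" if "a < CARD('n) choose i" for i a
    using bij_betwE[OF S[of i]] that by auto
  define T where "T I = inv_into {..<CARD('n) choose card I} (S (card I)) I" for I :: "'n set"
  have T: "T I < CARD('n) choose card I" "S (card I) (T I) = I" for I
  proof -
    have I: "I \<in> S (card I) ` {..<CARD('n) choose card I}" using bij_betw_imp_surj_on[OF S] by auto
    show "S (card I) (T I) = I" unfolding T_def by (rule f_inv_into_f[OF I])
    show "T I < CARD('n) choose card I" using inv_into_into[OF I] unfolding T_def by simp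
  qed
  have TS: "T (S i a) = a" if "a < CARD('n) choose i" for i a
    unfolding T_def card_S[OF that] using bij_betw_imp_inj_on[OF S] that by (intro inv_into_f_f) auto
  have "quotient_vs (fun_scale (pm_scale sW)) (gf_cocycles m) (gf_boundaries m) \<cong>\<^sub>k
    direct_sum_vs {(i, j). i + j = m} (\<lambda>ij. coordinate_tensor_vs (CARD('n) choose fst ij)
      (quotient_vs (fun_scale sW) (ce_cocycles (snd ij)) (ce_boundaries (snd ij))))"
  proof (rule quotient_direct_sum_iso[where R = "\<lambda>ij a. comparison (S (fst ij) a)",
        OF vector_space_gf vector_space_fun_scale[OF vs] subspace_gf_cocycles subspace_gf_boundaries subspace_ce_boundaries])
    show "comparison (S (fst ij) a) \<phi> \<in> ce_cocycles (snd ij)"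
      if "ij \<in> {(i, j). i + j = m}" "a < CARD('n) choose fst ij" "\<phi> \<in> gf_cocycles m" for ij a \<phi>
      using that by (intro comparison_cocycle[OF that(3)]) (auto simp: card_S)
  next
    fix \<phi> assume \<phi>: "\<phi> \<in> gf_cocycles m"
    show "(\<forall>ij\<in>{(i, j). i + j = m}. \<forall>a<CARD('n) choose fst ij. comparison (S (fst ij) a) \<phi> \<in> ce_boundaries (snd ij))
      \<longleftrightarrow> \<phi> \<in> gf_boundaries m" (is "?L \<longleftrightarrow> ?R")
    proof
      assume L: ?L
      show ?R
      proof (rule comparison_injective[OF \<phi>])
        fix I :: "'n set" and j assume "card I + j = m"
        then show "comparison I \<phi> \<in> ce_boundaries j" using L T[of I] by fastforce
      qed
    next
      assume R: ?R
      show ?L using comparison_boundary[OF R] card_S by auto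
    qed
  next
    fix y assume y: "\<And>ij a. ij \<in> {(i, j). i + j = m} \<Longrightarrow> a < CARD('n) choose fst ij \<Longrightarrow> y ij a \<in> ce_cocycles (snd ij)"
    have "y (card I, m - card I) (T I) \<in> ce_cocycles j" if "card I + j = m" for I j
      using y[of "(card I, m - card I)" "T I"] T(1) that by auto
    then obtain \<phi> where \<phi>: "\<phi> \<in> gf_cocycles m"
      "\<And>I j. card I + j = m \<Longrightarrow> comparison I \<phi> - y (card I, m - card I) (T I) \<in> ce_boundaries j"
      by (rule comparison_surjective[of m "\<lambda>I. y (card I, m - card I) (T I)"]) blast+
    have "comparison (S (fst ij) a) \<phi> - y ij a \<in> ce_boundaries (snd ij)"
      if "ij \<in> {(i, j). i + j = m}" "a < CARD('n) choose fst ij" for ij a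
    proof -
      have c: "card (S (fst ij) a) = fst ij" by (rule card_S[OF that(2)])
      have "ij = (fst ij, m - fst ij)" using that(1) by auto
      then show ?thesis
        using \<phi>(2)[of "S (fst ij) a" "snd ij"] that(1) unfolding c TS[OF that(2)] by auto
    qed
    then show "\<exists>\<phi>\<in>gf_cocycles m. \<forall>ij\<in>{(i, j). i + j = m}. \<forall>a<CARD('n) choose fst ij.
        comparison (S (fst ij) a) \<phi> - y ij a \<in> ce_boundaries (snd ij)"
      using \<phi>(1) by blast
  qed (simp_all add: comparison_add comparison_scale)
  moreover have "(\<lambda>ij. coordinate_tensor_vs (CARD('n) choose fst ij)
      (quotient_vs (fun_scale sW) (ce_cocycles (snd ij)) (ce_boundaries (snd ij)))) =
    (\<lambda>(i, j). coordinate_tensor_vs (CARD('n) choose i) (ce_cohomology field_scale L_plus commutator sW \<rho> j))"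
    by (auto simp: ce_cohomology_def cohomology_def ce_cocycles_def ce_boundaries_def fun_eq_iff)
  moreover have "gf_cohomology sW \<rho> m = quotient_vs (fun_scale (pm_scale sW)) (gf_cocycles m) (gf_boundaries m)"
    by (simp add: gf_cohomology_def cohomology_def gf_cocycles_def gf_boundaries_def)
  ultimately show ?thesis by simp
qed

end

theorem corollary7p3:
  fixes sW :: "'k::field_char_0 \<Rightarrow> 'w::ab_group_add \<Rightarrow> 'w"
    and \<rho> :: "(('n::finite, 'k) mpoly \<Rightarrow> ('n, 'k) mpoly) \<Rightarrow> 'w \<Rightarrow> 'w"
    and m :: nat
  assumes "lie_module field_scale L_plus commutator sW \<rho>"
    and "\<exists>B. finite_dimensional_vector_space sW B"
  shows "gf_cohomology sW \<rho> m \<cong>\<^sub>k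
    direct_sum_vs {(i, j). i + j = m} (\<lambda>(i, j).
      coordinate_tensor_vs (CARD('n) choose i)
        (ce_cohomology field_scale L_plus commutator sW \<rho> j))"
proof -
  interpret L_plus_module sW \<rho>
    using assms by (simp add: L_plus_module_def L_plus_module_axioms_def)
  show ?thesis by (rule gf_cohomology_iso)
qed

end
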